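(* Let $G$ be a real reductive group and let $\rho\colon SL(2,\mathbb{R})\to G$ be a Lie group homomorphism. Then there exists an integer $g_0\ge 2$ such that for every $g\ge g_0$ and every discrete subgroup $\Gamma_g$ of $SL(2,\mathbb{R})$ isomorphic to the fundamental group $\pi_1(\Sigma_g)$ of a closed oriented surface $\Sigma_g$ of genus $g$, the following holds: every neighborhood of $\rho|_{\Gamma_g}$ in $\mathrm{Hom}(\Gamma_g,G)$ contains a representation $\rho'$ such that the Zariski closure of $\rho'(\Gamma_g)$ in $G$ coincides with $G^{\rho}_{\mathrm{even}}$.
   Context: A real reductive group is a (Euclidean) open subgroup $G$ of $\mathbf{G}(\mathbb{R})$, where $\mathbf{G}$ is a connected reductive linear algebraic group defined over $\mathbb{R}$. The Zariski topology on $G$ is the one induced from the Zariski topology of $\mathbf{G}(\mathbb{C})$. $\mathrm{Hom}(\Gamma_g,G)$ carries the topology of pointwise convergence. For a Lie group homomorphism $\rho\colon SL(2,\mathbb{R})\to G$ put $A_0=\begin{pmatrix}1&0\\0&-1\end{pmatrix}$ and $\sigma:=\exp(\pi\sqrt{-1}\,d\rho(A_0))\in\mathbf{G}(\mathbb{C})$. Let $\mathbf{G}^{\rho}_{\mathrm{even}}$ be the Zariski identity component of the centralizer $\{x\in\mathbf{G}\mid \sigma x=x\sigma\}$; it is defined over $\mathbb{R}$. Put $G^{\rho}_{\mathrm{even}}:=G\cap\mathbf{G}^{\rho}_{\mathrm{even}}(\mathbb{R})$. *)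

theory Defs
  imports "HOL-Analysis.Analysis" "HOL-Algebra.Coset"
begin

section \<open>Matrix groups\<close>

definition matrix_group :: "('a::semiring_1^'n^'n) set \<Rightarrow> ('a^'n^'n) monoid" where
  "matrix_group S = \<lparr>carrier = S, mult = (**), one = mat 1\<rparr>"

abbreviation GL_set :: "('a::semiring_1^'n^'n) set" where
  "GL_set \<equiv> {X. invertible X}"

definition SL2R :: "(real^2^2) set" where
  "SL2R = {X. det X = 1}"

primrec matrix_pow :: "'a::semiring_1^'n^'n \<Rightarrow> nat \<Rightarrow> 'a^'n^'n" where
  "matrix_pow X 0 = mat 1"
| "matrix_pow X (Suc k) = X ** matrix_pow X k"

text \<open>The type of square matrices is not an instance of the class required by the library's
  exponential, whence the explicit series.\<close>

definition matrix_exp :: "'a::real_normed_algebra_1^'n^'n \<Rightarrow> 'a^'n^'n" where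
  "matrix_exp X = (\<Sum>k. (1 / fact k) *\<^sub>R matrix_pow X k)"

lemma group_GL: "group (matrix_group (GL_set :: ('a::field^'n^'n) set))"
proof (rule groupI)
  show "\<one>\<^bsub>matrix_group GL_set\<^esub> \<in> carrier (matrix_group (GL_set :: ('a^'n^'n) set))"
    unfolding matrix_group_def invertible_def by (auto intro: exI[of _ "mat 1"])
  fix X :: "'a^'n^'n"
  assume "X \<in> carrier (matrix_group GL_set)"
  then obtain Y where "X ** Y = mat 1" "Y ** X = mat 1"
    unfolding matrix_group_def invertible_def by auto
  then show "\<exists>Y\<in>carrier (matrix_group GL_set).
      Y \<otimes>\<^bsub>matrix_group GL_set\<^esub> X = \<one>\<^bsub>matrix_group GL_set\<^esub>"
    unfolding matrix_group_def invertible_def by (intro bexI[of _ Y]) auto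
qed (simp_all add: matrix_group_def invertible_mult matrix_mul_assoc)

lemma subgroup_SL2R: "subgroup SL2R (matrix_group GL_set)"
proof (rule group.subgroupI[OF group_GL])
  show "SL2R \<subseteq> carrier (matrix_group GL_set)"
    by (auto simp: SL2R_def matrix_group_def invertible_det_nz)
  show "SL2R \<noteq> {}"
    unfolding SL2R_def using det_I[where 'a=real and 'n=2] by blast
  fix X :: "real^2^2"
  assume X: "X \<in> SL2R"
  then have Xc: "X \<in> carrier (matrix_group GL_set)"
    by (auto simp: SL2R_def matrix_group_def invertible_det_nz)
  have "inv\<^bsub>matrix_group GL_set\<^esub> X ** X = mat 1"
    using group.l_inv[OF group_GL Xc] by (simp add: matrix_group_def)
  then have "det (inv\<^bsub>matrix_group GL_set\<^esub> X) * det X = 1"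
    by (metis det_I det_mul)
  then show "inv\<^bsub>matrix_group GL_set\<^esub> X \<in> SL2R"
    using X by (simp add: SL2R_def)
next
  fix X Y :: "real^2^2"
  assume "X \<in> SL2R" "Y \<in> SL2R"
  then show "X \<otimes>\<^bsub>matrix_group GL_set\<^esub> Y \<in> SL2R"
    by (simp add: SL2R_def matrix_group_def det_mul)
qed


section \<open>The Zariski topology on the general linear group\<close>

text \<open>Polynomial functions in the matrix entries with coefficients in \<open>K\<close>.\<close>

inductive_set poly_fun :: "complex set \<Rightarrow> (complex^'n^'n \<Rightarrow> complex) set"
  for K :: "complex set" where
  const: "c \<in> K \<Longrightarrow> (\<lambda>X. c) \<in> poly_fun K"
| entry: "(\<lambda>X. X $ i $ j) \<in> poly_fun K"
| add: "p \<in> poly_fun K \<Longrightarrow> q \<in> poly_fun K \<Longrightarrow> (\<lambda>X. p X + q X) \<in> poly_fun K"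
| mult: "p \<in> poly_fun K \<Longrightarrow> q \<in> poly_fun K \<Longrightarrow> (\<lambda>X. p X * q X) \<in> poly_fun K"

text \<open>Regular functions on the general linear group are quotients of polynomial functions by
  powers of the determinant, so polynomials suffice to cut out all Zariski closed subsets.\<close>

definition zero_locus :: "(complex^'n^'n \<Rightarrow> complex) set \<Rightarrow> (complex^'n^'n) set" where
  "zero_locus P = {X \<in> GL_set. \<forall>p\<in>P. p X = 0}"

definition zariski :: "(complex^'n^'n) topology" where
  "zariski = topology (\<lambda>U. \<exists>P\<subseteq>poly_fun UNIV. U = GL_set - zero_locus P)"

lemma istopology_zariski:
  "istopology (\<lambda>U :: (complex^'n^'n) set. \<exists>P\<subseteq>poly_fun UNIV. U = GL_set - zero_locus P)"
  (is "istopology ?open")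
  unfolding istopology_def
proof (intro conjI allI impI)
  fix S T :: "(complex^'n^'n) set"
  assume "?open S" "?open T"
  then obtain P Q where PQ: "P \<subseteq> poly_fun UNIV" "Q \<subseteq> poly_fun UNIV"
    "S = GL_set - zero_locus P" "T = GL_set - zero_locus Q" by blast
  let ?R = "{\<lambda>X. p X * q X |p q. p \<in> P \<and> q \<in> Q}"
  have "?R \<subseteq> poly_fun UNIV"
    using PQ(1,2) by (auto intro!: poly_fun.mult)
  moreover have "S \<inter> T = GL_set - zero_locus ?R"
  proof (intro Set.set_eqI iffI)
    fix X assume "X \<in> S \<inter> T"
    then obtain p q where "X \<in> GL_set" "p \<in> P" "q \<in> Q" "p X \<noteq> 0" "q X \<noteq> 0"
      unfolding PQ(3,4) zero_locus_def by blast
    then have "(\<lambda>X. p X * q X) \<in> ?R" "p X * q X \<noteq> 0" by auto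
    then show "X \<in> GL_set - zero_locus ?R"
      using \<open>X \<in> GL_set\<close> unfolding zero_locus_def by fast
  next
    fix X assume "X \<in> GL_set - zero_locus ?R"
    then obtain p q where "X \<in> GL_set" "p \<in> P" "q \<in> Q" "p X * q X \<noteq> 0"
      unfolding zero_locus_def by blast
    then show "X \<in> S \<inter> T"
      unfolding PQ(3,4) zero_locus_def by auto
  qed
  ultimately show "?open (S \<inter> T)" by blast
next
  fix K :: "(complex^'n^'n) set set"
  assume "\<forall>S\<in>K. ?open S"
  then obtain P where P: "\<And>S. S \<in> K \<Longrightarrow> P S \<subseteq> poly_fun UNIV"
    "\<And>S. S \<in> K \<Longrightarrow> S = GL_set - zero_locus (P S)" by metis
  have "(\<Union>S\<in>K. P S) \<subseteq> poly_fun UNIV"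
    using P(1) by blast
  moreover have "\<Union>K = (\<Union>S\<in>K. GL_set - zero_locus (P S))"
    using P(2) by auto
  then have "\<Union>K = GL_set - zero_locus (\<Union>S\<in>K. P S)"
    by (auto simp: zero_locus_def)
  ultimately show "?open (\<Union>K)" by blast
qed

lemma openin_zariski:
  "openin zariski U \<longleftrightarrow> (\<exists>P\<subseteq>poly_fun UNIV. U = GL_set - zero_locus P)"
  unfolding zariski_def topology_inverse'[OF istopology_zariski] by (rule refl)

lemma topspace_zariski [simp]: "topspace zariski = GL_set"
proof -
  have "GL_set = GL_set - zero_locus {\<lambda>X. 1}"
    by (auto simp: zero_locus_def)
  then have "openin zariski (GL_set :: (complex^'n^'n) set)"
    unfolding openin_zariski by (metis UNIV_I empty_subsetI insert_subset poly_fun.const)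
  then have "GL_set \<subseteq> topspace (zariski :: (complex^'n^'n) topology)"
    by (rule openin_subset)
  moreover have "topspace (zariski :: (complex^'n^'n) topology) \<subseteq> GL_set"
    using openin_topspace[of "zariski :: (complex^'n^'n) topology"]
    unfolding openin_zariski by blast
  ultimately show ?thesis by blast
qed

lemma closedin_zariski:
  "closedin zariski S \<longleftrightarrow> (\<exists>P\<subseteq>poly_fun UNIV. S = zero_locus P)"
proof -
  have "S \<subseteq> GL_set \<and> GL_set - S = GL_set - zero_locus P \<longleftrightarrow> S = zero_locus P" for P
    unfolding zero_locus_def by blast
  then show ?thesis
    unfolding closedin_def topspace_zariski openin_zariski by blast
qed


section \<open>Linear algebraic groups and real reductive groups\<close>

text \<open>A linear algebraic group is identified with its group of complex points, a Zariski
  closed subgroup of a general linear group.\<close>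

definition linear_algebraic_group :: "(complex^'n^'n) set \<Rightarrow> bool" where
  "linear_algebraic_group H \<longleftrightarrow> closedin zariski H \<and> subgroup H (matrix_group GL_set)"

definition defined_over_R :: "(complex^'n^'n) set \<Rightarrow> bool" where
  "defined_over_R H \<longleftrightarrow> (\<exists>P\<subseteq>poly_fun \<real>. H = zero_locus P)"

definition real_points :: "(complex^'n^'n) set \<Rightarrow> (complex^'n^'n) set" where
  "real_points H = {X \<in> H. \<forall>i j. X $ i $ j \<in> \<real>}"

definition unipotent :: "complex^'n^'n \<Rightarrow> bool" where
  "unipotent X \<longleftrightarrow> (\<exists>k. matrix_pow (X - mat 1) k = 0)"

text \<open>Reductive: the unipotent radical, i.e. the largest Zariski connected closed normal
  unipotent subgroup, is trivial.\<close>

definition reductive :: "(complex^'n^'n) set \<Rightarrow> bool" where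
  "reductive H \<longleftrightarrow> linear_algebraic_group H \<and>
     (\<forall>U. closedin zariski U \<and> connectedin zariski U \<and> normal U (matrix_group H) \<and>
          (\<forall>X\<in>U. unipotent X) \<longrightarrow> U = {mat 1})"

definition real_reductive_group :: "(complex^'n^'n) set \<Rightarrow> (complex^'n^'n) set \<Rightarrow> bool" where
  "real_reductive_group GG G \<longleftrightarrow>
     reductive GG \<and> connectedin zariski GG \<and> defined_over_R GG \<and>
     subgroup G (matrix_group (real_points GG)) \<and> openin (top_of_set (real_points GG)) G"

definition identity_component :: "(complex^'n^'n) set \<Rightarrow> (complex^'n^'n) set" where
  "identity_component H = connected_component_of_set (subtopology zariski H) (mat 1)"


section \<open>Lie group homomorphisms\<close>

primrec Ck_on :: "nat \<Rightarrow> 'a::euclidean_space set \<Rightarrow> ('a \<Rightarrow> 'b::euclidean_space) \<Rightarrow> bool" where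
  "Ck_on 0 S f \<longleftrightarrow> continuous_on S f"
| "Ck_on (Suc k) S f \<longleftrightarrow> (\<forall>x\<in>S. f differentiable (at x)) \<and>
     (\<forall>v. Ck_on k S (\<lambda>x. frechet_derivative f (at x) v))"

text \<open>Smoothness of a map on an embedded submanifold \<open>S\<close> of a Euclidean space.\<close>

definition smooth_map_on :: "'a::euclidean_space set \<Rightarrow> ('a \<Rightarrow> 'b::euclidean_space) \<Rightarrow> bool" where
  "smooth_map_on S f \<longleftrightarrow> (\<forall>x\<in>S. \<exists>U F. open U \<and> x \<in> U \<and> (\<forall>k. Ck_on k U F) \<and>
     (\<forall>y\<in>U \<inter> S. F y = f y))"

definition lie_group_hom ::
  "(real^'m^'m) set \<Rightarrow> (complex^'n^'n) set \<Rightarrow> (real^'m^'m \<Rightarrow> complex^'n^'n) \<Rightarrow> bool" where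
  "lie_group_hom S G \<rho> \<longleftrightarrow> \<rho> \<in> hom (matrix_group S) (matrix_group G) \<and> smooth_map_on S \<rho>"

definition lie_differential :: "(real^'m^'m \<Rightarrow> complex^'n^'n) \<Rightarrow> real^'m^'m \<Rightarrow> complex^'n^'n" where
  "lie_differential \<rho> A = vector_derivative (\<lambda>t. \<rho> (matrix_exp (t *\<^sub>R A))) (at 0)"

definition A0 :: "real^2^2" where
  "A0 = vector [vector [1, 0], vector [0, -1]]"

definition sigma :: "(real^2^2 \<Rightarrow> complex^'n^'n) \<Rightarrow> complex^'n^'n" where
  "sigma \<rho> = matrix_exp (\<chi> i j. of_real pi * \<i> * lie_differential \<rho> A0 $ i $ j)"

definition GG_even :: "(complex^'n^'n) set \<Rightarrow> (real^2^2 \<Rightarrow> complex^'n^'n) \<Rightarrow> (complex^'n^'n) set" where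
  "GG_even GG \<rho> = identity_component {X \<in> GG. sigma \<rho> ** X = X ** sigma \<rho>}"

definition G_even ::
  "(complex^'n^'n) set \<Rightarrow> (complex^'n^'n) set \<Rightarrow> (real^2^2 \<Rightarrow> complex^'n^'n) \<Rightarrow> (complex^'n^'n) set" where
  "G_even GG G \<rho> = G \<inter> real_points (GG_even GG \<rho>)"


section \<open>Representation spaces\<close>

text \<open>Homomorphisms are made extensional, so that functions agreeing on \<open>\<Gamma>\<close> are identified; the
  product topology is the topology of pointwise convergence.\<close>

definition Hom_topology ::
  "(real^'m^'m) set \<Rightarrow> (complex^'n^'n) set \<Rightarrow> (real^'m^'m \<Rightarrow> complex^'n^'n) topology" where
  "Hom_topology \<Gamma> G = subtopology (product_topology (\<lambda>_. top_of_set G) \<Gamma>)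
     (hom (matrix_group \<Gamma>) (matrix_group G))"

lemma topspace_Hom_topology:
  "topspace (Hom_topology \<Gamma> G) = hom (matrix_group \<Gamma>) (matrix_group G) \<inter> extensional \<Gamma>"
  by (auto simp: Hom_topology_def PiE_def hom_def matrix_group_def)


section \<open>Fundamental groups\<close>

definition loops :: "'a topology \<Rightarrow> 'a \<Rightarrow> (real \<Rightarrow> 'a) set" where
  "loops X x = {p. pathin X p \<and> p 0 = x \<and> p 1 = x}"

definition loop_homotopy :: "'a topology \<Rightarrow> 'a \<Rightarrow> ((real \<Rightarrow> 'a) \<times> (real \<Rightarrow> 'a)) set" where
  "loop_homotopy X x = {(p, q). p \<in> loops X x \<and> q \<in> loops X x \<and>
     homotopic_with (\<lambda>r. r 0 = x \<and> r 1 = x) (top_of_set {0..1}) X p q}"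

definition loop_concat :: "(real \<Rightarrow> 'a) \<Rightarrow> (real \<Rightarrow> 'a) \<Rightarrow> real \<Rightarrow> 'a" where
  "loop_concat p q = (\<lambda>t. if t \<le> 1/2 then p (2 * t) else q (2 * t - 1))"

definition fundamental_group :: "'a topology \<Rightarrow> 'a \<Rightarrow> (real \<Rightarrow> 'a) set monoid" where
  "fundamental_group X x =
     \<lparr>carrier = loops X x // loop_homotopy X x,
      mult = (\<lambda>P Q. \<Union>p\<in>P. \<Union>q\<in>Q. loop_homotopy X x `` {loop_concat p q}),
      one = loop_homotopy X x `` {\<lambda>_. x}\<rparr>"


section \<open>The closed oriented surface of genus g\<close>

definition quotient_topology :: "'a topology \<Rightarrow> ('a \<times> 'a) set \<Rightarrow> 'a set topology" where
  "quotient_topology X R = topology (\<lambda>U. U \<subseteq> topspace X // R \<and>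
     openin X {x \<in> topspace X. R `` {x} \<in> U})"

lemma istopology_quotient:
  "istopology (\<lambda>U. U \<subseteq> topspace X // R \<and> openin X {x \<in> topspace X. R `` {x} \<in> U})"
  unfolding istopology_def
proof (intro conjI allI impI; (elim conjE)?)
  fix S T
  assume "openin X {x \<in> topspace X. R `` {x} \<in> S}" "openin X {x \<in> topspace X. R `` {x} \<in> T}"
  then have "openin X ({x \<in> topspace X. R `` {x} \<in> S} \<inter> {x \<in> topspace X. R `` {x} \<in> T})"
    by blast
  then show "openin X {x \<in> topspace X. R `` {x} \<in> S \<inter> T}"
    by (rule back_subst[of "openin X"]) auto
next
  fix K
  assume "\<forall>S\<in>K. S \<subseteq> topspace X // R \<and> openin X {x \<in> topspace X. R `` {x} \<in> S}"
  then have "openin X (\<Union>S\<in>K. {x \<in> topspace X. R `` {x} \<in> S})"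
    by blast
  then show "openin X {x \<in> topspace X. R `` {x} \<in> \<Union>K}"
    by (rule back_subst[of "openin X"]) auto
qed auto

lemma openin_quotient_topology:
  "openin (quotient_topology X R) U \<longleftrightarrow>
     U \<subseteq> topspace X // R \<and> openin X {x \<in> topspace X. R `` {x} \<in> U}"
  unfolding quotient_topology_def topology_inverse'[OF istopology_quotient] by (rule refl)

lemma topspace_quotient_topology: "topspace (quotient_topology X R) = topspace X // R"
proof -
  have "{x \<in> topspace X. R `` {x} \<in> topspace X // R} = topspace X"
    by (auto simp: quotient_def)
  then have "openin (quotient_topology X R) (topspace X // R)"
    by (simp add: openin_quotient_topology)
  then show ?thesis
    by (meson openin_quotient_topology openin_subset openin_topspace subset_antisym)
qed

lemma quotient_map_quotient_topology:
  "quotient_map X (quotient_topology X R) (\<lambda>x. R `` {x})"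
proof -
  have "(\<lambda>x. R `` {x}) ` topspace X = topspace X // R"
    by (auto simp: quotient_def)
  then show ?thesis
    unfolding quotient_map_def topspace_quotient_topology openin_quotient_topology by blast
qed

text \<open>The closed unit disc is regarded as a polygon with \<open>4 g\<close> sides, the \<open>k\<close>-th side being the
  boundary arc \<open>polygon_bd g ` {k..k+1}\<close>.  The sides are glued according to the boundary word
  \<open>a\<^sub>1 b\<^sub>1 a\<^sub>1\<^sup>-\<^sup>1 b\<^sub>1\<^sup>-\<^sup>1 \<dots> a\<^sub>g b\<^sub>g a\<^sub>g\<^sup>-\<^sup>1 b\<^sub>g\<^sup>-\<^sup>1\<close>: for \<open>j < g\<close> and \<open>k \<in> {0, 1}\<close>, side \<open>4 j + k\<close> is glued to
  side \<open>4 j + k + 2\<close> with reversed direction.  This is meaningful for \<open>g \<ge> 1\<close>.\<close>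

definition polygon_bd :: "nat \<Rightarrow> real \<Rightarrow> complex" where
  "polygon_bd g s = cis (2 * pi * s / (4 * real g))"

definition side_gluing :: "nat \<Rightarrow> (complex \<times> complex) set" where
  "side_gluing g =
     {(polygon_bd g (real (4 * j + k) + t), polygon_bd g (real (4 * j + k + 3) - t)) | j k t.
        j < g \<and> k < 2 \<and> 0 \<le> t \<and> t \<le> 1}"

definition genus_surface :: "nat \<Rightarrow> complex set topology" where
  "genus_surface g = quotient_topology (top_of_set (cball 0 1))
     ((side_gluing g \<union> (side_gluing g)\<inverse>)\<^sup>*)"

lemma genus_surface_gluing_class:
  assumes "z \<in> cball 0 1"
  shows "((side_gluing g \<union> (side_gluing g)\<inverse>)\<^sup>*) `` {z} \<subseteq> cball 0 1"
proof -
  have "w \<in> cball 0 1" if "(z, w) \<in> (side_gluing g \<union> (side_gluing g)\<inverse>)\<^sup>*" for w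
    using that assms
    by (induction rule: rtrancl_induct) (auto simp: side_gluing_def polygon_bd_def)
  then show ?thesis by blast
qed

end

theory Submission
  imports Defs "HOL-Computational_Algebra.Fundamental_Theorem_Algebra" "HOL-Library.Function_Algebras"
begin

text \<open>Let \<open>a\<^sub>i, b\<^sub>i\<close> be the standard generators of the surface group.  A homomorphism \<open>r\<close> into any group can
  be twisted along the curves \<open>a\<^sub>i\<close>: if \<open>z\<^sub>i\<close> commutes with \<open>r(a\<^sub>i)\<close>, then \<open>b\<^sub>i\<close> may be sent to \<open>z\<^sub>i r(b\<^sub>i)\<close>
  (van Kampen for path functors on the polygon with glued sides).  Discreteness makes every \<open>a\<^sub>i\<close> equal to
  \<open>\<plusminus>exp X\<^sub>i\<close> with \<open>X\<^sub>i\<close> conjugate to a multiple of the diagonal or the strictly upper triangular generator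
  of \<open>sl\<^sub>2\<close>.  Twisting by \<open>exp(t v\<^sub>i)\<close>, where the \<open>v\<^sub>i\<close> are conjugates of vectors spanning the centralizer of
  that generator in the Lie algebra of \<open>Z = {X \<in> GG. \<sigma> X = X \<sigma>}\<close>, deforms \<open>\<rho>\<close>.  For generic \<open>t\<close> the
  Zariski closure of the image contains \<open>\<rho>(SL\<^sub>2)\<close>, because \<open>a\<^sub>0, a\<^sub>1\<close> share no eigenvector, and all \<open>exp(s v\<^sub>i)\<close>.
  As \<open>\<sigma> = \<rho>(-1)\<close>, the \<open>sl\<^sub>2\<close>-module \<open>Lie Z\<close> has only even weights and is generated by such a centralizer,
  so the closure is a closed subgroup of \<open>Z\<close> with the same Lie algebra and contains the identity component.\<close>

section \<open>Path functors\<close>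

text \<open>The surface group enters only through homomorphisms, never through a presentation.
  Twisting with values in the group \<open>Q\<close> of continuous paths in \<open>H\<close> yields
  at once a family of representations continuous in t; evaluation at t = 0 kills the twisting
  elements, so the family starts at \<rho>. Twisting the trivial homomorphism along a second family
  of curves prescribes the images of the a_i at will: they have infinite order, and a_0, a_1 obey no
  law of triangular matrices. The genus bound 2 + 2 DIM: two handles produce \<rho>(SL2), and among
  the others one type, hyperbolic or parabolic, occurs DIM times, enough for a basis of the real
  part of its centralizer. The closure contains only powers of exp(t v). Polynomials along exp(s v)
  are exponential polynomials in s; they vanish when they vanish on an arithmetic progression whose
  step t separates the frequencies. Real spectrum, generic t and small norm each secure this. Equal
  Lie algebras suffice because the cosets are Euclidean open, hence countably many, and over an
  uncountable field an irreducible variety is no countable union of proper closed subsets.\<close>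

lemma continuous_on_pieces:
 fixes f h :: "real => 'a::topological_space"
 assumes "continuous_on {a..b} f" "continuous_on {b..c} h" "f b = h b" "a <= b" "b <= c"
 shows "continuous_on {a..c} (%t. if t <= b then f t else h t)"
proof -
 have "continuous_on ({a..b} \<union> {b..c}) (%t. if t <= b then f t else h t)"
  using assms by (intro continuous_on_If) (auto dest: antisym)
 moreover have "{a..b} \<union> {b..c} = {a..c}" using assms by auto
 ultimately show ?thesis by simp
qed

definition path_homotopic :: "'a topology => (real => 'a) => (real => 'a) => bool" where
 "path_homotopic X p q \<longleftrightarrow> p 0 = q 0 & p 1 = q 1 &
   homotopic_with (%r. r 0 = p 0 & r 1 = p 1) (top_of_set {0..1}) X p q"

text \<open>The straight-line homotopy between \<open>a\<close> and \<open>b\<close> inside the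
  convex set \<open>K\<close>, pushed forward by \<open>H\<close>. Reparametrizations, paths in the
  disc and paths in a side chart are all instances.\<close>

lemma path_homotopic_convex:
 fixes K :: "'b::real_normed_vector set"
 assumes H: "continuous_map (top_of_set K) X H" and K: "convex K"
  and a: "continuous_on {0..1} a" "a ` {0..1} \<subseteq> K"
  and b: "continuous_on {0..1} b" "b ` {0..1} \<subseteq> K"
  and e: "a 0 = b 0" "a 1 = b 1"
  and p: "!!t. t \<in> {0..1} ==> p t = H (a t)" and q: "!!t. t \<in> {0..1} ==> q t = H (b t)"
 shows "path_homotopic X p q"
proof -
 \<comment> \<open>\<open>homotopic_with\<close> requires \<open>h (0, t) = p t\<close> and
   \<open>h (1, t) = q t\<close> for every real t, whereas \<open>p\<close> and \<open>q\<close> are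
   controlled only on the unit interval; the second branch supplies the values outside.\<close>
 define h where "h = (%(s, t). if t \<in> {0..1::real} then H ((1 - s) *\<^sub>R a t + s *\<^sub>R b t)
   else if s = 0 then p t else q t)"
 have "continuous_map (prod_topology (top_of_set {0..1}) (top_of_set {0..1})) (top_of_set K)
   (%(s::real, t). (1 - s) *\<^sub>R a t + s *\<^sub>R b t)"
 proof -
  have "continuous_on ({0..1} \<times> {0..1}) (%(s::real, t). (1 - s) *\<^sub>R a t + s *\<^sub>R b t)"
   unfolding split_beta
   by (intro continuous_intros continuous_on_compose2[OF a(1)] continuous_on_compose2[OF b(1)]) auto
  moreover have "(1 - s) *\<^sub>R a t + s *\<^sub>R b t \<in> K" if "s \<in> {0..1}" "t \<in> {0..1}" for s t :: real
   using that a(2) b(2) by (intro convexD[OF K]) auto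
  ultimately show ?thesis
   by (subst prod_topology_subtopology_eu) (auto simp: continuous_map_in_subtopology image_subset_iff)
 qed
 then have "continuous_map (prod_topology (top_of_set {0..1}) (top_of_set {0..1})) X
   (H \<circ> (%(s::real, t). (1 - s) *\<^sub>R a t + s *\<^sub>R b t))"
  using H by (rule continuous_map_compose)
 then have "continuous_map (prod_topology (top_of_set {0..1}) (top_of_set {0..1})) X h"
  by (rule continuous_map_eq) (auto simp: h_def)
 moreover have "h (0, t) = p t" "h (1, t) = q t" for t
  by (auto simp: h_def p q)
 moreover have "h (s, 0) = p 0 & h (s, 1) = p 1" for s
  by (auto simp: h_def p q e simp flip: scaleR_add_left)
 ultimately show ?thesis
  unfolding path_homotopic_def homotopic_with_def using p q e by (auto intro!: exI[of _ h])
qed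

lemma path_homotopic_pathin: "path_homotopic X p q ==> pathin X p & pathin X q"
 unfolding path_homotopic_def pathin_def using homotopic_with_imp_continuous_maps by blast

lemma path_homotopic_refl: "pathin X p ==> path_homotopic X p p"
 by (simp add: path_homotopic_def pathin_def)

lemma path_homotopic_sym: "path_homotopic X p q ==> path_homotopic X q p"
 unfolding path_homotopic_def
 by (elim conjE, drule homotopic_with_symD) simp

lemma path_homotopic_trans: "path_homotopic X p q ==> path_homotopic X q r ==> path_homotopic X p r"
 unfolding path_homotopic_def by (auto intro: homotopic_with_trans)

lemma path_homotopic_subtopology:
 "path_homotopic (subtopology X U) p q ==> path_homotopic X p q"
 unfolding path_homotopic_def homotopic_with_def by (auto simp: continuous_map_in_subtopology)

text \<open>Paths are total functions of a real variable; this discards their irrelevant values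
  outside the unit interval.\<close>

lemma path_homotopic_eqI:
 "pathin X p ==> (!!t. t \<in> {0..1} ==> p t = q t) ==> path_homotopic X p q"
 by (rule path_homotopic_convex[where H=p and K="{0..1}" and a="%t. t" and b="%t. t"])
   (auto simp: pathin_def)

lemma pathin_loop_concat:
 assumes "pathin X p" "pathin X q" "p 1 = q 0"
 shows "pathin X (loop_concat p q)"
proof -
 have 1: "continuous_map (top_of_set {0..1/2}) X (p \<circ> (%t. 2 * t))"
  by (rule continuous_map_compose[OF _ assms(1)[unfolded pathin_def]])
    (auto simp: continuous_map_in_subtopology intro!: continuous_intros)
 have 2: "continuous_map (top_of_set {1/2..1}) X (q \<circ> (%t. 2 * t - 1))"
  by (rule continuous_map_compose[OF _ assms(2)[unfolded pathin_def]])
    (auto simp: continuous_map_in_subtopology intro!: continuous_intros)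
 have half: "p (2 * t) = q (2 * t - 1)" if "t * 2 = 1" for t :: real
 proof -
  have "t = 1/2" using that by simp
  show ?thesis unfolding \<open>t = 1/2\<close> using assms(3) by simp
 qed
 have "{t \<in> topspace (top_of_set {0..1}). t <= (1/2::real)} = {0..1/2}"
  "{t \<in> topspace (top_of_set {0..1}). (1/2::real) <= t} = {1/2..1}" by auto
 then have "continuous_map (top_of_set {0..1}) X (%t. if t <= 1/2 then (p \<circ> (%t. 2 * t)) t else (q \<circ> (%t. 2 * t - 1)) t)"
  using 1 2 half
  by (intro continuous_map_cases_le) (auto simp: subtopology_subtopology Int_absorb1 o_def)
 then show ?thesis unfolding pathin_def loop_concat_def o_def .
qed

lemma loop_concat_ends [simp]:
 "loop_concat p q 0 = p 0" "loop_concat p q 1 = q 1"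
 by (auto simp: loop_concat_def)

definition subpath_on :: "(real => 'a) => real => real => real => 'a" where
 "subpath_on p a b = (%t. p (a + (b - a) * t))"

lemma subpath_on_ends [simp]: "subpath_on p a b 0 = p a" "subpath_on p a b 1 = p b"
 by (auto simp: subpath_on_def)

lemma segment_in_interval:
 fixes a b t :: real
 assumes "0 <= t" "t <= 1" "a \<in> {c..d}" "b \<in> {c..d}"
 shows "a + (b - a) * t \<in> {c..d}"
proof -
 have "a + (b - a) * t = (1 - t) *\<^sub>R a + t *\<^sub>R b" by (simp add: algebra_simps)
 then show ?thesis using convexD[OF convex_real_interval(5)[of c d] assms(3,4), of "1 - t" t] assms by simp
qed

lemma pathin_subpath_on:
 assumes "continuous_map (top_of_set {c..d}) X p" "a \<in> {c..d}" "b \<in> {c..d}"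
 shows "pathin X (subpath_on p a b)"
proof -
 have "continuous_map (top_of_set {0..1}) X (p \<circ> (%t. a + (b - a) * t))"
  using segment_in_interval[OF _ _ assms(2,3)]
  by (intro continuous_map_compose[OF _ assms(1)])
    (auto simp: continuous_map_in_subtopology intro!: continuous_intros)
 then show ?thesis by (simp add: pathin_def subpath_on_def o_def)
qed

lemma continuous_map_top_of_set_subtopology:
 "continuous_map (top_of_set {c..d}) X p ==> p ` {c..d} \<subseteq> U ==>
   continuous_map (top_of_set {c..d}) (subtopology X U) p"
 by (auto simp: continuous_map_in_subtopology)

text \<open>Both sides are \<open>p\<close> after maps of the unit interval into the convex set
  \<open>{c..d}\<close> with the same endpoints. The points \<open>a\<close>, \<open>b\<close>,
  \<open>e\<close> may come in any order.\<close>

lemma concat_subpaths_homotopic: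
 assumes "continuous_map (top_of_set {c..d}) X p" "{a, b, e} \<subseteq> {c..d}"
 shows "path_homotopic X (loop_concat (subpath_on p a b) (subpath_on p b e)) (subpath_on p a e)"
proof -
 let ?k = "%t. if t <= 1/2 then a + (b - a) * (2 * t) else b + (e - b) * (2 * t - 1)"
 have k: "continuous_on {0..1} ?k"
  by (intro continuous_on_pieces continuous_intros) auto
 have r: "?k t \<in> {c..d}" "a + (e - a) * t \<in> {c..d}" if "t \<in> {0..1}" for t
  using segment_in_interval[of "2 * t" a c d b] segment_in_interval[of "2 * t - 1" b c d e]
   segment_in_interval[of t a c d e] that assms(2) by auto
 have "?k ` {0..1} \<subseteq> {c..d}" "(%t. a + (e - a) * t) ` {0..1} \<subseteq> {c..d}" using r by blast+
 then show ?thesis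
  by (intro path_homotopic_convex[OF assms(1) _ k, where b = "%t. a + (e - a) * t"])
    (auto intro!: continuous_intros simp: loop_concat_def subpath_on_def)
qed

text \<open>\<open>X\<close> need not be metric, so the cover is pulled back along \<open>f\<close>
  to open sets of the Euclidean space around \<open>S\<close>, where Lebesgue numbers exist.\<close>

lemma cover_Lebesgue:
 fixes S :: "'b::euclidean_space set"
 assumes S: "compact S" "S ~= {}" and f: "continuous_map (top_of_set S) X f"
  and C: "!!U. U \<in> C ==> openin X U" "topspace X \<subseteq> \<Union>C"
 shows "\<exists>\<delta>>0. \<forall>T\<subseteq>S. T ~= {} --> diameter T < \<delta> --> (\<exists>U\<in>C. f ` T \<subseteq> U)"
proof -
 define D where "D = {W. open W & (\<exists>U\<in>C. f ` (S \<inter> W) \<subseteq> U)}"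
 have "\<exists>W\<in>D. x \<in> W" if "x \<in> S" for x
 proof -
  have "f x \<in> topspace X" using f that by (auto simp: continuous_map_def)
  then obtain U where U: "U \<in> C" "f x \<in> U" using C by blast
  then have "openin (top_of_set S) {y \<in> topspace (top_of_set S). f y \<in> U}"
   using f C(1) openin_continuous_map_preimage by blast
  then obtain W where "open W" "{y \<in> S. f y \<in> U} = S \<inter> W"
   by (auto simp: openin_open)
  then show ?thesis using U that unfolding D_def by blast
 qed
 then have D: "S \<subseteq> \<Union>D" "D ~= {}" using S(2) by blast+
 have "open B" if "B \<in> D" for B using that by (simp add: D_def)
 then obtain \<delta> where d: "\<delta> > 0" "!!T. T \<subseteq> S ==> diameter T < \<delta> ==> \<exists>B\<in>D. T \<subseteq> B"
  using Lebesgue_number_lemma[OF S(1) D(2,1)] by blast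
 have "\<exists>U\<in>C. f ` T \<subseteq> U" if T: "T \<subseteq> S" "diameter T < \<delta>" for T
 proof -
  obtain B where B: "B \<in> D" "T \<subseteq> B" using d(2)[OF T] by blast
  then obtain U where "U \<in> C" "f ` (S \<inter> B) \<subseteq> U" by (auto simp: D_def)
  then show ?thesis using B(2) T(1) by blast
 qed
 with d(1) show ?thesis by blast
qed

section \<open>Transport along paths from local data (van Kampen by subdivision)\<close>

primrec rprod :: "('q, 'b) monoid_scheme => (nat => 'q) => nat => 'q" where
 "rprod Q f 0 = \<one>\<^bsub>Q\<^esub>"
| "rprod Q f (Suc n) = rprod Q f n \<otimes>\<^bsub>Q\<^esub> f n"

context monoid begin

lemma rprod_closed: "(!!i. i < n ==> f i \<in> carrier G) ==> rprod G f n \<in> carrier G"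
 by (induction n) auto

lemma rprod_cong: "(!!i. i < n ==> f i = h i) ==> rprod G f n = rprod G h n"
 by (induction n) auto

lemma rprod_add:
 "(!!i. i < m + n ==> f i \<in> carrier G) ==>
   rprod G f (m + n) = rprod G f m \<otimes> rprod G (%i. f (m + i)) n"
 by (induction n) (auto simp: m_assoc rprod_closed)

lemma rprod_mult:
 "(!!i. i < n * k ==> f i \<in> carrier G) ==>
   rprod G f (n * k) = rprod G (%i. rprod G (%j. f (i * k + j)) k) n"
proof (induction n)
 case (Suc n)
 have "rprod G f (n * k + k) = rprod G f (n * k) \<otimes> rprod G (%i. f (n * k + i)) k"
  using Suc.prems by (intro rprod_add) (simp add: add.commute)
 moreover have "rprod G f (n * k) = rprod G (%i. rprod G (%j. f (i * k + j)) k) n"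
  using Suc by simp
 ultimately show ?case by (simp add: add.commute)
qed auto

text \<open>Commuting squares laid side by side: \<open>f\<close> is one row of horizontal edges,
  \<open>h\<close> the other, \<open>c\<close> the vertical edges between them.\<close>

lemma rprod_telescope:
 assumes "!!i. i < n ==> f i \<in> carrier G & h i \<in> carrier G" "!!i. i <= n ==> c i \<in> carrier G"
  and "!!i. i < n ==> f i \<otimes> c (Suc i) = c i \<otimes> h i"
 shows "rprod G f n \<otimes> c n = c 0 \<otimes> rprod G h n"
 using assms
proof (induction n)
 case (Suc n)
 have [simp]: "rprod G f n \<in> carrier G" "rprod G h n \<in> carrier G" "f n \<in> carrier G" "h n \<in> carrier G"
   "c n \<in> carrier G" "c (Suc n) \<in> carrier G" "c 0 \<in> carrier G"
  using Suc.prems(1,2) by (auto intro!: rprod_closed)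
 have "rprod G f (Suc n) \<otimes> c (Suc n) = rprod G f n \<otimes> (c n \<otimes> h n)"
  using Suc.prems(3)[of n] by (simp add: m_assoc)
 also have "... = (rprod G f n \<otimes> c n) \<otimes> h n" by (simp add: m_assoc)
 also have "rprod G f n \<otimes> c n = c 0 \<otimes> rprod G h n"
  using Suc by simp
 finally show ?case by (simp add: m_assoc)
qed auto

end

text \<open>A multiplicative, homotopy invariant assignment on the paths that stay inside one member
  of an open cover. Since \<open>\<tau>\<close> does not take the member as an argument, values on
  overlaps agree by construction; \<open>transport\<close> extends it to all paths.\<close>

locale local_transport = Q: group Q
 for Q :: "('q, 'b) monoid_scheme" (structure) +
 fixes X :: "'a topology" and C :: "'a set set" and \<tau> :: "(real => 'a) => 'q"
 assumes C_open: "U \<in> C ==> openin X U"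
  and C_cover: "topspace X \<subseteq> \<Union>C"
  and \<tau>_closed: "U \<in> C ==> pathin (subtopology X U) p ==> \<tau> p \<in> carrier Q"
  and \<tau>_concat: "U \<in> C ==> pathin (subtopology X U) p ==> pathin (subtopology X U) q ==>
    p 1 = q 0 ==> \<tau> (loop_concat p q) = \<tau> p \<otimes> \<tau> q"
  and \<tau>_homotopic: "U \<in> C ==> path_homotopic (subtopology X U) p q ==> \<tau> p = \<tau> q"
begin

definition subord :: "(real => 'a) => nat => bool" where
 "subord p n \<longleftrightarrow> n > 0 & (\<forall>j<n. \<exists>U\<in>C. p ` {real j / n..(real j + 1) / n} \<subseteq> U)"

definition subdivide :: "(real => 'a) => nat => 'q" where
 "subdivide p n = rprod Q (%j. \<tau> (subpath_on p (real j / n) ((real j + 1) / n))) n"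

definition transport :: "(real => 'a) => 'q" where
 "transport p = subdivide p (SOME n. subord p n)"

text \<open>A constant path is its own concatenation with itself, so its value is idempotent in a
  group.\<close>

lemma \<tau>_const: "U \<in> C ==> x \<in> U ==> (!!t. t \<in> {0..1} ==> p t = x) ==> \<tau> p = \<one>"
proof -
 assume U: "U \<in> C" "x \<in> U" and p: "!!t. t \<in> {0..1} ==> p t = x"
 have "x \<in> topspace X" using U C_open openin_subset by blast
 then have c: "pathin (subtopology X U) (%_. x)" using U by (simp add: pathin_const)
 then have pc: "pathin (subtopology X U) p"
  unfolding pathin_def by (rule continuous_map_eq) (use p in auto)
 have "path_homotopic (subtopology X U) p (loop_concat p p)"
  by (rule path_homotopic_eqI[OF pc]) (use p in \<open>auto simp: loop_concat_def\<close>)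
 then have "\<tau> p = \<tau> p \<otimes> \<tau> p"
  using \<tau>_homotopic[OF U(1)] \<tau>_concat[OF U(1) pc pc] p by simp
 then show ?thesis using \<tau>_closed[OF U(1) pc] by (simp add: Q.l_cancel_one')
qed

lemma \<tau>_subpath_split:
 assumes "U \<in> C" "continuous_map (top_of_set {c..d}) (subtopology X U) p" "{a, b, e} \<subseteq> {c..d}"
 shows "\<tau> (subpath_on p a b) \<otimes> \<tau> (subpath_on p b e) = \<tau> (subpath_on p a e)"
proof -
 have "pathin (subtopology X U) (subpath_on p a b)" "pathin (subtopology X U) (subpath_on p b e)"
  using assms by (auto intro: pathin_subpath_on)
 then show ?thesis
  using \<tau>_concat[OF assms(1)] \<tau>_homotopic[OF assms(1) concat_subpaths_homotopic[OF assms(2,3)]] by simp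
qed

lemma \<tau>_subpath_rprod:
 assumes "U \<in> C" "continuous_map (top_of_set {c..d}) (subtopology X U) p" "!!i. i <= n ==> a i \<in> {c..d}"
 shows "rprod Q (%i. \<tau> (subpath_on p (a i) (a (Suc i)))) n = \<tau> (subpath_on p (a 0) (a n))"
 using assms(3)
proof (induction n)
 case 0
 have "p (a 0) \<in> topspace X \<inter> U" using assms(2) 0 by (auto simp: continuous_map_def)
 then have "\<tau> (subpath_on p (a 0) (a 0)) = \<one>"
  by (intro \<tau>_const[OF assms(1), of "p (a 0)"]) (auto simp: subpath_on_def)
 then show ?case by simp
next
 case (Suc n)
 then show ?case using \<tau>_subpath_split[OF assms(1,2), of "a 0" "a n" "a (Suc n)"] by simp
qed

lemma subord_exists:
 assumes "pathin X p" shows "\<exists>n. subord p n"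
proof -
 obtain \<delta> where d: "\<delta> > 0" "!!T. T \<subseteq> {0..1} ==> T ~= {} ==> diameter T < \<delta> ==> \<exists>U\<in>C. p ` T \<subseteq> U"
  using cover_Lebesgue[of "{0..1::real}" X p C] assms C_open C_cover by (auto simp: pathin_def)
 obtain n where n: "inverse (real (Suc n)) < \<delta>" using reals_Archimedean[OF d(1)] by blast
 have "\<exists>U\<in>C. p ` {real j / Suc n..(real j + 1) / Suc n} \<subseteq> U" if "j < Suc n" for j
 proof (rule d(2))
  have "(real j + 1) / Suc n <= 1" using that by (simp add: field_simps)
  then show "{real j / Suc n..(real j + 1) / Suc n} \<subseteq> {0..1}" by auto
  have le: "real j / Suc n <= (real j + 1) / Suc n" by (simp add: divide_right_mono)
  then show "{real j / Suc n..(real j + 1) / Suc n} ~= {}" by auto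
  have "diameter {real j / Suc n..(real j + 1) / Suc n} = (real j + 1) / Suc n - real j / Suc n"
   using le by (simp add: diameter_closed_interval)
  also have "... = inverse (real (Suc n))" by (simp add: field_simps del: of_nat_Suc)
  finally show "diameter {real j / Suc n..(real j + 1) / Suc n} < \<delta>" using n by simp
 qed
 then show ?thesis unfolding subord_def by blast
qed

lemma piece:
 assumes "pathin X p" "j < n"
 shows "continuous_map (top_of_set {real j / n..(real j + 1) / n}) X p"
proof -
 have "(real j + 1) / n <= 1" "real j / n >= 0" using assms(2) by (auto simp: field_simps)
 then have "{real j / n..(real j + 1) / n} \<subseteq> {0..1}" by auto
 then show ?thesis using assms(1) continuous_map_from_subtopology_mono unfolding pathin_def by blast
qed

lemma piece_le: "real j / real n <= (real j + 1) / real n"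
 by (simp add: divide_right_mono)

lemma subord_piece:
 assumes "pathin X p" "subord p n" "j < n"
 obtains U where "U \<in> C" "continuous_map (top_of_set {real j / n..(real j + 1) / n}) (subtopology X U) p"
proof -
 obtain U where "U \<in> C" "p ` {real j / n..(real j + 1) / n} \<subseteq> U"
  using assms unfolding subord_def by blast
 then show ?thesis
  using that continuous_map_top_of_set_subtopology[OF piece[OF assms(1,3)]] by blast
qed

lemma subord_closed:
 assumes "pathin X p" "subord p n" "j < n"
 shows "\<tau> (subpath_on p (real j / n) ((real j + 1) / n)) \<in> carrier Q"
proof -
 obtain U where "U \<in> C" "continuous_map (top_of_set {real j / n..(real j + 1) / n}) (subtopology X U) p"
  using subord_piece[OF assms] .
 then show ?thesis using piece_le by (intro \<tau>_closed pathin_subpath_on) auto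
qed

lemma subpiece:
 assumes "j < n" "i < k"
 shows "{real (j * k + i) / (real n * real k)..(real (j * k + i) + 1) / (real n * real k)} \<subseteq> {real j / n..(real j + 1) / n}"
proof -
 have "n > 0" "k > 0" using assms by auto
 have "real i + 1 <= k" using assms(2) by linarith
 then have "real j * k + (real i + 1) <= (real j + 1) * k" by (simp add: algebra_simps)
 moreover have "real j * k <= real j * k + i" by simp
 ultimately have "(real j * k + i + 1) / (real n * k) <= ((real j + 1) * k) / (real n * k)"
  "(real j * k) / (real n * k) <= (real j * k + i) / (real n * k)"
  by (intro divide_right_mono; simp)+
 then show ?thesis using \<open>k > 0\<close> by auto
qed

lemma subord_mult:
 assumes "subord p n" "k > 0" shows "subord p (n * k)"
proof -
 have "\<exists>U\<in>C. p ` {real l / (n * k)..(real l + 1) / (n * k)} \<subseteq> U" if "l < n * k" for l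
 proof -
  have l: "l div k < n" "l mod k < k" using that assms(2) by (auto simp: less_mult_imp_div_less)
  then obtain U where "U \<in> C" "p ` {real (l div k) / n..(real (l div k) + 1) / n} \<subseteq> U"
   using assms unfolding subord_def by blast
  moreover have "{real l / (n * k)..(real l + 1) / (n * k)} \<subseteq> {real (l div k) / n..(real (l div k) + 1) / n}"
   using subpiece[OF l] by simp
  ultimately show ?thesis by (meson image_mono subset_trans)
 qed
 then show ?thesis using assms unfolding subord_def by auto
qed

text \<open>Each of the n pieces lies in one member of the cover, where cutting it into k further
  pieces does not change the product.\<close>

lemma subdivide_mult:
 assumes p: "pathin X p" and n: "subord p n" and k: "k > 0"
 shows "subdivide p (n * k) = subdivide p n"
proof -
 have "subdivide p (n * k) = rprod Q (%j. rprod Q (%i. \<tau> (subpath_on p (real (j * k + i) / (n * k)) ((real (j * k + i) + 1) / (n * k)))) k) n"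
  unfolding subdivide_def using subord_closed[OF p subord_mult[OF n k]] by (intro Q.rprod_mult) auto
 also have "... = rprod Q (%j. \<tau> (subpath_on p (real j / n) ((real j + 1) / n))) n"
 proof (rule Q.rprod_cong)
  fix j assume j: "j < n"
  obtain U where U: "U \<in> C" "continuous_map (top_of_set {real j / n..(real j + 1) / n}) (subtopology X U) p"
   using subord_piece[OF p n j] .
  define a where "a i = real (j * k + i) / (n * k)" for i
  have "a i \<in> {real j / n..(real j + 1) / n}" if "i <= k" for i
  proof (cases "i = k")
   case True
   have "a i = (real j + 1) * k / (real n * k)" by (simp add: a_def True algebra_simps)
   then have "a i = (real j + 1) / n" using k by simp
   then show ?thesis using piece_le by auto
  next
   case False
   have "a i <= (real (j * k + i) + 1) / (real n * real k)" by (simp add: a_def divide_right_mono)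
   then show ?thesis using subpiece[OF j, of i k] False that by (auto simp: a_def subset_iff)
  qed
  from \<tau>_subpath_rprod[OF U, of k a, OF this]
  have "rprod Q (%i. \<tau> (subpath_on p (a i) (a (Suc i)))) k = \<tau> (subpath_on p (a 0) (a k))" by simp
  moreover have "a k = (real j + 1) * k / (real n * k)" by (simp add: a_def algebra_simps)
  moreover have "a 0 = real j / n" using k by (simp add: a_def)
  moreover have "a (Suc i) = (real (j * k + i) + 1) / (n * k)" for i by (simp add: a_def add_ac)
  ultimately have "rprod Q (%i. \<tau> (subpath_on p (a i) ((real (j * k + i) + 1) / (n * k)))) k
    = \<tau> (subpath_on p (real j / n) ((real j + 1) / n))" using k by (simp del: of_nat_add of_nat_mult)
  then show "rprod Q (%i. \<tau> (subpath_on p (real (j * k + i) / (n * k)) ((real (j * k + i) + 1) / (n * k)))) k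
    = \<tau> (subpath_on p (real j / n) ((real j + 1) / n))"
   by (simp add: a_def[abs_def])
 qed
 finally show ?thesis by (simp add: subdivide_def)
qed

text \<open>Independence of the choice made by \<open>SOME\<close>: two admissible subdivisions are
  compared through their common refinement.\<close>

lemma transport_eq:
 assumes "pathin X p" "subord p n" shows "transport p = subdivide p n"
proof -
 define m where "m = (SOME n. subord p n)"
 have m: "subord p m" unfolding m_def using assms(2) by (rule someI)
 then have "subdivide p (m * n) = subdivide p m" "subdivide p (n * m) = subdivide p n"
  using assms subdivide_mult by (auto simp: subord_def)
 then show ?thesis by (simp add: transport_def m_def mult.commute)
qed

lemma transport_closed:
 assumes "pathin X p" shows "transport p \<in> carrier Q"
proof -
 obtain n where n: "subord p n" using subord_exists[OF assms] by blast
 show ?thesis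
  unfolding transport_eq[OF assms n] subdivide_def
  using subord_closed[OF assms n] by (rule Q.rprod_closed)
qed

lemma transport_local:
 assumes "U \<in> C" "pathin (subtopology X U) p" shows "transport p = \<tau> p"
proof -
 have "pathin X p" using assms by (simp add: pathin_subtopology)
 moreover have "subord p 1" using assms unfolding subord_def pathin_subtopology by auto
 ultimately have "transport p = \<one> \<otimes> \<tau> (subpath_on p 0 1)" using transport_eq by (simp add: subdivide_def)
 moreover have "path_homotopic (subtopology X U) p (subpath_on p 0 1)"
  by (rule path_homotopic_eqI[OF assms(2)]) (simp add: subpath_on_def)
 ultimately show ?thesis using \<tau>_homotopic[OF assms(1)] \<tau>_closed[OF assms] by simp
qed

lemma transport_concat:
 assumes p: "pathin X p" and q: "pathin X q" and e: "p 1 = q 0"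
 shows "transport (loop_concat p q) = transport p \<otimes> transport q"
proof -
 \<comment> \<open>The same number n of pieces is used for both paths; the midpoint of the
   concatenation is then a node of its subdivision into n + n pieces, half of them belonging to each
   path.\<close>
 obtain m k where "subord p m" "subord q k" using subord_exists p q by metis
 then have "subord p (m * k)" "subord q (m * k)"
  using subord_mult[of p m k] subord_mult[of q k m] by (auto simp: subord_def mult.commute)
 then obtain n where n: "subord p n" "subord q n" by blast
 then have n0: "n > 0" by (simp add: subord_def)
 define I where "I l N = {real l / real N..(real l + 1) / real N}" for l N
 have half: "loop_concat p q (s / 2) = p s" if "s <= 1" for s using that by (simp add: loop_concat_def)
 have half': "loop_concat p q (1/2 + s / 2) = q s" if "0 <= s" for s
  using that e by (cases "s = 0") (simp_all add: loop_concat_def)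
 have lp: "loop_concat p q (s / 2) = p s" if "j < n" "s \<in> I j n" for j s
 proof -
  have "(real j + 1) / n <= 1" using that(1) by (simp add: field_simps)
  then show ?thesis using that(2) by (intro half) (simp add: I_def)
 qed
 have lq: "loop_concat p q (1/2 + s / 2) = q s" if "s \<in> I j n" for j s
 proof -
  have "0 <= real j / n" by simp
  also have "... <= s" using that by (simp add: I_def)
  finally show ?thesis by (rule half')
 qed
 have sp: "2 * t \<in> I j n" if "t \<in> I j (n + n)" for j t using that n0 by (auto simp: I_def field_simps)
 have sq: "2 * t - 1 \<in> I j n" if "t \<in> I (n + j) (n + n)" for j t using that n0 by (auto simp: I_def field_simps)
 have subord: "subord (loop_concat p q) (n + n)"
  unfolding subord_def I_def[symmetric]
 proof (intro conjI allI impI)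
  fix l assume l: "l < n + n"
  show "\<exists>U\<in>C. loop_concat p q ` I l (n + n) \<subseteq> U"
  proof (cases "l < n")
   case True
   then obtain U where U: "U \<in> C" "p ` I l n \<subseteq> U" using n by (auto simp: subord_def I_def)
   have "loop_concat p q t \<in> U" if "t \<in> I l (n + n)" for t using lp[OF True sp[OF that]] sp[OF that] U(2) by auto
   then show ?thesis using U(1) by blast
  next
   case False
   then obtain j where j: "l = n + j" "j < n" using l by (metis add_less_cancel_left le_Suc_ex not_less)
   then obtain U where U: "U \<in> C" "q ` I j n \<subseteq> U" using n by (auto simp: subord_def I_def)
   have "loop_concat p q t \<in> U" if "t \<in> I (n + j) (n + n)" for t using lq[OF sq[OF that]] sq[OF that] U(2) by (auto simp: diff_divide_distrib)
   then show ?thesis using U(1) j(1) by blast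
  qed
 qed (use n0 in auto)
 have pc: "pathin X (loop_concat p q)" using assms by (rule pathin_loop_concat)
 have eq: "\<tau> (subpath_on (loop_concat p q) (c + (real j / n) / 2) (c + ((real j + 1) / n) / 2)) = \<tau> (subpath_on r (real j / n) ((real j + 1) / n))"
  if r: "pathin X r" "subord r n" and j: "j < n" and l: "!!s. s \<in> I j n ==> loop_concat p q (c + s / 2) = r s" for r c j
 proof -
  let ?a = "real j / n" and ?b = "(real j + 1) / n"
  obtain U where U: "U \<in> C" "continuous_map (top_of_set {?a..?b}) (subtopology X U) r" using subord_piece[OF r j] .
  have "pathin (subtopology X U) (subpath_on r ?a ?b)" using U piece_le by (intro pathin_subpath_on) auto
  moreover have "subpath_on r ?a ?b t = subpath_on (loop_concat p q) (c + ?a / 2) (c + ?b / 2) t" if t: "t \<in> {0..1}" for t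
  proof -
   have "?a + (?b - ?a) * t \<in> I j n" unfolding I_def using t piece_le[of j n] by (intro segment_in_interval) auto
   from l[OF this] show ?thesis by (simp add: subpath_on_def algebra_simps diff_divide_distrib add_divide_distrib)
  qed
  ultimately show ?thesis using \<tau>_homotopic[OF U(1)] path_homotopic_eqI by metis
 qed
 have "real j / real (n + n) = 0 + (real j / n) / 2" "(real j + 1) / real (n + n) = 0 + ((real j + 1) / n) / 2"
  "real (n + j) / real (n + n) = 1/2 + (real j / n) / 2" "(real (n + j) + 1) / real (n + n) = 1/2 + ((real j + 1) / n) / 2" for j
  using n0 by (simp_all add: field_simps)
 note h = this
 have eq1: "\<tau> (subpath_on (loop_concat p q) (real j / real (n + n)) ((real j + 1) / real (n + n))) = \<tau> (subpath_on p (real j / n) ((real j + 1) / n))"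
  if "j < n" for j unfolding h(1,2)[of j] by (rule eq[OF p n(1) that]) (simp add: lp[OF that])
 have eq2: "\<tau> (subpath_on (loop_concat p q) (real (n + j) / real (n + n)) ((real (n + j) + 1) / real (n + n))) = \<tau> (subpath_on q (real j / n) ((real j + 1) / n))"
  if "j < n" for j unfolding h(3,4)[of j] by (rule eq[OF q n(2) that lq])
 have "subdivide (loop_concat p q) (n + n) = subdivide p n \<otimes> subdivide q n"
  unfolding subdivide_def using subord_closed[OF pc subord] eq1 eq2
  by (subst Q.rprod_add) (auto intro!: arg_cong2[where f="mult Q"] Q.rprod_cong)
 then show ?thesis using transport_eq[OF p n(1)] transport_eq[OF q n(2)] transport_eq[OF pc subord] by simp
qed

text \<open>The square of the homotopy is cut into n by n small squares, each mapped into one member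
  of the cover. Every small square gives one commutation relation, a row of them telescopes, and so
  adjacent rows have equal transport.\<close>

lemma transport_homotopic:
 assumes "path_homotopic X p q" shows "transport p = transport q"
proof -
 obtain h where h: "continuous_map (prod_topology (top_of_set {0..1::real}) (top_of_set {0..1})) X h"
  "!!t. h (0, t) = p t" "!!t. h (1, t) = q t" "!!s. s \<in> {0..1} ==> h (s, 0) = p 0 & h (s, 1) = p 1"
  using assms unfolding path_homotopic_def homotopic_with_def by blast
 have h': "continuous_map (top_of_set ({0..1} \<times> {0..1})) X h"
  using h(1) by (simp add: prod_topology_subtopology_eu)
 obtain \<delta> where d: "\<delta> > 0" "!!T. T \<subseteq> {0..1} \<times> {0..1} ==> T ~= {} ==> diameter T < \<delta> ==> \<exists>U\<in>C. h ` T \<subseteq> U"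
  using cover_Lebesgue[of "{0..1::real} \<times> {0..1::real}" X h C] h' C_open C_cover by (auto intro: compact_Times)
 \<comment> \<open>A grid square has diameter at most 2 / n, which the factor 1/4 keeps below
   \<open>\<delta>\<close>.\<close>
 obtain m where m: "inverse (real (Suc m)) < \<delta> / 4" using reals_Archimedean[of "\<delta> / 4"] d(1) by auto
 define n where "n = Suc m"
 define I where "I j = {real j / n..(real j + 1) / n}" for j
 have I01: "I j \<subseteq> {0..1}" if "j < n" for j
 proof -
  have "(real j + 1) / n <= 1" using that by (simp add: field_simps)
  then show ?thesis by (auto simp: I_def)
 qed
 have Ile: "real j / n \<in> I j" "(real j + 1) / n \<in> I j" for j using piece_le by (auto simp: I_def)
 have sq: "\<exists>U\<in>C. h ` (I i \<times> I j) \<subseteq> U" if "i < n" "j < n" for i j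
 proof (rule d(2))
  show "I i \<times> I j \<subseteq> {0..1} \<times> {0..1}" using I01 that by blast
  show "I i \<times> I j ~= {}" using Ile by blast
  have "dist x y <= 2 / n" if "x \<in> I i \<times> I j" "y \<in> I i \<times> I j" for x y :: "real \<times> real"
  proof -
   have "dist (fst x) (fst y) <= 1 / n" "dist (snd x) (snd y) <= 1 / n"
    using that by (auto simp: I_def dist_real_def add_divide_distrib abs_le_iff)
   then show ?thesis using norm_triangle_ineq[of "(fst x - fst y, 0)" "(0, snd x - snd y)"]
    by (cases x; cases y; simp add: dist_norm norm_Pair)
  qed
  then have "diameter (I i \<times> I j) <= 2 / n"
   using Ile by (intro diameter_le) (auto simp: dist_norm)
  also have "2 / n < \<delta>" using m d(1) by (simp add: n_def field_simps)
  finally show "diameter (I i \<times> I j) < \<delta>" .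
 qed
 define row where "row s = (%t. h (s, t))" for s
 have row: "pathin X (row s)" if "s \<in> {0..1}" for s
  unfolding pathin_def row_def
 proof (rule continuous_map_compose[OF _ h', unfolded o_def])
  show "continuous_map (top_of_set {0..1}) (top_of_set ({0..1} \<times> {0..1})) (Pair s)"
   using that by (auto simp: continuous_map_in_subtopology intro!: continuous_intros)
 qed
 have frow: "subord (row s) n" if i0: "i < n" and s0: "s \<in> I i" for i s
  unfolding subord_def
 proof (intro conjI allI impI)
  fix j assume j: "j < n"
  obtain U where U: "U \<in> C" "h ` (I i \<times> I j) \<subseteq> U" using sq[OF i0 j] by blast
  have "row s ` I j \<subseteq> U" using U(2) s0 by (auto simp: row_def image_subset_iff)
  with U(1) show "\<exists>U\<in>C. row s ` {real j / n..(real j + 1) / n} \<subseteq> U" by (auto simp: I_def)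
 qed (simp add: n_def)
 have step: "transport (row (real i / n)) = transport (row ((real i + 1) / n))" if i: "i < n" for i
 proof -
  define s s' where "s = real i / n" and "s' = (real i + 1) / n"
  have ss: "s \<in> I i" "s' \<in> I i" "s \<in> {0..1}" "s' \<in> {0..1}"
   using Ile[of i] I01[OF i] by (auto simp: s_def s'_def subset_iff)
  define col where "col j = (%t. h (s + (s' - s) * t, real j / n))" for j :: nat
  define f where "f j = \<tau> (subpath_on (row s) (real j / n) ((real j + 1) / n))" for j
  define f' where "f' j = \<tau> (subpath_on (row s') (real j / n) ((real j + 1) / n))" for j
  have sqr: "f j \<otimes> \<tau> (col (Suc j)) = \<tau> (col j) \<otimes> f' j & \<tau> (col j) \<in> carrier Q & \<tau> (col (Suc j)) \<in> carrier Q" if j: "j < n" for j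
  proof -
   obtain U where U: "U \<in> C" "h ` (I i \<times> I j) \<subseteq> U" using sq[OF i j] by blast
   have hc: "continuous_map (top_of_set (I i \<times> I j)) (subtopology X U) h"
   proof -
    have "I i \<times> I j \<subseteq> {0..1} \<times> {0..1}" using I01[OF i] I01[OF j] by blast
    then have "continuous_map (top_of_set (I i \<times> I j)) X h"
     using h' continuous_map_from_subtopology_mono by blast
    then show ?thesis using U(2) by (auto simp: continuous_map_in_subtopology)
   qed
   have cv: "convex (I i \<times> I j)" unfolding I_def by (intro convex_Times) auto
   have P: "pathin (subtopology X U) (%t. h (a t, b t))"
    if "continuous_on {0..1} a" "continuous_on {0..1} b" "a ` {0..1} \<subseteq> I i" "b ` {0..1} \<subseteq> I j" for a b
    unfolding pathin_def
   proof (rule continuous_map_compose[OF _ hc, unfolded o_def])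
    show "continuous_map (top_of_set {0..1}) (top_of_set (I i \<times> I j)) (%t. (a t, b t))"
     using that by (auto simp: continuous_map_in_subtopology intro!: continuous_intros)
   qed
   define c c' where "c = real j / n" and "c' = (real j + 1) / n"
   have cc: "c \<in> I j" "c' \<in> I j" using Ile by (auto simp: c_def c'_def)
   have r1: "s + (s' - s) * t \<in> I i" "c + (c' - c) * t \<in> I j" if "0 <= t" "t <= 1" for t
    using segment_in_interval[OF that] ss cc unfolding I_def by blast+
   have p1: "pathin (subtopology X U) (subpath_on (row s) c c')"
    unfolding subpath_on_def row_def using r1 ss by (intro P) (auto intro!: continuous_intros)
   have p2: "pathin (subtopology X U) (subpath_on (row s') c c')"
    unfolding subpath_on_def row_def using r1 ss by (intro P) (auto intro!: continuous_intros)
   have p3: "pathin (subtopology X U) (%t. h (s + (s' - s) * t, c))"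
    using r1 cc by (intro P) (auto intro!: continuous_intros)
   have p4: "pathin (subtopology X U) (%t. h (s + (s' - s) * t, c'))"
    using r1 cc by (intro P) (auto intro!: continuous_intros)
   have c: "col j = (%t. h (s + (s' - s) * t, c))" "col (Suc j) = (%t. h (s + (s' - s) * t, c'))"
    by (auto simp: col_def c_def c'_def add.commute)
   \<comment> \<open>The two ways around the small square, along its edges, from one corner to the
     opposite one.\<close>
   let ?a = "%t. if t <= 1/2 then (s, c + (c' - c) * (2 * t)) else (s + (s' - s) * (2 * t - 1), c')"
   let ?b = "%t. if t <= 1/2 then (s + (s' - s) * (2 * t), c) else (s', c + (c' - c) * (2 * t - 1))"
   have ab: "continuous_on {0..1} ?a" "continuous_on {0..1} ?b"
    by (intro continuous_on_pieces continuous_intros; simp)+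
   have "path_homotopic (subtopology X U)
     (loop_concat (subpath_on (row s) c c') (%t. h (s + (s' - s) * t, c')))
     (loop_concat (%t. h (s + (s' - s) * t, c)) (subpath_on (row s') c c'))"
    by (rule path_homotopic_convex[OF hc cv ab(1) _ ab(2)])
      (use r1 ss cc in \<open>auto simp: loop_concat_def subpath_on_def row_def\<close>)
   then have "\<tau> (subpath_on (row s) c c') \<otimes> \<tau> (%t. h (s + (s' - s) * t, c')) =
     \<tau> (%t. h (s + (s' - s) * t, c)) \<otimes> \<tau> (subpath_on (row s') c c')"
    using \<tau>_homotopic[OF U(1)] \<tau>_concat[OF U(1) p1 p4] \<tau>_concat[OF U(1) p3 p2]
    by (simp add: row_def)
   then show ?thesis
    using \<tau>_closed[OF U(1) p3] \<tau>_closed[OF U(1) p4] unfolding c f_def f'_def by (simp add: c_def c'_def)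
  qed
  have f: "f j \<in> carrier Q" "f' j \<in> carrier Q" if "j < n" for j
   unfolding f_def f'_def
   using subord_closed[OF row[OF ss(3)] frow[OF i ss(1)] that] subord_closed[OF row[OF ss(4)] frow[OF i ss(2)] that]
   by simp_all
  have "\<tau> (col j) \<in> carrier Q" if "j <= n" for j
   using sqr[of j] sqr[of "j - 1"] that by (cases "j < n"; cases j) (auto simp: n_def)
  then have tel: "rprod Q f n \<otimes> \<tau> (col n) = \<tau> (col 0) \<otimes> rprod Q f' n"
   using sqr f by (intro Q.rprod_telescope) auto
  have n0: "0 < n" by (simp add: n_def)
  have r1: "s + (s' - s) * t \<in> {0..1}" if "0 <= t" "t <= 1" for t
   using segment_in_interval[OF that ss(3,4)] .
  have "p \<in> topspace (top_of_set {0..1}) \<rightarrow> topspace X"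
   using path_homotopic_pathin[OF assms] by (simp add: pathin_def continuous_map_def)
  then have "p 0 \<in> topspace X" "p 1 \<in> topspace X" by auto
  then obtain U0 U1 where U: "U0 \<in> C" "p 0 \<in> U0" "U1 \<in> C" "p 1 \<in> U1" using C_cover by blast
  \<comment> \<open>The homotopy fixes endpoints, so the outer columns are constant and drop out of
    the telescoped identity.\<close>
  have "col 0 t = p 0" "col n t = p 1" if "t \<in> {0..1}" for t
   using h(4)[of "s + (s' - s) * t"] r1[of t] that n0 by (auto simp: col_def)
  then have "\<tau> (col 0) = \<one>" "\<tau> (col n) = \<one>"
   using \<tau>_const[OF U(1,2)] \<tau>_const[OF U(3,4)] by blast+
  then have "rprod Q f n = rprod Q f' n"
   using tel Q.rprod_closed[of n f] Q.rprod_closed[of n f'] f by auto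
  then have "subdivide (row s) n = subdivide (row s') n"
   unfolding subdivide_def f_def f'_def by simp
  then show ?thesis
   using transport_eq[OF row[OF ss(3)] frow[OF i ss(1)]] transport_eq[OF row[OF ss(4)] frow[OF i ss(2)]]
   unfolding s_def s'_def by simp
 qed
 have "transport (row (real i / n)) = transport (row 0)" if "i <= n" for i
  using that by (induction i) (use step in \<open>auto simp: add.commute\<close>)
 from this[of n] have "transport (row 1) = transport (row 0)" by (simp add: n_def del: of_nat_Suc)
 moreover have "row 0 = p" "row 1 = q" using h(2,3) by (auto simp: row_def)
 ultimately show ?thesis by simp
qed

text \<open>Both sides are multiplicative along a subdivision and agree on its pieces. This is what
  compares, after a homomorphism \<open>f\<close>, a twisted functor with the original one.\<close>

lemma transport_unique:
 assumes Q': "group Q'" and f: "f \<in> hom Q Q'"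
  and T_concat: "!!p q. pathin X p ==> pathin X q ==> p 1 = q 0 ==> T (loop_concat p q) = T p \<otimes>\<^bsub>Q'\<^esub> T q"
  and T_homotopic: "!!p q. path_homotopic X p q ==> T p = T q"
  and T_closed: "!!p. pathin X p ==> T p \<in> carrier Q'"
  and T_local: "!!U p. U \<in> C ==> pathin (subtopology X U) p ==> T p = f (\<tau> p)"
  and p: "pathin X p"
 shows "T p = f (transport p)"
proof -
 interpret Q': group Q' by fact
 interpret f: group_hom Q Q' f using f by unfold_locales
 obtain n where n: "subord p n" using subord_exists[OF p] by blast
 have "T (subpath_on p 0 (real i / n)) = f (rprod Q (%j. \<tau> (subpath_on p (real j / n) ((real j + 1) / n))) i)" if "i <= n" for i
  using that
 proof (induction i)
  case 0
  have c: "pathin X (subpath_on p 0 0)" using p by (intro pathin_subpath_on[of 0 1]) (auto simp: pathin_def)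
  have "loop_concat (subpath_on p 0 0) (subpath_on p 0 0) = subpath_on p 0 0"
   by (auto simp: loop_concat_def subpath_on_def)
  then have "T (subpath_on p 0 0) \<otimes>\<^bsub>Q'\<^esub> T (subpath_on p 0 0) = T (subpath_on p 0 0)"
   using T_concat[OF c c] by simp
  then show ?case using T_closed[OF c] Q'.l_cancel_one' by (simp add: Q'.l_cancel_one)
 next
  case (Suc i)
  then have i: "i < n" by simp
  obtain U where U: "U \<in> C" "continuous_map (top_of_set {real i / n..(real i + 1) / n}) (subtopology X U) p"
   using subord_piece[OF p n i] .
  have pU: "pathin (subtopology X U) (subpath_on p (real i / n) ((real i + 1) / n))"
   using U piece_le by (intro pathin_subpath_on) auto
  have pi: "{0, real i / n, (real i + 1) / n} \<subseteq> {0..1}"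
   using i by (auto simp: field_simps)
  then have "pathin X (subpath_on p 0 (real i / n))" "pathin X (subpath_on p (real i / n) ((real i + 1) / n))"
   using pathin_subpath_on[OF p[unfolded pathin_def]] by simp_all
  then have "T (subpath_on p 0 (real (Suc i) / n)) = T (subpath_on p 0 (real i / n)) \<otimes>\<^bsub>Q'\<^esub> T (subpath_on p (real i / n) ((real i + 1) / n))"
   using T_homotopic[OF concat_subpaths_homotopic[OF p[unfolded pathin_def] pi]] T_concat
   by (simp add: add.commute)
  also have "... = f (rprod Q (%j. \<tau> (subpath_on p (real j / n) ((real j + 1) / n))) i) \<otimes>\<^bsub>Q'\<^esub> f (\<tau> (subpath_on p (real i / n) ((real i + 1) / n)))"
   using Suc T_local[OF U(1) pU] by simp
  also have "... = f (rprod Q (%j. \<tau> (subpath_on p (real j / n) ((real j + 1) / n))) (Suc i))"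
   using subord_closed[OF p n] i by (simp add: Q.rprod_closed f.hom_mult)
  finally show ?case .
 qed
 from this[of n] have "T (subpath_on p 0 1) = f (transport p)"
  using n transport_eq[OF p n] by (simp add: subdivide_def subord_def)
 moreover have "path_homotopic X p (subpath_on p 0 1)"
  by (rule path_homotopic_eqI[OF p]) (simp add: subpath_on_def)
 ultimately show ?thesis using T_homotopic by metis
qed

end

section \<open>Calculus of paths up to homotopy and the fundamental group\<close>

declare path_homotopic_trans [trans]

definition path_rev :: "(real => 'a) => real => 'a" where
 "path_rev p = (%t. p (1 - t))"

lemma path_rev_ends [simp]: "path_rev p 0 = p 1" "path_rev p 1 = p 0" "path_rev (path_rev p) = p"
 by (auto simp: path_rev_def)

lemma path_homotopic_reparam:
 assumes "pathin X p" "continuous_on {0..1} a" "a ` {0..1} \<subseteq> {0..1}" "continuous_on {0..1} b" "b ` {0..1} \<subseteq> {0..1}"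
  "a 0 = b 0" "a 1 = b 1" "!!t. t \<in> {0..1} ==> q t = p (a t)" "!!t. t \<in> {0..1} ==> r t = p (b t)"
 shows "path_homotopic X q r"
 by (rule path_homotopic_convex[OF assms(1)[unfolded pathin_def] _ assms(2-9)]) auto

lemma pathin_path_rev: assumes "pathin X p" shows "pathin X (path_rev p)"
proof -
 have "path_homotopic X (path_rev p) (path_rev p)"
  by (rule path_homotopic_reparam[OF assms, of "%t. 1 - t" "%t. 1 - t"])
    (auto intro!: continuous_intros simp: path_rev_def)
 then show ?thesis using path_homotopic_pathin by blast
qed

lemma path_homotopic_assoc:
 assumes "pathin X p" "pathin X q" "pathin X r" "p 1 = q 0" "q 1 = r 0"
 shows "path_homotopic X (loop_concat (loop_concat p q) r) (loop_concat p (loop_concat q r))"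
proof -
 let ?b = "%t::real. if t <= 1/2 then t / 2 else if t <= 3/4 then t - 1/4 else 2 * t - 1"
 have c: "continuous_on {0..1} ?b"
  by (intro continuous_on_pieces continuous_intros) auto
 have "pathin X (loop_concat (loop_concat p q) r)"
  using assms by (intro pathin_loop_concat) auto
 then show ?thesis
  by (rule path_homotopic_reparam[where a="%t. t" and b="?b"])
    (use c in \<open>auto intro!: continuous_intros simp: loop_concat_def algebra_simps\<close>)
qed

lemma path_homotopic_lunit:
 assumes "pathin X p" "!!t. t \<in> {0..1} ==> c t = p 0"
 shows "path_homotopic X (loop_concat c p) p"
proof -
 have "continuous_on {0..1} (%t::real. if t <= 1/2 then 0 else 2 * t - 1)"
  by (intro continuous_on_pieces continuous_intros) auto
 with assms show ?thesis
  by (intro path_homotopic_reparam[OF assms(1), where a="%t. if t <= 1/2 then 0 else 2 * t - 1" and b="%t. t"])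
    (auto intro!: continuous_intros simp: loop_concat_def)
qed

lemma path_homotopic_runit:
 assumes "pathin X p" "!!t. t \<in> {0..1} ==> c t = p 1"
 shows "path_homotopic X (loop_concat p c) p"
proof -
 have "continuous_on {0..1} (%t::real. if t <= 1/2 then 2 * t else 1)"
  by (intro continuous_on_pieces continuous_intros) auto
 with assms show ?thesis
  by (intro path_homotopic_reparam[OF assms(1), where a="%t. if t <= 1/2 then 2 * t else 1" and b="%t. t"])
    (auto intro!: continuous_intros simp: loop_concat_def)
qed

lemma path_homotopic_rinv:
 assumes "pathin X p" "c = (%_. p 0)"
 shows "path_homotopic X (loop_concat p (path_rev p)) c"
proof -
 have "continuous_on {0..1} (%t::real. if t <= 1/2 then 2 * t else 2 - 2 * t)"
  by (intro continuous_on_pieces continuous_intros) auto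
 with assms show ?thesis
  by (intro path_homotopic_reparam[OF assms(1), where a="%t. if t <= 1/2 then 2 * t else 2 - 2 * t" and b="%t. 0"])
    (auto intro!: continuous_intros simp: loop_concat_def path_rev_def)
qed

lemma path_homotopic_linv:
 assumes "pathin X p" "c = (%_. p 1)"
 shows "path_homotopic X (loop_concat (path_rev p) p) c"
 using path_homotopic_rinv[OF pathin_path_rev[OF assms(1)], of c] assms(2) by simp

lemma path_homotopic_cong:
 assumes "path_homotopic X p p'" "path_homotopic X q q'" "p 1 = q 0"
 shows "path_homotopic X (loop_concat p q) (loop_concat p' q')"
proof -
 let ?I = "top_of_set {0..1::real}"
 obtain h where h: "continuous_map (prod_topology ?I ?I) X h"
  "!!t. h (0, t) = p t" "!!t. h (1, t) = p' t" "!!s. s \<in> {0..1} ==> h (s, 0) = p 0 & h (s, 1) = p 1"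
  using assms(1) unfolding path_homotopic_def homotopic_with_def by blast
 obtain k where k: "continuous_map (prod_topology ?I ?I) X k"
  "!!t. k (0, t) = q t" "!!t. k (1, t) = q' t" "!!s. s \<in> {0..1} ==> k (s, 0) = q 0 & k (s, 1) = q 1"
  using assms(2) unfolding path_homotopic_def homotopic_with_def by blast
 let ?f = "%z. if snd z <= 1/2 then h (fst z, 2 * snd z) else k (fst z, 2 * snd z - 1)"
 have h': "continuous_map (top_of_set ({0..1} \<times> {0..1})) X h" and k': "continuous_map (top_of_set ({0..1} \<times> {0..1})) X k"
  using h(1) k(1) by (simp_all add: prod_topology_subtopology_eu)
 have "continuous_map (top_of_set ({0..1} \<times> {0..1})) X ?f"
 proof (rule continuous_map_cases_le)
  let ?A = "{z \<in> topspace (top_of_set ({0..1::real} \<times> {0..1::real})). snd z <= 1/2}"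
  let ?B = "{z \<in> topspace (top_of_set ({0..1::real} \<times> {0..1::real})). 1/2 <= snd z}"
  have "continuous_map (subtopology (top_of_set ({0..1} \<times> {0..1})) ?A) (top_of_set ({0..1} \<times> {0..1})) (%z. (fst z, 2 * snd z))"
   unfolding subtopology_subtopology continuous_map_in_subtopology
   by (auto intro!: continuous_intros)
  from continuous_map_compose[OF this h']
  show "continuous_map (subtopology (top_of_set ({0..1} \<times> {0..1})) ?A) X (%z. h (fst z, 2 * snd z))" by (simp add: o_def)
  have "continuous_map (subtopology (top_of_set ({0..1} \<times> {0..1})) ?B) (top_of_set ({0..1} \<times> {0..1})) (%z. (fst z, 2 * snd z - 1))"
   unfolding subtopology_subtopology continuous_map_in_subtopology
   by (auto intro!: continuous_intros)
  from continuous_map_compose[OF this k']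
  show "continuous_map (subtopology (top_of_set ({0..1} \<times> {0..1})) ?B) X (%z. k (fst z, 2 * snd z - 1))" by (simp add: o_def)
  show "h (fst z, 2 * snd z) = k (fst z, 2 * snd z - 1)"
   if "z \<in> topspace (top_of_set ({0..1} \<times> {0..1}))" "snd z = 1/2" for z
  proof -
   have "h (fst z, 1) = k (fst z, 0)" using h(4) k(4) assms(3) that by (auto simp: mem_Times_iff)
   then show ?thesis by (simp only: that) simp
  qed
 qed (auto intro!: continuous_intros)
 then have "continuous_map (prod_topology ?I ?I) X ?f" by (simp add: prod_topology_subtopology_eu)
 moreover have "?f (0, t) = loop_concat p q t" "?f (1, t) = loop_concat p' q' t" for t
  using h k by (auto simp: loop_concat_def)
 moreover have "?f (s, 0) = p 0 & ?f (s, 1) = q 1" if "s \<in> {0..1}" for s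
  using h(4)[OF that] k(4)[OF that] by simp
 ultimately show ?thesis using assms(1,2)
  unfolding path_homotopic_def homotopic_with_def by (auto intro!: exI[of _ ?f])
qed

lemmas path_homotopic_congL = path_homotopic_cong[OF _ path_homotopic_refl]
lemmas path_homotopic_congR = path_homotopic_cong[OF path_homotopic_refl]

abbreviation loop_class :: "'a topology => 'a => (real => 'a) => (real => 'a) set" where
 "loop_class X x p \<equiv> loop_homotopy X x `` {p}"

lemma loop_homotopy_iff:
 "(p, q) \<in> loop_homotopy X x \<longleftrightarrow> p 0 = x & p 1 = x & path_homotopic X p q"
 unfolding loop_homotopy_def loops_def
 using path_homotopic_pathin[of X p q] by (auto simp: path_homotopic_def)

lemma loop_class_eqI:
 assumes "p 0 = x" "p 1 = x" "path_homotopic X p q"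
 shows "loop_class X x p = loop_class X x q"
proof (rule Set.set_eqI)
 fix r
 have "q 0 = x" "q 1 = x" using assms by (auto simp: path_homotopic_def)
 then show "r \<in> loop_class X x p \<longleftrightarrow> r \<in> loop_class X x q"
  using assms path_homotopic_trans[OF assms(3), of r]
   path_homotopic_trans[OF path_homotopic_sym[OF assms(3)], of r]
  by (auto simp: loop_homotopy_iff)
qed

lemma loop_class_carrier: "p \<in> loops X x ==> loop_class X x p \<in> carrier (fundamental_group X x)"
 by (auto simp: fundamental_group_def quotient_def)

lemma fundamental_group_carrierE:
 assumes "P \<in> carrier (fundamental_group X x)"
 obtains p where "p \<in> loops X x" "P = loop_class X x p"
 using assms by (auto simp: fundamental_group_def quotient_def)

lemma loop_concat_loops: "p \<in> loops X x ==> q \<in> loops X x ==> loop_concat p q \<in> loops X x"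
 by (auto simp: loops_def intro: pathin_loop_concat)

lemma loop_class_mult:
 assumes "p \<in> loops X x" "q \<in> loops X x"
 shows "loop_class X x p \<otimes>\<^bsub>fundamental_group X x\<^esub> loop_class X x q = loop_class X x (loop_concat p q)"
proof -
 have 1: "loop_class X x (loop_concat p' q') = loop_class X x (loop_concat p q)"
  if "p' \<in> loop_class X x p" "q' \<in> loop_class X x q" for p' q'
  using that assms
  by (intro loop_class_eqI[symmetric]) (auto simp: loop_homotopy_iff loops_def intro: path_homotopic_cong)
 have 2: "loop_class X x p ~= {}" "loop_class X x q ~= {}"
  using assms path_homotopic_refl[of X p] path_homotopic_refl[of X q]
  by (auto simp: loop_homotopy_iff loops_def)
 have "(\<Union>p'\<in>loop_class X x p. \<Union>q'\<in>loop_class X x q. loop_class X x (loop_concat p' q')) =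
   (\<Union>p'\<in>loop_class X x p. \<Union>q'\<in>loop_class X x q. loop_class X x (loop_concat p q))"
  by (intro SUP_cong refl 1)
 also have "... = loop_class X x (loop_concat p q)" using 2 by simp
 finally show ?thesis by (simp add: fundamental_group_def)
qed

text \<open>A functor from the fundamental groupoid of \<open>X\<close> to a group, regarded as a
  groupoid with one object.\<close>

locale path_functor = Q: group Q
 for Q :: "('q, 'b) monoid_scheme" (structure) +
 fixes X :: "'a topology" and E :: "(real => 'a) => 'q"
 assumes E_closed: "pathin X p ==> E p \<in> carrier Q"
  and E_concat: "pathin X p ==> pathin X q ==> p 1 = q 0 ==> E (loop_concat p q) = E p \<otimes> E q"
  and E_homotopic: "path_homotopic X p q ==> E p = E q"
begin

lemma E_const: "x \<in> topspace X ==> (!!t. t \<in> {0..1} ==> c t = x) ==> E c = \<one>"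
proof -
 assume x: "x \<in> topspace X" and c: "!!t. t \<in> {0..1} ==> c t = x"
 have p: "pathin X (%_. x)" using x by (simp add: pathin_const)
 have "E (%_. x) \<otimes> E (%_. x) = E (%_. x)"
  using E_concat[OF p p] by (simp add: loop_concat_def)
 then have "E (%_. x) = \<one>" using E_closed[OF p] by (simp add: Q.l_cancel_one)
 moreover have "path_homotopic X (%_. x) c" by (rule path_homotopic_eqI[OF p]) (simp add: c)
 ultimately show ?thesis using E_homotopic by metis
qed

lemma E_rev: "pathin X p ==> E (path_rev p) = inv E p"
proof -
 assume p: "pathin X p"
 have "p 0 \<in> topspace X" using p by (auto simp: pathin_def continuous_map_def)
 then have "E p \<otimes> E (path_rev p) = \<one>"
  using E_homotopic[OF path_homotopic_rinv[OF p refl]] E_concat[OF p pathin_path_rev[OF p]] E_const[of "p 0"] by auto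
 then show ?thesis
  using p E_closed pathin_path_rev by (metis Q.inv_equality Q.inv_inv)
qed

end

text \<open>A homomorphism on the fundamental group is extended to all paths along a choice of
 base paths \<open>\<nu> y\<close>, which are then transported trivially.\<close>

lemma (in group) path_functor_exists:
 assumes r: "r \<in> hom (fundamental_group X x) G" and x: "x \<in> topspace X"
  and \<nu>: "!!y. y \<in> topspace X ==> pathin X (\<nu> y) & \<nu> y 0 = o' & \<nu> y 1 = y"
  and \<nu>o: "!!t. \<nu> o' t = o'"
 shows "\<exists>E. path_functor G X E & (\<forall>p\<in>loops X x. E p = r (loop_class X x p)) &
   (\<forall>y\<in>topspace X. E (\<nu> y) = \<one>)"
proof -
 have o': "o' \<in> topspace X" using \<nu>[OF x] by (auto simp: pathin_def continuous_map_def Pi_iff)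
 \<comment> \<open>The connecting path from \<open>x\<close> to \<open>y\<close> runs back to the
   common start \<open>o'\<close> of the base paths and out again along
   \<open>\<nu> y\<close>.\<close>
 define B where "B y = loop_concat (path_rev (\<nu> x)) (\<nu> y)" for y
 have B: "pathin X (B y)" "B y 0 = x" "B y 1 = y" if "y \<in> topspace X" for y
  using \<nu>[OF x] \<nu>[OF that] by (auto simp: B_def intro!: pathin_loop_concat pathin_path_rev)
 \<comment> \<open>Closes an arbitrary path to a loop at \<open>x\<close>, on which \<open>r\<close>
   can be evaluated.\<close>
 define W where "W p = loop_concat (loop_concat (B (p 0)) p) (path_rev (B (p 1)))" for p
 have ends: "p 0 \<in> topspace X" "p 1 \<in> topspace X" if "pathin X p" for p
  using that by (auto simp: pathin_def continuous_map_def Pi_iff)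
 have W: "W p \<in> loops X x" if "pathin X p" for p
  using that B ends[OF that] by (auto simp: W_def loops_def intro!: pathin_loop_concat pathin_path_rev)
 have c: "pathin X (%_. y)" if "y \<in> topspace X" for y using that by (simp add: pathin_const)
 \<comment> \<open>The connecting path at the common point is traversed back and forth, and
   cancels.\<close>
 have Wc: "path_homotopic X (loop_concat (W p) (W q)) (W (loop_concat p q))"
  if p: "pathin X p" and q: "pathin X q" and e: "p 1 = q 0" for p q
 proof -
  let ?A = "B (p 0)" and ?B = "B (q 0)" and ?C = "path_rev (B (q 1))"
  note S = pathin_loop_concat pathin_path_rev B ends p q e
  have "path_homotopic X (loop_concat (W p) (W q))
    (loop_concat (loop_concat ?A p) (loop_concat (path_rev ?B) (W q)))"
   unfolding W_def e by (rule path_homotopic_assoc) (simp_all add: S)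
  also have "path_homotopic X ...
    (loop_concat (loop_concat ?A p) (loop_concat (loop_concat (path_rev ?B) (loop_concat ?B q)) ?C))"
   unfolding W_def by (rule path_homotopic_congR[OF _ path_homotopic_sym[OF path_homotopic_assoc]]) (simp_all add: S)
  also have "path_homotopic X ...
    (loop_concat (loop_concat ?A p) (loop_concat (loop_concat (loop_concat (path_rev ?B) ?B) q) ?C))"
   by (rule path_homotopic_congR[OF _ path_homotopic_congL[OF path_homotopic_sym[OF path_homotopic_assoc]]]) (simp_all add: S)
  also have "path_homotopic X ...
    (loop_concat (loop_concat ?A p) (loop_concat (loop_concat (%_. q 0) q) ?C))"
   by (rule path_homotopic_congR[OF _ path_homotopic_congL[OF path_homotopic_congL[OF path_homotopic_linv]]]) (simp_all add: S)
  also have "path_homotopic X ...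
    (loop_concat (loop_concat ?A p) (loop_concat q ?C))"
   by (rule path_homotopic_congR[OF _ path_homotopic_congL[OF path_homotopic_lunit]]) (simp_all add: S)
  also have "path_homotopic X ...
    (loop_concat (loop_concat (loop_concat ?A p) q) ?C)"
   by (rule path_homotopic_sym[OF path_homotopic_assoc]) (simp_all add: S)
  also have "path_homotopic X ... (W (loop_concat p q))"
   unfolding W_def loop_concat_ends by (rule path_homotopic_congL[OF path_homotopic_assoc]) (simp_all add: S)
  finally show ?thesis .
 qed
 have Wh: "path_homotopic X (W p) (W q)" if "path_homotopic X p q" for p q
 proof -
  have e: "p 0 = q 0" "p 1 = q 1" using that by (auto simp: path_homotopic_def)
  have "pathin X p" "pathin X q" using path_homotopic_pathin[OF that] by auto
  then show ?thesis unfolding W_def e using that B ends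
   by (intro path_homotopic_congL path_homotopic_congR) (auto intro!: pathin_path_rev simp: e)
 qed
 define E where "E p = r (loop_class X x (W p))" for p
 have one: "r (loop_class X x (%_. x)) = \<one>"
 proof -
  have l: "(%_. x) \<in> loops X x" using c[OF x] by (simp add: loops_def)
  have "r (loop_class X x (%_. x)) \<otimes> r (loop_class X x (%_. x)) = r (loop_class X x (%_. x))"
   using hom_mult[OF r loop_class_carrier[OF l] loop_class_carrier[OF l]] loop_class_mult[OF l l]
   by (simp add: loop_concat_def)
  then show ?thesis using hom_in_carrier[OF r loop_class_carrier[OF l]] by (simp add: l_cancel_one)
 qed
 have WW: "W p 0 = x" "W p 1 = x" if "pathin X p" for p using W[OF that] by (auto simp: loops_def)
 have "path_functor G X E"
 proof
  fix p assume "pathin X p"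
  then show "E p \<in> carrier G" unfolding E_def using hom_in_carrier[OF r] loop_class_carrier W by metis
 next
  fix p q assume pq: "pathin X p" "pathin X q" "p 1 = q 0"
  have "loop_class X x (W (loop_concat p q)) = loop_class X x (loop_concat (W p) (W q))"
   using Wc[OF pq] WW pq by (intro loop_class_eqI[symmetric]) auto
  then show "E (loop_concat p q) = E p \<otimes> E q"
   unfolding E_def using loop_class_mult[OF W[OF pq(1)] W[OF pq(2)]]
    hom_mult[OF r loop_class_carrier[OF W[OF pq(1)]] loop_class_carrier[OF W[OF pq(2)]]] by simp
 next
  fix p q assume "path_homotopic X p q"
  then show "E p = E q" unfolding E_def
   using loop_class_eqI[OF WW(1,2) Wh] path_homotopic_pathin by metis
 qed
 moreover have "E p = r (loop_class X x p)" if "p \<in> loops X x" for p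
 proof -
  have p: "pathin X p" "p 0 = x" "p 1 = x" using that by (auto simp: loops_def)
  have Bx: "path_homotopic X (B x) (%_. x)" unfolding B_def using \<nu>[OF x] by (intro path_homotopic_linv) auto
  then have "path_homotopic X (path_rev (B x)) (path_rev (%_. x))"
  proof -
   have "path_homotopic X (path_rev (B x)) (loop_concat (path_rev (B x)) (%_. x))"
    using B[OF x] by (intro path_homotopic_sym[OF path_homotopic_runit]) (auto intro: pathin_path_rev)
   also have "path_homotopic X ... (loop_concat (path_rev (B x)) (B x))"
    using B[OF x] path_homotopic_sym[OF Bx] by (intro path_homotopic_congR) (auto intro: pathin_path_rev)
   also have "path_homotopic X ... (%_. x)"
    using B[OF x] by (intro path_homotopic_linv) auto
   finally show ?thesis by (simp add: path_rev_def)
  qed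
  then have Bx': "path_homotopic X (path_rev (B x)) (%_. x)" by (simp add: path_rev_def)
  have "path_homotopic X (W p) (loop_concat (loop_concat (B x) p) (%_. x))"
   unfolding W_def p using p B[OF x] Bx' by (intro path_homotopic_congR) (auto intro: pathin_loop_concat)
  also have "path_homotopic X ... (loop_concat (B x) p)"
   using p B[OF x] by (intro path_homotopic_runit) (auto intro: pathin_loop_concat)
  also have "path_homotopic X ... (loop_concat (%_. x) p)"
   using p Bx B[OF x] by (intro path_homotopic_congL) auto
  also have "path_homotopic X ... p"
   using p by (intro path_homotopic_lunit) auto
  finally have "path_homotopic X (W p) p" .
  then show ?thesis unfolding E_def using loop_class_eqI[OF WW[OF p(1)]] by metis
 qed
 \<comment> \<open>As \<open>\<nu> o'\<close> is constant, \<open>B o'\<close> followed by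
   \<open>\<nu> y\<close> is homotopic to \<open>B y\<close>, so closing up \<open>\<nu> y\<close>
   gives a contractible loop.\<close>
 moreover have "E (\<nu> y) = \<one>" if y: "y \<in> topspace X" for y
 proof -
  have "path_homotopic X (B o') (path_rev (\<nu> x))"
   unfolding B_def using \<nu>[OF x] by (intro path_homotopic_runit) (auto simp: \<nu>o pathin_path_rev)
  then have "path_homotopic X (loop_concat (B o') (\<nu> y)) (B y)"
   unfolding B_def[of y] by (rule path_homotopic_congL) (use \<nu>[OF y] B[OF o'] in simp_all)
  then have "path_homotopic X (loop_concat (loop_concat (B o') (\<nu> y)) (path_rev (B y))) (loop_concat (B y) (path_rev (B y)))"
   by (rule path_homotopic_congL) (use \<nu>[OF y] B[OF y] in \<open>simp_all add: pathin_path_rev\<close>)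
  then have "path_homotopic X (W (\<nu> y)) (loop_concat (B y) (path_rev (B y)))"
   using \<nu>[OF y] by (simp add: W_def)
  also have "path_homotopic X ... (%_. x)"
   using B[OF y] by (intro path_homotopic_rinv) auto
  finally have "path_homotopic X (W (\<nu> y)) (%_. x)" .
  then have "loop_class X x (W (\<nu> y)) = loop_class X x (%_. x)"
   using WW[of "\<nu> y"] \<nu>[OF y] by (intro loop_class_eqI) auto
  then show ?thesis unfolding E_def using one by simp
 qed
 ultimately show ?thesis by blast
qed

section \<open>The polygon model\<close>

locale surface =
 fixes g :: nat
 assumes g: "g >= 1"
begin

abbreviation "bd \<equiv> polygon_bd g"
abbreviation "D \<equiv> cball (0::complex) 1"
definition "glue = (side_gluing g \<union> (side_gluing g)\<inverse>)\<^sup>*"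
abbreviation "X \<equiv> genus_surface g"
definition "pj z = glue `` {z}"
text \<open>A set-theoretic section of \<open>pj\<close>, in general discontinuous. A function on
  the disc that respects the gluing may be evaluated through it, which is how maps descend to the
  surface.\<close>

definition "rp y = (SOME z :: complex. z \<in> y)"

lemma norm_bd [simp]: "cmod (bd s) = 1" by (simp add: polygon_bd_def)

lemma bd_add: "bd (s + t) = bd s * bd t"
 by (simp add: polygon_bd_def cis_mult distrib_left add_divide_distrib)

lemma cnj_bd: "cnj (bd s) = bd (- s)" by (simp add: polygon_bd_def cis_cnj)

lemma bd_mult_cnj: "bd s * cnj (bd t) = bd (s - t)"
 unfolding cnj_bd by (simp flip: bd_add)

lemma bd_eq: "bd s = cis (pi * s / (2 * real g))"
 by (simp add: polygon_bd_def field_simps)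

lemma equiv_glue: "equiv UNIV glue"
proof -
 have "sym ((side_gluing g \<union> (side_gluing g)\<inverse>)\<^sup>*)" by (intro sym_rtrancl sym_Un_converse)
 then show ?thesis unfolding glue_def equiv_def by (auto simp: refl_rtrancl trans_rtrancl)
qed

lemma pj_eq_iff: "pj z = pj w \<longleftrightarrow> (z, w) \<in> glue"
 unfolding pj_def using eq_equiv_class_iff[OF equiv_glue] by auto

lemma side_gluing_norm: "(z, w) \<in> side_gluing g ==> cmod z = 1 & cmod w = 1"
 by (auto simp: side_gluing_def)

lemma pj_glue: "(z, w) \<in> side_gluing g ==> pj z = pj w"
 by (auto simp: pj_eq_iff glue_def)

lemma topspace_X: "topspace X = pj ` D"
 unfolding genus_surface_def topspace_quotient_topology by (auto simp: quotient_def pj_def glue_def)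

lemma openin_X: "openin X U \<longleftrightarrow> U \<subseteq> topspace X & openin (top_of_set D) {z \<in> D. pj z \<in> U}"
 unfolding genus_surface_def openin_quotient_topology topspace_quotient_topology pj_def glue_def by simp

lemma continuous_map_pj: "continuous_map (top_of_set D) X pj"
 using quotient_imp_continuous_map[OF quotient_map_quotient_topology[of "top_of_set D" "(side_gluing g \<union> (side_gluing g)\<inverse>)\<^sup>*"]]
 by (simp add: genus_surface_def pj_def[abs_def] glue_def)

lemma rp: assumes "y \<in> topspace X" shows "rp y \<in> D" "pj (rp y) = y"
proof -
 obtain z where z: "z \<in> D" "y = pj z" using assms topspace_X by auto
 have "z \<in> y" using z(2) by (simp add: pj_def glue_def)
 then have r: "rp y \<in> y" unfolding rp_def by (rule someI)
 then show "pj (rp y) = y" unfolding z(2) pj_eq_iff[symmetric] using pj_eq_iff[of z "rp (pj z)"] by (simp add: pj_def)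
 show "rp y \<in> D" using r genus_surface_gluing_class[OF z(1), of g] z(2) by (auto simp: pj_def glue_def)
qed

text \<open>Saturation is tested on the generating pairs of sides only; \<open>sat_fun\<close>
  carries it over to the generated equivalence relation.\<close>

definition "sat S \<longleftrightarrow> S \<subseteq> D & (\<forall>z w. (z, w) \<in> side_gluing g --> (z \<in> S \<longleftrightarrow> w \<in> S))"

lemma sat_fun:
 assumes S: "sat S" and f: "!!z w. (z, w) \<in> side_gluing g ==> z \<in> S ==> f z = f w"
  and z: "z \<in> S" "(z, w) \<in> glue"
 shows "w \<in> S & f w = f z"
 using z(2) unfolding glue_def
proof (induction rule: rtrancl_induct)
 case (step y w)
 then show ?case using S f[of y w] f[of w y] by (auto simp: sat_def)
qed (use z in auto)

lemma sat_mem: assumes "sat S" "z \<in> D" shows "pj z \<in> pj ` S \<longleftrightarrow> z \<in> S"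
proof
 assume "pj z \<in> pj ` S"
 then obtain x where x: "x \<in> S" "pj x = pj z" by (metis imageE)
 then show "z \<in> S" using sat_fun[OF assms(1), of "%_. ()" x z] by (simp add: pj_eq_iff)
qed simp

lemma sat_open:
 assumes "sat S" "openin (top_of_set D) S" shows "openin X (pj ` S)"
proof -
 have "{z \<in> D. pj z \<in> pj ` S} = S" using sat_mem[OF assms(1)] assms(1) by (auto simp: sat_def)
 then show ?thesis using assms by (auto simp: openin_X topspace_X sat_def)
qed

lemma sat_rp: assumes "sat S" "y \<in> pj ` S" shows "rp y \<in> S"
proof -
 have y: "y \<in> topspace X" using assms by (auto simp: topspace_X sat_def)
 show ?thesis using sat_mem[OF assms(1) rp(1)[OF y]] assms(2) rp(2)[OF y] by simp
qed

lemma rp_fun: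
 assumes S: "sat S" and f: "!!z w. (z, w) \<in> side_gluing g ==> z \<in> S ==> f z = f w" and z: "z \<in> S"
 shows "f (rp (pj z)) = f z"
proof -
 have "pj z \<in> topspace X" using S z by (auto simp: topspace_X sat_def)
 then have "(z, rp (pj z)) \<in> glue" using rp(2) pj_eq_iff by metis
 then show ?thesis using sat_fun[OF S f z, of "%x. x"] sat_fun[OF S f z] by blast
qed

text \<open>The universal property of the quotient, restricted to a saturated open set: preimages of
  open sets are again saturated and open, hence have open image.\<close>

lemma continuous_map_descend:
 fixes f :: "complex => 'b::topological_space"
 assumes S: "sat S" "openin (top_of_set D) S" and f: "!!z w. (z, w) \<in> side_gluing g ==> z \<in> S ==> f z = f w"
  and c: "continuous_on S f"
 shows "continuous_map (subtopology X (pj ` S)) euclidean (%y. f (rp y))"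
 unfolding continuous_map_def
proof (intro conjI allI impI)
 fix V :: "'b set" assume V: "openin euclidean V"
 define T where "T = {z \<in> S. f z \<in> V}"
 have "openin (top_of_set S) T"
  using continuous_openin_preimage_gen[OF c, of V] V unfolding T_def by (simp add: vimage_def Int_def)
 then have o: "openin (top_of_set D) T" using S(2) openin_trans by blast
 have "sat T"
  unfolding sat_def
 proof (intro conjI allI impI)
  show "T \<subseteq> D" using S(1) by (auto simp: sat_def T_def)
  fix z w assume zw: "(z, w) \<in> side_gluing g"
  then have "z \<in> S \<longleftrightarrow> w \<in> S" using S(1) by (simp add: sat_def)
  then show "z \<in> T \<longleftrightarrow> w \<in> T" using f[OF zw] by (auto simp: T_def)
 qed
 then have "openin X (pj ` T)" using o by (rule sat_open)
 moreover have "f (rp (pj z)) = f z" if "z \<in> S" for z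
  by (rule rp_fun[OF S(1) _ that]) (rule f)
 then have "{y \<in> topspace (subtopology X (pj ` S)). f (rp y) \<in> V} = pj ` T"
  using S(1) by (auto simp: T_def topspace_X sat_def)
 moreover have "pj ` T \<subseteq> pj ` S" by (auto simp: T_def)
 ultimately show "openin (subtopology X (pj ` S)) {y \<in> topspace (subtopology X (pj ` S)). f (rp y) \<in> V}"
  by (metis inf.absorb1 openin_subtopology_Int)
qed auto

lemma sat_ball: "S \<subseteq> ball 0 1 ==> sat S"
 using side_gluing_norm by (fastforce simp: sat_def subset_iff)

lemma rp_ball: "z \<in> ball 0 1 ==> rp (pj z) = z"
 using rp_fun[OF sat_ball[of "ball 0 1"], of "%z. z" z] side_gluing_norm by fastforce

section \<open>Rays, arches and strips in the disc\<close>

definition "ray z = (%t::real. pj (t *\<^sub>R z))"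

lemma pathin_pj:
 assumes "continuous_on {0..1} \<sigma>" "\<sigma> ` {0..1} \<subseteq> D" shows "pathin X (%t. pj (\<sigma> t))"
proof -
 have "continuous_map (top_of_set {0..1}) (top_of_set D) \<sigma>" using assms by (auto simp: continuous_map_in_subtopology)
 from continuous_map_compose[OF this continuous_map_pj] show ?thesis by (simp add: pathin_def o_def)
qed

lemma pathin_pj_sub:
 assumes "continuous_on {0..1} \<sigma>" "\<sigma> ` {0..1} \<subseteq> S" "S \<subseteq> D" shows "pathin (subtopology X (pj ` S)) (%t. pj (\<sigma> t))"
 using pathin_pj[of \<sigma>] assms by (auto simp: pathin_subtopology)

lemma scale_D: "z \<in> D ==> 0 <= t ==> t <= 1 ==> t *\<^sub>R z \<in> D"
 by (auto simp: mult_le_one)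

lemma pathin_ray: "z \<in> D ==> pathin X (ray z)"
 unfolding ray_def using scale_D by (intro pathin_pj) (auto intro!: continuous_intros)

lemma ray_ends [simp]: "ray z 0 = pj 0" "ray z 1 = pj z" by (auto simp: ray_def)

text \<open>One side spans the angle pi / (2 g), so \<open>cc a\<close> is the cosine of the angle
  of a sides, and \<open>vv m z\<close> is |z| times the cosine of the angle between z and the
  direction m + 3/2. That direction lies halfway between side m and its partner m + 2. Comparing
  \<open>cc a * cmod z\<close> with \<open>vv m z\<close> thus tests angular distance without any
  argument function.\<close>

definition "cc a = cos (a * pi / (2 * real g))"
definition "vv m z = Re (z * cnj (bd (real m + 3/2)))"
definition "OS m a r = {z \<in> D. r < cmod z & cc a * cmod z < vv m z}"
definition "CS m a r = {z \<in> D. r <= cmod z & cc a * cmod z <= vv m z}"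
text \<open>An arch-shaped strip around \<open>Gam m\<close>: a collar of width 1/8 on both sides in
  angle, counted in sides, and in radius.\<close>

definition "Nt m = OS m (9/8) (3/8) - CS m (7/8) (5/8)"
text \<open>The two halves of the strip away from \<open>Gam m\<close>: \<open>Nm\<close> lies under
  the arch, on the side of the boundary side m + 1, and \<open>Np\<close> on the side of the disc's
  centre.\<close>

definition "Nm m = Nt m \<inter> OS m 1 (1/2)"
definition "Np m = Nt m - CS m 1 (1/2)"
text \<open>An arch consisting of two radial segments from the midpoints of the sides m and m + 2
  down to radius 1/2 and the arc joining them. The midpoints are glued, so it becomes a closed curve
  on the surface; it is the curve along which the twist is performed.\<close>

definition "Gam m = CS m 1 (1/2) - OS m 1 (1/2)"

lemma continuous_on_vv [continuous_intros]: "continuous_on S f ==> continuous_on S (%z. vv m (f z))"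
 unfolding vv_def by (intro continuous_intros)

lemma open_OS: "openin (top_of_set D) (OS m a r)"
proof -
 have "open {z. r < cmod z & cc a * cmod z < vv m z}"
  by (intro open_Collect_conj open_Collect_less continuous_intros)
 moreover have "OS m a r = D \<inter> {z. r < cmod z & cc a * cmod z < vv m z}" by (auto simp: OS_def)
 ultimately show ?thesis by (auto simp: openin_open)
qed

lemma closed_CS: "closedin (top_of_set D) (CS m a r)"
proof -
 have "closed {z. r <= cmod z & cc a * cmod z <= vv m z}"
  by (intro closed_Collect_conj closed_Collect_le continuous_intros)
 moreover have "CS m a r = D \<inter> {z. r <= cmod z & cc a * cmod z <= vv m z}" by (auto simp: CS_def)
 ultimately show ?thesis by (auto simp: closedin_closed)
qed

lemma open_Nt: "openin (top_of_set D) (Nt m)"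
 unfolding Nt_def by (intro openin_diff open_OS closed_CS)
lemma open_Nm: "openin (top_of_set D) (Nm m)"
 unfolding Nm_def by (intro openin_Int open_OS open_Nt)
lemma open_Np: "openin (top_of_set D) (Np m)"
 unfolding Np_def by (intro openin_diff open_Nt closed_CS)
lemma closed_Gam: "closedin (top_of_set D) (Gam m)"
 unfolding Gam_def by (intro closedin_diff open_OS closed_CS)

text \<open>The cosine is monotone only on half a turn. A parameter at distance d > 2 g from the
  centre m + 3/2 reflects to 4 g - d, which is at least 3/2 because m + 3 <= 4 g, and therefore
  exceeds a.\<close>

lemma cos_sector:
 fixes s a :: real and m :: nat
 assumes s: "0 <= s" "s <= 4 * real g" and m: "m + 3 <= 4 * g" and a: "0 <= a" "a < 3/2"
 shows "cc a < cc (s - (real m + 3/2)) \<longleftrightarrow> \<bar>s - (real m + 3/2)\<bar> < a"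
  and "cc a <= cc (s - (real m + 3/2)) \<longleftrightarrow> \<bar>s - (real m + 3/2)\<bar> <= a"
proof -
 define d where "d = \<bar>s - (real m + 3/2)\<bar>"
 define h where "h = pi / (2 * real g)"
 have h: "h > 0" "2 * real g * h = pi" using g by (auto simp: h_def)
 have m': "real m + 3 <= 4 * real g" using m by linarith
 have d: "0 <= d" "d <= 4 * real g - 3/2" using s m' by (auto simp: d_def abs_le_iff)
 have eq: "cc (s - (real m + 3/2)) = cos (d * h)"
 proof -
  have "cos (\<bar>x\<bar> * h) = cos (x * h)" for x :: real by (cases "x < 0") (simp_all only: abs_if if_True if_False mult_minus_left cos_minus)
  then show ?thesis by (simp add: cc_def d_def h_def)
 qed
 have ca: "cc a = cos (a * h)" by (simp add: cc_def h_def)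
 have g1: "real g >= 1" using g by simp
 have "a * h < 3/2 * h" using a h by simp
 also have "... <= 2 * real g * h" using h g1 by (intro mult_right_mono) auto
 finally have ah: "0 <= a * h" "a * h < pi" using a h by (auto simp: h(2))
 have "(cos (a * h) < cos (d * h) \<longleftrightarrow> d < a) & (cos (a * h) <= cos (d * h) \<longleftrightarrow> d <= a)"
 proof (cases "d <= 2 * real g")
  case True
  then have "d * h <= 2 * real g * h" using h by (intro mult_right_mono) auto
  then have "d * h <= pi" using h by simp
  then have "(cos (a * h) < cos (d * h) \<longleftrightarrow> d * h < a * h) & (cos (a * h) <= cos (d * h) \<longleftrightarrow> d * h <= a * h)"
   using ah d h by (auto simp: cos_mono_less_eq cos_mono_le_eq)
  then show ?thesis using h by simp
 next
  case False
  have "d * h <= (4 * real g - 3/2) * h" using d h by (intro mult_right_mono) auto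
  then have 1: "3/2 * h <= 2 * pi - d * h" using h(2) by (simp add: algebra_simps)
  have "2 * real g * h < d * h" using False h(1) by (intro mult_strict_right_mono) auto
  then have 2: "2 * pi - d * h < pi" using h(2) by simp
  have "cos (d * h) = cos (2 * pi - d * h)" by (simp add: cos_diff)
  also have "... < cos (a * h)" using ah 1 2 \<open>a * h < 3/2 * h\<close> by (intro cos_monotone_0_pi) auto
  finally show ?thesis using False a g1 by auto
 qed
 then show "cc a < cc (s - (real m + 3/2)) \<longleftrightarrow> \<bar>s - (real m + 3/2)\<bar> < a"
  "cc a <= cc (s - (real m + 3/2)) \<longleftrightarrow> \<bar>s - (real m + 3/2)\<bar> <= a"
  by (auto simp: eq ca d_def[symmetric])
qed

lemma vv_polar: "vv m (r *\<^sub>R bd s) = r * cc (s - (real m + 3/2))"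
 unfolding vv_def using bd_mult_cnj[of s "real m + 3/2"]
 by (simp add: cc_def bd_eq mult.commute)

lemma polar:
 assumes "0 <= s" "s <= 4 * real g" "m + 3 <= 4 * g" "0 <= a" "a < 3/2" "0 < \<rho>" "\<rho> <= 1"
 shows "\<rho> *\<^sub>R bd s \<in> OS m a r \<longleftrightarrow> r < \<rho> & \<bar>s - (real m + 3/2)\<bar> < a"
  and "\<rho> *\<^sub>R bd s \<in> CS m a r \<longleftrightarrow> r <= \<rho> & \<bar>s - (real m + 3/2)\<bar> <= a"
 using cos_sector[OF assms(1-5)] assms(6,7) unfolding OS_def CS_def
 by (auto simp: vv_polar mult.commute[of _ \<rho>])

lemma polar_exists:
 assumes "z \<in> D" "z ~= 0"
 obtains s where "0 <= s" "s <= 4 * real g" "z = cmod z *\<^sub>R bd s"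
proof -
 define s where "s = Arg2pi z * (2 * real g) / pi"
 have "bd s = cis (Arg2pi z)" unfolding bd_eq s_def using g by simp
 then have "z = cmod z *\<^sub>R bd s" using Arg2pi_eq[of z] by (simp add: cis_conv_exp scaleR_conv_of_real is_Arg_def)
 moreover have "0 <= s" using Arg2pi_ge_0[of z] by (simp add: s_def)
 moreover have "s <= 2 * pi * (2 * real g) / pi"
  unfolding s_def using Arg2pi_lt_2pi[of z] by (intro divide_right_mono mult_right_mono) auto
 ultimately show ?thesis using that by simp
qed

lemma Gam_ne0: "z \<in> Gam m ==> z ~= 0" by (auto simp: Gam_def CS_def)

lemma Nt_ne0: "z \<in> Nt m ==> z ~= 0 & z \<in> D" unfolding Nt_def by (auto simp: OS_def)

lemma Gam_Nt: assumes "m + 3 <= 4 * g" shows "Gam m \<subseteq> Nt m"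
proof
 fix z assume z: "z \<in> Gam m"
 then have "z ~= 0" "z \<in> D" using Gam_ne0 by (auto simp: Gam_def CS_def)
 then obtain s where s: "0 <= s" "s <= 4 * real g" "z = cmod z *\<^sub>R bd s" using polar_exists by blast
 define \<rho> where "\<rho> = cmod z"
 have \<rho>: "0 < \<rho>" "\<rho> <= 1" "z = \<rho> *\<^sub>R bd s" using \<open>z ~= 0\<close> \<open>z \<in> D\<close> s(3) by (auto simp: \<rho>_def)
 note p = polar[OF s(1,2) assms _ _ \<rho>(1,2)]
 show "z \<in> Nt m" using z unfolding Gam_def Nt_def \<rho>(3) by (auto simp: p)
qed

lemma side_gluingE:
 assumes "(z, w) \<in> side_gluing g"
 obtains j k t where "z = bd (real (4 * j + k) + t)" "w = bd (real (4 * j + k + 3) - t)" "j < g" "k < 2" "0 <= t" "t <= 1"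
 using assms unfolding side_gluing_def by blast

text \<open>The pair of sides m and m + 2 is symmetric about m + 3/2, so glued points pass the same
  angular tests. Any other pair keeps away from angular distances between 7/8 and 9/8 and does not
  meet the strip.\<close>

lemma glue_sector:
 assumes zw: "(z, w) \<in> side_gluing g" and m: "m = 4 * i + k" "i < g" "k < 2"
 shows "z \<notin> Nt m & w \<notin> Nt m \<or>
   (\<exists>t. 0 <= t & t <= 1 & z = bd (real m + t) & w = bd (real m + 3 - t) &
    (\<forall>a r. 0 <= a --> a < 3/2 --> (z \<in> OS m a r \<longleftrightarrow> w \<in> OS m a r) & (z \<in> CS m a r \<longleftrightarrow> w \<in> CS m a r)))"
proof -
 obtain j k' t where jk: "z = bd (real (4 * j + k') + t)" "w = bd (real (4 * j + k' + 3) - t)" "j < g" "k' < 2" "0 <= t" "t <= 1"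
  using side_gluingE[OF zw] .
 define n where "n = 4 * j + k'"
 have m3: "m + 3 <= 4 * g" and n3: "n + 3 <= 4 * g" using m jk by (auto simp: n_def)
 then have n3': "real n + 3 <= 4 * real g" by linarith
 have s: "0 <= real n + t" "real n + t <= 4 * real g" "0 <= real n + 3 - t" "real n + 3 - t <= 4 * real g"
  using jk n3' by auto
 have z: "z = 1 *\<^sub>R bd (real n + t)" and w: "w = 1 *\<^sub>R bd (real n + 3 - t)" using jk by (auto simp: n_def)
 note pz = polar[OF s(1,2) m3 _ _, of _ 1] and pw = polar[OF s(3,4) m3 _ _, of _ 1]
 show ?thesis
 proof (cases "n = m")
  case True
  have "\<bar>real n + t - (real m + 3/2)\<bar> = \<bar>real n + 3 - t - (real m + 3/2)\<bar>" using True by (simp add: abs_if)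
  then have "\<forall>a r. 0 <= a --> a < 3/2 --> (z \<in> OS m a r \<longleftrightarrow> w \<in> OS m a r) & (z \<in> CS m a r \<longleftrightarrow> w \<in> CS m a r)"
   unfolding z w by (simp add: pz pw del: scaleR_one)
  then show ?thesis using jk True by (intro disjI2 exI[of _ t]) (auto simp: z w)
 next
  case False
  \<comment> \<open>The first side of a pair has residue 0 or 1 modulo 4, which excludes the one
    shift by which another pair could reach the feet of the arch.\<close>
  have "n ~= m + 2" "n + 2 ~= m" using m jk(4) by (auto simp: n_def, presburger+)
  then have "real n <= real m - 1 & real n ~= real m - 2 \<or> real n >= real m + 1 & real n ~= real m + 2" using False by linarith
  then have "n + 3 <= m \<or> n + 1 = m \<or> n = m + 1 \<or> n >= m + 3" using False \<open>n ~= m + 2\<close> \<open>n + 2 ~= m\<close> by linarith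
  then have "real n + 3 <= real m \<or> real n + 1 = real m \<or> real n = real m + 1 \<or> real n >= real m + 3" by linarith
  then have "\<not> (\<bar>real n + t - (real m + 3/2)\<bar> < 9/8 & \<not> \<bar>real n + t - (real m + 3/2)\<bar> <= 7/8)"
   "\<not> (\<bar>real n + 3 - t - (real m + 3/2)\<bar> < 9/8 & \<not> \<bar>real n + 3 - t - (real m + 3/2)\<bar> <= 7/8)"
   using jk(5,6) by (auto simp: abs_if)
  then have "z \<notin> Nt m & w \<notin> Nt m" unfolding z w Nt_def by (simp add: pz pw del: scaleR_one)
  then show ?thesis by blast
 qed
qed

context
 fixes i k m :: nat
 assumes m: "m = 4 * i + k" "i < g" "k < 2"
begin

lemma m3: "m + 3 <= 4 * g" using m by auto

lemma sat_sector:
 assumes "S \<subseteq> Nt m" "!!z w. (!!a r. 0 <= a ==> a < 3/2 ==> (z \<in> OS m a r \<longleftrightarrow> w \<in> OS m a r) & (z \<in> CS m a r \<longleftrightarrow> w \<in> CS m a r)) ==>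
   cmod z = 1 ==> cmod w = 1 ==> z \<in> S \<longleftrightarrow> w \<in> S"
 shows "sat S"
 unfolding sat_def
proof (intro conjI allI impI)
 show "S \<subseteq> D" using assms(1) Nt_ne0 by blast
 fix z w assume zw: "(z, w) \<in> side_gluing g"
 show "z \<in> S \<longleftrightarrow> w \<in> S"
  using glue_sector[OF zw m] assms(1) assms(2)[of z w] side_gluing_norm[OF zw] by blast
qed

lemma sat_Nt: "sat (Nt m)" by (rule sat_sector) (auto simp: Nt_def)
lemma sat_Nm: "sat (Nm m)" by (rule sat_sector) (auto simp: Nm_def Nt_def)
lemma sat_Np: "sat (Np m)" by (rule sat_sector) (auto simp: Np_def Nt_def)
lemma sat_Gam: "sat (Gam m)" by (rule sat_sector[OF Gam_Nt[OF m3]]) (auto simp: Gam_def)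
lemma sat_Nside: "sat (Nt m \<inter> {z. 5/8 < cmod z})" by (rule sat_sector) (auto simp: Nt_def)

lemma open_Nside: "openin (top_of_set D) (Nt m \<inter> {z. 5/8 < cmod z})"
 by (intro openin_Int_open open_Nt open_Collect_less continuous_intros)

lemma Nt_polar:
 assumes "z \<in> Nt m"
 obtains s where "0 <= s" "s <= 4 * real g" "z = cmod z *\<^sub>R bd s" "\<bar>s - (real m + 3/2)\<bar> < 9/8"
  "5/8 <= cmod z ==> 7/8 < \<bar>s - (real m + 3/2)\<bar>"
proof -
 have z: "z ~= 0" "z \<in> D" using Nt_ne0[OF assms] by auto
 then obtain s where s: "0 <= s" "s <= 4 * real g" "z = cmod z *\<^sub>R bd s" using polar_exists by blast
 define \<rho> where "\<rho> = cmod z"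
 have \<rho>: "0 < \<rho>" "\<rho> <= 1" "z = \<rho> *\<^sub>R bd s" using z s(3) by (auto simp: \<rho>_def)
 note p = polar[OF s(1,2) m3 _ _ \<rho>(1,2)]
 have "\<bar>s - (real m + 3/2)\<bar> < 9/8" "5/8 <= \<rho> ==> 7/8 < \<bar>s - (real m + 3/2)\<bar>"
  using assms unfolding Nt_def by (subst (asm) \<rho>(3), auto simp: p)+
 then show ?thesis using that s by (auto simp: \<rho>_def)
qed

end

lemma Nt_disjoint:
 assumes "i < g" "i' < g" "k < 2" "i ~= i'" shows "Nt (4 * i + k) \<inter> Nt (4 * i' + k) = {}"
proof (rule ccontr)
 assume "\<not> ?thesis"
 then obtain z where z: "z \<in> Nt (4 * i + k)" "z \<in> Nt (4 * i' + k)" by blast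
 obtain s where s: "0 <= s" "s <= 4 * real g" "z = cmod z *\<^sub>R bd s" "\<bar>s - (real (4 * i + k) + 3/2)\<bar> < 9/8"
  using Nt_polar[OF refl assms(1,3) z(1)] by metis
 define \<rho> where "\<rho> = cmod z"
 have \<rho>: "0 < \<rho>" "\<rho> <= 1" "z = \<rho> *\<^sub>R bd s" using Nt_ne0[OF z(1)] s(3) by (auto simp: \<rho>_def)
 have "\<rho> *\<^sub>R bd s \<in> OS (4 * i' + k) (9/8) (3/8)" using z(2) \<rho>(3) by (simp add: Nt_def)
 then have "\<bar>s - (real (4 * i' + k) + 3/2)\<bar> < 9/8"
  using polar(1)[OF s(1,2) m3[OF refl assms(2,3)] _ _ \<rho>(1,2), of "9/8"] by simp
 moreover have "real i + 1 <= real i' \<or> real i' + 1 <= real i" using assms(4) by linarith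
 ultimately show False using s(4) by (auto simp: abs_if split: if_splits)
qed

text \<open>A side point is described by the sine \<open>x\<close> of its angle to the midpoint of the side; the chart
 \<open>chart m\<close> unfolds a neighbourhood of the side \<open>m\<close> and of its partner \<open>m + 2\<close>.\<close>

definition "carc (x::real) = Complex (sqrt (1 - x\<^sup>2)) x"
definition "x0 = sin (pi / (4 * real g))"
definition "chart m p = (if snd p <= 0 then pj ((1 + snd p) *\<^sub>R (bd (real m + 1/2) * carc (fst p)))
  else pj ((1 - snd p) *\<^sub>R (bd (real m + 5/2) * cnj (carc (fst p)))))"
text \<open>Inverts the chart near the feet of the strip. The sign of the imaginary part against the
  middle direction tells the two sides apart. Using the sine instead of the angle keeps the first
  coordinate algebraic in z; the second is the signed depth below the boundary.\<close>

definition "side_coord m z = (if Im (z * cnj (bd (real m + 3/2))) < 0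
  then (Im (z * cnj (bd (real m + 1/2))) / cmod z, cmod z - 1)
  else (- Im (z * cnj (bd (real m + 5/2))) / cmod z, 1 - cmod z))"

lemma x0: "0 <= x0" "x0 <= 1"
 using g by (auto simp: x0_def intro!: sin_ge_zero simp: field_simps)

lemma carc_sin: assumes "\<bar>\<theta>\<bar> <= pi / 2" shows "carc (sin \<theta>) = cis \<theta>"
proof -
 have "0 <= cos \<theta>" using assms by (intro cos_ge_zero) (auto simp: abs_le_iff)
 moreover have "1 - (sin \<theta>)\<^sup>2 = (cos \<theta>)\<^sup>2" by (simp add: cos_squared_eq)
 ultimately show ?thesis by (simp add: carc_def complex_eq_iff)
qed

lemma cmod_carc: "\<bar>x\<bar> <= 1 ==> cmod (carc x) = 1"
 by (simp add: carc_def cmod_def abs_square_le_1)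

lemma bd_carc: assumes "\<bar>t\<bar> <= real g" shows "bd t = carc (sin (pi * t / (2 * real g)))"
proof -
 have "\<bar>pi * t / (2 * real g)\<bar> = pi * \<bar>t\<bar> / (2 * real g)" by (simp add: abs_mult)
 also have "... <= pi * real g / (2 * real g)" using assms by (intro divide_right_mono mult_left_mono) auto
 finally have "\<bar>pi * t / (2 * real g)\<bar> <= pi / 2" using g by simp
 then show ?thesis using carc_sin bd_eq by simp
qed

text \<open>If t is the angle with sine x, counted in sides, the points 1/2 + t on side m and 5/2 -
  t, counted from m, are glued. Complex conjugation of \<open>carc\<close> expresses the reversal of
  direction, and \<open>x0\<close> is the sine of half a side.\<close>

lemma chart_glue:
 assumes m: "m = 4 * i + k" "i < g" "k < 2" and x: "\<bar>x\<bar> <= x0"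
 shows "pj (bd (real m + 1/2) * carc x) = pj (bd (real m + 5/2) * cnj (carc x))"
proof -
 have "x0 <= 1" by (rule x0)
 then have x1: "-1 <= x" "x <= 1" using x by auto
 define t where "t = arcsin x * (2 * real g) / pi"
 have g0: "real g > 0" using g by simp
 have b: "0 < pi / (4 * real g)" "pi / (4 * real g) <= pi / 2" using g by (auto simp: field_simps)
 have a0: "arcsin x0 = pi / (4 * real g)" unfolding x0_def using b by (intro arcsin_sin) auto
 have "arcsin x <= arcsin x0" using x x0 x1 by (intro arcsin_le_arcsin) auto
 moreover have "arcsin (- x0) <= arcsin x" using x x0 x1 by (intro arcsin_le_arcsin) auto
 then have "- arcsin x0 <= arcsin x" using x0 by (simp add: arcsin_minus)
 ultimately have "\<bar>arcsin x\<bar> <= pi / (4 * real g)" using a0 by auto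
 then have t: "\<bar>t\<bar> <= 1/2" using g0 by (simp add: t_def abs_mult field_simps)
 have "\<bar>t\<bar> <= real g" "pi * t / (2 * real g) = arcsin x" using t g g0 by (simp_all add: t_def[symmetric] del: divide_le_eq) (simp add: t_def)
 then have e: "bd t = carc x" using bd_carc[of t] x1 by simp
 have "(bd (real (4 * i + k) + (1/2 + t)), bd (real (4 * i + k + 3) - (1/2 + t))) \<in> side_gluing g"
  unfolding side_gluing_def using m t by (intro CollectI exI[of _ i] exI[of _ k] exI[of _ "1/2 + t"]) auto
 then have "pj (bd (real m + 1/2 + t)) = pj (bd (real m + 5/2 - t))"
  using pj_glue m(1) by (simp add: algebra_simps)
 then show ?thesis using e by (simp add: bd_add cnj_bd[of t, symmetric] diff_conv_add_uminus del: add_uminus_conv_diff)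
qed

lemma chart_pos:
 assumes m: "m = 4 * i + k" "i < g" "k < 2" and "\<bar>fst p\<bar> <= x0" "0 <= snd p"
 shows "chart m p = pj ((1 - snd p) *\<^sub>R (bd (real m + 5/2) * cnj (carc (fst p))))"
 using assms(5) chart_glue[OF m assms(4)] by (auto simp: chart_def)

definition "K = {p :: real \<times> real. \<bar>fst p\<bar> <= x0 & \<bar>snd p\<bar> <= 1}"

lemma convex_K: "convex K"
proof -
 have "K = {- x0..x0} \<times> {- 1..1}" by (auto simp: K_def abs_le_iff)
 then show ?thesis by (simp add: convex_Times)
qed

lemma scale_K: "p \<in> K ==> 0 <= t ==> t <= 1 ==> t *\<^sub>R p \<in> K"
 using convexD[OF convex_K, of 0 p "1 - t" t] x0 by (auto simp: K_def)

lemma continuous_on_carc: "continuous_on S f ==> continuous_on S (%p. carc (f p))"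
 unfolding carc_def by (intro continuous_intros)

lemma chart_D: "\<bar>x\<bar> <= x0 ==> 0 <= r ==> r <= 1 ==> r *\<^sub>R (bd s * carc x) \<in> D"
  "\<bar>x\<bar> <= x0 ==> 0 <= r ==> r <= 1 ==> r *\<^sub>R (bd s * cnj (carc x)) \<in> D"
 using cmod_carc[of x] x0 by (auto simp: norm_mult)

lemma continuous_chart:
 assumes m: "m = 4 * i + k" "i < g" "k < 2"
 shows "continuous_map (top_of_set K) X (chart m)"
proof -
 let ?f = "%p. pj ((1 + snd p) *\<^sub>R (bd (real m + 1/2) * carc (fst p)))"
 let ?h = "%p. pj ((1 - snd p) *\<^sub>R (bd (real m + 5/2) * cnj (carc (fst p))))"
 let ?A = "{p \<in> topspace (top_of_set K). snd p <= 0}" and ?B = "{p \<in> topspace (top_of_set K). 0 <= snd p}"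
 have "continuous_map (top_of_set K) X (%p. if snd p <= 0 then ?f p else ?h p)"
 proof (rule continuous_map_cases_le)
  have "continuous_map (subtopology (top_of_set K) ?A) (top_of_set D) (%p. (1 + snd p) *\<^sub>R (bd (real m + 1/2) * carc (fst p)))"
   unfolding subtopology_subtopology continuous_map_in_subtopology
   using chart_D by (auto intro!: continuous_intros continuous_on_carc simp: K_def simp del: mem_cball)
  from continuous_map_compose[OF this continuous_map_pj]
  show "continuous_map (subtopology (top_of_set K) ?A) X ?f" by (simp add: o_def)
  have "continuous_map (subtopology (top_of_set K) ?B) (top_of_set D) (%p. (1 - snd p) *\<^sub>R (bd (real m + 5/2) * cnj (carc (fst p))))"
   unfolding subtopology_subtopology continuous_map_in_subtopology
   using chart_D by (auto intro!: continuous_intros continuous_on_carc simp: K_def simp del: mem_cball)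
  from continuous_map_compose[OF this continuous_map_pj]
  show "continuous_map (subtopology (top_of_set K) ?B) X ?h" by (simp add: o_def)
  show "?f p = ?h p" if "p \<in> topspace (top_of_set K)" "snd p = 0" for p
   using chart_glue[OF m, of "fst p"] that by (auto simp: K_def)
 qed (auto intro!: continuous_intros)
 then show ?thesis by (simp add: chart_def[abs_def])
qed

lemma Im_bd: "Im (bd t) = sin (pi * t / (2 * real g))" by (simp add: bd_eq)

lemma Nside_cases:
 assumes m: "m = 4 * i + k" "i < g" "k < 2" and z: "z \<in> Nt m" "5/8 < cmod z"
 obtains
  (A) x where "\<bar>x\<bar> <= x0" "z = cmod z *\<^sub>R (bd (real m + 1/2) * carc x)" "side_coord m z = (x, cmod z - 1)"
    "Im (z * cnj (bd (real m + 3/2))) < 0"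
 | (B) x where "\<bar>x\<bar> <= x0" "z = cmod z *\<^sub>R (bd (real m + 5/2) * cnj (carc x))" "side_coord m z = (x, 1 - cmod z)"
    "Im (z * cnj (bd (real m + 3/2))) > 0"
proof -
 obtain s where s: "z = cmod z *\<^sub>R bd s" "\<bar>s - (real m + 3/2)\<bar> < 9/8" "7/8 < \<bar>s - (real m + 3/2)\<bar>"
  using Nt_polar[OF m z(1)] z(2) by (metis less_imp_le)
 define \<rho> where "\<rho> = cmod z"
 have \<rho>: "\<rho> > 0" "z = \<rho> *\<^sub>R bd s" using z(2) s(1) by (auto simp: \<rho>_def)
 have g1: "1 <= real g" using g by simp
 have I: "Im (z * cnj (bd t)) = \<rho> * sin (pi * (s - t) / (2 * real g))" for t
  using bd_mult_cnj[of s t] by (simp add: \<rho>(2) Im_bd)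
 have pos: "0 < sin (pi * t / (2 * real g))" if "0 < t" "t <= 9/8" for t
 proof (rule sin_gt_zero)
  have "pi * t / (2 * real g) <= pi * (9/8) / 2" using that g1 by (intro frac_le mult_left_mono) auto
  also have "... < pi" by simp
  finally show "pi * t / (2 * real g) < pi" .
 qed (use that g1 in auto)
 have sm: "\<bar>sin (pi * t / (2 * real g))\<bar> <= x0" if "\<bar>t\<bar> <= 1/2" for t
 proof -
  have e: "\<bar>pi * t / (2 * real g)\<bar> <= pi / (4 * real g)"
  proof -
   have "\<bar>pi * t / (2 * real g)\<bar> = pi * \<bar>t\<bar> / (2 * real g)" by (simp add: abs_mult)
   also have "... <= pi * (1/2) / (2 * real g)" using that by (intro divide_right_mono mult_left_mono) auto
   finally show ?thesis by simp
  qed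
  have q: "pi / (4 * real g) <= pi / 2" using g1 by (intro divide_left_mono) auto
  have "\<bar>sin y\<bar> <= sin q" if "\<bar>y\<bar> <= q" "q <= pi / 2" for y q :: real
  proof -
   have "sin y <= sin q" "sin (- q) <= sin y" using that by (intro sin_monotone_2pi_le; auto)+
   then show ?thesis by auto
  qed
  from this[OF e q] show ?thesis by (simp only: x0_def)
 qed
 show ?thesis
 proof (cases "s < real m + 3/2")
  case True
  define t where "t = s - (real m + 1/2)"
  have t: "\<bar>t\<bar> <= 1/2" using s True by (auto simp: t_def abs_if split: if_splits)
  have "bd s = bd (real m + 1/2) * carc (sin (pi * t / (2 * real g)))"
   using bd_carc[of t] t g1 bd_add[of "real m + 1/2" t] by (simp add: t_def)
  moreover have "sin (pi * (s - (real m + 3/2)) / (2 * real g)) < 0"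
  proof -
   have e: "s - (real m + 3/2) = - (real m + 3/2 - s)" by simp
   have "sin (pi * (s - (real m + 3/2)) / (2 * real g)) = - sin (pi * (real m + 3/2 - s) / (2 * real g))"
    unfolding e by (simp only: mult_minus_right minus_divide_left[symmetric] sin_minus minus_minus)
   then show ?thesis using pos[of "real m + 3/2 - s"] True s(2) by simp
  qed
  then have "Im (z * cnj (bd (real m + 3/2))) < 0" unfolding I using \<rho> by (simp add: mult_less_0_iff)
  ultimately show ?thesis
   using A[of "sin (pi * t / (2 * real g))"] sm[OF t] \<rho> I[of "real m + 1/2"] unfolding side_coord_def \<rho>_def[symmetric]
   by (simp add: t_def)
 next
  case False
  define t where "t = real m + 5/2 - s"
  have t: "\<bar>t\<bar> <= 1/2" using s False by (auto simp: t_def abs_if split: if_splits)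
  have "bd s = bd (real m + 5/2) * cnj (carc (sin (pi * t / (2 * real g))))"
  proof -
   have "bd s = bd (real m + 5/2) * bd (- t)" using bd_add[of "real m + 5/2" "- t"] by (simp add: t_def)
   moreover have "\<bar>t\<bar> <= real g" using t g1 by linarith
   ultimately show ?thesis using bd_carc[of t] by (simp add: cnj_bd[symmetric])
  qed
  moreover have "0 < sin (pi * (s - (real m + 3/2)) / (2 * real g))"
   using False s by (intro pos) auto
  then have "Im (z * cnj (bd (real m + 3/2))) > 0" unfolding I using \<rho> by simp
  moreover have "- sin (pi * (s - (real m + 5/2)) / (2 * real g)) = sin (pi * t / (2 * real g))"
  proof -
   have e: "s - (real m + 5/2) = - t" by (simp add: t_def)
   show ?thesis by (simp only: e mult_minus_right minus_divide_left[symmetric] sin_minus minus_minus)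
  qed
  ultimately show ?thesis
   using B[of "sin (pi * t / (2 * real g))"] sm[OF t] \<rho> I[of "real m + 5/2"] unfolding side_coord_def \<rho>_def[symmetric]
   by simp
 qed
qed

lemma side_coord_chart:
 assumes m: "m = 4 * i + k" "i < g" "k < 2" and z: "z \<in> Nt m" "5/8 < cmod z"
 shows "side_coord m z \<in> K" "chart m (side_coord m z) = pj z"
proof -
 have c: "cmod z <= 1" using Nt_ne0[OF z(1)] by auto
 show "side_coord m z \<in> K" using Nside_cases[OF m z] c z(2) by cases (auto simp: K_def)
 show "chart m (side_coord m z) = pj z"
 proof (rule Nside_cases[OF m z])
  fix x assume "z = cmod z *\<^sub>R (bd (real m + 1/2) * carc x)" "side_coord m z = (x, cmod z - 1)"
  then show ?thesis using c by (simp add: chart_def)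
 next
  fix x assume "\<bar>x\<bar> <= x0" "z = cmod z *\<^sub>R (bd (real m + 5/2) * cnj (carc x))" "side_coord m z = (x, 1 - cmod z)"
  then show ?thesis using c chart_pos[OF m, of "side_coord m z"] by simp
 qed
qed

lemma side_coord_glue:
 assumes m: "m = 4 * i + k" "i < g" "k < 2" and z: "z \<in> Nt m" "5/8 < cmod z" and zw: "(z, w) \<in> side_gluing g"
 shows "side_coord m z = side_coord m w"
proof -
 obtain t where t: "0 <= t" "t <= 1" "z = bd (real m + t)" "w = bd (real m + 3 - t)"
  using glue_sector[OF zw m] z(1) by blast
 have g1: "1 <= real g" using g by simp
 have pos: "0 < sin (pi * (3/2 - t) / (2 * real g))"
 proof (rule sin_gt_zero)
  have "pi * (3/2 - t) / (2 * real g) <= pi * (3/2) / 2" using t g1 by (intro frac_le mult_left_mono) auto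
  also have "... < pi" by simp
  finally show "pi * (3/2 - t) / (2 * real g) < pi" .
 qed (use t g1 in auto)
 have e: "real m + t - (real m + 3/2) = - (3/2 - t)" "real m + 3 - t - (real m + 3/2) = 3/2 - t"
  "real m + t - (real m + 1/2) = t - 1/2" "real m + 3 - t - (real m + 5/2) = - (t - 1/2)" by auto
 have "Im (z * cnj (bd (real m + 3/2))) = - sin (pi * (3/2 - t) / (2 * real g))"
  "Im (w * cnj (bd (real m + 3/2))) = sin (pi * (3/2 - t) / (2 * real g))"
  "Im (w * cnj (bd (real m + 5/2))) = - Im (z * cnj (bd (real m + 1/2)))"
  unfolding t(3,4) bd_mult_cnj Im_bd e by (simp_all only: mult_minus_right minus_divide_left[symmetric] sin_minus)
 then show ?thesis using pos t(3,4) by (simp add: side_coord_def)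
qed

text \<open>The two defining formulas hold on disjoint open pieces, because at radius above 5/8 the
  strip does not meet the middle direction.\<close>

lemma continuous_side_coord:
 assumes m: "m = 4 * i + k" "i < g" "k < 2"
 shows "continuous_on (Nt m \<inter> {z. 5/8 < cmod z}) (side_coord m)"
proof -
 let ?S = "Nt m \<inter> {z. 5/8 < cmod z}"
 let ?A = "?S \<inter> {z. Im (z * cnj (bd (real m + 3/2))) < 0}" and ?B = "?S \<inter> {z. 0 < Im (z * cnj (bd (real m + 3/2)))}"
 have S: "?S = ?A \<union> ?B" using Nside_cases[OF m] by auto
 have "continuous_on (?A \<union> ?B) (side_coord m)"
 proof (rule continuous_on_Un_local_open)
  show "openin (top_of_set (?A \<union> ?B)) ?A" "openin (top_of_set (?A \<union> ?B)) ?B"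
   unfolding S[symmetric] by (intro openin_Int_open openin_subtopology_self open_Collect_less continuous_intros)+
  show "continuous_on ?A (side_coord m)"
  proof (rule continuous_on_eq)
   show "continuous_on ?A (%z. (Im (z * cnj (bd (real m + 1/2))) / cmod z, cmod z - 1))"
    by (intro continuous_intros) auto
  qed (auto simp: side_coord_def)
  show "continuous_on ?B (side_coord m)"
  proof (rule continuous_on_eq)
   show "continuous_on ?B (%z. (- Im (z * cnj (bd (real m + 5/2))) / cmod z, 1 - cmod z))"
    by (intro continuous_intros) auto
  qed (auto simp: side_coord_def)
 qed
 then show ?thesis using S by simp
qed

text \<open>The loop that leaves through side m and returns through side m + 2. It crosses at 1/4 of
  the side and not at the midpoint, since the arches end at midpoints; in this way
  \<open>lamp m\<close> avoids \<open>Gam m\<close>, to which it is parallel.\<close>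

definition "lamp m = loop_concat (ray (bd (real m + 1/4))) (path_rev (ray (bd (real m + 11/4))))"

lemma bd_D [simp]: "bd s \<in> D" "r *\<^sub>R bd s \<in> D \<longleftrightarrow> \<bar>r\<bar> <= 1" by auto

lemma pj_lamp:
 assumes m: "m = 4 * i + k" "i < g" "k < 2" and t: "0 <= t" "t <= 1"
 shows "pj (bd (real m + t)) = pj (bd (real m + 3 - t))"
proof -
 have "(bd (real (4 * i + k) + t), bd (real (4 * i + k + 3) - t)) \<in> side_gluing g"
  unfolding side_gluing_def using m t by (intro CollectI exI[of _ i] exI[of _ k] exI[of _ t]) auto
 then show ?thesis using pj_glue m(1) by (simp add: algebra_simps)
qed

lemma pj_lamp_mid:
 assumes "m = 4 * i + k" "i < g" "k < 2"
 shows "pj (bd (real m + 11/4)) = pj (bd (real m + 1/4))"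
proof -
 have "real m + 3 - 1/4 = real m + 11/4" by simp
 then show ?thesis using pj_lamp[OF assms, of "1/4"] by (simp only:)
qed

lemma lamp:
 assumes m: "m = 4 * i + k" "i < g" "k < 2"
 shows "pathin X (lamp m)" "lamp m 0 = pj 0" "lamp m 1 = pj 0"
 using pj_lamp_mid[OF m] by (simp_all add: lamp_def pathin_loop_concat pathin_path_rev pathin_ray)

end

text \<open>The functor is normalized to be trivial on rays to chosen representatives. An interior
  point represents itself, so \<open>e\<close> is trivial there, and at boundary points
  \<open>e\<close> carries all the holonomy.\<close>

locale surface_functor = surface g + path_functor Q "genus_surface g" E
 for g :: nat and Q :: "('q, 'b) monoid_scheme" (structure) and E +
 assumes E_rp: "!!y. y \<in> topspace (genus_surface g) ==> E (ray (rp y)) = \<one>"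
begin

abbreviation "e z \<equiv> E (ray z)"

lemma e_closed [simp]: "z \<in> D ==> e z \<in> carrier Q" using E_closed pathin_ray by simp

lemma e_ball: "z \<in> ball 0 1 ==> e z = \<one>"
 using E_rp[of "pj z"] rp_ball[of z] by (auto simp: topspace_X)

text \<open>The disc is convex, so the value on a projected path depends only on its endpoints and
  is read off from the two rays.\<close>

lemma functor_disc:
 assumes T: "path_functor Q X T" and \<sigma>: "continuous_on {0..1} \<sigma>" "\<sigma> ` {0..1} \<subseteq> D"
 shows "T (%t. pj (\<sigma> t)) = inv T (ray (\<sigma> 0)) \<otimes> T (ray (\<sigma> 1))"
proof -
 interpret T: path_functor Q X T by fact
 have D: "\<sigma> 0 \<in> D" "\<sigma> 1 \<in> D" using \<sigma>(2) unfolding image_subset_iff by (auto simp del: mem_cball)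
 let ?a = "%t. if t <= 1/2 then (2 * t) *\<^sub>R \<sigma> 0 else \<sigma> (2 * t - 1)"
 have "continuous_on {0..1} ?a"
  by (intro continuous_on_pieces continuous_intros continuous_on_compose2[OF \<sigma>(1)]) auto
 moreover have "?a t \<in> D" if "t \<in> {0..1}" for t
  using that scale_D[OF D(1), of "2 * t"] subsetD[OF \<sigma>(2) imageI[of "2 * t - 1"]] by (auto simp del: mem_cball)
 then have "?a ` {0..1} \<subseteq> D" by blast
 moreover have "(%t. t *\<^sub>R \<sigma> 1) ` {0..1} \<subseteq> D" using scale_D[OF D(2)] by auto
 ultimately have "path_homotopic X (loop_concat (ray (\<sigma> 0)) (%t. pj (\<sigma> t))) (ray (\<sigma> 1))"
  by (intro path_homotopic_convex[OF continuous_map_pj convex_cball, of ?a "%t. t *\<^sub>R \<sigma> 1"])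
    (auto intro!: continuous_intros simp: loop_concat_def ray_def)
 then have "T (ray (\<sigma> 0)) \<otimes> T (%t. pj (\<sigma> t)) = T (ray (\<sigma> 1))"
  using T.E_homotopic T.E_concat[OF pathin_ray[OF D(1)] pathin_pj[OF \<sigma>]] by simp
 then show ?thesis
  using T.E_closed[OF pathin_ray[OF D(1)]] T.E_closed[OF pathin_pj[OF \<sigma>]]
  by (metis Q.inv_closed Q.l_inv Q.l_one Q.m_assoc)
qed

lemmas E_disc = functor_disc[OF path_functor_axioms]

text \<open>On the open disc \<open>rp\<close> is a continuous inverse of \<open>pj\<close>; such a
  path lifts, and rays to interior points have trivial value.\<close>

lemma E_interior:
 assumes "pathin (subtopology X (pj ` S)) q" "S \<subseteq> ball 0 1"
 shows "E q = \<one>"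
proof -
 have q1: "pathin X q" "\<forall>t\<in>{0..1}. q t \<in> pj ` S"
  using assms by (simp_all add: pathin_subtopology)
 have q: "pathin X q" "!!t. t \<in> {0..1} ==> q t \<in> pj ` ball 0 1"
  using q1 image_mono[OF assms(2), of pj] by blast+
 have "continuous_map (subtopology X (pj ` ball 0 1)) euclidean rp"
  by (rule continuous_map_descend[where f="%z. z"])
    (use side_gluing_norm in \<open>fastforce simp: sat_ball openin_open intro: exI[of _ "ball 0 1"]\<close>)+
 moreover have "continuous_map (top_of_set {0..1}) (subtopology X (pj ` ball 0 1)) q"
  using q by (auto simp: pathin_def continuous_map_in_subtopology)
 ultimately have "continuous_map (top_of_set {0..1}) euclidean (rp \<circ> q)" using continuous_map_compose by blast
 then have c: "continuous_on {0..1} (%t. rp (q t))" by (simp add: o_def)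
 have b: "rp (q t) \<in> ball 0 1" "pj (rp (q t)) = q t" if "t \<in> {0..1}" for t
  using q(2)[OF that] rp_ball by auto
 have D: "(%t. rp (q t)) ` {0..1} \<subseteq> D" using b by (force simp del: mem_ball mem_cball dest: subsetD[OF ball_subset_cball])
 have "path_homotopic X q (%t. pj (rp (q t)))" by (rule path_homotopic_eqI[OF q(1)]) (simp add: b)
 then have "E q = E (%t. pj (rp (q t)))" by (rule E_homotopic)
 also have "... = inv e (rp (q 0)) \<otimes> e (rp (q 1))" using E_disc[OF c D] .
 also have "... = \<one>" using b[of 0] b[of 1] by (simp add: e_ball)
 finally show ?thesis .
qed

text \<open>The crossing point may slide along the side from 1/4 to 1/2: the boundary arcs swept on
  both sides have the same image in the surface. The midpoints are the centre of the side
  chart.\<close>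

lemma E_lamp:
 assumes m: "m = 4 * i + k" "i < g" "k < 2"
 shows "E (lamp m) = e (bd (real m + 1/2)) \<otimes> inv e (bd (real m + 5/2))"
proof -
 have cb: "continuous_on {0..1} (%t::real. bd (f t))" if "continuous_on {0..1} f" for f
  unfolding polygon_bd_def using that g by (intro continuous_intros) auto
 have "pj (bd (real m + 1/4 + t / 4)) = pj (bd (real m + 11/4 - t / 4))" if "t \<in> {0..1}" for t
  using pj_lamp[OF m, of "1/4 + t/4"] that by (simp add: algebra_simps)
 then have "path_homotopic X (%t. pj (bd (real m + 1/4 + t / 4))) (%t. pj (bd (real m + 11/4 - t / 4)))"
  by (intro path_homotopic_eqI pathin_pj cb) (auto intro!: continuous_intros)
 then have "E (%t. pj (bd (real m + 1/4 + t / 4))) = E (%t. pj (bd (real m + 11/4 - t / 4)))" by (rule E_homotopic)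
 moreover have "E (%t. pj (bd (real m + 1/4 + t / 4))) = inv e (bd (real m + 1/4)) \<otimes> e (bd (real m + 1/2))"
  by (subst E_disc) (auto intro!: cb continuous_intros simp: algebra_simps)
 moreover have "E (%t. pj (bd (real m + 11/4 - t / 4))) = inv e (bd (real m + 11/4)) \<otimes> e (bd (real m + 5/2))"
  by (subst E_disc) (auto intro!: cb continuous_intros simp: algebra_simps)
 ultimately have *: "inv e (bd (real m + 1/4)) \<otimes> e (bd (real m + 1/2)) = inv e (bd (real m + 11/4)) \<otimes> e (bd (real m + 5/2))"
  by simp
 have "E (lamp m) = e (bd (real m + 1/4)) \<otimes> inv e (bd (real m + 11/4))"
  unfolding lamp_def using pj_lamp_mid[OF m] by (subst E_concat) (simp_all add: E_rev pathin_ray pathin_path_rev)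
 moreover have "a \<otimes> inv b = c \<otimes> inv d"
  if "a \<in> carrier Q" "b \<in> carrier Q" "c \<in> carrier Q" "d \<in> carrier Q" "inv a \<otimes> c = inv b \<otimes> d" for a b c d
 proof -
  have "c = a \<otimes> (inv b \<otimes> d)" using that(1-4) by (simp add: that(5)[symmetric] Q.m_assoc[symmetric])
  then show ?thesis using that(1-4) by (simp add: Q.m_assoc)
 qed
 ultimately show ?thesis using * by simp
qed

text \<open>Within the convex chart only the endpoints of \<open>q\<close> matter. Each of them has
  its representative on one or the other of the two glued sides, so \<open>E q\<close> is trivial or
  equals the value of \<open>lamp m\<close> or its inverse; all of these commute with
  \<open>z\<close>.\<close>

lemma E_side:
 assumes m: "m = 4 * i + k" "i < g" "k < 2"
  and q: "pathin (subtopology X (pj ` (Nt m \<inter> {z. 5/8 < cmod z}))) q"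
  and z: "z \<in> carrier Q" "z \<otimes> E (lamp m) = E (lamp m) \<otimes> z"
 shows "z \<otimes> E q = E q \<otimes> z"
proof -
 let ?S = "Nt m \<inter> {z. 5/8 < cmod z}"
 define b b' where "b = bd (real m + 1/2)" and "b' = bd (real m + 5/2)"
 have bD [simp]: "b \<in> D" "b' \<in> D" "e b \<in> carrier Q" "e b' \<in> carrier Q" by (simp_all add: b_def b'_def del: mem_cball)
 have satS: "sat ?S" by (rule sat_Nside[OF m])
 have q': "pathin X q" "q t \<in> pj ` ?S" if "t \<in> {0..1}" for t using q that by (auto simp: pathin_subtopology)
 define \<sigma> where "\<sigma> t = side_coord m (rp (q t))" for t
 have "continuous_map (subtopology X (pj ` ?S)) euclidean (%y. side_coord m (rp y))"
  using side_coord_glue[OF m] by (intro continuous_map_descend[OF satS open_Nside[OF m] _ continuous_side_coord[OF m]]) auto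
 from continuous_map_compose[OF q[unfolded pathin_def] this]
 have c: "continuous_on {0..1} \<sigma>" by (simp add: \<sigma>_def[abs_def] o_def)
 have r: "rp (q t) \<in> Nt m" "5/8 < cmod (rp (q t))" "pj (rp (q t)) = q t" if "t \<in> {0..1}" for t
  using sat_rp[OF satS q'(2)[OF that]] rp(2)[of "q t"] q'(2)[OF that] satS by (auto simp: topspace_X sat_def)
 have \<sigma>K: "\<sigma> t \<in> K" "q t = chart m (\<sigma> t)" if "t \<in> {0..1}" for t
  using side_coord_chart[OF m r(1,2)[OF that]] r(3)[OF that] by (auto simp: \<sigma>_def)
 \<comment> \<open>The straight chart path from the glued midpoints \<open>pj b = pj b'\<close> to
   the point with chart coordinates \<open>p\<close>.\<close>
 define \<epsilon> where "\<epsilon> p = (%t. chart m (t *\<^sub>R p))" for p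
 have pe: "pathin X (\<epsilon> p)" if "p \<in> K" for p
 proof -
  have "continuous_map (top_of_set {0..1}) (top_of_set K) (%t. t *\<^sub>R p)"
   using scale_K[OF that] by (auto simp: continuous_map_in_subtopology intro!: continuous_intros)
  from continuous_map_compose[OF this continuous_chart[OF m]] show ?thesis by (simp add: pathin_def \<epsilon>_def o_def)
 qed
 have e0: "\<epsilon> p 0 = chart m 0" for p by (simp add: \<epsilon>_def)
 have K01: "\<sigma> 0 \<in> K" "\<sigma> 1 \<in> K" using \<sigma>K by auto
 let ?a = "%t. if t <= 1/2 then (1 - 2 * t) *\<^sub>R \<sigma> 0 else (2 * t - 1) *\<^sub>R \<sigma> 1"
 have "continuous_on {0..1} ?a" by (intro continuous_on_pieces continuous_intros) auto
 moreover have "?a t \<in> K" if "t \<in> {0..1}" for t using that scale_K K01 by auto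
 then have "?a ` {0..1} \<subseteq> K" by blast
 moreover have "\<sigma> ` {0..1} \<subseteq> K" using \<sigma>K by blast
 ultimately have "path_homotopic X (loop_concat (path_rev (\<epsilon> (\<sigma> 0))) (\<epsilon> (\<sigma> 1))) q"
  using c \<sigma>K by (intro path_homotopic_convex[OF continuous_chart[OF m] convex_K, of ?a \<sigma>])
    (auto simp: loop_concat_def path_rev_def \<epsilon>_def)
 then have "E q = E (loop_concat (path_rev (\<epsilon> (\<sigma> 0))) (\<epsilon> (\<sigma> 1)))" by (rule E_homotopic[symmetric])
 also have "... = inv E (\<epsilon> (\<sigma> 0)) \<otimes> E (\<epsilon> (\<sigma> 1))"
  using pe[OF K01(1)] pe[OF K01(2)] by (subst E_concat) (simp_all add: E_rev pathin_path_rev e0)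
 finally have Eq: "E q = inv E (\<epsilon> (\<sigma> 0)) \<otimes> E (\<epsilon> (\<sigma> 1))" .
 \<comment> \<open>The alternative records on which side the representative of \<open>q t\<close>
   lies. The chart path lifts to a disc path from \<open>b\<close> or \<open>b'\<close> to that
   representative, where \<open>e\<close> is trivial.\<close>
 have E\<epsilon>: "E (\<epsilon> (\<sigma> t)) = inv e b \<or> E (\<epsilon> (\<sigma> t)) = inv e b'" if t: "t \<in> {0..1}" for t
 proof (rule Nside_cases[OF m r(1,2)[OF t]])
  define w where "w = rp (q t)"
  have w1: "cmod w <= 1" "w \<in> D" using Nt_ne0[OF r(1)[OF t]] by (auto simp: w_def)
  have "q t \<in> topspace X" using q'(1)[OF t] t by (auto simp: pathin_def continuous_map_def)
  then have ew: "e w = \<one>" unfolding w_def by (rule E_rp)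
  have gen: "E (\<epsilon> (\<sigma> t)) = inv e c"
   if "continuous_on {0..1} S" and S: "!!u. u \<in> {0..1} ==> S u \<in> D & \<epsilon> (\<sigma> t) u = pj (S u)" "S 0 = c" "S 1 = w" for S c
  proof -
   have "path_homotopic X (\<epsilon> (\<sigma> t)) (%u. pj (S u))" using S(1) pe[OF \<sigma>K(1)[OF t]] by (intro path_homotopic_eqI) auto
   then have "E (\<epsilon> (\<sigma> t)) = E (%u. pj (S u))" by (rule E_homotopic)
   also have "... = inv e (S 0) \<otimes> e (S 1)" using S(1) by (intro E_disc that(1)) blast
   finally show ?thesis using ew S(1)[of 0] by (simp add: S(2,3) del: mem_cball)
  qed
  have u: "u * (1 - cmod w) <= 1" "0 <= u * (1 - cmod w)" "\<bar>x\<bar> <= x0 ==> \<bar>u * x\<bar> <= x0" if "u \<in> {0..1}" for u x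
   using that w1(1) mult_left_le_one_le[of "\<bar>x\<bar>" u] by (auto simp: abs_mult intro!: mult_le_one)
  show ?thesis if x: "\<bar>x\<bar> <= x0" "rp (q t) = cmod (rp (q t)) *\<^sub>R (bd (real m + 1/2) * carc x)"
    "side_coord m (rp (q t)) = (x, cmod (rp (q t)) - 1)" for x
  proof (rule disjI1, rule gen[of "%u. (1 - u * (1 - cmod w)) *\<^sub>R (b * carc (u * x))"])
   show "(1 - u * (1 - cmod w)) *\<^sub>R (b * carc (u * x)) \<in> D & \<epsilon> (\<sigma> t) u = pj ((1 - u * (1 - cmod w)) *\<^sub>R (b * carc (u * x)))" if "u \<in> {0..1}" for u
   proof -
    have e: "1 + u * (cmod w - 1) = 1 - u * (1 - cmod w)" by (simp add: algebra_simps)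
    have "u * (cmod w - 1) <= 0" using e u(2)[OF that] by linarith
    then show ?thesis unfolding b_def using u[OF that] x by (intro conjI chart_D) (auto simp: \<epsilon>_def \<sigma>_def w_def chart_def e[unfolded w_def])
   qed
  qed (use x(2) in \<open>auto simp: b_def w_def carc_def complex_eq_iff intro!: continuous_intros continuous_on_carc\<close>)
  show ?thesis if x: "\<bar>x\<bar> <= x0" "rp (q t) = cmod (rp (q t)) *\<^sub>R (bd (real m + 5/2) * cnj (carc x))"
    "side_coord m (rp (q t)) = (x, 1 - cmod (rp (q t)))" for x
  proof (rule disjI2, rule gen[of "%u. (1 - u * (1 - cmod w)) *\<^sub>R (b' * cnj (carc (u * x)))"])
   show "(1 - u * (1 - cmod w)) *\<^sub>R (b' * cnj (carc (u * x))) \<in> D & \<epsilon> (\<sigma> t) u = pj ((1 - u * (1 - cmod w)) *\<^sub>R (b' * cnj (carc (u * x))))" if "u \<in> {0..1}" for u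
    unfolding b'_def using u[OF that] x chart_pos[OF m, of "u *\<^sub>R \<sigma> t"]
    by (intro conjI chart_D) (auto simp: \<epsilon>_def \<sigma>_def w_def)
  qed (use x(2) in \<open>auto simp: b'_def w_def carc_def complex_eq_iff intro!: continuous_intros continuous_on_carc\<close>)
 qed
 define c0 where "c0 = e b \<otimes> inv e b'"
 have c0: "c0 \<in> carrier Q" by (simp add: c0_def)
 have "inv c0 = e b' \<otimes> inv e b" by (simp add: c0_def Q.inv_mult_group)
 then have cases: "E q = \<one> \<or> E q = c0 \<or> E q = inv c0"
  unfolding Eq using E\<epsilon>[of 0] E\<epsilon>[of 1] by (auto simp: c0_def)
 have zc: "z \<otimes> c0 = c0 \<otimes> z" using z(2) unfolding E_lamp[OF m] c0_def b_def b'_def .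
 have "z \<otimes> inv c0 = inv c0 \<otimes> (c0 \<otimes> z) \<otimes> inv c0" using z(1) c0 by (simp add: Q.m_assoc[symmetric])
 also have "... = inv c0 \<otimes> z" unfolding zc[symmetric] using z(1) c0 by (simp add: Q.m_assoc)
 finally show ?thesis using cases zc z(1) by auto
qed

end

lemma (in path_functor) E_subpath:
 assumes "pathin X p" "{a, b, c} \<subseteq> {0..1}"
 shows "E (subpath_on p a c) = E (subpath_on p a b) \<otimes> E (subpath_on p b c)"
proof -
 have "pathin X (subpath_on p a b)" "pathin X (subpath_on p b c)"
  using assms(2) by (auto intro!: pathin_subpath_on[OF assms(1)[unfolded pathin_def]])
 then show ?thesis
  using E_homotopic[OF concat_subpaths_homotopic[OF assms(1)[unfolded pathin_def] assms(2)]] E_concat by simp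
qed

section \<open>Twisting a functor along disjoint closed curves\<close>

locale surface_twist = surface_functor g Q E
 for g :: nat and Q :: "('q, 'b) monoid_scheme" (structure) and E +
 fixes k :: nat and z :: "nat => 'q"
 assumes k: "k < 2" and z_closed: "i < g ==> z i \<in> carrier Q"
  and z_commute: "i < g ==> z i \<otimes> E (lamp (4 * i + k)) = E (lamp (4 * i + k)) \<otimes> z i"
begin

definition "mm i = 4 * i + k"
definition "V0 = D - (\<Union>i<g. Gam (mm i))"
text \<open>A step function that jumps across the curve \<open>Gam (mm i)\<close>; a path crossing
  the curve picks up the quotient of its values.\<close>

definition "zs i y = (if y \<in> pj ` Nm (mm i) then z i else \<one>)"
definition "idx y = (THE i. i < g & y \<in> pj ` Nt (mm i))"
definition "tw i q = inv (zs i (q 0)) \<otimes> E q \<otimes> zs i (q (1::real))"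
text \<open>Away from all curves nothing changes. A path meeting a curve is assumed to stay in one
  strip, which its starting point identifies, and is corrected by the step function of that
  strip.\<close>

definition "\<tau> q = (if q ` {0..1} \<subseteq> pj ` V0 then E q else tw (idx (q 0)) q)"
text \<open>Each strip is covered by two sets, so that paths in it are controlled either by
  \<open>E_interior\<close> or by \<open>E_side\<close>.\<close>

definition "strips i = {Nt (mm i) \<inter> ball 0 1, Nt (mm i) \<inter> {z. 5/8 < cmod z}}"
definition "C = insert (pj ` V0) (\<Union>i<g. (`) pj ` strips i)"

lemma mm: "i < g ==> mm i = 4 * i + k & i < g & k < 2" using k by (simp add: mm_def)

lemma mm_sat: assumes "i < g"
 shows "sat (Nt (mm i))" "sat (Nm (mm i))" "sat (Np (mm i))" "sat (Gam (mm i))" "mm i + 3 <= 4 * g"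
 using mm[OF assms] by (auto intro: sat_Nt[of _ i k] sat_Nm[of _ i k] sat_Np[of _ i k] sat_Gam[of _ i k])

lemma zs_closed [simp]: "i < g ==> zs i y \<in> carrier Q" by (simp add: zs_def z_closed)

lemma sat_V0: "sat V0"
 unfolding sat_def
proof (intro conjI allI impI)
 fix a b assume ab: "(a, b) \<in> side_gluing g"
 have "a \<in> D" "b \<in> D" using side_gluing_norm[OF ab] by auto
 moreover have "a \<in> Gam (mm i) \<longleftrightarrow> b \<in> Gam (mm i)" if "i < g" for i
  using mm_sat(4)[OF that] ab by (simp add: sat_def)
 ultimately show "a \<in> V0 \<longleftrightarrow> b \<in> V0" by (auto simp: V0_def)
qed (auto simp: V0_def)

lemma open_V0: "openin (top_of_set D) V0"
 unfolding V0_def by (intro openin_diff closedin_Union) (auto simp: closed_Gam)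

lemma strips: assumes "i < g" "S \<in> strips i"
 shows "sat S" "openin (top_of_set D) S" "S \<subseteq> Nt (mm i)"
 using assms mm[OF assms(1)] sat_Nside[of "mm i" i k] open_Nside[of "mm i" i k] sat_ball[of "Nt (mm i) \<inter> ball 0 1"]
 by (auto simp: strips_def intro: openin_Int_open open_Nt)

lemma idx: assumes "i < g" "y \<in> pj ` Nt (mm i)" shows "idx y = i"
 unfolding idx_def
proof (rule the_equality)
 fix j assume j: "j < g & y \<in> pj ` Nt (mm j)"
 then have "rp y \<in> Nt (mm j)" "rp y \<in> Nt (mm i)" using sat_rp mm_sat(1) assms by blast+
 then show "j = i" using Nt_disjoint[of i j k] j assms(1) k by (auto simp: mm_def)
qed (use assms in auto)

text \<open>The compatibility of the two prescriptions. A path in the strip that avoids the curve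
  stays in one of the two open halves by connectedness. In the outer half the correction is trivial;
  in the inner half it conjugates by \<open>z i\<close>, which commutes with \<open>E q\<close>.
  This is where \<open>z_commute\<close> is used.\<close>

lemma \<tau>_strip:
 assumes i: "i < g" "S \<in> strips i" and q: "pathin (subtopology X (pj ` S)) q"
 shows "\<tau> q = tw i q"
proof (cases "q ` {0..1} \<subseteq> pj ` V0")
 case False
 have "q 0 \<in> pj ` S" using q by (auto simp: pathin_subtopology)
 then have "q 0 \<in> pj ` Nt (mm i)" using strips(3)[OF i] by blast
 then show ?thesis using False idx[OF i(1)] by (simp add: \<tau>_def)
next
 case True
 have q': "pathin X q" using q by (simp add: pathin_subtopology)
 then have E: "E q \<in> carrier Q" by (rule E_closed)
 have in_: "q t \<in> pj ` Nm (mm i) \<or> q t \<in> pj ` Np (mm i)" if t: "t \<in> {0..1}" for t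
 proof -
  have "q t \<in> pj ` S" using q t by (auto simp: pathin_subtopology)
  then have a: "rp (q t) \<in> Nt (mm i)" "q t \<in> topspace X" using sat_rp[OF strips(1)[OF i]] strips[OF i]
   by (auto simp: topspace_X sat_def)
  have "rp (q t) \<in> V0" using sat_rp[OF sat_V0] True t by blast
  then have "rp (q t) \<in> Nm (mm i) \<union> Np (mm i)" using a(1) i(1) by (auto simp: V0_def Nm_def Np_def Gam_def)
  then show ?thesis using rp(2)[OF a(2)] by (metis UnE imageI)
 qed
 have "pj ` Nm (mm i) \<inter> pj ` Np (mm i) = {}"
 proof (rule ccontr)
  assume "\<not> ?thesis"
  then obtain y where "y \<in> pj ` Nm (mm i)" "y \<in> pj ` Np (mm i)" by blast
  then have "rp y \<in> Nm (mm i)" "rp y \<in> Np (mm i)" using sat_rp mm_sat(2,3)[OF i(1)] by blast+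
  then show False by (auto simp: Nm_def Np_def OS_def CS_def)
 qed
 moreover have "connectedin X (q ` {0..1})" using q' by (rule connectedin_path_image)
 moreover have "openin X (pj ` Nm (mm i))" "openin X (pj ` Np (mm i))"
  using sat_open mm_sat(2,3)[OF i(1)] open_Nm open_Np by auto
 moreover have "q ` {0..1} \<subseteq> pj ` Nm (mm i) \<union> pj ` Np (mm i)" using in_ by blast
 ultimately have dich: "pj ` Nm (mm i) \<inter> q ` {0..1} = {} \<or> pj ` Np (mm i) \<inter> q ` {0..1} = {}"
  using connectedinD[of X "q ` {0..1}" "pj ` Nm (mm i)" "pj ` Np (mm i)"] by blast
 have q01: "q 0 \<in> q ` {0..1}" "q 1 \<in> q ` {0..1}" by auto
 from dich have "tw i q = E q"
 proof
  assume "pj ` Nm (mm i) \<inter> q ` {0..1} = {}"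
  then have "q 0 \<notin> pj ` Nm (mm i)" "q 1 \<notin> pj ` Nm (mm i)" using q01 by blast+
  then have "zs i (q 0) = \<one>" "zs i (q 1) = \<one>" unfolding zs_def by simp_all
  then show ?thesis using E by (simp add: tw_def)
 next
  assume "pj ` Np (mm i) \<inter> q ` {0..1} = {}"
  then have "q 0 \<notin> pj ` Np (mm i)" "q 1 \<notin> pj ` Np (mm i)" using q01 by blast+
  then have "q 0 \<in> pj ` Nm (mm i)" "q 1 \<in> pj ` Nm (mm i)" using in_[of 0] in_[of 1] by simp_all
  then have zz: "zs i (q 0) = z i" "zs i (q 1) = z i" unfolding zs_def by simp_all
  have "z i \<otimes> E q = E q \<otimes> z i"
  proof (cases "S = Nt (mm i) \<inter> ball 0 1")
   case True
   then have "E q = \<one>" using E_interior[OF q] by simp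
   then show ?thesis using z_closed[OF i(1)] by simp
  next
   case False
   then have "S = Nt (mm i) \<inter> {z. 5/8 < cmod z}" using i(2) by (auto simp: strips_def)
   then have q2: "pathin (subtopology X (pj ` (Nt (mm i) \<inter> {z. 5/8 < cmod z}))) q" using q by simp
   show ?thesis
    by (rule E_side[OF mm_def i(1) k q2 z_closed[OF i(1)] z_commute[OF i(1), folded mm_def]])
  qed
  then have c: "E q \<otimes> z i = z i \<otimes> E q" by (rule sym)
  have "tw i q = inv z i \<otimes> (E q \<otimes> z i)"
   unfolding tw_def zz using E z_closed[OF i(1)] by (intro Q.m_assoc) auto
  also have "... = inv z i \<otimes> z i \<otimes> E q"
   unfolding c using E z_closed[OF i(1)] by (intro Q.m_assoc[symmetric]) auto
  finally show ?thesis using E z_closed[OF i(1)] by simp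
 qed
 then show ?thesis using True by (simp add: \<tau>_def)
qed

lemma \<tau>_V0: "pathin (subtopology X (pj ` V0)) q ==> \<tau> q = E q"
 by (auto simp: \<tau>_def pathin_subtopology)

lemma C_cases: assumes "U \<in> C"
 obtains "U = pj ` V0" | i S where "i < g" "S \<in> strips i" "U = pj ` S"
 using assms by (auto simp: C_def)

sublocale tr: local_transport Q X C \<tau>
proof
 fix U assume U: "U \<in> C"
 show "openin X U"
  using U by (cases rule: C_cases) (auto intro: sat_open sat_V0 open_V0 strips)
next
 show "topspace X \<subseteq> \<Union>C"
 proof
  fix y assume y: "y \<in> topspace X"
  then have r: "rp y \<in> D" "pj (rp y) = y" using rp by auto
  show "y \<in> \<Union>C"
  proof (cases "rp y \<in> V0")
   case True
   then show ?thesis using r(2) unfolding C_def by (metis UnionI imageI insertI1)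
  next
   case False
   then obtain i where i: "i < g" "rp y \<in> Gam (mm i)" using r(1) by (auto simp: V0_def)
   then have "rp y \<in> Nt (mm i)" using Gam_Nt[OF mm_sat(5)] by blast
   then have "\<exists>S\<in>strips i. rp y \<in> S" using r(1) by (cases "cmod (rp y) < 1") (auto simp: strips_def)
   then obtain S where "S \<in> strips i" "rp y \<in> S" by blast
   then have "y \<in> pj ` S" "pj ` S \<in> C" using r(2) i(1) by (auto simp: C_def)
   then show ?thesis by blast
  qed
 qed
next
 fix U p assume U: "U \<in> C" and p: "pathin (subtopology X U) p"
 have E: "E p \<in> carrier Q" using p E_closed by (simp add: pathin_subtopology)
 show "\<tau> p \<in> carrier Q"
  using U
 proof (cases rule: C_cases)
  case 1
  then show ?thesis using \<tau>_V0 p E by simp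
 next
  case (2 i S)
  then show ?thesis using \<tau>_strip[OF 2(1,2)] p E by (simp add: tw_def)
 qed
next
 fix U p q assume U: "U \<in> C" and p: "pathin (subtopology X U) p" and q: "pathin (subtopology X U) q" and e: "p 1 = q 0"
 have pq: "pathin (subtopology X U) (loop_concat p q)" using p q e by (rule pathin_loop_concat)
 have E: "E p \<in> carrier Q" "E q \<in> carrier Q" using p q E_closed by (auto simp: pathin_subtopology)
 have Ec: "E (loop_concat p q) = E p \<otimes> E q" using p q e by (intro E_concat) (auto simp: pathin_subtopology)
 show "\<tau> (loop_concat p q) = \<tau> p \<otimes> \<tau> q"
  using U
 proof (cases rule: C_cases)
  case 1
  then show ?thesis using \<tau>_V0 p q pq Ec by simp
 next
  case (2 i S)
  have *: "a \<otimes> (b \<otimes> c) \<otimes> d = (a \<otimes> b \<otimes> x) \<otimes> (inv x \<otimes> c \<otimes> d)"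
   if "a \<in> carrier Q" "b \<in> carrier Q" "c \<in> carrier Q" "d \<in> carrier Q" "x \<in> carrier Q" for a b c d x
  proof -
   have "x \<otimes> (inv x \<otimes> (c \<otimes> d)) = c \<otimes> d" using that by (simp add: Q.m_assoc[symmetric])
   then show ?thesis using that by (simp add: Q.m_assoc)
  qed
  have "tw i (loop_concat p q) = tw i p \<otimes> tw i q"
   unfolding tw_def loop_concat_ends Ec e using E 2(1) by (intro *) auto
  then show ?thesis using \<tau>_strip[OF 2(1,2)] p q pq 2(3) by simp
 qed
next
 fix U p q assume U: "U \<in> C" and h: "path_homotopic (subtopology X U) p q"
 have pq: "pathin (subtopology X U) p" "pathin (subtopology X U) q" using path_homotopic_pathin[OF h] by auto
 have e: "p 0 = q 0" "p 1 = q 1" using h by (auto simp: path_homotopic_def)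
 have E: "E p = E q" using h path_homotopic_subtopology by (intro E_homotopic) blast
 show "\<tau> p = \<tau> q"
  using U
 proof (cases rule: C_cases)
  case 1
  then show ?thesis using \<tau>_V0 pq E by simp
 next
  case (2 i S)
  then show ?thesis using \<tau>_strip[OF 2(1,2)] pq E e by (simp add: tw_def)
 qed
qed

abbreviation "T \<equiv> tr.transport"

sublocale T: path_functor Q X T
 by unfold_locales (auto intro: tr.transport_closed tr.transport_concat tr.transport_homotopic)

lemma polar_V0:
 assumes "0 <= s" "s <= 4 * real g" "0 <= \<rho>" "\<rho> <= 1"
  and "!!i. i < g ==> 1 < \<bar>s - (real (mm i) + 3/2)\<bar> \<or> \<rho> < 1/2 \<or> \<bar>s - (real (mm i) + 3/2)\<bar> < 1 & 1/2 < \<rho>"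
 shows "\<rho> *\<^sub>R bd s \<in> V0"
proof -
 have "\<rho> *\<^sub>R bd s \<notin> Gam (mm i)" if i: "i < g" for i
 proof (cases "\<rho> = 0")
  case True
  then show ?thesis using Gam_ne0 by auto
 next
  case False
  then have "0 < \<rho>" using assms by simp
  from polar[OF assms(1,2) mm_sat(5)[OF i] _ _ this assms(4), of 1 "1/2"]
  show ?thesis using assms(5)[OF i] by (auto simp: Gam_def)
 qed
 then show ?thesis using assms(3,4) by (auto simp: V0_def)
qed

lemma T_ray_out:
 assumes s: "0 <= s" "s <= 4 * real g" and out: "!!i. i < g ==> 1 < \<bar>s - (real (mm i) + 3/2)\<bar>"
 shows "T (ray (bd s)) = e (bd s)"
proof -
 have "t *\<^sub>R bd s \<in> V0" if "t \<in> {0..1}" for t using polar_V0[OF s, of t] out that by auto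
 then have "pathin (subtopology X (pj ` V0)) (ray (bd s))"
  unfolding ray_def by (intro pathin_pj_sub) (auto intro!: continuous_intros simp: V0_def)
 then show ?thesis using tr.transport_local[of "pj ` V0"] \<tau>_V0 by (simp add: C_def)
qed

lemma T_ray_cross:
 assumes s: "0 <= s" "s <= 4 * real g" and j: "j < g" "\<bar>s - (real (mm j) + 3/2)\<bar> < 7/8"
  and out: "!!i. i < g ==> i ~= j ==> 1 < \<bar>s - (real (mm i) + 3/2)\<bar>"
 shows "T (ray (bd s)) = z j \<otimes> e (bd s)"
proof -
 \<comment> \<open>The radii straddle 1/2, the radius of the arc of the arch, and lie strictly
   between 3/8 and 5/8; the middle piece of the ray is thus inside the strip and the outer pieces
   avoid the curves.\<close>
 define a b :: real where "a = 7/16" and "b = 9/16"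
 have ab: "0 <= a" "a < 1/2" "3/8 < a" "1/2 < b" "b < 5/8" "a <= b" "b <= 1" by (auto simp: a_def b_def)
 define R where "R = ray (bd s)"
 have R: "pathin X R" unfolding R_def by (rule pathin_ray) simp
 have R1: "subpath_on R 0 1 = R" by (simp add: subpath_on_def)
 have sub: "subpath_on R c d = (%t. pj ((c + (d - c) * t) *\<^sub>R bd s))" for c d by (simp add: subpath_on_def R_def ray_def)
 have cont: "continuous_on {0..1} (%t. (c + (d - c) * t) *\<^sub>R bd s)" for c d by (intro continuous_intros)
 have "T R = T (subpath_on R 0 a) \<otimes> T (subpath_on R a 1)"
  using T.E_subpath[OF R, of 0 a 1] R1 ab by simp
 moreover have "T (subpath_on R a 1) = T (subpath_on R a b) \<otimes> T (subpath_on R b 1)"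
  using T.E_subpath[OF R, of a b 1] ab by simp
 moreover have inD: "(%t. (c + (d - c) * t) *\<^sub>R bd s) ` {0..1} \<subseteq> D" if "c \<in> {0..1}" "d \<in> {0..1}" for c d
  using segment_in_interval[OF _ _ that] by auto
 have Esub: "E (subpath_on R c d) = inv e (c *\<^sub>R bd s) \<otimes> e (d *\<^sub>R bd s)" if "c \<in> {0..1}" "d \<in> {0..1}" for c d
  unfolding sub using E_disc[OF cont inD[OF that]] by simp
 have eb: "e (c *\<^sub>R bd s) = \<one>" if "0 <= c" "c < 1" for c using that by (intro e_ball) auto
 have V: "(c + (d - c) * t) *\<^sub>R bd s \<in> V0" if "t \<in> {0..1}" "0 <= c" "d <= 1" "c <= d" "d <= a \<or> b <= c" for c d t
 proof -
  have *: "c + (d - c) * t \<in> {c..d}" using segment_in_interval[of t c c d d] that by auto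
  show ?thesis
  proof (rule polar_V0[OF s])
   fix i assume "i < g"
   then show "1 < \<bar>s - (real (mm i) + 3/2)\<bar> \<or> c + (d - c) * t < 1/2 \<or> \<bar>s - (real (mm i) + 3/2)\<bar> < 1 & 1/2 < c + (d - c) * t"
    using out[of i] j(2) * that(5) ab by (cases "i = j") auto
  qed (use * that in auto)
 qed
 have TV: "T (subpath_on R c d) = E (subpath_on R c d)" if "0 <= c" "d <= 1" "c <= d" "d <= a \<or> b <= c" for c d
 proof -
  have "pathin (subtopology X (pj ` V0)) (subpath_on R c d)"
   unfolding sub using V[OF _ that] by (intro pathin_pj_sub cont) (auto simp: V0_def)
  then show ?thesis using tr.transport_local[of "pj ` V0"] \<tau>_V0 by (simp add: C_def)
 qed
 have "T (subpath_on R 0 a) = \<one>" using TV[of 0 a] Esub[of 0 a] eb[of 0] eb[of a] ab by simp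
 moreover have "T (subpath_on R b 1) = e (bd s)" using TV[of b 1] Esub[of b 1] eb[of b] ab by simp
 moreover have "T (subpath_on R a b) = z j"
 proof -
  let ?S = "Nt (mm j) \<inter> ball 0 1"
  note pol = polar[OF s mm_sat(5)[OF j(1)]]
  have S: "\<rho> *\<^sub>R bd s \<in> ?S" if "\<rho> \<in> {a..b}" for \<rho>
   using that ab j(2) pol[of "9/8" \<rho>] pol[of "7/8" \<rho>] by (auto simp: Nt_def)
  have "(a + (b - a) * t) *\<^sub>R bd s \<in> ?S" if "t \<in> {0..1}" for t
   using segment_in_interval[of t a a b b] that ab by (intro S) auto
  then have p: "pathin (subtopology X (pj ` ?S)) (subpath_on R a b)"
   unfolding sub using Nt_ne0 by (intro pathin_pj_sub cont) blast+
  have St: "?S \<in> strips j" by (simp add: strips_def)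
  then have "T (subpath_on R a b) = tw j (subpath_on R a b)"
   using tr.transport_local[OF _ p] \<tau>_strip[OF j(1) St p] j(1) by (auto simp: C_def)
  moreover have "E (subpath_on R a b) = \<one>" using E_interior[OF p] by simp
  moreover have "zs j (subpath_on R a b 0) = \<one>"
  proof -
   have "a *\<^sub>R bd s \<notin> Nm (mm j)" using ab by (auto simp: Nm_def OS_def)
   then have "pj (a *\<^sub>R bd s) \<notin> pj ` Nm (mm j)" using sat_mem[OF mm_sat(2)[OF j(1)], of "a *\<^sub>R bd s"] ab by auto
   then show ?thesis by (simp add: zs_def R_def ray_def)
  qed
  moreover have "zs j (subpath_on R a b 1) = z j"
  proof -
   have "b *\<^sub>R bd s \<in> Nm (mm j)" using S[of b] ab j(2) pol[of 1 b] by (auto simp: Nm_def)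
   then show ?thesis by (simp add: zs_def R_def ray_def)
  qed
  ultimately show ?thesis using z_closed[OF j(1)] by (simp add: tw_def)
 qed
 ultimately show ?thesis using z_closed[OF j(1)] unfolding R_def by simp
qed

lemma T_lamp: assumes "m = 4 * i + k'" "i < g" "k' < 2"
 shows "T (lamp m) = T (ray (bd (real m + 1/4))) \<otimes> inv T (ray (bd (real m + 11/4)))"
  "E (lamp m) = e (bd (real m + 1/4)) \<otimes> inv e (bd (real m + 11/4))"
 unfolding lamp_def using pj_lamp_mid[OF assms]
 by (subst T.E_concat, simp_all add: T.E_rev pathin_ray pathin_path_rev,
   subst E_concat, simp_all add: E_rev pathin_ray pathin_path_rev)

text \<open>Relative to 4 i the loop \<open>lamp (4 * i)\<close> meets the boundary at 1/4 and 11/4,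
  \<open>lamp (4 * i + 1)\<close> at 5/4 and 15/4, and the arch covers the parameters within
  distance 1 of k + 3/2. Only 5/4 for k = 0 and 11/4 for k = 1 lie under it; these are the two
  crossings.\<close>

lemma T_lamp_twist: assumes i: "i < g"
 shows "k = 0 ==> T (lamp (4 * i)) = E (lamp (4 * i))" "k = 0 ==> T (lamp (4 * i + 1)) = z i \<otimes> E (lamp (4 * i + 1))"
  "k = 1 ==> T (lamp (4 * i)) = E (lamp (4 * i)) \<otimes> inv z i"
proof -
 have mm: "real (mm j) = 4 * real j + real k" "real k <= 1" for j using k by (simp_all add: mm_def)
 have ig: "real i + 1 <= real g" and sep: "j ~= i ==> real i + 1 <= real j \<or> real j + 1 <= real i" for j using i by linarith+
 have far: "1 < \<bar>4 * real i + c - (real (mm j) + 3/2)\<bar>" if "0 <= c" "c <= 15/4" "j ~= i" for c j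
  using sep[OF that(3)] that(1,2) mm(1)[of j] mm(2) of_nat_0_le_iff[of k, where 'a=real] by (elim disjE; linarith)
 have out: "T (ray (bd (4 * real i + c))) = e (bd (4 * real i + c))" if c: "0 <= c" "c <= 15/4" "1 < \<bar>c - (real k + 3/2)\<bar>" for c
 proof (rule T_ray_out)
  show "1 < \<bar>4 * real i + c - (real (mm j) + 3/2)\<bar>" for j
   using far[OF c(1,2)] c(3) by (cases "j = i") (simp_all add: mm(1))
 qed (use c ig in auto)
 have cross: "T (ray (bd (4 * real i + c))) = z i \<otimes> e (bd (4 * real i + c))" if c: "0 <= c" "c <= 15/4" "\<bar>c - (real k + 3/2)\<bar> < 7/8" for c
  by (rule T_ray_cross[OF _ _ i _ far[OF c(1,2)]]) (use c ig mm(1)[of i] in linarith)+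
 have b: "real (4 * i) + c = 4 * real i + c" "real (4 * i + 1) + 1/4 = 4 * real i + 5/4" "real (4 * i + 1) + 11/4 = 4 * real i + 15/4" for c by simp_all
 note L = T_lamp[of "4 * i" i 0, unfolded b] T_lamp[of "4 * i + 1" i 1, unfolded b]
 show "T (lamp (4 * i)) = E (lamp (4 * i))" if "k = 0" using L(1,2) out[of "1/4"] out[of "11/4"] that i by simp
 show "T (lamp (4 * i + 1)) = z i \<otimes> E (lamp (4 * i + 1))" if "k = 0"
  using L(3,4) cross[of "5/4"] out[of "15/4"] that i z_closed by (simp add: Q.m_assoc)
 show "T (lamp (4 * i)) = E (lamp (4 * i)) \<otimes> inv z i" if "k = 1"
  using L(1,2) out[of "1/4"] cross[of "11/4"] that i z_closed by (simp add: Q.m_assoc Q.inv_mult_group)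
qed

end

text \<open>The standard generators as based loops: index 4 i stands for a_i and 4 i + 1 for
  b_i.\<close>

definition surface_loop :: "nat => complex set => nat => (real => complex set) set" where
 "surface_loop g x m = loop_class (genus_surface g) x
   (loop_concat (loop_concat (path_rev (surface.ray g (surface.rp x))) (surface.lamp g m)) (surface.ray g (surface.rp x)))"

text \<open>The twist as a statement about homomorphisms. The homomorphism \<open>f\<close> kills
  the twisting elements and hence does not see the twist; taking for it the evaluation of paths at 0
  identifies the start of a deformation.\<close>

theorem surface_twist:
 fixes r :: "(real => complex set) set => 'q" and f :: "'q => 'p" and Q' :: "('p, 'c) monoid_scheme" and Q (structure)
 assumes g: "g >= 1" and x: "x \<in> topspace (genus_surface g)" and Q: "group Q"
  and r: "r \<in> hom (fundamental_group (genus_surface g) x) Q" and k: "k < 2"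
  and z: "!!i. i < g ==> z i \<in> carrier Q"
  and zr: "!!i. i < g ==> z i \<otimes> r (surface_loop g x (4 * i + k)) = r (surface_loop g x (4 * i + k)) \<otimes> z i"
  and Q': "group Q'" and f: "f \<in> hom Q Q'" "!!i. i < g ==> f (z i) = \<one>\<^bsub>Q'\<^esub>"
 shows "\<exists>r'\<in>hom (fundamental_group (genus_surface g) x) Q.
   (\<forall>i<g. (k = 0 --> r' (surface_loop g x (4 * i)) = r (surface_loop g x (4 * i)) &
        r' (surface_loop g x (4 * i + 1)) = z i \<otimes> r (surface_loop g x (4 * i + 1))) &
      (k = 1 --> r' (surface_loop g x (4 * i)) = r (surface_loop g x (4 * i)) \<otimes> inv z i)) &
   (\<forall>\<gamma>\<in>carrier (fundamental_group (genus_surface g) x). f (r' \<gamma>) = f (r \<gamma>))"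
proof -
 interpret S: surface g by unfold_locales (rule g)
 interpret Q: group Q by (rule Q)
 let ?X = "genus_surface g"
 let ?\<nu> = "%y. S.ray (S.rp y)"
 have \<nu>: "pathin ?X (?\<nu> y) & ?\<nu> y 0 = S.pj 0 & ?\<nu> y 1 = y" if "y \<in> topspace ?X" for y
  using S.rp[OF that] S.pathin_ray by simp
 have "?\<nu> (S.pj 0) t = S.pj 0" for t using S.rp_ball[of 0] by (simp add: S.ray_def)
 from Q.path_functor_exists[OF r x, of ?\<nu> "S.pj 0", OF \<nu> this]
 obtain E where E: "path_functor Q ?X E" "\<forall>p\<in>loops ?X x. E p = r (loop_class ?X x p)" "\<forall>y\<in>topspace ?X. E (?\<nu> y) = \<one>"
  by blast
 interpret E: path_functor Q ?X E by (rule E(1))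
 let ?w = "%m. loop_concat (loop_concat (path_rev (?\<nu> x)) (S.lamp m)) (?\<nu> x)"
 have sl: "surface_loop g x m = loop_class ?X x (?w m)" for m by (simp add: surface_loop_def)
 have w: "?w m \<in> loops ?X x" "path_functor Q ?X F ==> F (?w m) = inv F (?\<nu> x) \<otimes> F (S.lamp m) \<otimes> F (?\<nu> x)"
  if m: "m = 4 * i + k'" "i < g" "k' < 2" for m i k' F
 proof -
  note l = S.lamp[OF m]
  show "?w m \<in> loops ?X x" using \<nu>[OF x] l by (simp add: loops_def pathin_loop_concat pathin_path_rev)
  assume "path_functor Q ?X F"
  then interpret F: path_functor Q ?X F .
  show "F (?w m) = inv F (?\<nu> x) \<otimes> F (S.lamp m) \<otimes> F (?\<nu> x)"
   using \<nu>[OF x] l by (simp add: F.E_concat F.E_rev pathin_loop_concat pathin_path_rev)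
 qed
 have rE: "r (surface_loop g x m) = E (S.lamp m)" if m: "m = 4 * i + k'" "i < g" "k' < 2" for m i k'
 proof -
  have "r (surface_loop g x m) = E (?w m)" unfolding sl using E(2) w(1)[OF m] by simp
  also have "... = E (S.lamp m)" using w(2)[OF m E(1)] E(3) x E.E_closed[OF S.lamp(1)[OF m]] by simp
  finally show ?thesis .
 qed
 interpret W: surface_twist g Q E k z
 proof unfold_locales
  show "E (S.ray (S.rp y)) = \<one>" if "y \<in> topspace ?X" for y using E(3) that by simp
  show "z i \<otimes> E (S.lamp (4 * i + k)) = E (S.lamp (4 * i + k)) \<otimes> z i" if "i < g" for i
   using zr[OF that] rE[OF refl that k] by simp
 qed (use k z in auto)
 let ?T = "W.tr.transport"
 note TF = W.T.path_functor_axioms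
 \<comment> \<open>The twisted functor need not be trivial on the base path to \<open>x\<close>;
   conjugation by \<open>c\<close> compensates, so that each surface loop takes exactly the value of
   its lamp.\<close>
 define c where "c = ?T (?\<nu> x)"
 have c: "c \<in> carrier Q" unfolding c_def using \<nu>[OF x] by (intro W.T.E_closed) simp
 define r' where "r' P = c \<otimes> ?T (SOME p. p \<in> loops ?X x & P = loop_class ?X x p) \<otimes> inv c" for P
 have r': "r' (loop_class ?X x p) = c \<otimes> ?T p \<otimes> inv c" if p: "p \<in> loops ?X x" for p
 proof -
  define q where "q = (SOME q. q \<in> loops ?X x & loop_class ?X x p = loop_class ?X x q)"
  have q: "q \<in> loops ?X x & loop_class ?X x p = loop_class ?X x q"
   unfolding q_def by (rule someI[of _ p]) (simp add: p)
  then have "q \<in> loop_class ?X x q" using path_homotopic_refl[of ?X q] by (auto simp: loop_homotopy_iff loops_def)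
  then have "q \<in> loop_class ?X x p" using q by simp
  then have "path_homotopic ?X p q" by (simp add: loop_homotopy_iff)
  then have "?T p = ?T q" by (rule W.T.E_homotopic)
  then show ?thesis by (simp add: r'_def q_def)
 qed
 have Tc: "?T p \<in> carrier Q" if "p \<in> loops ?X x" for p using that W.T.E_closed by (simp add: loops_def)
 have hom: "r' \<in> hom (fundamental_group ?X x) Q"
 proof (rule homI)
  fix P assume "P \<in> carrier (fundamental_group ?X x)"
  then show "r' P \<in> carrier Q" using c Tc r' by (elim fundamental_group_carrierE) simp
 next
  fix P P' assume "P \<in> carrier (fundamental_group ?X x)" "P' \<in> carrier (fundamental_group ?X x)"
  then obtain p p' where p: "p \<in> loops ?X x" "P = loop_class ?X x p" "p' \<in> loops ?X x" "P' = loop_class ?X x p'"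
   by (elim fundamental_group_carrierE)
  have "?T (loop_concat p p') = ?T p \<otimes> ?T p'" using p by (intro W.T.E_concat) (auto simp: loops_def)
  moreover have "inv c \<otimes> (c \<otimes> a) = a" if "a \<in> carrier Q" for a using that c by (simp add: Q.m_assoc[symmetric])
  ultimately show "r' (P \<otimes>\<^bsub>fundamental_group ?X x\<^esub> P') = r' P \<otimes> r' P'"
   using p c Tc r' r'[OF loop_concat_loops[OF p(1,3)]] by (simp add: loop_class_mult Q.m_assoc)
 qed
 have r'T: "r' (surface_loop g x m) = ?T (S.lamp m)" if m: "m = 4 * i + k'" "i < g" "k' < 2" for m i k'
 proof -
  have t: "?T (S.lamp m) \<in> carrier Q" using S.lamp(1)[OF m] by (rule W.T.E_closed)
  have "r' (surface_loop g x m) = c \<otimes> (inv c \<otimes> ?T (S.lamp m) \<otimes> c) \<otimes> inv c"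
   unfolding sl r'[OF w(1)[OF m]] w(2)[OF m TF] c_def ..
  also have "... = (c \<otimes> inv c) \<otimes> ?T (S.lamp m) \<otimes> (c \<otimes> inv c)"
   using c t by (simp only: Q.m_assoc Q.m_closed Q.inv_closed)
  also have "... = ?T (S.lamp m)" using c t by simp
  finally show ?thesis .
 qed
 have part1: "k = 0 --> r' (surface_loop g x (4 * i)) = r (surface_loop g x (4 * i)) &
        r' (surface_loop g x (4 * i + 1)) = z i \<otimes> r (surface_loop g x (4 * i + 1))"
   "k = 1 --> r' (surface_loop g x (4 * i)) = r (surface_loop g x (4 * i)) \<otimes> inv z i" if i: "i < g" for i
  using r'T[of "4 * i" i 0] r'T[of "4 * i + 1" i 1] rE[of "4 * i" i 0] rE[of "4 * i + 1" i 1] i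
   W.T_lamp_twist[OF i] by simp_all
 have part2: "f (r' \<gamma>) = f (r \<gamma>)" if \<gamma>: "\<gamma> \<in> carrier (fundamental_group ?X x)" for \<gamma>
 proof -
  interpret Q': group Q' by (rule Q')
  interpret f: group_hom Q Q' f using f(1) by unfold_locales
  \<comment> \<open>Under \<open>f\<close> the step functions become trivial, so \<open>E\<close>
    and the twisted functor agree on every member of the cover.\<close>
  have *: "f (E p) = f (?T p)" if "pathin ?X p" for p
  proof (rule W.tr.transport_unique[OF Q' f(1) _ _ _ _ that, where T="%p. f (E p)"])
   show "f (E p) = f (W.\<tau> p)" if "U \<in> W.C" "pathin (subtopology ?X U) p" for U p
    using that(1)
   proof (cases rule: W.C_cases)
    case 1
    then show ?thesis using that W.\<tau>_V0 by simp
   next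
    case (2 i S)
    have "pathin ?X p" using that by (simp add: pathin_subtopology)
    then have Ep: "E p \<in> carrier Q" by (rule E.E_closed)
    have "f (W.zs i y) = \<one>\<^bsub>Q'\<^esub>" for y using f(2)[OF 2(1)] by (simp add: W.zs_def)
    then show ?thesis using W.\<tau>_strip[OF 2(1,2)] that 2 Ep by (simp add: W.tw_def f.hom_inv)
   qed
  qed (auto simp: E.E_concat E.E_closed dest: E.E_homotopic)
  obtain p where p: "p \<in> loops ?X x" "\<gamma> = loop_class ?X x p" using fundamental_group_carrierE[OF \<gamma>] .
  have pp: "pathin ?X p" using p by (simp add: loops_def)
  have "f c = f (E (?\<nu> x))" unfolding c_def using *[of "?\<nu> x"] \<nu>[OF x] by simp
  then have "f c = \<one>\<^bsub>Q'\<^esub>" using E(3) x by simp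
  then have "f (r' \<gamma>) = f (?T p)" unfolding p(2) r'[OF p(1)] using c Tc[OF p(1)] by (simp add: f.hom_inv)
  also have "... = f (r \<gamma>)" using *[OF pp] E(2) p by simp
  finally show ?thesis .
 qed
 show ?thesis using hom part1 part2 by blast
qed

section \<open>Two by two matrices\<close>

definition mat2 :: "real => real => real => real => real^2^2" where
 "mat2 a b c d = vector [vector [a, b], vector [c, d]]"

lemma mat2_nth [simp]: "mat2 a b c d $ 1 $ 1 = a" "mat2 a b c d $ 1 $ 2 = b" "mat2 a b c d $ 2 $ 1 = c" "mat2 a b c d $ 2 $ 2 = d"
 by (simp_all add: mat2_def)

lemma mat2_collapse: "mat2 (X $ 1 $ 1) (X $ 1 $ 2) (X $ 2 $ 1) (X $ 2 $ 2) = X"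
 by (simp add: vec_eq_iff forall_2)

lemma mat2_cases: obtains a b c d where "X = mat2 a b c d" using mat2_collapse by metis

lemma mat2_eq_iff [simp]: "mat2 a b c d = mat2 a' b' c' d' \<longleftrightarrow> a = a' & b = b' & c = c' & d = d'"
 by (auto simp: vec_eq_iff forall_2)

lemma mat2_simps:
 "mat2 a b c d ** mat2 a' b' c' d' = mat2 (a * a' + b * c') (a * b' + b * d') (c * a' + d * c') (c * b' + d * d')"
 "mat2 a b c d + mat2 a' b' c' d' = mat2 (a + a') (b + b') (c + c') (d + d')"
 "mat2 a b c d - mat2 a' b' c' d' = mat2 (a - a') (b - b') (c - c') (d - d')"
 "x *\<^sub>R mat2 a b c d = mat2 (x * a) (x * b) (x * c) (x * d)"
 "- mat2 a b c d = mat2 (- a) (- b) (- c) (- d)"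
 by (simp_all add: vec_eq_iff forall_2 matrix_matrix_mult_def sum_2)

lemma mat2_one: "mat 1 = mat2 1 0 0 1" by (simp add: vec_eq_iff forall_2 mat_def)

lemma mat2_SL2R [simp]: "mat2 a b c d \<in> SL2R \<longleftrightarrow> a * d - b * c = 1"
 by (simp add: SL2R_def det_2)

text \<open>The adjugate: the inverse on \<open>SL2R\<close>, but polynomial in the entries and
  therefore usable directly in limits and algebraic identities.\<close>

definition adj2 :: "real^2^2 => real^2^2" where
 "adj2 X = mat2 (X $ 2 $ 2) (- X $ 1 $ 2) (- X $ 2 $ 1) (X $ 1 $ 1)"

lemma adj2_mat2 [simp]: "adj2 (mat2 a b c d) = mat2 d (- b) (- c) a" by (simp add: adj2_def)

lemma SL2R_mult: "k \<in> SL2R ==> l \<in> SL2R ==> k ** l \<in> SL2R" by (simp add: SL2R_def det_mul)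
lemma SL2R_one: "mat 1 \<in> SL2R" by (simp add: SL2R_def)

lemma adj2_SL2R:
 assumes "k \<in> SL2R" shows "adj2 k \<in> SL2R" "k ** adj2 k = mat 1" "adj2 k ** k = mat 1" "adj2 (adj2 k) = k"
proof -
 obtain a b c d where k: "k = mat2 a b c d" by (rule mat2_cases)
 have "a * d - b * c = 1" using assms by (simp add: k)
 then show "adj2 k \<in> SL2R" "k ** adj2 k = mat 1" "adj2 k ** k = mat 1" "adj2 (adj2 k) = k"
  unfolding k mat2_one by (simp_all add: mat2_simps algebra_simps)
qed

lemma has_vector_derivative_mat2:
 assumes "(a has_vector_derivative a') F" "(b has_vector_derivative b') F" "(c has_vector_derivative c') F" "(d has_vector_derivative d') F"
 shows "((%t. mat2 (a t) (b t) (c t) (d t)) has_vector_derivative mat2 a' b' c' d') F"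
proof -
 have e: "mat2 a b c d = a *\<^sub>R mat2 1 0 0 0 + b *\<^sub>R mat2 0 1 0 0 + c *\<^sub>R mat2 0 0 1 0 + d *\<^sub>R mat2 0 0 0 1" for a b c d
  by (simp add: mat2_simps)
 show ?thesis
  unfolding e[of "a _"] e[of a'] using assms
  by (intro has_vector_derivative_add bounded_linear.has_vector_derivative[OF bounded_linear_scaleR_left])
qed

lemma linear_sandwich2: "linear (%Y. (k :: real^2^2) ** Y ** (l :: real^2^2))"
proof (rule linearI)
 fix x y :: "real^2^2" and r :: real
 obtain a b c d where k: "k = mat2 a b c d" by (rule mat2_cases)
 obtain a' b' c' d' where l: "l = mat2 a' b' c' d'" by (rule mat2_cases)
 obtain p q u v where x: "x = mat2 p q u v" by (rule mat2_cases)
 obtain p' q' u' v' where y: "y = mat2 p' q' u' v'" by (rule mat2_cases)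
 show "k ** (x + y) ** l = k ** x ** l + k ** y ** l" "k ** (r *\<^sub>R x) ** l = r *\<^sub>R (k ** x ** l)"
  unfolding k l x y by (simp_all add: mat2_simps algebra_simps)
qed

abbreviation sl :: "real => real => real => real^2^2" where "sl p q r \<equiv> mat2 p q r (- p)"
abbreviation "cE t \<equiv> mat2 1 t 0 1"
abbreviation "cF t \<equiv> mat2 1 0 t 1"
abbreviation "cH t \<equiv> mat2 (exp t) 0 0 (exp (- t))"
abbreviation "rot t \<equiv> mat2 (cos t) (sin t) (- sin t) (cos t)"

definition one_param :: "(real => real^2^2) => real^2^2 => bool" where
 "one_param c X \<longleftrightarrow> (\<forall>t. c t \<in> SL2R) & c 0 = mat 1 & (\<forall>s t. c (s + t) = c s ** c t) & (c has_vector_derivative X) (at 0)"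

lemma has_vd: "(f has_real_derivative f') (at x) ==> (f has_vector_derivative f') (at x)"
 by (simp add: has_real_derivative_iff_has_vector_derivative)

lemma one_param_cE: "one_param (%t. cE t) (sl 0 1 0)"
 unfolding one_param_def
 by (auto simp: mat2_one mat2_simps intro!: has_vector_derivative_mat2 has_vd derivative_eq_intros)
lemma one_param_cF: "one_param (%t. cF t) (sl 0 0 1)"
 unfolding one_param_def
 by (auto simp: mat2_one mat2_simps intro!: has_vector_derivative_mat2 has_vd derivative_eq_intros)
lemma one_param_cH: "one_param (%t. cH t) (sl 1 0 0)"
 unfolding one_param_def
 by (auto simp: mat2_one mat2_simps exp_add exp_diff exp_minus field_simps intro!: has_vector_derivative_mat2 has_vd derivative_eq_intros)
lemma one_param_rot: "one_param (%t. rot t) (sl 0 1 (- 1))"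
 unfolding one_param_def
 by (auto simp: mat2_one mat2_simps cos_add sin_add power2_eq_square[symmetric] intro!: has_vector_derivative_mat2 has_vd derivative_eq_intros)

lemma matrix_exp_A0: "matrix_exp (t *\<^sub>R A0) = cH t"
proof -
 have A: "t *\<^sub>R A0 = mat2 t 0 0 (- t)" unfolding A0_def mat2_def[symmetric] by (simp add: mat2_simps)
 have p: "matrix_pow (mat2 t 0 0 (- t)) k = mat2 (t ^ k) 0 0 ((- t) ^ k)" for k
  by (induction k) (auto simp: mat2_one mat2_simps)
 have "(%k. (t ^ k /\<^sub>R fact k) *\<^sub>R mat2 1 0 0 0 + ((- t) ^ k /\<^sub>R fact k) *\<^sub>R mat2 0 0 0 1)
   sums (exp t *\<^sub>R mat2 1 0 0 0 + exp (- t) *\<^sub>R mat2 0 0 0 1)"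
  by (intro sums_add bounded_linear.sums[OF bounded_linear_scaleR_left] exp_converges)
 then have "(%k. (1 / fact k) *\<^sub>R matrix_pow (t *\<^sub>R A0) k) sums cH t"
  unfolding A p by (simp add: mat2_simps field_simps)
 then show ?thesis unfolding matrix_exp_def by (rule sums_unique[symmetric])
qed

lemma SL2R_generated:
 assumes "k \<in> SL2R" shows "\<exists>x y z w. k = cE x ** cF y ** cE z ** cF w"
proof -
 obtain a b c d where k: "k = mat2 a b c d" by (rule mat2_cases)
 have det: "a * d - b * c = 1" using assms by (simp add: k)
 show ?thesis
 proof (cases "c = 0")
  case False
  have "k = cE ((a - 1) / c) ** cF c ** cE ((d - 1) / c) ** cF 0"
   unfolding k using False det by (simp add: mat2_simps field_simps)
  then show ?thesis by blast
 next
  case True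
  have ad: "a * d = 1" using det True by simp
  then have d: "d ~= 0" by auto
  \<comment> \<open>Multiplying \<open>k\<close> by \<open>cF 1\<close> moves the nonzero entry
    \<open>d\<close> into the lower left corner; the first case applies to the product, and
    \<open>cF (- 1)\<close> undoes the multiplication.\<close>
  have "k = cE ((a + b - 1) / d) ** cF d ** cE ((d - 1) / d) ** cF (- 1)"
   unfolding k using True d ad by (simp add: mat2_simps field_simps)
  then show ?thesis by blast
 qed
qed

lemma matrix_mult_adj2:
 "X ** adj2 Y = mat2 (X$1$1 * Y$2$2 - X$1$2 * Y$2$1) (X$1$2 * Y$1$1 - X$1$1 * Y$1$2)
   (X$2$1 * Y$2$2 - X$2$2 * Y$2$1) (X$2$2 * Y$1$1 - X$2$1 * Y$1$2)"
 by (simp add: vec_eq_iff forall_2 matrix_matrix_mult_def sum_2 adj2_def)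

lemma tendsto_mat2:
 assumes "(a \<longlongrightarrow> a') F" "(b \<longlongrightarrow> b') F" "(c \<longlongrightarrow> c') F" "(d \<longlongrightarrow> d') F"
 shows "((%t. mat2 (a t) (b t) (c t) (d t)) \<longlongrightarrow> mat2 a' b' c' d') F"
proof -
 have e: "mat2 a b c d = a *\<^sub>R mat2 1 0 0 0 + b *\<^sub>R mat2 0 1 0 0 + c *\<^sub>R mat2 0 0 1 0 + d *\<^sub>R mat2 0 0 0 1" for a b c d
  by (simp add: mat2_simps)
 show ?thesis unfolding e[of "a _"] e[of a'] by (intro tendsto_intros assms)
qed

lemma tendsto_mult_adj2:
 fixes X Y :: "nat => real^2^2"
 assumes "X \<longlonglongrightarrow> L" "Y \<longlonglongrightarrow> M" shows "(%n. X n ** adj2 (Y n)) \<longlonglongrightarrow> L ** adj2 M"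
 unfolding matrix_mult_adj2 by (intro tendsto_mat2 tendsto_intros tendsto_vec_nth assms)

text \<open>Cayley-Hamilton gives a^2 = 2 cos \<theta> a - 1, and the sines satisfy the same
  recursion. The point is that the coefficients stay bounded, so the powers of an elliptic element
  do.\<close>

lemma elliptic_power:
 assumes a: "a \<in> SL2R" "a $ 1 $ 1 + a $ 2 $ 2 = 2 * cos \<theta>" "sin \<theta> ~= 0"
 shows "matrix_pow a (Suc n) = (sin (real (Suc n) * \<theta>) / sin \<theta>) *\<^sub>R a - (sin (real n * \<theta>) / sin \<theta>) *\<^sub>R mat 1"
proof (induction n)
 case 0 then show ?case using a by simp
next
 case (Suc n)
 obtain p q r w where k: "a = mat2 p q r w" by (rule mat2_cases)
 have det: "p * w - q * r = 1" and tr: "w = 2 * cos \<theta> - p" using a by (simp_all add: k)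
 have sq: "a ** (u *\<^sub>R a - v *\<^sub>R mat 1) = (2 * cos \<theta> * u - v) *\<^sub>R a - u *\<^sub>R mat 1" for u v
 proof -
  have "u * (p * p + q * r) = u * (2 * cos \<theta> * p - 1)" "u * (r * q + w * w) = u * (2 * cos \<theta> * w - 1)"
   using det unfolding tr by (simp_all add: algebra_simps)
  then show ?thesis unfolding k mat2_one mat2_simps mat2_eq_iff tr by (auto simp: algebra_simps)
 qed
 have "sin (real (Suc (Suc n)) * \<theta>) = 2 * cos \<theta> * sin (real (Suc n) * \<theta>) - sin (real n * \<theta>)"
 proof -
  have "sin (real (Suc n) * \<theta> + \<theta>) + sin (real (Suc n) * \<theta> - \<theta>) = 2 * cos \<theta> * sin (real (Suc n) * \<theta>)"
   unfolding sin_add sin_diff by simp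
  then show ?thesis by (simp add: algebra_simps)
 qed
 then have "2 * cos \<theta> * (sin (real (Suc n) * \<theta>) / sin \<theta>) - sin (real n * \<theta>) / sin \<theta> = sin (real (Suc (Suc n)) * \<theta>) / sin \<theta>"
  by (simp add: diff_divide_distrib)
 moreover have "matrix_pow a (Suc (Suc n)) = a ** matrix_pow a (Suc n)" by simp
 ultimately show ?case unfolding Suc.IH sq by simp
qed

text \<open>The flag distinguishes the hyperbolic type (\<open>True\<close>, diagonal) from the
  parabolic type (\<open>False\<close>, upper unipotent); \<open>slY\<close> is the generator of the
  corresponding one-parameter group.\<close>

definition cY :: "bool => real => real^2^2" where "cY T c = (if T then cH c else cE c)"
definition slY :: "bool => real^2^2" where "slY T = (if T then sl 1 0 0 else sl 0 1 0)"

lemma adj2_mult: "adj2 (X ** Y) = adj2 Y ** adj2 X"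
proof -
 obtain a b c d where k: "X = mat2 a b c d" by (rule mat2_cases)
 obtain a' b' c' d' where l: "Y = mat2 a' b' c' d'" by (rule mat2_cases)
 show ?thesis unfolding k l by (simp add: mat2_simps algebra_simps)
qed

text \<open>After a sign the trace is at least 2, so there is a real positive eigenvalue and the
  matrix becomes triangular. Eigenvalue 1 leads to the parabolic type, any other to the hyperbolic
  one. Excluding involutions rules out plus and minus the identity, for which c would be 0.\<close>

lemma trace_ge_2_conj:
 assumes a: "a \<in> SL2R" "\<bar>a $ 1 $ 1 + a $ 2 $ 2\<bar> >= 2" "a ** a ~= mat 1"
 shows "\<exists>s c k T. (s = 1 \<or> s = - 1) & c ~= 0 & k \<in> SL2R & a = s *\<^sub>R (k ** cY T c ** adj2 k)"
proof -
 define s :: real where "s = (if a $ 1 $ 1 + a $ 2 $ 2 >= 0 then 1 else - 1)"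
 have s: "s = 1 \<or> s = - 1" "s * (a $ 1 $ 1 + a $ 2 $ 2) >= 2" "s * s = 1" using a(2) by (auto simp: s_def)
 obtain p q r w where k: "s *\<^sub>R a = mat2 p q r w" by (rule mat2_cases)
 have as: "a = s *\<^sub>R mat2 p q r w" unfolding k[symmetric] by (simp add: s)
 have det: "p * w - q * r = 1" using a(1) s(1) unfolding as by (auto simp: mat2_simps)
 have tr: "p + w >= 2" using s(2) arg_cong[OF k, of "%X. X $ 1 $ 1"] arg_cong[OF k, of "%X. X $ 2 $ 2"] by (simp add: distrib_left)
 have "\<exists>k l m b. k \<in> SL2R & l > 0 & l * m = 1 & mat2 p q r w = k ** mat2 l b 0 m ** adj2 k"
 proof (cases "r = 0")
  case True
  have "p > 0" using det tr True mult_nonpos_nonneg[of p w] by (cases "p > 0") auto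
  then show ?thesis using True det
   by (intro exI[of _ "mat2 1 0 0 1"] exI[of _ p] exI[of _ w] exI[of _ q]) (simp add: mat2_simps)
 next
  case False
  define S l m where "S = sqrt ((p + w)\<^sup>2 - 4)" and "l = (p + w + S) / 2" and "m = p + w - l"
  have "(p + w)\<^sup>2 >= 4" using power_mono[of 2 "p + w" 2] tr by simp
  then have S: "S * S = (p + w)\<^sup>2 - 4" "S >= 0" by (simp_all add: S_def)
  have lm: "l * m = 1" using S(1) by (simp add: l_def m_def power2_eq_square field_simps)
  have p: "p = l + m - w" by (simp add: m_def)
  have "q * r = (l - w) * (w - m)" using det lm unfolding p by (simp add: algebra_simps)
  then have q: "q = (l - w) * (w - m) / r" using False by (simp add: field_simps)
  \<comment> \<open>The first column is an eigenvector for \<open>l\<close>; the second one makes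
    the determinant 1.\<close>
  let ?k = "mat2 (l - w) (- 1 / r) r 0"
  have "mat2 p q r w = ?k ** mat2 l (- 1 / r) 0 m ** adj2 ?k"
   unfolding adj2_mat2 mat2_simps mat2_eq_iff q p using False lm by (simp add: field_simps)
  moreover have "?k \<in> SL2R" "l > 0" using False tr S(2) by (simp_all add: l_def)
  ultimately show ?thesis using lm by blast
 qed
 then obtain k l m b where k: "k \<in> SL2R" "l > 0" "l * m = 1" "mat2 p q r w = k ** mat2 l b 0 m ** adj2 k" by blast
 have "\<exists>c k' T. c ~= 0 & k' \<in> SL2R & mat2 p q r w = k' ** cY T c ** adj2 k'"
 proof (cases "l = 1")
  case True
  have "b ~= 0"
  proof
   assume "b = 0"
   then have "a = s *\<^sub>R mat 1" using True k as by (simp add: mat2_one[symmetric] adj2_SL2R)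
   then show False using a(3) s(1) by (auto simp: mat2_one mat2_simps)
  qed
  then show ?thesis using True k by (intro exI[of _ b] exI[of _ k] exI[of _ False]) (simp add: cY_def)
 next
  case False
  have m: "m = 1 / l" using k(2,3) by (simp add: field_simps)
  have "m ~= l" using False k(2,3) by (auto simp: square_eq_1_iff)
  \<comment> \<open>Conjugation by \<open>cE u\<close> removes the upper right entry exactly when b
    = u m - l u.\<close>
  define u where "u = b / (m - l)"
  have "b = u * (m - l)" using \<open>m ~= l\<close> by (simp add: u_def)
  then have "b = u * m - l * u" by (simp add: algebra_simps)
  then have "mat2 l b 0 m = cE u ** cY True (ln l) ** adj2 (cE u)"
   using k(2) by (simp add: cY_def mat2_simps exp_minus m inverse_eq_divide)
  then have "mat2 p q r w = (k ** cE u) ** cY True (ln l) ** adj2 (k ** cE u)"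
   using k(4) by (simp add: adj2_mult matrix_mul_assoc)
  moreover have "k ** cE u \<in> SL2R" by (intro SL2R_mult k) simp
  ultimately show ?thesis using False k(2) by (intro exI[of _ "ln l"] exI[of _ "k ** cE u"] exI[of _ True]) simp
 qed
 then show ?thesis using s(1) unfolding as by metis
qed

lemma adj2_adj2: "adj2 (adj2 X) = X" using mat2_collapse[of X] by (simp add: adj2_def)

text \<open>The commutators [a, b] and [a^-1, b] commute. This is a law of triangular matrices,
  whose commutators are unipotent; a pair that violates it cannot be triangularized simultaneously.
  Being an identity between words, it can be tested in any homomorphic image.\<close>

definition words_commute :: "real^2^2 => real^2^2 => bool" where
 "words_commute a b \<longleftrightarrow> (a ** b ** adj2 a ** adj2 b) ** (adj2 a ** b ** a ** adj2 b) = (adj2 a ** b ** a ** adj2 b) ** (a ** b ** adj2 a ** adj2 b)"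

lemma words_commute_conj:
 assumes k: "k \<in> SL2R" and w: "words_commute a b"
 shows "words_commute (k ** a ** adj2 k) (k ** b ** adj2 k)"
proof -
 let ?c = "%x. k ** x ** adj2 k"
 have m: "?c x ** ?c y = ?c (x ** y)" for x y
 proof -
  have "?c x ** ?c y = k ** x ** (adj2 k ** k) ** y ** adj2 k" by (simp add: matrix_mul_assoc)
  then show ?thesis by (simp add: adj2_SL2R[OF k] matrix_mul_assoc)
 qed
 have j: "adj2 (?c x) = ?c (adj2 x)" for x by (simp add: adj2_mult adj2_adj2 matrix_mul_assoc)
 show ?thesis using w unfolding words_commute_def j m by simp
qed

lemma words_commute_upper:
 assumes "a * d = 1" "a' * d' = 1" shows "words_commute (mat2 a b 0 d) (mat2 a' b' 0 d')"
proof -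
 have "\<exists>x. mat2 a b 0 d ** mat2 a' b' 0 d' ** adj2 (mat2 a b 0 d) ** adj2 (mat2 a' b' 0 d') = cE x"
  if "a * d = 1" "a' * d' = 1" for a b d a' b' d' :: real
 proof -
  have n0: "a ~= 0" "a' ~= 0" using that by auto
  then have n: "a ~= 0" "a' ~= 0" "d = 1 / a" "d' = 1 / a'" using that by (simp_all add: nonzero_eq_divide_eq mult.commute)
  show ?thesis unfolding adj2_mat2 mat2_simps
  proof (rule exI, rule iffD2[OF mat2_eq_iff], intro conjI)
   show "((a * a' + b * 0) * d + (a * b' + b * d') * - 0) * d' + ((a * a' + b * 0) * - b + (a * b' + b * d') * a) * - 0 = 1"
    unfolding n(3,4) using n(1,2) by simp
  qed (unfold n(3,4), rule refl, use n(1,2) in simp_all)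
 qed
 note t = this
 obtain x y where "mat2 a b 0 d ** mat2 a' b' 0 d' ** adj2 (mat2 a b 0 d) ** adj2 (mat2 a' b' 0 d') = cE x"
  "adj2 (mat2 a b 0 d) ** mat2 a' b' 0 d' ** mat2 a b 0 d ** adj2 (mat2 a' b' 0 d') = cE y"
  using t[OF assms, of b b'] t[of d a a' d' "- b" b'] assms by (auto simp: mult.commute)
 then show ?thesis unfolding words_commute_def by (simp add: mat2_simps)
qed

lemma words_commute_lower:
 assumes "a * d = 1" "a' * d' = 1" shows "words_commute (mat2 a 0 b d) (mat2 a' 0 b' d')"
proof -
 let ?J = "mat2 0 1 (- 1) 0"
 have "words_commute (?J ** mat2 d (- b) 0 a ** adj2 ?J) (?J ** mat2 d' (- b') 0 a' ** adj2 ?J)"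
  by (rule words_commute_conj[OF _ words_commute_upper]) (use assms in \<open>simp_all add: mult.commute\<close>)
 then show ?thesis by (simp add: mat2_simps)
qed

text \<open>Conjugating by \<open>k0\<close> makes the first element upper triangular, and diagonal
  if \<open>T0\<close> holds. The second becomes a combination of the identity and
  \<open>sl p q r\<close>; with r = 0 both would be upper triangular, with \<open>T0\<close> and q =
  0 both lower triangular, and in either case the commutators would commute.\<close>

lemma generation_criterion:
 assumes a0: "a0 = s0 *\<^sub>R (k0 ** cY T0 c0 ** adj2 k0)" "s0 = 1 \<or> s0 = - 1" "k0 \<in> SL2R"
  and a1: "a1 = s1 *\<^sub>R (k1 ** cY T1 c1 ** adj2 k1)" "s1 = 1 \<or> s1 = - 1" "k1 \<in> SL2R"
  and nc: "\<not> words_commute a0 a1"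
 shows "\<exists>p q r. (adj2 k0 ** k1) ** slY T1 ** adj2 (adj2 k0 ** k1) = sl p q r & r ~= 0 & (T0 --> q ~= 0)"
proof -
 let ?M = "adj2 k0 ** k1"
 have MS: "?M \<in> SL2R" by (intro SL2R_mult adj2_SL2R a0 a1)
 obtain A B C D where "?M = mat2 A B C D" by (rule mat2_cases)
 then have "\<exists>p q r. ?M ** slY T1 ** adj2 ?M = sl p q r" unfolding slY_def by (simp add: mat2_simps algebra_simps)
 then obtain p q r where X: "?M ** slY T1 ** adj2 ?M = sl p q r" by blast
 \<comment> \<open>\<open>cY\<close> is a combination of the identity and its generator: with
   hyperbolic cosine and sine in the diagonal case, and exactly 1 + c E in the unipotent
   case.\<close>
 have lin: "\<exists>\<alpha> \<beta>. ?M ** cY T1 c1 ** adj2 ?M = \<alpha> *\<^sub>R mat 1 + \<beta> *\<^sub>R sl p q r"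
 proof (cases T1)
  case True
  let ?u = "(exp c1 + exp (- c1)) / 2" and ?v = "(exp c1 - exp (- c1)) / 2"
  have "cY T1 c1 = ?u *\<^sub>R mat2 1 0 0 1 + ?v *\<^sub>R slY T1" using True by (simp add: cY_def slY_def mat2_simps field_simps)
  then have "?M ** cY T1 c1 ** adj2 ?M = ?u *\<^sub>R (?M ** mat2 1 0 0 1 ** adj2 ?M) + ?v *\<^sub>R (?M ** slY T1 ** adj2 ?M)"
   by (simp only: linear_add[OF linear_sandwich2] linear_scale[OF linear_sandwich2])
  then show ?thesis unfolding X mat2_one[symmetric] by (auto simp: adj2_SL2R[OF MS])
 next
  case False
  have "cY T1 c1 = 1 *\<^sub>R mat2 1 0 0 1 + c1 *\<^sub>R slY T1" using False by (simp add: cY_def slY_def mat2_simps)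
  then have "?M ** cY T1 c1 ** adj2 ?M = 1 *\<^sub>R (?M ** mat2 1 0 0 1 ** adj2 ?M) + c1 *\<^sub>R (?M ** slY T1 ** adj2 ?M)"
   by (simp only: linear_add[OF linear_sandwich2] linear_scale[OF linear_sandwich2])
  then show ?thesis unfolding X mat2_one[symmetric] by (intro exI[of _ 1] exI[of _ c1]) (simp add: adj2_SL2R[OF MS])
 qed
 then obtain \<alpha> \<beta> where ab: "?M ** cY T1 c1 ** adj2 ?M = \<alpha> *\<^sub>R mat 1 + \<beta> *\<^sub>R sl p q r" by blast
 define b0 where "b0 = s0 *\<^sub>R cY T0 c0"
 define b1 where "b1 = s1 *\<^sub>R (?M ** cY T1 c1 ** adj2 ?M)"
 have sc: "k ** (t *\<^sub>R y) ** l = t *\<^sub>R (k ** y ** l)" for k y l :: "real^2^2" and t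
  by (simp add: vec_eq_iff forall_2 matrix_matrix_mult_def sum_2 algebra_simps)
 have e0: "a0 = k0 ** b0 ** adj2 k0" unfolding a0(1) b0_def sc ..
 have e1: "a1 = k0 ** b1 ** adj2 k0"
 proof -
  have "k0 ** (?M ** cY T1 c1 ** adj2 ?M) ** adj2 k0 = (k0 ** adj2 k0) ** k1 ** cY T1 c1 ** adj2 k1 ** (k0 ** adj2 k0)"
   by (simp add: adj2_mult adj2_adj2 matrix_mul_assoc)
  then show ?thesis unfolding a1(1) b1_def sc by (simp add: adj2_SL2R[OF a0(3)])
 qed
 have nw: "\<not> words_commute b0 b1" using nc words_commute_conj[OF a0(3), of b0 b1] unfolding e0 e1 by blast
 have b1m: "b1 = mat2 (s1 * (\<alpha> + \<beta> * p)) (s1 * (\<beta> * q)) (s1 * (\<beta> * r)) (s1 * (\<alpha> - \<beta> * p))"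
  unfolding b1_def ab mat2_one by (simp add: mat2_simps algebra_simps)
 have "cY T1 c1 \<in> SL2R" by (simp add: cY_def exp_minus)
 then have "?M ** cY T1 c1 ** adj2 ?M \<in> SL2R" by (intro SL2R_mult adj2_SL2R MS)
 then have b1S: "b1 \<in> SL2R" using a1(2) unfolding b1_def SL2R_def by (auto simp: det_2)
 have r: "r ~= 0"
 proof
  assume r0: "r = 0"
  have "words_commute b0 b1"
   unfolding b1m r0 mult_zero_right b0_def cY_def
   using a0(2) b1S[unfolded b1m r0] by (auto simp: mat2_simps exp_minus intro!: words_commute_upper)
  then show False using nw by simp
 qed
 have q: "q ~= 0" if T0
 proof
  assume q0: "q = 0"
  have "words_commute b0 b1"
   unfolding b1m q0 mult_zero_right b0_def cY_def
   using a0(2) b1S[unfolded b1m q0] that by (auto simp: mat2_simps exp_minus intro!: words_commute_lower)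
  then show False using nw by simp
 qed
 show ?thesis using X r q by blast
qed

lemma surface_loop_carrier:
 assumes g: "g >= 1" and x: "x \<in> topspace (genus_surface g)" and i: "i < g" "k < 2"
 shows "surface_loop g x (4 * i + k) \<in> carrier (fundamental_group (genus_surface g) x)"
proof -
 interpret S: surface g by unfold_locales (rule g)
 have \<nu>: "pathin (genus_surface g) (S.ray (S.rp x)) & S.ray (S.rp x) 0 = S.pj 0 & S.ray (S.rp x) 1 = x"
  using S.rp[OF x] S.pathin_ray by simp
 note l = S.lamp[OF refl i]
 show ?thesis unfolding surface_loop_def
  by (rule loop_class_carrier) (use \<nu> l in \<open>simp add: loops_def pathin_loop_concat pathin_path_rev\<close>)
qed

lemma group_SL2R: "group (matrix_group SL2R)"
 using group.subgroup_imp_group[OF group_GL subgroup_SL2R] by (simp add: matrix_group_def)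

section \<open>Surface subgroups of SL(2,R)\<close>

locale surface_group =
 fixes g :: nat and x :: "complex set" and \<Gamma> :: "(real^2^2) set" and \<phi> :: "real^2^2 => (real => complex set) set"
 assumes g1: "g >= 1" and x: "x \<in> topspace (genus_surface g)" and sub: "subgroup \<Gamma> (matrix_group SL2R)"
  and iso: "\<phi> \<in> iso (matrix_group \<Gamma>) (fundamental_group (genus_surface g) x)"
begin

text \<open>The elements of \<Gamma> corresponding to the standard generators a_i and, in the next
  definition, b_i.\<close>

definition ga :: "nat => real^2^2" where "ga i = inv_into \<Gamma> \<phi> (surface_loop g x (4 * i))"
definition gb :: "nat => real^2^2" where "gb i = inv_into \<Gamma> \<phi> (surface_loop g x (4 * i + 1))"

lemma group_\<Gamma>: "group (matrix_group \<Gamma>)"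
 using group.subgroup_imp_group[OF group_SL2R sub] by (simp add: matrix_group_def)

lemma \<Gamma>_SL: "\<Gamma> \<subseteq> SL2R" using subgroup.subset[OF sub] by (simp add: matrix_group_def)
lemma \<Gamma>_mult: "a \<in> \<Gamma> ==> b \<in> \<Gamma> ==> a ** b \<in> \<Gamma>" using subgroup.m_closed[OF sub] by (simp add: matrix_group_def)
lemma \<Gamma>_one: "mat 1 \<in> \<Gamma>" using subgroup.one_closed[OF sub] by (simp add: matrix_group_def)

lemma \<Gamma>_adj2: assumes "a \<in> \<Gamma>" shows "adj2 a \<in> \<Gamma>"
proof -
 have a: "a \<in> SL2R" using assms \<Gamma>_SL by blast
 have "inv\<^bsub>matrix_group SL2R\<^esub> a = adj2 a"
  by (rule group.inv_equality[OF group_SL2R]) (simp_all add: matrix_group_def adj2_SL2R a)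
 then show ?thesis using subgroup.m_inv_closed[OF sub assms] by simp
qed

lemma \<phi>_image: "\<phi> ` \<Gamma> = carrier (fundamental_group (genus_surface g) x)"
 using iso by (auto simp: iso_def bij_betw_def matrix_group_def)

lemma ga: assumes "i < g" shows "ga i \<in> \<Gamma>" "\<phi> (ga i) = surface_loop g x (4 * i)"
 and gb: "gb i \<in> \<Gamma>" "\<phi> (gb i) = surface_loop g x (4 * i + 1)"
proof -
 have "surface_loop g x (4 * i) \<in> \<phi> ` \<Gamma>" "surface_loop g x (4 * i + 1) \<in> \<phi> ` \<Gamma>"
  unfolding \<phi>_image using surface_loop_carrier[OF g1 x assms, of 0] surface_loop_carrier[OF g1 x assms, of 1] by simp_all
 then show "ga i \<in> \<Gamma>" "\<phi> (ga i) = surface_loop g x (4 * i)" "gb i \<in> \<Gamma>" "\<phi> (gb i) = surface_loop g x (4 * i + 1)"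
  unfolding ga_def gb_def by (simp_all only: inv_into_into f_inv_into_f)
qed

lemma inv_\<phi>_hom: "inv_into \<Gamma> \<phi> \<in> hom (fundamental_group (genus_surface g) x) (matrix_group \<Gamma>)"
 using group.iso_set_sym[OF group_\<Gamma> iso] by (simp add: iso_def matrix_group_def)

lemma \<phi>_hom: "\<phi> \<in> hom (matrix_group \<Gamma>) (fundamental_group (genus_surface g) x)"
 using iso by (simp add: iso_def)

lemma twist:
 fixes r :: "real^2^2 => 'q" and f :: "'q => 'p" and Q' :: "('p, 'c) monoid_scheme" and Q (structure)
 assumes Q: "group Q" and r: "r \<in> hom (matrix_group \<Gamma>) Q" and z: "!!i. i < g ==> z i \<in> carrier Q"
  and zr: "!!i. i < g ==> z i \<otimes> r (ga i) = r (ga i) \<otimes> z i"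
  and Q': "group Q'" and f: "f \<in> hom Q Q'" "!!i. i < g ==> f (z i) = \<one>\<^bsub>Q'\<^esub>"
 shows "\<exists>r'\<in>hom (matrix_group \<Gamma>) Q. (\<forall>i<g. r' (ga i) = r (ga i) & r' (gb i) = z i \<otimes> r (gb i)) &
   (\<forall>\<gamma>\<in>\<Gamma>. f (r' \<gamma>) = f (r \<gamma>))"
proof -
 let ?P = "fundamental_group (genus_surface g) x"
 let ?r = "r \<circ> inv_into \<Gamma> \<phi>"
 have rh: "?r \<in> hom ?P Q" by (rule hom_compose[OF inv_\<phi>_hom r])
 have c: "z i \<otimes> ?r (surface_loop g x (4 * i + 0)) = ?r (surface_loop g x (4 * i + 0)) \<otimes> z i" if "i < g" for i
  using zr[OF that] by (simp add: ga_def)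
 have "(0::nat) < 2" by simp
 note tw = surface_twist[OF g1 x Q rh this z c Q' f]
 obtain r' where r': "r' \<in> hom ?P Q" "\<forall>i<g. r' (surface_loop g x (4 * i)) = ?r (surface_loop g x (4 * i)) &
        r' (surface_loop g x (4 * i + 1)) = z i \<otimes> ?r (surface_loop g x (4 * i + 1))"
   "\<forall>\<gamma>\<in>carrier ?P. f (r' \<gamma>) = f (?r \<gamma>)" using tw by auto
 show ?thesis
 proof (intro bexI[of _ "r' \<circ> \<phi>"] conjI allI impI ballI)
  show "r' \<circ> \<phi> \<in> hom (matrix_group \<Gamma>) Q" by (rule hom_compose[OF \<phi>_hom r'(1)])
  fix i assume i: "i < g"
  show "(r' \<circ> \<phi>) (ga i) = r (ga i)" "(r' \<circ> \<phi>) (gb i) = z i \<otimes> r (gb i)"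
   using r'(2) i ga[OF i] gb[OF i] by (simp_all add: ga_def gb_def)
 next
  fix \<gamma> assume "\<gamma> \<in> \<Gamma>"
  then have "\<phi> \<gamma> \<in> carrier ?P" "inv_into \<Gamma> \<phi> (\<phi> \<gamma>) = \<gamma>"
   using \<phi>_image iso by (auto simp: iso_def bij_betw_def matrix_group_def)
  then show "f ((r' \<circ> \<phi>) \<gamma>) = f (r \<gamma>)" using r'(3) by simp
 qed
qed

text \<open>The trivial homomorphism may be twisted by arbitrary elements. With k = 1 the twist
  alters the a_i, and the inverse of \<open>q i\<close> is used because this twist multiplies by the
  inverse of the twisting element.\<close>

lemma assign:
 fixes Q :: "'q monoid" (structure)
 assumes Q: "group Q" and q: "!!i. i < g ==> q i \<in> carrier Q"
 shows "\<exists>r'\<in>hom (matrix_group \<Gamma>) Q. \<forall>i<g. r' (ga i) = q i"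
proof -
 interpret Q: group Q by (rule Q)
 let ?P = "fundamental_group (genus_surface g) x"
 have 1: "(%_. \<one>) \<in> hom ?P Q" "(%_. \<one>) \<in> hom Q Q" by (auto simp: hom_def)
 have q': "inv (q i) \<in> carrier Q" if "i < g" for i using q[OF that] by simp
 have c: "inv (q i) \<otimes> \<one> = \<one> \<otimes> inv (q i)" if "i < g" for i using q[OF that] by simp
 have "(1::nat) < 2" by simp
 note tw = surface_twist[OF g1 x Q 1(1) this, of "%i. inv (q i)" Q "%_. \<one>", OF q' c Q 1(2) refl]
 obtain r' where r': "r' \<in> hom ?P Q" "\<forall>i<g. r' (surface_loop g x (4 * i)) = \<one> \<otimes> inv (inv (q i))" using tw by auto
 show ?thesis
 proof (intro bexI[of _ "r' \<circ> \<phi>"] allI impI)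
  show "r' \<circ> \<phi> \<in> hom (matrix_group \<Gamma>) Q" by (rule hom_compose[OF \<phi>_hom r'(1)])
  fix i assume i: "i < g"
  show "(r' \<circ> \<phi>) (ga i) = q i" using r'(2) i ga(2)[OF i] q[OF i] by simp
 qed
qed

lemma hom_facts:
 assumes "\<psi> \<in> hom (matrix_group \<Gamma>) (matrix_group SL2R)"
 shows "a \<in> \<Gamma> ==> \<psi> a \<in> SL2R" "a \<in> \<Gamma> ==> b \<in> \<Gamma> ==> \<psi> (a ** b) = \<psi> a ** \<psi> b" "\<psi> (mat 1) = mat 1"
  "a \<in> \<Gamma> ==> \<psi> (adj2 a) = adj2 (\<psi> a)"
proof -
 show c: "\<psi> a \<in> SL2R" if "a \<in> \<Gamma>" for a using assms that by (auto simp: hom_def matrix_group_def)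
 show m: "\<psi> (a ** b) = \<psi> a ** \<psi> b" if "a \<in> \<Gamma>" "b \<in> \<Gamma>" for a b using assms that by (auto simp: hom_def matrix_group_def)
 show o: "\<psi> (mat 1) = mat 1"
  using group_hom.hom_one[of "matrix_group \<Gamma>" "matrix_group SL2R" \<psi>] assms group_\<Gamma> group_SL2R
  by (simp add: group_hom_def group_hom_axioms_def matrix_group_def)
 show "\<psi> (adj2 a) = adj2 (\<psi> a)" if a: "a \<in> \<Gamma>"
 proof -
  have aS: "a \<in> SL2R" using a \<Gamma>_SL by blast
  have "\<psi> a ** \<psi> (adj2 a) = mat 1" using m[OF a \<Gamma>_adj2[OF a]] adj2_SL2R(2)[OF aS] o by simp
  then have "adj2 (\<psi> a) ** (\<psi> a ** \<psi> (adj2 a)) = adj2 (\<psi> a)" by simp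
  then show ?thesis by (simp add: matrix_mul_assoc adj2_SL2R[OF c[OF a]])
 qed
qed

lemma pow_\<Gamma>: "a \<in> \<Gamma> ==> matrix_pow a n \<in> \<Gamma>" by (induction n) (auto simp: \<Gamma>_one \<Gamma>_mult)

text \<open>Some homomorphism sends the element to the unipotent \<open>cE 1\<close>, whose powers
  are distinct.\<close>

lemma ga_infinite_order:
 assumes i: "i < g" and e: "matrix_pow (ga i) p = matrix_pow (ga i) q" shows "p = q"
proof -
 have c: "cE 1 \<in> carrier (matrix_group SL2R)" by (simp add: matrix_group_def)
 obtain \<psi> where \<psi>: "\<psi> \<in> hom (matrix_group \<Gamma>) (matrix_group SL2R)" "\<forall>i<g. \<psi> (ga i) = cE 1"
  using assign[OF group_SL2R, of "%_. cE 1", OF c] by (elim bexE)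
 note h = hom_facts[OF \<psi>(1)]
 have "\<psi> (matrix_pow (ga i) n) = cE (real n)" for n
 proof (induction n)
  case 0 show ?case using h(3) by (simp add: mat2_one)
 next
  case (Suc n)
  then show ?case using h(2)[OF ga(1)[OF i] pow_\<Gamma>[OF ga(1)[OF i]]] \<psi>(2) i by (simp add: mat2_simps)
 qed
 note pw = this
 have "cE (real p) = cE (real q)" unfolding pw[symmetric] e ..
 then show ?thesis by simp
qed

text \<open>Some homomorphism sends the two elements to \<open>cE 1\<close> and \<open>cF 1\<close>,
  for which the two commutators visibly do not commute.\<close>

lemma not_words_commute: assumes "g >= 2" shows "\<not> words_commute (ga 0) (ga 1)"
proof
 assume w: "words_commute (ga 0) (ga 1)"
 let ?q = "%i::nat. if i = 0 then cE 1 else cF 1"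
 have c: "?q i \<in> carrier (matrix_group SL2R)" for i by (simp add: matrix_group_def)
 obtain \<psi> where \<psi>: "\<psi> \<in> hom (matrix_group \<Gamma>) (matrix_group SL2R)" "\<forall>i<g. \<psi> (ga i) = ?q i"
  using assign[OF group_SL2R, of ?q, OF c] by (elim bexE)
 note h = hom_facts[OF \<psi>(1)]
 have G: "ga 0 \<in> \<Gamma>" "ga 1 \<in> \<Gamma>" "\<psi> (ga 0) = cE 1" "\<psi> (ga 1) = cF 1" using ga(1) \<psi>(2) assms by auto
 have "words_commute (\<psi> (ga 0)) (\<psi> (ga 1))"
  using arg_cong[OF w[unfolded words_commute_def], of \<psi>] unfolding words_commute_def
  by (simp only: h(2) h(4) G(1,2) \<Gamma>_mult \<Gamma>_adj2)
 then show False unfolding G words_commute_def by (simp add: mat2_simps)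
qed

text \<open>Discreteness excludes elliptic elements: their powers are bounded and so have a
  convergent subsequence. Quotients of consecutive terms lie in \<Gamma> and tend to 1, hence one of
  them equals 1, contradicting infinite order.\<close>

lemma ga_conj:
 assumes disc: "discrete \<Gamma>" and i: "i < g"
 shows "\<exists>s c k T. (s = 1 \<or> s = - 1) & c ~= 0 & k \<in> SL2R & ga i = s *\<^sub>R (k ** cY T c ** adj2 k)"
proof (rule trace_ge_2_conj)
 let ?a = "ga i"
 have a\<Gamma>: "?a \<in> \<Gamma>" by (rule ga(1)[OF i])
 then show aS: "?a \<in> SL2R" using \<Gamma>_SL by blast
 show "?a ** ?a ~= mat 1" using ga_infinite_order[OF i, of 2 0] by (auto simp: numeral_2_eq_2)
 show "\<bar>?a $ 1 $ 1 + ?a $ 2 $ 2\<bar> >= 2"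
 proof (rule ccontr)
  assume n: "\<not> ?thesis"
  define \<theta> where "\<theta> = arccos ((?a $ 1 $ 1 + ?a $ 2 $ 2) / 2)"
  have c: "cos \<theta> = (?a $ 1 $ 1 + ?a $ 2 $ 2) / 2" unfolding \<theta>_def by (rule cos_arccos_abs) (use n in simp)
  have s: "sin \<theta> ~= 0"
  proof
   assume "sin \<theta> = 0"
   then have "(cos \<theta>)\<^sup>2 = 1" using sin_cos_squared_add[of \<theta>] by simp
   moreover have "\<bar>cos \<theta>\<bar> < 1" using n c by simp
   then have "(cos \<theta>)\<^sup>2 < 1" by (simp only: abs_square_less_1)
   ultimately show False by simp
  qed
  have "norm (matrix_pow ?a (Suc m)) <= (1 / \<bar>sin \<theta>\<bar>) * norm ?a + (1 / \<bar>sin \<theta>\<bar>) * norm (mat 1 :: real^2^2)" for m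
  proof -
   have ep: "matrix_pow ?a (Suc m) = (sin (real (Suc m) * \<theta>) / sin \<theta>) *\<^sub>R ?a - (sin (real m * \<theta>) / sin \<theta>) *\<^sub>R mat 1"
    by (rule elliptic_power[OF aS _ s]) (simp add: c)
   have b: "\<bar>sin t / sin \<theta>\<bar> <= 1 / \<bar>sin \<theta>\<bar>" for t by (simp add: abs_divide divide_right_mono)
   have "norm (matrix_pow ?a (Suc m)) <= norm ((sin (real (Suc m) * \<theta>) / sin \<theta>) *\<^sub>R ?a) + norm ((sin (real m * \<theta>) / sin \<theta>) *\<^sub>R (mat 1 :: real^2^2))"
    unfolding ep by (rule norm_triangle_ineq4)
   also have "... <= (1 / \<bar>sin \<theta>\<bar>) * norm ?a + (1 / \<bar>sin \<theta>\<bar>) * norm (mat 1 :: real^2^2)"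
    unfolding norm_scaleR by (intro add_mono mult_right_mono b norm_ge_zero)
   finally show ?thesis .
  qed
  then have "bounded (range (%m. matrix_pow ?a (Suc m)))" by (auto intro!: boundedI)
  then obtain L r where r: "strict_mono r" "((%m. matrix_pow ?a (Suc m)) \<circ> r) \<longlonglongrightarrow> L"
   using bounded_imp_convergent_subsequence by blast
  define X where "X m = matrix_pow ?a (Suc (r m))" for m
  have XL: "X \<longlonglongrightarrow> L" using r(2) by (simp add: X_def[abs_def] o_def)
  have X\<Gamma>: "X m \<in> \<Gamma>" for m unfolding X_def by (rule pow_\<Gamma>[OF a\<Gamma>])
  have XS: "X m \<in> SL2R" for m using X\<Gamma> \<Gamma>_SL by blast
  have "(%m. X m ** adj2 (X m)) \<longlonglongrightarrow> L ** adj2 L" by (rule tendsto_mult_adj2[OF XL XL])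
  then have L1: "L ** adj2 L = mat 1" unfolding adj2_SL2R(2)[OF XS] using LIMSEQ_unique tendsto_const by blast
  have lim: "(%m. X (Suc m) ** adj2 (X m)) \<longlonglongrightarrow> mat 1"
   using tendsto_mult_adj2[OF LIMSEQ_Suc[OF XL] XL] unfolding L1 .
  obtain U where U: "open U" "U \<inter> \<Gamma> = {mat 1}" using disc \<Gamma>_one unfolding discrete_def isolated_in_def by blast
  have "mat 1 \<in> U" using U(2) by blast
  from topological_tendstoD[OF lim U(1) this] obtain m where "X (Suc m) ** adj2 (X m) \<in> U"
   by (auto simp: eventually_sequentially)
  then have "X (Suc m) ** adj2 (X m) = mat 1" using U(2) \<Gamma>_mult[OF X\<Gamma> \<Gamma>_adj2[OF X\<Gamma>]] by blast
  then have "X (Suc m) ** adj2 (X m) ** X m = X m" by simp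
  then have "X (Suc m) = X m" by (simp add: matrix_mul_assoc[symmetric] adj2_SL2R[OF XS])
  then have "Suc (r (Suc m)) = Suc (r m)" unfolding X_def by (rule ga_infinite_order[OF i])
  then show False using strict_mono_less[OF r(1), of m "Suc m"] by simp
 qed
qed

end

section \<open>Complex matrices as a normed algebra\<close>

text \<open>A copy of the matrix type in which matrix multiplication is the ring multiplication and
  the norm is the operator norm. It is a Banach algebra with \<open>norm 1 = 1\<close>, so
  \<open>exp\<close> and its calculus apply.\<close>

typedef 'n cmat = "UNIV :: (complex^'n::finite^'n) set" morphisms rep Cm ..

setup_lifting type_definition_cmat

lemma rep_Cm [simp]: "rep (Cm A) = A" by (simp add: Cm_inverse)
lemma Cm_rep [simp]: "Cm (rep A) = A" by (simp add: rep_inverse)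
lemma cmat_eqI: "rep A = rep B ==> A = B" by (simp add: rep_inject)

lemma matrix_add_rdistrib: "((A :: complex^'n::finite^'m) + B) ** C = A ** C + B ** C"
 by (simp add: matrix_matrix_mult_def vec_eq_iff sum.distrib distrib_right)

instantiation cmat :: (finite) ring_1
begin
lift_definition zero_cmat :: "'a cmat" is 0 .
lift_definition one_cmat :: "'a cmat" is "mat 1" .
lift_definition plus_cmat :: "'a cmat => 'a cmat => 'a cmat" is "(+)" .
lift_definition minus_cmat :: "'a cmat => 'a cmat => 'a cmat" is "(-)" .
lift_definition uminus_cmat :: "'a cmat => 'a cmat" is "uminus" .
lift_definition times_cmat :: "'a cmat => 'a cmat => 'a cmat" is "(**)" .
instance
proof
 have "(mat 1 :: complex^'a^'a) ~= 0"
  by (auto simp: vec_eq_iff mat_def)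
 then show "(0 :: 'a cmat) ~= 1" by transfer metis
qed (transfer; simp add: algebra_simps matrix_mul_assoc matrix_add_ldistrib matrix_add_rdistrib)+
end

lemma matrix_vector_bounded_linear: "bounded_linear (%x. (A :: complex^'n::finite^'m::finite) *v x)"
proof -
 have "linear (%x. A *v x)"
  by (rule linearI) (auto simp: vec_eq_iff matrix_vector_mult_def scaleR_sum_right sum.distrib algebra_simps)
 then show ?thesis by (simp add: linear_conv_bounded_linear)
qed

instantiation cmat :: (finite) real_algebra_1
begin
lift_definition scaleR_cmat :: "real => 'a cmat => 'a cmat" is "scaleR" .
instance
proof
 fix A B :: "'a cmat" and a b :: real
 show "a *\<^sub>R (A + B) = a *\<^sub>R A + a *\<^sub>R B" "(a + b) *\<^sub>R A = a *\<^sub>R A + b *\<^sub>R A"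
  "a *\<^sub>R b *\<^sub>R A = (a * b) *\<^sub>R A" "1 *\<^sub>R A = A"
  by (transfer; simp add: algebra_simps)+
 show "a *\<^sub>R A * B = a *\<^sub>R (A * B)" "A * a *\<^sub>R B = a *\<^sub>R (A * B)"
  by (transfer; simp add: vec_eq_iff matrix_matrix_mult_def scaleR_sum_right)+
qed
end

instantiation cmat :: (finite) real_normed_algebra_1
begin
definition norm_cmat :: "'a cmat => real" where "norm_cmat A = onorm (%x. rep A *v x)"
definition dist_cmat :: "'a cmat => 'a cmat => real" where "dist_cmat A B = norm (A - B)"
definition sgn_cmat :: "'a cmat => 'a cmat" where "sgn_cmat A = A /\<^sub>R norm A"
definition uniformity_cmat :: "('a cmat \<times> 'a cmat) filter" where
 "uniformity_cmat = (INF e\<in>{0<..}. principal {(x, y). dist x y < e})"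
definition open_cmat :: "'a cmat set => bool" where
 "open_cmat U = (\<forall>x\<in>U. eventually (%(x', y). x' = x --> y \<in> U) uniformity)"
instance
proof
 fix A B :: "'a cmat" and a b :: real
 have bl: "bounded_linear (%x. rep A *v x)" for A :: "'a cmat" by (rule matrix_vector_bounded_linear)
 show "dist A B = norm (A - B)" by (rule dist_cmat_def)
 show "sgn A = A /\<^sub>R norm A" by (rule sgn_cmat_def)
 show "uniformity = (INF e\<in>{0<..}. principal {(x :: 'a cmat, y). dist x y < e})" by (rule uniformity_cmat_def)
 show "open U = (\<forall>x\<in>U. eventually (%(x', y). x' = x --> y \<in> U) uniformity)" for U :: "'a cmat set"
  by (rule open_cmat_def)
 have "(\<forall>x. rep A *v x = 0) \<longleftrightarrow> rep A = 0"
  by (metis matrix_vector_mul_lid matrix_vector_mult_0 matrix_eq)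
 then show "norm A = 0 \<longleftrightarrow> A = 0"
  unfolding norm_cmat_def onorm_eq_0[OF bl] by (transfer; simp)
 have "(%x. rep (A + B) *v x) = (%x. rep A *v x + rep B *v x)"
  by transfer (auto simp: matrix_vector_mult_add_rdistrib)
 then show "norm (A + B) <= norm A + norm B"
  unfolding norm_cmat_def using onorm_triangle[OF bl bl] by simp
 have "(%x. rep (a *\<^sub>R A) *v x) = (%x. a *\<^sub>R (rep A *v x))"
  by transfer (auto simp: vec_eq_iff matrix_vector_mult_def scaleR_sum_right)
 then show "norm (a *\<^sub>R A) = \<bar>a\<bar> * norm A"
  unfolding norm_cmat_def using onorm_scaleR[OF bl] by simp
 have "(%x. rep (A * B) *v x) = (%x. rep A *v x) \<circ> (%x. rep B *v x)"
  by transfer (auto simp: matrix_vector_mul_assoc)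
 then show "norm (A * B) <= norm A * norm B"
  unfolding norm_cmat_def using onorm_compose[OF bl bl] by simp
 have "(%x. rep (1 :: 'a cmat) *v x) = (%x. x)"
  by transfer (auto simp: matrix_vector_mul_lid)
 then show "norm (1 :: 'a cmat) = 1"
  unfolding norm_cmat_def using onorm_id by simp
qed
end

abbreviation ent :: "'n::finite cmat => 'n => 'n => complex" where "ent A i j \<equiv> rep A $ i $ j"

lemma rep_simps [simp]:
 "rep 0 = 0" "rep 1 = mat 1" "rep (A + B) = rep A + rep B" "rep (A - B) = rep A - rep B"
 "rep (- A) = - rep A" "rep (A * B) = rep A ** rep B" "rep (r *\<^sub>R A) = r *\<^sub>R rep A"
 by (transfer; simp)+

lemma rep_sum [simp]: "rep (sum f S) = (\<Sum>x\<in>S. rep (f x))"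
 by (induction S rule: infinite_finite_induct) auto

lemma cmat_entI: "(!!i j. ent A i j = ent B i j) ==> A = B"
 by (rule cmat_eqI) (simp add: vec_eq_iff)

lemma norm_axis: "norm (axis j (c::complex) :: complex^'n) = cmod c"
 by (simp add: norm_vec_def L2_set_def axis_def if_distrib[of norm] if_distrib[of "%x. x\<^sup>2"] cong: if_cong)

lemma ent_le_norm: "cmod (ent A i j) <= norm A"
proof -
 have "ent A i j = (rep A *v axis j 1) $ i"
  by (simp add: matrix_vector_mult_def axis_def if_distrib cong: if_cong)
 also have "cmod ... <= norm (rep A *v axis j 1)" by (rule Finite_Cartesian_Product.norm_nth_le)
 also have "... <= norm A * norm (axis j (1::complex))"
  unfolding norm_cmat_def by (rule onorm[OF matrix_vector_bounded_linear])
 also have "norm (axis j (1::complex)) = 1" by (simp add: norm_axis)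
 finally show ?thesis by simp
qed

lemma bounded_linear_Cm: "bounded_linear (Cm :: (complex^'n::finite^'n) => 'n cmat)"
proof -
 have "linear (Cm :: (complex^'n^'n) => 'n cmat)" by (rule linearI; rule cmat_eqI; simp)
 then show ?thesis by (simp add: linear_conv_bounded_linear)
qed

lemma norm_vec_le_sum: "norm (x :: 'a::real_normed_vector^'n) <= (\<Sum>i\<in>UNIV. norm (x $ i))"
 unfolding norm_vec_def by (rule L2_set_le_sum) auto

lemma bounded_linear_rep: "bounded_linear (rep :: 'n::finite cmat => complex^'n^'n)"
proof
 show "\<exists>K. \<forall>x :: 'n cmat. norm (rep x) <= norm x * K"
 proof (intro exI allI)
  fix x :: "'n cmat"
  have "norm (rep x) <= (\<Sum>i\<in>UNIV. norm (rep x $ i))" by (rule norm_vec_le_sum)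
  also have "... <= (\<Sum>i\<in>(UNIV::'n set). \<Sum>j\<in>(UNIV::'n set). norm (ent x i j))"
   by (intro sum_mono norm_vec_le_sum)
  also have "... <= (\<Sum>i\<in>(UNIV::'n set). \<Sum>j\<in>(UNIV::'n set). norm x)" by (intro sum_mono ent_le_norm)
  finally show "norm (rep x) <= norm x * (real CARD('n) * real CARD('n))" by (simp add: algebra_simps)
 qed
qed auto

lemmas tendsto_rep [tendsto_intros] = bounded_linear.tendsto[OF bounded_linear_rep]
lemmas tendsto_Cm [tendsto_intros] = bounded_linear.tendsto[OF bounded_linear_Cm]
lemmas continuous_on_rep [continuous_intros] = bounded_linear.continuous_on[OF bounded_linear_rep]
lemmas continuous_on_Cm [continuous_intros] = bounded_linear.continuous_on[OF bounded_linear_Cm]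

instance cmat :: (finite) banach
proof
 fix X :: "nat => 'a cmat" assume "Cauchy X"
 then have "Cauchy (%n. rep (X n))" by (rule bounded_linear.Cauchy[OF bounded_linear_rep])
 then have "convergent (%n. rep (X n))" by (simp add: Cauchy_convergent_iff)
 then obtain L where "(%n. rep (X n)) \<longlonglongrightarrow> L" by (auto simp: convergent_def)
 then have "(%n. Cm (rep (X n))) \<longlonglongrightarrow> Cm L" by (rule tendsto_Cm)
 then show "convergent X" by (auto simp: convergent_def)
qed

lemma rep_power: "rep (A ^ k) = matrix_pow (rep A) k"
 by (induction k) auto

lemma matrix_exp_eq: "matrix_exp A = rep (exp (Cm A))"
proof -
 have "(%k. Cm A ^ k /\<^sub>R fact k) sums exp (Cm A)" by (rule exp_converges)
 then have "(%k. rep (Cm A ^ k /\<^sub>R fact k)) sums rep (exp (Cm A))"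
  by (rule bounded_linear.sums[OF bounded_linear_rep])
 then have "(%k. (1 / fact k) *\<^sub>R matrix_pow A k) sums rep (exp (Cm A))"
  by (simp add: rep_power divide_inverse)
 then show ?thesis unfolding matrix_exp_def by (rule sums_unique[symmetric])
qed

text \<open>The algebra is a real one; complex scalars act as multiplication by central scalar
  matrices.\<close>

definition smat :: "complex => 'n::finite cmat" where "smat c = Cm (mat c)"

lemma rep_smat [simp]: "rep (smat c) = mat c" by (simp add: smat_def)

lemma ent_smat_mult [simp]: "ent (smat c * A) i j = c * ent A i j"
 by (simp add: matrix_matrix_mult_def mat_def if_distrib[of "%x. x * _"] cong: if_cong)

lemma smat_central: "A * smat c = smat c * A"
 by (rule cmat_entI) (simp only: ent_smat_mult, simp add: matrix_matrix_mult_def mat_def if_distrib cong: if_cong)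

lemma smat_left_commute: "A * (smat c * B) = smat c * (A * B)"
 by (metis mult.assoc smat_central)

lemma smat_simps:
 "smat 0 = 0" "smat 1 = 1" "smat (c + d) = smat c + smat d" "smat (c - d) = smat c - smat d"
 "smat (- c) = - smat c"
 by (rule cmat_entI; simp add: mat_def)+

lemma smat_mult: "smat (c * d) = smat c * smat d"
 by (rule cmat_entI) (simp only: ent_smat_mult, simp add: mat_def)

lemma smat_of_real: "smat (of_real r) * A = r *\<^sub>R A"
 by (rule cmat_entI) (simp only: ent_smat_mult, simp add: scaleR_conv_of_real[where 'a=complex])

lemma smat_power: "smat (c ^ k) = smat c ^ k"
 by (induction k) (auto simp: smat_simps smat_mult)

lemma norm_smat: "norm (smat c :: 'n::finite cmat) = cmod c"
proof -
 have "norm ((mat c :: complex^'n^'n) *v x) = cmod c * norm x" for x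
 proof -
  have "(mat c :: complex^'n^'n) *v x = (\<chi> i. c * x $ i)"
   by (simp add: vec_eq_iff matrix_vector_mult_def mat_def if_distrib[of "%x. x * _"] cong: if_cong)
  then show ?thesis
   by (simp add: norm_vec_def norm_mult L2_set_right_distrib)
 qed
 then have "onorm (%x. (mat c :: complex^'n^'n) *v x) = cmod c"
  using onorm[OF matrix_vector_bounded_linear, of "mat c :: complex^'n^'n" "axis undefined 1"]
  by (intro antisym onorm_bound) (auto simp: norm_axis)
 then show ?thesis by (simp add: norm_cmat_def)
qed

lemma bounded_linear_smat: "bounded_linear (smat :: complex => 'n::finite cmat)"
proof
 show "smat (r *\<^sub>R c) = r *\<^sub>R smat c" for r c
  by (simp add: scaleR_conv_of_real smat_mult smat_of_real)
qed (auto simp: smat_simps norm_smat intro!: exI[of _ 1])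

lemmas continuous_on_smat [continuous_intros] = bounded_linear.continuous_on[OF bounded_linear_smat]

lemma smat_scaleR: "smat (r *\<^sub>R c) = r *\<^sub>R smat c"
 using bounded_linear_smat by (metis linear_simps(5))

lemma exp_smat: "exp (smat c) = smat (exp c)"
proof -
 have "(%k. c ^ k /\<^sub>R fact k) sums exp c" by (rule exp_converges)
 then have "(%k. smat (c ^ k /\<^sub>R fact k)) sums smat (exp c)"
  by (rule bounded_linear.sums[OF bounded_linear_smat])
 then have "(%k. smat c ^ k /\<^sub>R fact k) sums smat (exp c)"
  by (simp add: smat_scaleR smat_power)
 then show ?thesis using exp_converges sums_unique2 by blast
qed

lemma exp_add_smat: "exp (smat c + A) = smat (exp c) * exp A"
 by (subst exp_add_commuting) (auto simp: smat_central exp_smat)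

lemma exp_smat_add: "exp (smat (s + t) * A) = exp (smat s * A) * exp (smat t * A)"
proof -
 have "(smat s * A) * (smat t * A) = (smat t * A) * (smat s * A)"
  by (metis (no_types, opaque_lifting) mult.assoc smat_central)
 from exp_add_commuting[OF this] show ?thesis by (simp add: smat_simps distrib_right)
qed

lemma norm_exp_remainder:
 fixes x :: "'a::{real_normed_algebra_1, banach}"
 assumes "norm x <= 1" shows "norm (exp x - 1 - x) <= (norm x)\<^sup>2"
proof -
 have s: "summable (%n. norm x ^ (n + 2) /\<^sub>R fact (n + 2))"
  by (rule summable_ignore_initial_segment) (rule summable_exp_generic)
 have "exp x - 1 - x = (\<Sum>n. inverse (fact (n + 2)) *\<^sub>R x ^ (n + 2))"
  by (subst exp_first_two_terms) simp
 also have "norm ... <= (\<Sum>n. norm x ^ (n + 2) /\<^sub>R fact (n + 2))"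
  by (rule norm_suminf_le[OF _ s]) (simp del: power_Suc add_2_eq_Suc' add: norm_power_ineq mult_left_mono)
 also have "... = exp (norm x) - 1 - norm x"
  using exp_first_two_terms[of "norm x"] by simp
 also have "... <= (norm x)\<^sup>2" using exp_bound[of "norm x"] assms by simp
 finally show ?thesis .
qed

lemma exp_power: "exp (A :: 'n::finite cmat) ^ k = exp (of_nat k * A)"
proof (induction k)
 case (Suc k)
 have "exp A * exp (of_nat k * A) = exp (A + of_nat k * A)"
  by (rule exp_add_commuting[symmetric]) (metis mult.assoc mult_of_nat_commute)
 then show ?case using Suc by (simp add: distrib_right)
qed simp

lemma of_nat_smat: "(of_nat k :: 'n::finite cmat) = smat (of_nat k)"
 by (induction k) (auto simp: smat_simps)

lemma exp_inverse_cmat: "exp A * exp (- A) = 1" "exp (- A) * exp A = (1 :: 'n::finite cmat)"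
 by (rule exp_minus_inverse, metis exp_minus_inverse minus_minus)

text \<open>Complex differentiability is stated for single entries, since scalars act on
  \<open>cmat\<close> through the reals only. It follows from the quadratic remainder of the
  exponential at 0 and the addition formula.\<close>

lemma has_field_derivative_exp_ent:
 "((%s. ent (A * exp (smat s * v) * B) i j) has_field_derivative ent (A * exp (smat s * v) * v * B) i j) (at s)"
proof -
 let ?G = "%s. exp (smat s * v)"
 have "((%h. (?G h - 1 - smat h * v) /\<^sub>R cmod h) \<longlongrightarrow> 0) (at 0)"
 proof (rule Lim_null_comparison)
  have "\<forall>\<^sub>F h in at (0::complex). cmod h < 1 / (norm v + 1)"
   by (rule order_tendstoD(2)[of cmod 0]) (auto intro!: tendsto_eq_intros add_nonneg_pos)
  then show "\<forall>\<^sub>F h in at 0. norm ((?G h - 1 - smat h * v) /\<^sub>R cmod h) <= cmod h * (norm v)\<^sup>2"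
  proof (rule eventually_mono)
   fix h assume h: "cmod h < 1 / (norm v + 1)"
   have "0 < norm v + 1" by (simp add: add_nonneg_pos)
   then have "cmod h * (norm v + 1) < 1" using h by (simp add: pos_less_divide_eq)
   then have "cmod h * norm v <= 1" using norm_ge_zero[of h] unfolding distrib_left by linarith
   moreover have n: "norm (smat h * v) <= cmod h * norm v"
    using norm_mult_ineq[of "smat h" v] by (simp add: norm_smat)
   ultimately have "norm (?G h - 1 - smat h * v) <= (norm (smat h * v))\<^sup>2"
    by (intro norm_exp_remainder) simp
   also have "... <= (cmod h * norm v)\<^sup>2" using n by (intro power_mono) auto
   finally have "norm (?G h - 1 - smat h * v) * inverse (cmod h) <= (cmod h * norm v)\<^sup>2 * inverse (cmod h)"
    by (intro mult_right_mono) auto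
   moreover have "(cmod h * norm v)\<^sup>2 * inverse (cmod h) = cmod h * (norm v)\<^sup>2"
    by (cases "h = 0") (simp_all add: power2_eq_square field_simps)
   ultimately show "norm ((?G h - 1 - smat h * v) /\<^sub>R cmod h) <= cmod h * (norm v)\<^sup>2"
    by (simp add: mult.commute[of "inverse _"])
  qed
  show "((%h. cmod h * (norm v)\<^sup>2) \<longlongrightarrow> 0) (at 0)" by (auto intro!: tendsto_eq_intros)
 qed
 then have "((%h. A * ?G s * ((?G h - 1 - smat h * v) /\<^sub>R cmod h) * B) \<longlongrightarrow> A * ?G s * 0 * B) (at 0)"
  by (intro tendsto_intros)
 then have "((%h. ent (A * ?G s * ((?G h - 1 - smat h * v) /\<^sub>R cmod h) * B) i j) \<longlongrightarrow> ent (A * ?G s * 0 * B) i j) (at 0)"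
  by (intro tendsto_vec_nth bounded_linear.tendsto[OF bounded_linear_rep])
 then have "((%h. ent (A * ?G s * (?G h - 1 - smat h * v) * B) i j /\<^sub>R cmod h) \<longlongrightarrow> 0) (at 0)"
  by (simp del: rep_simps add: rep_simps(1,7))
 moreover have "ent (A * ?G s * (?G h - 1 - smat h * v) * B) i j =
   ent (A * ?G (s + h) * B) i j - ent (A * ?G s * B) i j - ent (A * ?G s * v * B) i j * h" for h
 proof -
  have "A * ?G s * (?G h - 1 - smat h * v) * B = A * ?G (s + h) * B - A * ?G s * B - smat h * (A * ?G s * v * B)"
   unfolding exp_smat_add[of s h v] by (simp add: algebra_simps smat_left_commute)
  then show ?thesis by (simp only: rep_simps(4) vector_minus_component ent_smat_mult mult.commute)
 qed
 ultimately have "((%h. (ent (A * ?G (s + h) * B) i j - ent (A * ?G s * B) i j - ent (A * ?G s * v * B) i j * h) /\<^sub>R cmod h) \<longlongrightarrow> 0) (at 0)"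
  by simp
 from tendsto_norm_zero[OF this]
 have "((%h. cmod (ent (A * ?G (s + h) * B) i j - ent (A * ?G s * B) i j - ent (A * ?G s * v * B) i j * h) / cmod h) \<longlongrightarrow> 0) (at 0)"
  by (simp add: divide_inverse mult.commute)
 then show ?thesis unfolding has_field_derivative_def has_derivative_at
  by (simp add: bounded_linear_mult_right)
qed

section \<open>Exponential polynomials with prescribed frequencies\<close>

inductive_set epoly :: "complex set => (complex => complex) set" for \<Lambda> where
 zero: "(%_. 0) \<in> epoly \<Lambda>"
| add_term: "f \<in> epoly \<Lambda> ==> \<mu> \<in> \<Lambda> ==> (%s. f s + poly p s * exp (\<mu> * s)) \<in> epoly \<Lambda>"

lemma epoly_term: "\<mu> \<in> \<Lambda> ==> (%s. poly p s * exp (\<mu> * s)) \<in> epoly \<Lambda>"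
 using epoly.add_term[OF epoly.zero, of \<mu> \<Lambda> p] by simp

lemma epoly_const: "0 \<in> \<Lambda> ==> (%_. c) \<in> epoly \<Lambda>"
 using epoly_term[of 0 \<Lambda> "[:c:]"] by simp

lemma epoly_add: "f \<in> epoly \<Lambda> ==> h \<in> epoly \<Lambda> ==> (%s. f s + h s) \<in> epoly \<Lambda>"
proof (induction rule: epoly.induct)
 case (add_term f \<mu> p)
 from epoly.add_term[OF add_term.IH[OF add_term.prems] add_term.hyps(2), of p]
 show ?case by (simp add: algebra_simps)
qed simp

lemma epoly_mult_term:
 assumes "f \<in> epoly \<Lambda>" "!!\<mu>. \<mu> \<in> \<Lambda> ==> \<mu> + \<nu> \<in> \<Lambda>'"
 shows "(%s. f s * (poly q s * exp (\<nu> * s))) \<in> epoly \<Lambda>'"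
 using assms(1)
proof (induction rule: epoly.induct)
 case (add_term f \<mu> p)
 from epoly.add_term[OF add_term.IH assms(2)[OF add_term.hyps(2)], of "p * q"]
 show ?case by (simp add: algebra_simps exp_add)
qed (use epoly.zero in simp)

lemma epoly_mult:
 assumes "f \<in> epoly \<Lambda>" "h \<in> epoly \<Lambda>'" "!!\<mu> \<nu>. \<mu> \<in> \<Lambda> ==> \<nu> \<in> \<Lambda>' ==> \<mu> + \<nu> \<in> \<Lambda>''"
 shows "(%s. f s * h s) \<in> epoly \<Lambda>''"
 using assms(2)
proof (induction rule: epoly.induct)
 case (add_term h \<mu> p)
 from epoly_add[OF add_term.IH epoly_mult_term[OF assms(1), of \<mu> \<Lambda>'' p]] assms(3) add_term.hyps
 show ?case by (simp add: algebra_simps)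
qed (use epoly.zero in simp)

lemma epoly_mono: assumes "f \<in> epoly \<Lambda>" "\<Lambda> \<subseteq> \<Lambda>'" shows "f \<in> epoly \<Lambda>'"
 using epoly_mult_term[OF assms(1), of 0 \<Lambda>' 1] assms(2) by auto

lemma epoly_normal_form:
 assumes "f \<in> epoly \<Lambda>"
 shows "\<exists>M P. finite M & M \<subseteq> \<Lambda> & (\<forall>s. f s = (\<Sum>\<mu>\<in>M. poly (P \<mu>) s * exp (\<mu> * s)))"
 using assms
proof (induction rule: epoly.induct)
 case zero
 then show ?case by (intro exI[of _ "{}"]) auto
next
 case (add_term f \<mu> p)
 then obtain M P where M: "finite M" "M \<subseteq> \<Lambda>" "!!s. f s = (\<Sum>\<mu>\<in>M. poly (P \<mu>) s * exp (\<mu> * s))" by blast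
 define P' where "P' \<nu> = (if \<nu> \<in> M then P \<nu> else 0) + (if \<nu> = \<mu> then p else 0)" for \<nu>
 have "(\<Sum>\<nu>\<in>insert \<mu> M. poly (P' \<nu>) s * exp (\<nu> * s)) =
   (\<Sum>\<nu>\<in>insert \<mu> M. (if \<nu> \<in> M then poly (P \<nu>) s * exp (\<nu> * s) else 0)) +
   (\<Sum>\<nu>\<in>insert \<mu> M. (if \<nu> = \<mu> then poly p s * exp (\<nu> * s) else 0))" for s
  unfolding sum.distrib[symmetric] by (rule sum.cong) (auto simp: P'_def algebra_simps)
 moreover have "(\<Sum>\<nu>\<in>insert \<mu> M. (if \<nu> \<in> M then poly (P \<nu>) s * exp (\<nu> * s) else 0)) = f s" for s
  unfolding M(3) using M(1) by (intro sum.mono_neutral_cong_right) auto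
 moreover have "(\<Sum>\<nu>\<in>insert \<mu> M. (if \<nu> = \<mu> then poly p s * exp (\<nu> * s) else 0)) = poly p s * exp (\<mu> * s)" for s
  using M(1) by simp
 ultimately show ?case using M add_term.hyps(2)
  by (intro exI[of _ "insert \<mu> M"] exI[of _ P']) auto
qed

text \<open>Replacing k by k + 1 in p(k) y^k and subtracting z p(k) y^k acts on the polynomial
  factor as displayed. For y different from z the leading coefficient survives; for y = z, in the
  next lemma, it cancels and the degree drops.\<close>

lemma shift_combination_nonzero:
 fixes p :: "complex poly" assumes "y ~= z" "smult y (pcompose p [:1, 1:]) - smult z p = 0" shows "p = 0"
proof (rule ccontr)
 assume "p ~= 0"
 have "degree (pcompose p [:1, 1:]) = degree p" by (simp add: degree_pcompose)
 then have "coeff (pcompose p [:1, 1:]) (degree p) = lead_coeff p"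
  using lead_coeff_comp[of "[:1, 1:]" p] by simp
 then have "coeff (smult y (pcompose p [:1, 1:]) - smult z p) (degree p) = (y - z) * lead_coeff p"
  by (simp add: algebra_simps)
 then show False using assms \<open>p ~= 0\<close> by simp
qed

lemma shift_difference_degree:
 fixes p :: "complex poly" assumes "degree p < Suc d"
 shows "smult y (pcompose p [:1, 1:]) - smult y p = 0 \<or> degree (smult y (pcompose p [:1, 1:]) - smult y p) < d"
proof (rule ccontr)
 let ?q = "smult y (pcompose p [:1, 1:]) - smult y p"
 assume n: "\<not> ?thesis"
 have e: "degree (pcompose p [:1, 1:]) = degree p" by (simp add: degree_pcompose)
 then have "coeff (pcompose p [:1, 1:]) (degree p) = lead_coeff p"
  using lead_coeff_comp[of "[:1, 1:]" p] by simp
 then have 0: "coeff ?q (degree p) = 0" by simp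
 have "degree ?q <= degree p"
  by (rule degree_diff_le) (auto intro: order_trans[OF degree_smult_le] simp: e)
 with n assms have "degree ?q = degree p" by linarith
 then show False using 0 n by (metis leading_coeff_0_iff)
qed

text \<open>The difference operator belonging to one base lowers the degree of its own polynomial
  and annihilates no other. Iterating it, by the inner induction on the degree, removes that base
  from the sum and leaves the remaining ones to the outer induction.\<close>

lemma poly_power_sum_zero:
 fixes x :: "'i => complex"
 assumes "finite M" "inj_on x M" "!!\<mu>. \<mu> \<in> M ==> x \<mu> ~= 0"
  "!!k::nat. (\<Sum>\<mu>\<in>M. poly (Q \<mu>) (of_nat k) * x \<mu> ^ k) = 0"
 shows "\<forall>\<mu>\<in>M. Q \<mu> = 0"
 using assms
proof (induction M arbitrary: Q rule: finite_induct)
 case (insert \<nu> M)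
 have inner: "\<forall>\<mu>\<in>M. Q \<mu> = 0"
  if "Q \<nu> = 0 \<or> degree (Q \<nu>) < d" "!!k::nat. (\<Sum>\<mu>\<in>insert \<nu> M. poly (Q \<mu>) (of_nat k) * x \<mu> ^ k) = 0" for d Q
  using that
 proof (induction d arbitrary: Q)
  case 0
  then have "Q \<nu> = 0" by simp
  then have "!!k::nat. (\<Sum>\<mu>\<in>M. poly (Q \<mu>) (of_nat k) * x \<mu> ^ k) = 0"
   using 0(2) insert.hyps by simp
  then show ?case using insert.IH[of Q] insert.prems(1,2) by auto
 next
  case (Suc d)
  define R where "R \<mu> = smult (x \<mu>) (pcompose (Q \<mu>) [:1, 1:]) - smult (x \<nu>) (Q \<mu>)" for \<mu>
  have sumR: "(\<Sum>\<mu>\<in>insert \<nu> M. poly (R \<mu>) (of_nat k) * x \<mu> ^ k) = 0" for k :: nat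
  proof -
   have "poly (R \<mu>) (of_nat k) * x \<mu> ^ k = poly (Q \<mu>) (of_nat (Suc k)) * x \<mu> ^ Suc k - x \<nu> * (poly (Q \<mu>) (of_nat k) * x \<mu> ^ k)" for \<mu>
    by (simp add: R_def poly_pcompose algebra_simps)
   then have "(\<Sum>\<mu>\<in>insert \<nu> M. poly (R \<mu>) (of_nat k) * x \<mu> ^ k) =
     (\<Sum>\<mu>\<in>insert \<nu> M. poly (Q \<mu>) (of_nat (Suc k)) * x \<mu> ^ Suc k) - x \<nu> * (\<Sum>\<mu>\<in>insert \<nu> M. poly (Q \<mu>) (of_nat k) * x \<mu> ^ k)"
    by (simp only: sum_subtractf sum_distrib_left)
   then show ?thesis by (simp only: Suc.prems(2)) simp
  qed
  have degR: "R \<nu> = 0 \<or> degree (R \<nu>) < d"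
  proof (cases "Q \<nu> = 0")
   case False
   then show ?thesis using shift_difference_degree[of "Q \<nu>" d "x \<nu>"] Suc.prems(1) unfolding R_def by simp
  qed (simp add: R_def)
  have R0: "\<forall>\<mu>\<in>M. R \<mu> = 0" by (rule Suc.IH[OF degR sumR])
  show ?case
  proof
   fix \<mu> assume \<mu>: "\<mu> \<in> M"
   then have "x \<mu> ~= x \<nu>" using inj_onD[OF insert.prems(1), of \<mu> \<nu>] insert.hyps(2) by blast
   then show "Q \<mu> = 0" using R0 \<mu> shift_combination_nonzero unfolding R_def by blast
  qed
 qed
 have M: "\<forall>\<mu>\<in>M. Q \<mu> = 0" by (rule inner[of Q "Suc (degree (Q \<nu>))", OF _ insert.prems(3)]) simp
 have "poly (Q \<nu>) (of_nat k) = 0" for k :: nat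
 proof -
  have "(\<Sum>\<mu>\<in>insert \<nu> M. poly (Q \<mu>) (of_nat k) * x \<mu> ^ k) = poly (Q \<nu>) (of_nat k) * x \<nu> ^ k"
   using M insert.hyps by simp
  then show ?thesis using insert.prems(2)[of \<nu>] insert.prems(3)[of k] by simp
 qed
 then have "range (of_nat :: nat => complex) \<subseteq> {z. poly (Q \<nu>) z = 0}" by auto
 moreover have "infinite (range (of_nat :: nat => complex))" by (rule range_inj_infinite) (rule inj_of_nat)
 ultimately have "Q \<nu> = 0" using poly_roots_finite[of "Q \<nu>"] infinite_super by blast
 then show ?case using M by simp
qed simp

text \<open>The tool behind every passage from a discrete set of powers to a whole one-parameter
  group: an arithmetic progression of zeros suffices as soon as its step separates the
  frequencies.\<close>

lemma epoly_zero:
 assumes f: "f \<in> epoly \<Lambda>" and inj: "inj_on (%\<mu>. exp (\<mu> * t)) \<Lambda>" and t: "t ~= 0"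
  and z: "!!k::nat. f (of_nat k * t) = 0"
 shows "f s = 0"
proof -
 obtain M P where M: "finite M" "M \<subseteq> \<Lambda>" "!!s. f s = (\<Sum>\<mu>\<in>M. poly (P \<mu>) s * exp (\<mu> * s))"
  using epoly_normal_form[OF f] by blast
 define Q where "Q \<mu> = pcompose (P \<mu>) [:0, t:]" for \<mu>
 have "(\<Sum>\<mu>\<in>M. poly (Q \<mu>) (of_nat k) * exp (\<mu> * t) ^ k) = 0" for k :: nat
  using z[of k] unfolding M(3) by (simp add: Q_def poly_pcompose exp_of_nat_mult[symmetric] mult_ac)
 from poly_power_sum_zero[OF M(1) inj_on_subset[OF inj M(2)] _ this]
 have Q: "\<forall>\<mu>\<in>M. Q \<mu> = 0" by simp
 have "poly (P \<mu>) s = 0" if "\<mu> \<in> M" for \<mu>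
 proof -
  have "poly (Q \<mu>) (s / t) = 0" using Q that by simp
  then show ?thesis using t by (simp add: Q_def poly_pcompose)
 qed
 then show ?thesis unfolding M(3) by simp
qed

lemma pderiv_sum: "pderiv (sum f S) = (\<Sum>i\<in>S. pderiv (f i :: complex poly))"
 by (induction S rule: infinite_finite_induct) (auto simp: pderiv_add)

text \<open>For \<mu> = 0 this is termwise integration; otherwise p / \<mu> solves the equation up
  to a derivative of smaller degree.\<close>

lemma poly_antideriv:
 fixes p :: "complex poly" shows "\<exists>R. pderiv R + smult \<mu> R = p"
proof (cases "\<mu> = 0")
 case True
 have "pderiv (\<Sum>i\<le>degree p. monom (coeff p i / of_nat (Suc i)) (Suc i)) = (\<Sum>i\<le>degree p. monom (coeff p i) i)"
  by (simp add: pderiv_sum pderiv_monom del: of_nat_Suc)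
 then show ?thesis using True poly_as_sum_of_monoms[of p] by auto
next
 case False
 show ?thesis
 proof (induction "degree p" arbitrary: p rule: less_induct)
  case less
  define R where "R = smult (1 / \<mu>) p"
  show ?case
  proof (cases "degree p = 0")
   case True
   then have "pderiv R = 0" by (simp add: R_def pderiv_smult pderiv_eq_0_iff)
   then show ?thesis using False by (intro exI[of _ R]) (simp add: R_def)
  next
   case dp: False
   have "degree (- pderiv R) < degree p" using dp by (simp add: R_def pderiv_smult degree_pderiv False)
   from less[OF this] obtain S where "pderiv S + smult \<mu> S = - pderiv R" by blast
   then have "pderiv (R + S) + smult \<mu> (R + S) = smult \<mu> R" by (simp add: pderiv_add smult_add_right algebra_simps)
   then show ?thesis using False by (intro exI[of _ "R + S"]) (simp add: R_def)
  qed
 qed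
qed

lemma epoly_antideriv:
 assumes "f \<in> epoly \<Lambda>"
 shows "\<exists>F\<in>epoly \<Lambda>. \<forall>s. (F has_field_derivative f s) (at s)"
 using assms
proof (induction rule: epoly.induct)
 case zero
 show ?case by (rule bexI[OF _ epoly.zero]) auto
next
 case (add_term f \<mu> p)
 then obtain F where F: "F \<in> epoly \<Lambda>" "!!s. (F has_field_derivative f s) (at s)" by blast
 obtain R where R: "pderiv R + smult \<mu> R = p" using poly_antideriv by blast
 have "((%s. F s + poly R s * exp (\<mu> * s)) has_field_derivative f s + poly p s * exp (\<mu> * s)) (at s)" for s
  unfolding R[symmetric] by (auto intro!: derivative_eq_intros F(2) poly_DERIV simp: algebra_simps)
 then show ?case using epoly.add_term[OF F(1) add_term.hyps(2)] by blast
qed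

section \<open>Exponentials of matrices\<close>

definition pev :: "complex poly => 'n::finite cmat => 'n cmat" where
 "pev p v = fold_coeffs (%a B. smat a + v * B) p 0"

lemma pev_0 [simp]: "pev 0 v = 0" by (simp add: pev_def)

lemma pev_pCons [simp]: "pev (pCons a p) v = smat a + v * pev p v"
 by (cases "p = 0 & a = 0") (auto simp: pev_def smat_simps)

lemma pev_add: "pev (p + q) v = pev p v + pev q v"
 by (induction p q rule: poly_induct2) (auto simp: smat_simps algebra_simps)

lemma pev_smult: "pev (smult c p) v = smat c * pev p v"
 by (induction p) (auto simp: smat_mult algebra_simps smat_left_commute intro: smat_central)

lemma pev_linear_factor: "pev ([:- l, 1:] * q) v = (v - smat l) * pev q v"
proof -
 have e: "[:- l, 1:] * q = smult (- l) q + pCons 0 q" by (simp only: mult_pCons_left) simp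
 show ?thesis unfolding e pev_add pev_smult by (simp add: smat_simps left_diff_distrib)
qed

lemma pev_monom: "pev (monom c i) v = smat c * v ^ i"
 by (induction i) (auto simp: monom_Suc smat_simps monom_0 smat_left_commute power_commutes)

lemma pev_sum: "pev (sum f S) v = (\<Sum>i\<in>S. pev (f i) v)"
 by (induction S rule: infinite_finite_induct) (auto simp: pev_add)

text \<open>The powers of v up to the real dimension of the matrix space cannot be independent. If
  two of them coincide, the indexed family collapses as a set, and a difference of monomials is
  taken instead.\<close>

lemma annihilating_poly: "\<exists>p\<noteq>0. pev p (v :: 'n::finite cmat) = 0"
proof -
 define N where "N = DIM(complex^'n^'n)"
 define S where "S = (%i. rep (v ^ i)) ` {..N}"
 show ?thesis
 proof (cases "inj_on (%i. rep (v ^ i)) {..N}")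
  case False
  then obtain i j where ij: "i ~= j" "v ^ i = v ^ j" by (auto simp: inj_on_def rep_inject)
  define p where "p = monom (1::complex) i + monom (-1) j"
  have "coeff p i = 1" using ij by (simp add: p_def)
  then have "p ~= 0" by auto
  moreover have "pev p v = 0" using ij by (simp add: p_def pev_add pev_monom smat_simps)
  ultimately show ?thesis by blast
 next
  case True
  then have "card S = Suc N" by (simp add: S_def card_image)
  then have "dependent S" using dependent_biggerset[of S] by (simp add: S_def N_def)
  then obtain u w where u: "w \<in> S" "u w ~= 0" "(\<Sum>w\<in>S. u w *\<^sub>R w) = 0"
   using dependent_finite[of S] by (auto simp: S_def)
  define p where "p = (\<Sum>i\<le>N. monom (complex_of_real (u (rep (v ^ i)))) i)"
  obtain j where j: "j <= N" "w = rep (v ^ j)" using u(1) by (auto simp: S_def)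
  have "coeff p j = complex_of_real (u (rep (v ^ j)))"
   unfolding p_def coeff_sum using j(1) by simp
  then have "p ~= 0" using u(2) j by auto
  moreover have "(\<Sum>i\<le>N. u (rep (v ^ i)) *\<^sub>R rep (v ^ i)) = 0"
   using u(3) True unfolding S_def by (simp add: sum.reindex)
  then have "rep (\<Sum>i\<le>N. u (rep (v ^ i)) *\<^sub>R v ^ i) = rep 0" by simp
  then have "(\<Sum>i\<le>N. u (rep (v ^ i)) *\<^sub>R v ^ i) = 0" by (rule cmat_eqI)
  then have "pev p v = 0" by (simp add: p_def pev_sum pev_monom smat_of_real)
  ultimately show ?thesis by blast
 qed
qed

abbreviation factors :: "'n::finite cmat => complex list => 'n cmat" where
 "factors v ls \<equiv> foldr (%l A. (v - smat l) * A) ls 1"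

lemma pev_factors: "p ~= 0 ==> \<exists>c ls. c ~= 0 & pev p v = smat c * factors v ls"
proof (induction "degree p" arbitrary: p)
 case 0
 then obtain c where "p = [:c:]" by (metis degree_eq_zeroE)
 then show ?case using 0 by (intro exI[of _ c] exI[of _ "[]"]) auto
next
 case (Suc n)
 then have "\<not> constant (poly p)" by (simp add: constant_degree)
 then obtain l where "poly p l = 0" using fundamental_theorem_of_algebra by blast
 then obtain q where q: "p = [:- l, 1:] * q" by (auto simp: poly_eq_0_iff_dvd)
 have "q ~= 0" using Suc q by auto
 moreover have "degree q = n" using Suc(2) \<open>q ~= 0\<close> unfolding q by (subst (asm) degree_mult_eq) auto
 ultimately obtain c ls where "c ~= 0" "pev q v = smat c * factors v ls" using Suc(1) by blast
 then show ?case unfolding q pev_linear_factor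
  by (intro exI[of _ c] exI[of _ "l # ls"]) (simp add: smat_left_commute)
qed

lemma linear_commute: "(v - smat a) * (v - smat l) = (v - smat l) * (v - smat a)"
 by (simp add: algebra_simps smat_central[of v] smat_central[of "smat a" l])

lemma factors_commute: "factors v ls * (v - smat l) = (v - smat l) * factors v ls"
proof (induction ls)
 case (Cons a ls)
 note 1 = linear_commute[of v a l]
 have "factors v (a # ls) * (v - smat l) = (v - smat a) * (factors v ls * (v - smat l))" by (simp add: mult.assoc)
 also have "... = ((v - smat a) * (v - smat l)) * factors v ls" unfolding Cons by (simp only: mult.assoc)
 also have "... = (v - smat l) * factors v (a # ls)" unfolding 1 by (simp only: mult.assoc foldr.simps o_apply)
 finally show ?case .
qed simp

lemma factors_Cons_remove:
 "l \<in> set ls ==> factors v ls = (v - smat l) * factors v (remove1 l ls)"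
proof (induction ls)
 case (Cons a ls)
 show ?case
 proof (cases "a = l")
  case False
  then have "factors v (a # ls) = (v - smat a) * ((v - smat l) * factors v (remove1 l ls))" using Cons by simp
  also have "... = ((v - smat l) * (v - smat a)) * factors v (remove1 l ls)"
   unfolding linear_commute[of v l a] by (simp only: mult.assoc)
  finally show ?thesis using False by (simp add: mult.assoc)
 qed simp
qed simp

text \<open>In a shortest vanishing product, dropping a factor v - l leaves a nonzero matrix u with
  v u = l u. Hence all roots are eigenvalues, with a nonzero matrix in place of an
  eigenvector.\<close>

lemma annihilating_factors:
 "\<exists>ls. factors (v :: 'n::finite cmat) ls = 0 & (\<forall>l\<in>set ls. \<exists>u\<noteq>0. v * u = smat l * u)"
proof -
 obtain p where "p ~= 0" "pev p v = 0" using annihilating_poly by blast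
 then obtain c ls where "c ~= 0" "smat c * factors v ls = 0" using pev_factors by metis
 then have "smat (1 / c) * (smat c * factors v ls) = 0" by simp
 then have ex: "factors v ls = 0" using \<open>c ~= 0\<close> by (simp add: mult.assoc[symmetric] smat_mult[symmetric] smat_simps)
 define n where "n = (LEAST n. \<exists>ls. length ls = n & factors v ls = 0)"
 have "\<exists>ls. length ls = n & factors v ls = 0" unfolding n_def by (rule LeastI) (use ex in blast)
 then obtain ms where ms: "length ms = n" "factors v ms = 0" by blast
 have "\<exists>u\<noteq>0. v * u = smat l * u" if l: "l \<in> set ms" for l
 proof (rule exI[of _ "factors v (remove1 l ms)"], rule conjI)
  have "length (remove1 l ms) < n" using l ms(1) by (metis length_pos_if_in_set length_remove1 diff_less zero_less_one)
  then show "factors v (remove1 l ms) ~= 0" using not_less_Least unfolding n_def by blast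
  show "v * factors v (remove1 l ms) = smat l * factors v (remove1 l ms)"
   using factors_Cons_remove[OF l, of v] ms(2) by (simp add: left_diff_distrib)
 qed
 then show ?thesis using ms(2) by blast
qed

lemma eigenvalue_norm: assumes "u ~= 0" "v * u = smat l * (u :: 'n::finite cmat)" shows "cmod l <= norm v"
proof -
 have "cmod l * norm u = norm (smat l * u)"
 proof (cases "l = 0")
  case False
  have "norm (smat l * u) <= cmod l * norm u" using norm_mult_ineq[of "smat l" u] by (simp add: norm_smat)
  moreover have "norm u <= norm (smat (1 / l) :: 'n cmat) * norm (smat l * u)"
   using norm_mult_ineq[of "smat (1 / l)" "smat l * u"] False by (simp add: mult.assoc[symmetric] smat_mult[symmetric] smat_simps)
  then have "cmod l * norm u <= norm (smat l * u)" using False by (simp add: norm_smat norm_divide field_simps)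
  ultimately show ?thesis by simp
 qed (simp add: smat_simps)
 also have "... <= norm v * norm u" using assms(2) norm_mult_ineq[of v u] by simp
 finally show ?thesis using assms(1) by simp
qed

text \<open>Variation of constants, one factor at a time: G' - l G is an exponential polynomial by
  induction, so multiplying by exp(- l s), integrating, and multiplying back adds only the frequency
  l.\<close>

lemma exp_factors_epoly:
 "factors v ls * u = 0 ==> (%s. ent (exp (smat s * v) * u) i j) \<in> epoly (set ls)"
proof (induction ls arbitrary: u)
 case Nil
 then show ?case using epoly.zero by (simp del: rep_simps(6))
next
 case (Cons l ls)
 define w where "w = (v - smat l) * u"
 have "factors v ls * w = 0"
  using Cons.prems factors_commute[of v ls l] unfolding w_def by (simp add: mult.assoc[symmetric])
 then have IH: "(%s. ent (exp (smat s * v) * w) i j) \<in> epoly (set ls)" by (rule Cons.IH)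
 define G where "G s = ent (exp (smat s * v) * u) i j" for s
 define H where "H s = ent (exp (smat s * v) * v * u) i j" for s
 define W where "W s = ent (exp (smat s * v) * w) i j" for s
 have dG: "(G has_field_derivative H s) (at s)" for s
  using has_field_derivative_exp_ent[of 1 v u i j s] unfolding G_def H_def by simp
 have w: "W s = H s - l * G s" for s
 proof -
  have "exp (smat s * v) * w = exp (smat s * v) * v * u - smat l * (exp (smat s * v) * u)"
   by (simp add: w_def algebra_simps smat_left_commute)
  then show ?thesis unfolding G_def H_def W_def by (simp only: rep_simps(4) vector_minus_component ent_smat_mult)
 qed
 have IH': "W \<in> epoly (set ls)" using IH by (simp only: W_def[abs_def])
 have "(%s. W s * (poly 1 s * exp (- l * s))) \<in> epoly ((%\<mu>. \<mu> - l) ` set ls)"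
  by (rule epoly_mult_term[OF IH']) auto
 from epoly_antideriv[OF this] obtain F where F: "F \<in> epoly ((%\<mu>. \<mu> - l) ` set ls)"
  "!!s. (F has_field_derivative W s * exp (- l * s)) (at s)" by auto
 have "((%s. G s * exp (- l * s) - F s) has_field_derivative 0) (at s)" for s
  by (auto intro!: derivative_eq_intros dG F(2) simp: w algebra_simps)
 then have "\<exists>c. \<forall>s\<in>UNIV. G s * exp (- l * s) - F s = c"
  by (intro has_field_derivative_zero_constant) auto
 then obtain c where c: "!!s. G s * exp (- l * s) - F s = c" by auto
 have "G s = F s * (poly 1 s * exp (l * s)) + poly [:c:] s * exp (l * s)" for s
 proof -
  have "G s * exp (- l * s) = F s + c" using c[of s] unfolding diff_eq_eq by (simp only: add.commute)
  then have "G s * (exp (- l * s) * exp (l * s)) = (F s + c) * exp (l * s)" by (simp add: mult.assoc[symmetric])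
  then show ?thesis by (simp add: exp_minus algebra_simps)
 qed
 then have "G = (%s. F s * (poly 1 s * exp (l * s)) + poly [:c:] s * exp (l * s))" by blast
 moreover have "(%s. F s * (poly 1 s * exp (l * s))) \<in> epoly (set (l # ls))"
  by (rule epoly_mult_term[OF F(1)]) auto
 moreover have "(%s. poly [:c:] s * exp (l * s)) \<in> epoly (set (l # ls))" by (rule epoly_term) simp
 ultimately have "G \<in> epoly (set (l # ls))" by (simp only: epoly_add)
 then show ?case by (simp add: G_def[abs_def])
qed

lemma exp_epoly:
 obtains \<Lambda> where "finite \<Lambda>" "!!l. l \<in> \<Lambda> ==> \<exists>u\<noteq>0. v * u = smat l * (u :: 'n::finite cmat)"
  "!!i j. (%s. ent (exp (smat s * v)) i j) \<in> epoly \<Lambda>"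
proof -
 from annihilating_factors[of v]
 obtain ls where ls: "factors v ls = 0" "\<forall>l\<in>set ls. \<exists>u\<noteq>0. v * u = smat l * u"
  by (elim exE conjE)
 show ?thesis
 proof (rule that[of "set ls"])
  show "(%s. ent (exp (smat s * v)) i j) \<in> epoly (set ls)" for i j
   using exp_factors_epoly[of v ls 1 i j] ls(1) by (simp del: rep_simps)
 qed (use ls(2) in auto)
qed

section \<open>Polynomial equations along one-parameter groups\<close>

lemma poly_fun_epoly:
 assumes "p \<in> poly_fun UNIV"
  and S: "0 \<in> S" "!!\<mu> \<nu>. \<mu> \<in> S ==> \<nu> \<in> S ==> \<mu> + \<nu> \<in> S"
  and M: "!!i j. (%s. M s $ i $ j) \<in> epoly S"
 shows "(%s. p (M s)) \<in> epoly S"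
 using assms(1)
proof (induction rule: poly_fun.induct)
 case (mult p q)
 then show ?case by (intro epoly_mult[of _ S _ S] S(2)) auto
qed (auto intro: epoly_const S M epoly_add)

text \<open>The number d plays the role of the degree: imaginary parts of frequencies grow at most
  by that factor. The bound depends only on the polynomial, not on the curve, as
  \<open>alg_sub_log\<close> requires.\<close>

lemma poly_fun_epoly_strip:
 fixes p :: "complex^'n^'n => complex"
 assumes "p \<in> poly_fun UNIV"
 shows "\<exists>d::nat. \<forall>c\<ge>0. \<forall>M :: complex => complex^'n^'n. (\<forall>i j. (%s. M s $ i $ j) \<in> epoly {\<mu>. \<bar>Im \<mu>\<bar> <= c}) -->
   (%s. p (M s)) \<in> epoly {\<mu>. \<bar>Im \<mu>\<bar> <= real d * c}"
 using assms
proof (induction rule: poly_fun.induct)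
 case (const c)
 show ?case by (intro exI[of _ 0]) (auto intro!: epoly_const)
next
 case (entry i j)
 show ?case by (intro exI[of _ 1]) auto
next
 case (add p q)
 then obtain d e where de: "!!c (M :: complex => complex^'n^'n). c >= 0 ==> (\<forall>i j. (%s. M s $ i $ j) \<in> epoly {\<mu>. \<bar>Im \<mu>\<bar> <= c}) ==> (%s. p (M s)) \<in> epoly {\<mu>. \<bar>Im \<mu>\<bar> <= real d * c}"
  "!!c (M :: complex => complex^'n^'n). c >= 0 ==> (\<forall>i j. (%s. M s $ i $ j) \<in> epoly {\<mu>. \<bar>Im \<mu>\<bar> <= c}) ==> (%s. q (M s)) \<in> epoly {\<mu>. \<bar>Im \<mu>\<bar> <= real e * c}" by blast
 have mono: "{\<mu>. \<bar>Im \<mu>\<bar> <= real d * c} \<subseteq> {\<mu>. \<bar>Im \<mu>\<bar> <= real (d + e) * c}" "{\<mu>. \<bar>Im \<mu>\<bar> <= real e * c} \<subseteq> {\<mu>. \<bar>Im \<mu>\<bar> <= real (d + e) * c}" if "c >= 0" for c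
  using that by (auto simp: distrib_right intro: order_trans)
 show ?case
 proof (intro exI[of _ "d + e"] allI impI)
  fix c :: real and M :: "complex => complex^'n^'n" assume c: "c >= 0" and M: "\<forall>i j. (%s. M s $ i $ j) \<in> epoly {\<mu>. \<bar>Im \<mu>\<bar> <= c}"
  show "(%s. p (M s) + q (M s)) \<in> epoly {\<mu>. \<bar>Im \<mu>\<bar> <= real (d + e) * c}"
   by (rule epoly_add[OF epoly_mono[OF de(1)[OF c M] mono(1)[OF c]] epoly_mono[OF de(2)[OF c M] mono(2)[OF c]]])
 qed
next
 case (mult p q)
 then obtain d e where de: "!!c (M :: complex => complex^'n^'n). c >= 0 ==> (\<forall>i j. (%s. M s $ i $ j) \<in> epoly {\<mu>. \<bar>Im \<mu>\<bar> <= c}) ==> (%s. p (M s)) \<in> epoly {\<mu>. \<bar>Im \<mu>\<bar> <= real d * c}"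
  "!!c (M :: complex => complex^'n^'n). c >= 0 ==> (\<forall>i j. (%s. M s $ i $ j) \<in> epoly {\<mu>. \<bar>Im \<mu>\<bar> <= c}) ==> (%s. q (M s)) \<in> epoly {\<mu>. \<bar>Im \<mu>\<bar> <= real e * c}" by blast
 show ?case
 proof (intro exI[of _ "d + e"] allI impI)
  fix c :: real and M :: "complex => complex^'n^'n" assume c: "c >= 0" and M: "\<forall>i j. (%s. M s $ i $ j) \<in> epoly {\<mu>. \<bar>Im \<mu>\<bar> <= c}"
  show "(%s. p (M s) * q (M s)) \<in> epoly {\<mu>. \<bar>Im \<mu>\<bar> <= real (d + e) * c}"
   by (rule epoly_mult[OF de(1)[OF c M] de(2)[OF c M]]) (auto simp: distrib_right)
 qed
qed

lemma invertible_exp: "invertible (rep (exp v))"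
 using exp_inverse_cmat[of v] unfolding invertible_def
 by (metis rep_simps(2) rep_simps(6))

lemma exp_zero_locus:
 assumes P: "P \<subseteq> poly_fun UNIV" and \<Lambda>: "!!i j. (%s. ent (exp (smat s * v)) i j) \<in> epoly \<Lambda>" "\<Lambda> \<subseteq> S"
  and S: "0 \<in> S" "!!\<mu> \<nu>. \<mu> \<in> S ==> \<nu> \<in> S ==> \<mu> + \<nu> \<in> S"
  and inj: "inj_on (%\<mu>. exp (\<mu> * t)) S" "t ~= 0"
  and z: "!!k::nat. rep (exp (smat (of_nat k * t) * v)) \<in> zero_locus P"
 shows "rep (exp (smat s * v)) \<in> zero_locus P"
proof -
 have "p (rep (exp (smat s * v))) = 0" if p: "p \<in> P" for p
 proof (rule epoly_zero[where f="%s. p (rep (exp (smat s * v)))" and s=s, OF _ inj])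
  show "(%s. p (rep (exp (smat s * v)))) \<in> epoly S"
   by (rule poly_fun_epoly[OF subsetD[OF P p] S epoly_mono[OF \<Lambda>]])
  show "p (rep (exp (smat (of_nat k * t) * v))) = 0" for k :: nat
   using z[of k] p by (auto simp: zero_locus_def)
 qed
 then show ?thesis by (simp add: zero_locus_def invertible_exp)
qed

text \<open>The exponential is injective on the real line, so for real eigenvalues the step 1
  already separates the frequencies.\<close>

lemma exp_zero_locus_real:
 assumes P: "P \<subseteq> poly_fun UNIV" and r: "!!l u. u ~= 0 ==> v * u = smat l * u ==> l \<in> \<real>"
  and z: "!!k::nat. rep (exp (smat (of_nat k) * v)) \<in> zero_locus P"
 shows "rep (exp (smat s * v)) \<in> zero_locus P"
proof -
 obtain \<Lambda> where "finite \<Lambda>" and \<Lambda>: "!!l. l \<in> \<Lambda> ==> \<exists>u\<noteq>0. v * u = smat l * u" "!!i j. (%s. ent (exp (smat s * v)) i j) \<in> epoly \<Lambda>"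
  using exp_epoly[of v] by metis
 have sub: "\<Lambda> \<subseteq> \<real>"
 proof
  fix l assume "l \<in> \<Lambda>"
  then obtain u where "u ~= 0" "v * u = smat l * u" using \<Lambda>(1) by blast
  then show "l \<in> \<real>" by (rule r)
 qed
 have inj: "inj_on (%\<mu>::complex. exp (\<mu> * 1)) \<real>"
  by (auto simp: inj_on_def Reals_def exp_of_real)
 show ?thesis
  by (rule exp_zero_locus[OF P \<Lambda>(2) sub Reals_0 Reals_add inj]) (use z in simp_all)
qed

text \<open>The frequencies of polynomials along exp(s v) lie in the countable additive monoid
  generated by the eigenvalues. Two distinct frequencies are confused by countably many t only, so
  one countable exceptional set serves for all systems \<open>P\<close>.\<close>

lemma exp_zero_locus_generic:
 "\<exists>B :: real set. countable B & (\<forall>t P. t \<notin> B --> P \<subseteq> poly_fun UNIV -->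
   (\<forall>k::nat. rep (exp (smat (of_nat k * of_real t) * (v :: 'n::finite cmat))) \<in> zero_locus P) -->
   (\<forall>s. rep (exp (smat s * v)) \<in> zero_locus P))"
proof -
 obtain \<Lambda> where \<Lambda>': "finite \<Lambda>" "!!l. l \<in> \<Lambda> ==> \<exists>u\<noteq>0. v * u = smat l * u" "!!i j. (%s. ent (exp (smat s * v)) i j) \<in> epoly \<Lambda>"
  using exp_epoly[of v] by metis
 note \<Lambda> = \<Lambda>'(1,3)
 define S where "S = sum_list ` lists \<Lambda>"
 have S: "0 \<in> S" "!!\<mu> \<nu>. \<mu> \<in> S ==> \<nu> \<in> S ==> \<mu> + \<nu> \<in> S" "\<Lambda> \<subseteq> S" "countable S"
 proof -
  show "0 \<in> S" unfolding S_def by (rule image_eqI[of _ _ "[]"]) auto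
  show "\<mu> + \<nu> \<in> S" if mn: "\<mu> \<in> S" "\<nu> \<in> S" for \<mu> \<nu>
  proof -
   obtain xs ys where "xs \<in> lists \<Lambda>" "ys \<in> lists \<Lambda>" "\<mu> = sum_list xs" "\<nu> = sum_list ys" using mn unfolding S_def by blast
   then show ?thesis unfolding S_def by (intro image_eqI[of _ _ "xs @ ys"]) auto
  qed
  show "\<Lambda> \<subseteq> S" unfolding S_def by (auto intro!: image_eqI[of _ _ "[_]"])
  show "countable S" unfolding S_def using \<Lambda>(1) by (intro countable_image countable_lists countable_finite)
 qed
 define B where "B = insert 0 (\<Union>(\<mu>, \<nu>)\<in>S \<times> S. {t::real. \<mu> ~= \<nu> & exp (\<mu> * of_real t) = exp (\<nu> * of_real t)})"
 have "countable {t::real. \<mu> ~= \<nu> & exp (\<mu> * of_real t) = exp (\<nu> * of_real t)}" for \<mu> \<nu> :: complex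
 proof -
  have "{t::real. \<mu> ~= \<nu> & exp (\<mu> * of_real t) = exp (\<nu> * of_real t)} \<subseteq> range (%n::int. Re (of_int (2 * n) * of_real pi * \<i> / (\<mu> - \<nu>)))"
  proof
   fix t :: real assume "t \<in> {t::real. \<mu> ~= \<nu> & exp (\<mu> * of_real t) = exp (\<nu> * of_real t)}"
   then obtain n :: int where "\<mu> ~= \<nu>" "\<mu> * of_real t = \<nu> * of_real t + of_int (2 * n) * of_real pi * \<i>"
    by (auto simp: exp_eq)
   then have "of_real t = of_int (2 * n) * of_real pi * \<i> / (\<mu> - \<nu>)" by (simp add: field_simps)
   then have "t = Re (of_int (2 * n) * of_real pi * \<i> / (\<mu> - \<nu>))" by (metis Re_complex_of_real)
   then show "t \<in> range (%n::int. Re (of_int (2 * n) * of_real pi * \<i> / (\<mu> - \<nu>)))" by blast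
  qed
  then show ?thesis by (rule countable_subset) simp
 qed
 then have cB: "countable B" unfolding B_def using S(4) by (intro countable_insert countable_UN) auto
 have loc: "rep (exp (smat s * v)) \<in> zero_locus P"
  if "t \<notin> B" "P \<subseteq> poly_fun UNIV" "\<forall>k::nat. rep (exp (smat (of_nat k * of_real t) * v)) \<in> zero_locus P" for t P s
 proof (rule exp_zero_locus[OF that(2) \<Lambda>(2) S(3,1,2), of "of_real t"])
  show "inj_on (%\<mu>. exp (\<mu> * complex_of_real t)) S" using that(1) unfolding B_def inj_on_def by blast
  show "complex_of_real t ~= 0" using that(1) by (auto simp: B_def)
 qed (use that in auto)
 show ?thesis
 proof (intro exI[of _ B] conjI allI impI)
  show "countable B" by (rule cB)
 qed (rule loc; assumption)
qed

section \<open>Noetherianity of the Zariski topology\<close>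

text \<open>Rings and ideals are subsets of one ambient ring of functions, so that adjoining another
  coordinate function stays within the same type.\<close>

definition subring_set :: "'r::comm_ring_1 set => bool" where
 "subring_set A \<longleftrightarrow> 0 \<in> A & 1 \<in> A & (\<forall>a\<in>A. \<forall>b\<in>A. a + b \<in> A & a * b \<in> A) & (\<forall>a\<in>A. - a \<in> A)"

inductive_set idl :: "'r::comm_ring_1 set => 'r set => 'r set" for A F where
 zero: "0 \<in> idl A F"
| step: "h \<in> idl A F ==> a \<in> A ==> f \<in> F ==> h + a * f \<in> idl A F"

definition noetherian_set :: "'r::comm_ring_1 set => bool" where
 "noetherian_set A \<longleftrightarrow> (\<forall>P\<subseteq>A. \<exists>F\<subseteq>P. finite F & P \<subseteq> idl A F)"

lemma subring_sum: "subring_set A ==> (!!i. i \<in> S ==> f i \<in> A) ==> sum f S \<in> A"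
 by (induction S rule: infinite_finite_induct) (auto simp: subring_set_def)

lemma idl_add: "h \<in> idl A F ==> k \<in> idl A F ==> h + k \<in> idl A F"
proof (induction rule: idl.induct)
 case (step h a f)
 from idl.step[OF step.IH[OF step.prems] step.hyps(2,3)] show ?case by (simp add: algebra_simps)
qed simp

lemma idl_mult: assumes "subring_set A" "h \<in> idl A F" "b \<in> A" shows "b * h \<in> idl A F"
 using assms(2)
proof (induction rule: idl.induct)
 case (step h a f)
 have "b * a \<in> A" using assms(1,3) step.hyps(2) by (simp add: subring_set_def)
 from idl.step[OF step.IH this step.hyps(3)] show ?case by (simp add: algebra_simps)
qed (simp add: idl.zero)

lemma idl_gen: assumes "subring_set A" "f \<in> F" shows "f \<in> idl A F"
 using idl.step[OF idl.zero, of 1 A f F] assms by (simp add: subring_set_def)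

lemma idl_minus: "subring_set A ==> h \<in> idl A F ==> - h \<in> idl A F"
 using idl_mult[of A h F "- 1"] by (simp add: subring_set_def)

lemma idl_sum: "(!!i. i \<in> S ==> f i \<in> idl A F) ==> sum f S \<in> idl A F"
 by (induction S rule: infinite_finite_induct) (auto simp: idl.zero idl_add)

lemma idl_mono: assumes "F \<subseteq> G" "h \<in> idl A F" shows "h \<in> idl A G"
 using assms(2) by (induction rule: idl.induct) (use assms(1) in \<open>auto intro: idl.intros\<close>)

lemma idl_trans: assumes A: "subring_set A" and G: "G \<subseteq> idl A F" and h: "h \<in> idl A G" shows "h \<in> idl A F"
 using h
proof (induction rule: idl.induct)
 case (step h a f)
 have "f \<in> idl A F" using step.hyps(3) G by (rule subsetD[rotated])
 from idl_add[OF step.IH idl_mult[OF A this step.hyps(2)]] show ?case .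
qed (rule idl.zero)

lemma idl_finite: "h \<in> idl A P ==> \<exists>F\<subseteq>P. finite F & h \<in> idl A F"
proof (induction rule: idl.induct)
 case (step h a f)
 then obtain F where F: "F \<subseteq> P" "finite F" "h \<in> idl A F" by (elim exE conjE)
 have "h \<in> idl A (insert f F)" by (rule idl_mono[OF _ F(3)]) auto
 from idl.step[OF this step.hyps(2), of f] show ?case
  using F step.hyps(3) by (intro exI[of _ "insert f F"]) auto
qed (auto intro: idl.zero)

lemma idl_finite_set: assumes "finite G" "G \<subseteq> idl A P" shows "\<exists>F\<subseteq>P. finite F & G \<subseteq> idl A F"
 using assms
proof (induction rule: finite_induct)
 case (insert g G)
 then obtain F where F: "F \<subseteq> P" "finite F" "G \<subseteq> idl A F" by (elim meta_impE exE conjE) auto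
 obtain F' where F': "F' \<subseteq> P" "finite F'" "g \<in> idl A F'" using idl_finite[of g A P] insert.prems by auto
 have "G \<subseteq> idl A (F \<union> F')" using F(3) idl_mono[of F "F \<union> F'" _ A] by auto
 moreover have "g \<in> idl A (F \<union> F')" by (rule idl_mono[OF _ F'(3)]) auto
 ultimately show ?case using F F' by (intro exI[of _ "F \<union> F'"]) auto
qed auto

lemma idl_image_sum:
 assumes A: "subring_set A" and h: "h \<in> idl A (g ` {..<N::nat})"
 shows "\<exists>c. (\<forall>j. c j \<in> A) & h = (\<Sum>j<N. c j * g j)"
 using h
proof (induction rule: idl.induct)
 case zero
 show ?case using A by (intro exI[of _ "%_. 0"]) (auto simp: subring_set_def)
next
 case (step h a f)
 then obtain c where c: "!!j. c j \<in> A" "h = (\<Sum>j<N. c j * g j)" by auto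
 obtain k where k: "k < N" "f = g k" using step.hyps(3) by auto
 define c' where "c' j = c j + (if j = k then a else 0)" for j
 have "(\<Sum>j<N. c' j * g j) = (\<Sum>j<N. c j * g j) + (\<Sum>j<N. if j = k then a * g j else 0)"
  unfolding sum.distrib[symmetric] by (rule sum.cong) (auto simp: c'_def algebra_simps)
 then have "h + a * f = (\<Sum>j<N. c' j * g j)" using c(2) k by simp
 moreover have "c' j \<in> A" for j using A c(1) step.hyps(2) by (auto simp: c'_def subring_set_def)
 ultimately show ?case by blast
qed

definition adjoin :: "'r::comm_ring_1 set => 'r => 'r set" where
 "adjoin A x = {poly q x | q. \<forall>i. coeff q i \<in> A}"

lemma subring_adjoin: assumes A: "subring_set A" shows "subring_set (adjoin A x)"
proof -
 have z: "0 \<in> A" "1 \<in> A" using A by (auto simp: subring_set_def)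
 have add: "a + b \<in> adjoin A x & a * b \<in> adjoin A x" if "a \<in> adjoin A x" "b \<in> adjoin A x" for a b
 proof -
  from that obtain p q where p: "a = poly p x" "\<forall>i. coeff p i \<in> A" and q: "b = poly q x" "\<forall>i. coeff q i \<in> A"
   by (auto simp: adjoin_def)
  have "\<forall>i. coeff (p + q) i \<in> A" using A p(2) q(2) by (simp add: subring_set_def)
  moreover have "\<forall>i. coeff (p * q) i \<in> A"
  proof
   fix i show "coeff (p * q) i \<in> A" unfolding coeff_mult
    by (rule subring_sum[OF A]) (use A p(2) q(2) in \<open>simp add: subring_set_def\<close>)
  qed
  ultimately show ?thesis unfolding adjoin_def p(1) q(1)
   by (intro conjI CollectI exI[of _ "p + q"] exI[of _ "p * q"]) simp_all
 qed
 have neg: "- a \<in> adjoin A x" if "a \<in> adjoin A x" for a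
 proof -
  from that obtain p where p: "a = poly p x" "\<forall>i. coeff p i \<in> A" by (auto simp: adjoin_def)
  have "\<forall>i. coeff (- p) i \<in> A" using A p(2) by (simp add: subring_set_def)
  then show ?thesis unfolding adjoin_def p(1) by (intro CollectI exI[of _ "- p"]) simp
 qed
 have "0 \<in> adjoin A x" unfolding adjoin_def using z by (intro CollectI exI[of _ 0]) simp
 moreover have "1 \<in> adjoin A x" unfolding adjoin_def
  using z by (intro CollectI exI[of _ "[:1:]"]) (auto simp: coeff_pCons split: nat.split)
 ultimately show ?thesis using add neg by (auto simp: subring_set_def)
qed

lemma adjoin_base: "subring_set A ==> a \<in> A ==> a \<in> adjoin A x"
 unfolding adjoin_def by (intro CollectI exI[of _ "[:a:]"]) (auto simp: coeff_pCons subring_set_def split: nat.split)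

lemma adjoin_elem: "subring_set A ==> x \<in> adjoin A x"
 unfolding adjoin_def by (intro CollectI exI[of _ "[:0, 1:]"]) (auto simp: coeff_pCons subring_set_def split: nat.split)

text \<open>The Hilbert basis theorem for A[x] with x not assumed transcendental: elements are
  represented by polynomials over A, and the usual choice of minimal degree is made among
  representatives.\<close>

lemma noetherian_adjoin:
 assumes A: "subring_set A" and N: "noetherian_set A"
 shows "noetherian_set (adjoin A x)"
 unfolding noetherian_set_def
proof (intro allI impI, rule ccontr)
 fix P assume P: "P \<subseteq> adjoin A x" and no: "\<not> (\<exists>F\<subseteq>P. finite F & P \<subseteq> idl (adjoin A x) F)"
 let ?B = "adjoin A x"
 have B: "subring_set ?B" by (rule subring_adjoin[OF A])
 define I where "I = idl ?B P"
 have IB: "h \<in> ?B" if "h \<in> I" for h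
  using that unfolding I_def by (induction rule: idl.induct) (use B P in \<open>auto simp: subring_set_def\<close>)
 have notfg: "\<exists>h\<in>I. h \<notin> idl ?B G" if G: "finite G" "G \<subseteq> I" for G
 proof (rule ccontr)
  assume "\<not> ?thesis"
  then have *: "I \<subseteq> idl ?B G" by blast
  obtain F where F: "F \<subseteq> P" "finite F" "G \<subseteq> idl ?B F" using idl_finite_set[OF G[unfolded I_def]] by blast
  have "P \<subseteq> idl ?B F"
  proof
   fix p assume "p \<in> P"
   then have "p \<in> I" unfolding I_def by (rule idl_gen[OF B])
   then show "p \<in> idl ?B F" using * idl_trans[OF B F(3)] by blast
  qed
  then show False using no F by blast
 qed
 \<comment> \<open>Polynomials whose value lies in the ideal but outside what \<open>G\<close>
   generates; the degree refers to the polynomial, not to its value.\<close>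
 define good where "good G q \<longleftrightarrow> (\<forall>i. coeff q i \<in> A) & poly q x \<in> I & poly q x \<notin> idl ?B G" for G q
 have ex: "\<exists>q. good G q" if G: "finite G" "G \<subseteq> I" for G
 proof -
  obtain h where h: "h \<in> I" "h \<notin> idl ?B G" using notfg[OF G] by blast
  obtain q where "h = poly q x" "\<forall>i. coeff q i \<in> A" using IB[OF h(1)] by (auto simp: adjoin_def)
  then show ?thesis using h by (intro exI[of _ q]) (simp add: good_def)
 qed
 define pick where "pick G = arg_min degree (good G)" for G
 have pick: "good G (pick G)" "!!q. good G q ==> degree (pick G) <= degree q" if G: "finite G" "G \<subseteq> I" for G
 proof -
  obtain q0 where "good G q0" using ex[OF G] by blast
  then show "good G (pick G)" unfolding pick_def by (rule arg_min_natI)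
  show "!!q. good G q ==> degree (pick G) <= degree q" unfolding pick_def by (rule arg_min_nat_le)
 qed
 \<comment> \<open>The recursion keeps the list of all earlier choices, since each choice depends on
   every one of them.\<close>
 define fs where "fs = rec_nat [] (%_ l. l @ [pick ((%q. poly q x) ` set l)])"
 define q where "q n = pick ((%q. poly q x) ` set (fs n))" for n
 have fs: "fs 0 = []" "!!n. fs (Suc n) = fs n @ [q n]" by (simp_all add: fs_def q_def)
 define ev where "ev n = poly (q n) x" for n
 have set_fs: "set (fs n) = q ` {..<n}" for n by (induction n) (auto simp: fs lessThan_Suc)
 have q_eq: "q n = pick (ev ` {..<n})" for n
  unfolding q_def[of n] set_fs image_image ev_def ..
 have evI: "ev ` {..<n} \<subseteq> I" for n
 proof (induction n)
  case (Suc n)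
  have "good (ev ` {..<n}) (q n)" unfolding q_eq[of n] by (rule pick(1)) (use Suc in auto)
  then have "ev n \<in> I" by (simp add: good_def ev_def)
  then show ?case using Suc by (simp add: lessThan_Suc)
 qed simp
 have good: "good (ev ` {..<n}) (q n)" for n
  unfolding q_eq[of n] by (rule pick(1)) (use evI in auto)
 have minimal: "degree (q n) <= degree r" if "good (ev ` {..<n}) r" for n r
  unfolding q_eq[of n] by (rule pick(2)) (use evI that in auto)
 have mono: "degree (q j) <= degree (q n)" if "j <= n" for j n
 proof (rule minimal)
  have "ev ` {..<j} \<subseteq> ev ` {..<n}" using that by auto
  then have "poly (q n) x \<notin> idl ?B (ev ` {..<j})" using good[of n] idl_mono[of "ev ` {..<j}" "ev ` {..<n}" _ ?B] by (auto simp: good_def)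
  then show "good (ev ` {..<j}) (q n)" using good[of n] by (simp add: good_def)
 qed
 define a where "a n = lead_coeff (q n)" for n
 have "range a \<subseteq> A" using good by (auto simp: a_def good_def)
 from N[unfolded noetherian_set_def, rule_format, OF this]
 obtain F where F: "F \<subseteq> range a" "finite F" "range a \<subseteq> idl A F" by (elim exE conjE)
 obtain K where K: "finite K" "F = a ` K" using finite_subset_image[OF F(2,1)] by blast
 obtain n where n: "K \<subseteq> {..<n}" using finite_nat_bounded[OF K(1)] by blast
 have "a n \<in> idl A (a ` {..<n})"
  by (rule idl_mono[of F]) (use K n F(3) in auto)
 from idl_image_sum[OF A this] obtain c where c: "!!j. c j \<in> A" "a n = (\<Sum>j<n. c j * a j)" by auto
 define D where "D j = degree (q n) - degree (q j)" for j
 \<comment> \<open>The leading coefficient of \<open>q n\<close> is a combination of the earlier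
   ones; subtracting the matching shifts cancels it. The value of \<open>r\<close> remains outside
   the generated ideal, contradicting the minimality of the degree of \<open>q n\<close>.\<close>
 define r where "r = q n - (\<Sum>j<n. monom (c j) (D j) * q j)"
 have cq: "coeff (q m) i \<in> A" for m i using good[of m] by (simp add: good_def)
 have mon: "coeff (monom (c j) (D j) * q j) i = (if i < D j then 0 else c j * coeff (q j) (i - D j))" for i j
  by (simp add: coeff_monom_mult)
 have rA: "coeff r i \<in> A" for i
 proof -
  have "coeff (monom (c j) (D j) * q j) i \<in> A" for j
   unfolding mon using A c(1) cq by (auto simp: subring_set_def)
  then have "(\<Sum>j<n. coeff (monom (c j) (D j) * q j) i) \<in> A" by (intro subring_sum[OF A])
  then have "coeff (q n) i + - (\<Sum>j<n. coeff (monom (c j) (D j) * q j) i) \<in> A" using A cq[of n i] by (simp add: subring_set_def del: add_uminus_conv_diff)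
  then show ?thesis by (simp add: r_def coeff_sum)
 qed
 have top: "coeff r (degree (q n)) = 0"
 proof -
  have "coeff (monom (c j) (D j) * q j) (degree (q n)) = c j * a j" if "j < n" for j
   using mono[of j n] that unfolding mon by (simp add: D_def a_def)
  then show ?thesis using c(2) by (simp add: r_def coeff_sum a_def)
 qed
 have deg: "degree r <= degree (q n)"
 proof -
  have "degree (monom (c j) (D j) * q j) <= degree (q n)" if "j < n" for j
  proof -
   have "degree (monom (c j) (D j) * q j) <= degree (monom (c j) (D j)) + degree (q j)" by (rule degree_mult_le)
   also have "... <= D j + degree (q j)" by (simp add: degree_monom_le)
   also have "... = degree (q n)" using mono[of j n] that by (simp add: D_def)
   finally show ?thesis .
  qed
  then have "degree (\<Sum>j<n. monom (c j) (D j) * q j) <= degree (q n)" by (intro degree_sum_le) auto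
  then show ?thesis unfolding r_def by (intro degree_diff_le) auto
 qed
 have sI: "(\<Sum>j<n. poly (monom (c j) (D j)) x * ev j) \<in> idl ?B (ev ` {..<n})"
 proof (rule idl_sum)
  fix j assume "j \<in> {..<n}"
  then have "ev j \<in> idl ?B (ev ` {..<n})" by (intro idl_gen[OF B]) auto
  moreover have "poly (monom (c j) (D j)) x \<in> ?B"
   unfolding adjoin_def using c(1) A by (intro CollectI exI[of _ "monom (c j) (D j)"]) (auto simp: subring_set_def)
  ultimately show "poly (monom (c j) (D j)) x * ev j \<in> idl ?B (ev ` {..<n})" by (rule idl_mult[OF B])
 qed
 have pr: "poly r x = ev n - (\<Sum>j<n. poly (monom (c j) (D j)) x * ev j)"
  by (simp add: r_def poly_sum ev_def)
 have "poly r x \<notin> idl ?B (ev ` {..<n})"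
 proof
  assume "poly r x \<in> idl ?B (ev ` {..<n})"
  from idl_add[OF this sI] have "ev n \<in> idl ?B (ev ` {..<n})" unfolding pr by simp
  then show False using good[of n] by (simp add: good_def ev_def)
 qed
 moreover have "poly r x \<in> I"
 proof -
  have "(\<Sum>j<n. poly (monom (c j) (D j)) x * ev j) \<in> I"
   unfolding I_def by (rule idl_trans[OF B evI[of n, unfolded I_def] sI])
  then have "- (\<Sum>j<n. poly (monom (c j) (D j)) x * ev j) \<in> I" unfolding I_def by (rule idl_minus[OF B])
  moreover have "ev n \<in> I" using good[of n] by (simp add: good_def ev_def)
  ultimately have "ev n + - (\<Sum>j<n. poly (monom (c j) (D j)) x * ev j) \<in> I" unfolding I_def by (intro idl_add)
  then show ?thesis unfolding pr by simp
 qed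
 ultimately have gr: "good (ev ` {..<n}) r" using rA by (simp add: good_def)
 have "r ~= 0" using gr idl.zero[of ?B "ev ` {..<n}"] by (auto simp: good_def)
 then have "degree r ~= degree (q n)" using top by (metis leading_coeff_0_iff)
 then have "degree r < degree (q n)" using deg by simp
 then show False using minimal[OF gr] by simp
qed

lemma noetherian_constants: "noetherian_set (range (%c (_::'x). c :: complex))"
 unfolding noetherian_set_def
proof (intro allI impI)
 fix P :: "('x => complex) set" assume P: "P \<subseteq> range (%c _. c)"
 show "\<exists>F\<subseteq>P. finite F & P \<subseteq> idl (range (%c _. c)) F"
 proof (cases "P \<subseteq> {0}")
  case True
  then show ?thesis using idl.zero by (intro exI[of _ "{}"]) auto
 next
  case False
  then obtain f where f: "f \<in> P" "f ~= 0" by auto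
  then obtain c where c: "f = (%_. c)" using P by auto
  have c0: "c ~= 0" using f(2) unfolding c by (auto simp: zero_fun_def)
  have "h \<in> idl (range (%c _. c)) {f}" if h: "h \<in> P" for h
  proof -
   obtain d where d: "h = (%_. d)" using P h by auto
   have "0 + (%_. d / c) * f \<in> idl (range (%c _. c)) {f}" by (rule idl.step[OF idl.zero]) auto
   moreover have "0 + (%_. d / c) * f = h" using c0 by (auto simp: c d fun_eq_iff)
   ultimately show ?thesis by simp
  qed
  then show ?thesis using f(1) by (intro exI[of _ "{f}"]) auto
 qed
qed

lemma subring_constants: "subring_set (range (%c (_::'x). c :: complex))"
 unfolding subring_set_def by (auto simp: zero_fun_def one_fun_def plus_fun_def times_fun_def fun_Compl_def)

text \<open>Starting from the constant functions, the finitely many entry functions are adjoined one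
  by one.\<close>

lemma noetherian_poly_fun:
 "\<exists>A. subring_set A & noetherian_set A & poly_fun UNIV \<subseteq> (A :: (complex^'n^'n => complex) set)"
proof -
 let ?e = "%(i, j) (X :: complex^'n^'n). X $ i $ j"
 have "\<exists>A. subring_set A & noetherian_set A & range (%c _. c) \<subseteq> A & ?e ` V \<subseteq> A" if "finite V" for V
  using that
 proof (induction rule: finite_induct)
  case empty
  then show ?case using subring_constants noetherian_constants by (intro exI[of _ "range (%c _. c)"]) auto
 next
  case (insert v V)
  then obtain A where A: "subring_set A" "noetherian_set A" "range (%c _. c) \<subseteq> A" "?e ` V \<subseteq> A" by (elim exE conjE)
  have "A \<subseteq> adjoin A (?e v)" using adjoin_base[OF A(1)] by blast
  then show ?case
   using A subring_adjoin[OF A(1), of "?e v"] noetherian_adjoin[OF A(1,2), of "?e v"] adjoin_elem[OF A(1), of "?e v"]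
   by (intro exI[of _ "adjoin A (?e v)"]) auto
 qed
 from this[of UNIV] obtain A where A: "subring_set A" "noetherian_set A" "range (%c _. c) \<subseteq> A" "range ?e \<subseteq> A" by auto
 have "p \<in> A" if "p \<in> poly_fun UNIV" for p
  using that
 proof (induction rule: poly_fun.induct)
  case (entry i j)
  then show ?case using A(4) by (auto dest!: subsetD[of _ _ "?e (i, j)"])
 next
  case (add p q)
  then have "p + q \<in> A" using A(1) by (simp add: subring_set_def)
  then show ?case by (simp add: plus_fun_def)
 next
  case (mult p q)
  then have "p * q \<in> A" using A(1) by (simp add: subring_set_def)
  then show ?case by (simp add: times_fun_def)
 qed (use A(3) in auto)
 then show ?thesis using A by blast
qed

lemma zero_locus_finite:
 fixes P :: "(complex^'n^'n => complex) set"
 assumes "P \<subseteq> poly_fun UNIV" shows "\<exists>F\<subseteq>P. finite F & zero_locus F = zero_locus P"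
proof -
 obtain A :: "(complex^'n^'n => complex) set" where A: "noetherian_set A" "poly_fun UNIV \<subseteq> A" using noetherian_poly_fun by blast
 have "P \<subseteq> A" using assms A(2) by blast
 from A(1)[unfolded noetherian_set_def, rule_format, OF this]
 obtain F where F: "F \<subseteq> P" "finite F" "P \<subseteq> idl A F" by (elim exE conjE)
 have "h X = 0" if "h \<in> idl A F" "\<forall>p\<in>F. p X = 0" for h X
  using that(1) by (induction rule: idl.induct) (use that(2) in auto)
 then have "zero_locus F \<subseteq> zero_locus P" using F(3) unfolding zero_locus_def by auto
 moreover have "zero_locus P \<subseteq> zero_locus F" using F(1) unfolding zero_locus_def by auto
 ultimately show ?thesis using F by blast
qed

text \<open>Finitely many equations cut out the intersection of the chain, and all of them already
  hold at some finite stage.\<close>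

lemma zariski_descending_chain:
 assumes C: "!!k::nat. closedin zariski (C k)" and d: "!!k. C (Suc k) \<subseteq> C k"
 shows "\<exists>k. C (Suc k) = C k"
proof -
 have dec: "C l \<subseteq> C k" if "k <= l" for k l using that d by (rule lift_Suc_antimono_le[rotated])
 have "\<forall>k. \<exists>P\<subseteq>poly_fun UNIV. C k = zero_locus P" using C by (simp add: closedin_zariski)
 then obtain P where P: "!!k. P k \<subseteq> poly_fun UNIV" "!!k. C k = zero_locus (P k)" by metis
 have "(\<Union>k. P k) \<subseteq> poly_fun UNIV" using P(1) by blast
 from zero_locus_finite[OF this] obtain F where F: "F \<subseteq> (\<Union>k. P k)" "finite F" "zero_locus F = zero_locus (\<Union>k. P k)" by blast
 have "\<forall>f\<in>F. \<exists>k. f \<in> P k" using F(1) by blast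
 then obtain \<kappa> where \<kappa>: "!!f. f \<in> F ==> f \<in> P (\<kappa> f)" by metis
 obtain n where n: "\<kappa> ` F \<subseteq> {..<n}" using finite_nat_bounded[of "\<kappa> ` F"] F(2) by auto
 have "C n \<subseteq> zero_locus F"
 proof
  fix X assume X: "X \<in> C n"
  have "f X = 0" if f: "f \<in> F" for f
  proof -
   have "\<kappa> f <= n" using n f by auto
   then have "X \<in> zero_locus (P (\<kappa> f))" using dec X P(2) by blast
   then show ?thesis using \<kappa>[OF f] by (simp add: zero_locus_def)
  qed
  moreover have "X \<in> GL_set" using X unfolding P(2) zero_locus_def by simp
  ultimately show "X \<in> zero_locus F" by (simp add: zero_locus_def)
 qed
 also have "zero_locus F \<subseteq> C (Suc n)"
 proof -
  have "zero_locus (\<Union>k. P k) \<subseteq> zero_locus (P (Suc n))" by (auto simp: zero_locus_def)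
  then show ?thesis using F(3) P(2)[of "Suc n"] by simp
 qed
 finally show ?thesis using d[of n] by blast
qed

section \<open>Polynomial functions, points of ideals, and countable covers\<close>

abbreviation Rg :: "(complex^'n^'n => complex) set" where "Rg \<equiv> poly_fun UNIV"

lemma Rg_const: "(%_. c) \<in> Rg" by (rule poly_fun.const) simp

lemma Rg_scale: "p \<in> Rg ==> (%X. c * p X) \<in> Rg" by (rule poly_fun.mult[OF Rg_const])

lemma Rg_diff: "p \<in> Rg ==> q \<in> Rg ==> (%X. p X - q X) \<in> Rg"
 using poly_fun.add[OF _ Rg_scale[of q "-1"], of p] by simp

lemma Rg_sum: "(!!i. i \<in> S ==> f i \<in> Rg) ==> (%X. \<Sum>i\<in>S. f i X) \<in> Rg"
 by (induction S rule: infinite_finite_induct) (auto intro: Rg_const poly_fun.add)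

lemma Rg_prod: "(!!i. i \<in> S ==> f i \<in> Rg) ==> (%X. \<Prod>i\<in>S. f i X) \<in> Rg"
 by (induction S rule: infinite_finite_induct) (auto intro: Rg_const poly_fun.mult)

lemma Rg_det: "(det :: complex^'n^'n => complex) \<in> Rg"
proof -
 have "(%X :: complex^'n^'n. \<Sum>p\<in>{p. p permutes UNIV}. of_int (sign p) * (\<Prod>i\<in>UNIV. X $ i $ p i)) \<in> Rg"
  by (intro Rg_sum Rg_scale Rg_prod poly_fun.entry)
 then show ?thesis by (simp add: det_def[abs_def])
qed

lemma Rg_poly: "x \<in> Rg ==> (%X. poly w (x X)) \<in> Rg"
 by (induction w) (auto intro: Rg_const poly_fun.add poly_fun.mult)

definition pideal :: "(complex^'n^'n => complex) set => bool" where
 "pideal J \<longleftrightarrow> J \<subseteq> Rg & (%_. 0) \<in> J & (\<forall>p\<in>J. \<forall>q\<in>J. (%X. p X + q X) \<in> J) & (\<forall>p\<in>J. \<forall>r\<in>Rg. (%X. r X * p X) \<in> J)"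

lemma pidealD:
 assumes "pideal J"
 shows "p \<in> J ==> p \<in> Rg" "(%_. 0) \<in> J" "p \<in> J ==> q \<in> J ==> (%X. p X + q X) \<in> J"
  "p \<in> J ==> r \<in> Rg ==> (%X. r X * p X) \<in> J"
 using assms unfolding pideal_def by auto

lemma pideal_sum: "pideal J ==> (!!i. i \<in> S ==> f i \<in> J) ==> (%X. \<Sum>i\<in>S. f i X) \<in> J"
 by (induction S rule: infinite_finite_induct) (auto intro: pidealD)

inductive_set mspan :: "(complex^'n^'n => complex) set" where
 zero: "(%_. 0) \<in> mspan"
| step: "p \<in> mspan ==> (%X. p X + c * prod_list (map (%(i, j). X $ i $ j) l)) \<in> mspan"

lemma mspan_mon: "(%X. c * prod_list (map (%(i, j). X $ i $ j) l)) \<in> mspan"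
 using mspan.step[OF mspan.zero, of c l] by simp

lemma mspan_add: "p \<in> mspan ==> q \<in> mspan ==> (%X. p X + q X) \<in> mspan"
proof (induction rule: mspan.induct)
 case (step p c l)
 from mspan.step[OF step.IH[OF step.prems], of c l] show ?case by (simp add: algebra_simps)
qed simp

lemma mspan_mult_mon: "p \<in> mspan ==> (%X. p X * (c * prod_list (map (%(i, j). X $ i $ j) l))) \<in> mspan"
proof (induction rule: mspan.induct)
 case (step p d k)
 from mspan.step[OF step.IH, of "d * c" "k @ l"] show ?case by (simp add: algebra_simps)
qed (simp add: mspan.zero)

lemma mspan_mult: assumes "p \<in> mspan" "q \<in> mspan" shows "(%X. p X * q X) \<in> mspan"
 using assms(2)
proof (induction rule: mspan.induct)
 case (step q c l)
 from mspan_add[OF step.IH mspan_mult_mon[OF assms(1), of c l]] show ?case by (simp add: algebra_simps)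
qed (simp add: mspan.zero)

lemma Rg_mspan: "p \<in> Rg ==> p \<in> mspan"
proof (induction rule: poly_fun.induct)
 case (const c)
 show ?case using mspan_mon[of c "[]"] by simp
next
 case (entry i j)
 show ?case using mspan_mon[of 1 "[(i, j)]"] by simp
qed (auto intro: mspan_add mspan_mult)

text \<open>An enumeration, with repetitions, of the monomials in the entries. The polynomial
  functions become a countable union of the finite-dimensional spaces
  \<open>lowspan n\<close>.\<close>

definition monf :: "nat => complex^'n::finite^'n => complex" where
 "monf k X = prod_list (map (%(i, j). X $ i $ j) (from_nat k))"

definition lowspan :: "nat => (complex^'n::finite^'n => complex) set" where
 "lowspan n = {(%X. \<Sum>k<n. \<alpha> k * monf k X) | \<alpha>. True}"

lemma mspan_lowspan: "(p :: complex^'a::finite^'a => complex) \<in> mspan ==> \<exists>n. p \<in> lowspan n"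
proof (induction rule: mspan.induct)
 case zero
 have "(%_. 0) \<in> lowspan 0" by (auto simp: lowspan_def)
 then show ?case by blast
next
 case (step p c l)
 then obtain n \<alpha> where p: "p = (%X. \<Sum>k<n. \<alpha> k * monf k X)" by (auto simp: lowspan_def)
 define m where "m = max n (Suc (to_nat l))"
 define \<beta> where "\<beta> k = (if k < n then \<alpha> k else 0) + (if k = to_nat l then c else 0)" for k
 have "(\<Sum>k<m. \<beta> k * monf k X) = (\<Sum>k<m. (if k < n then \<alpha> k * monf k X else 0)) + (\<Sum>k<m. (if k = to_nat l then c * monf k X else 0))" for X :: "complex^'a^'a"
  unfolding sum.distrib[symmetric] by (rule sum.cong) (auto simp: \<beta>_def algebra_simps)
 moreover have "(\<Sum>k<m. (if k < n then \<alpha> k * monf k X else 0)) = (\<Sum>k<n. \<alpha> k * monf k X)" for X :: "complex^'a^'a"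
  by (rule sum.mono_neutral_cong_right) (auto simp: m_def)
 moreover have "(\<Sum>k<m. (if k = to_nat l then c * monf k X else 0)) = c * monf (to_nat l) X" for X :: "complex^'a^'a"
  by (simp add: m_def)
 moreover have "monf (to_nat l) X = prod_list (map (%(i, j). X $ i $ j) l)" for X :: "complex^'a^'a"
  by (simp add: monf_def)
 ultimately have "p X + c * prod_list (map (%(i, j). X $ i $ j) l) = (\<Sum>k<m. \<beta> k * monf k X)" for X :: "complex^'a^'a"
  by (simp only: p)
 then have "(%X. p X + c * prod_list (map (%(i, j). X $ i $ j) l)) = (%X. \<Sum>k<m. \<beta> k * monf k X)" by (rule ext)
 then have "(%X. p X + c * prod_list (map (%(i, j). X $ i $ j) l)) \<in> lowspan m"
  unfolding lowspan_def by (intro CollectI exI[of _ \<beta>]) simp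
 then show ?case by (rule exI)
qed

text \<open>More than n vectors in the span of n monomials are dependent over the complex numbers;
  the induction eliminates the last monomial.\<close>

lemma lowspan_dependent:
 assumes "finite T" "card T > n" "!!t. t \<in> T ==> p t \<in> lowspan n"
 shows "\<exists>\<gamma> :: 't => complex. (\<exists>t\<in>T. \<gamma> t ~= 0) & (\<forall>X. (\<Sum>t\<in>T. \<gamma> t * p t X) = 0)"
 using assms
proof (induction n arbitrary: T p)
 case 0
 then have "T ~= {}" by auto
 moreover have "p t X = 0" if "t \<in> T" for t X using 0(3)[OF that] by (auto simp: lowspan_def)
 ultimately show ?case by (intro exI[of _ "%_. 1"]) auto
next
 case (Suc n)
 have "\<forall>t\<in>T. \<exists>\<alpha>. p t = (%X. \<Sum>k<Suc n. \<alpha> k * monf k X)" using Suc.prems(3) by (auto simp: lowspan_def)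
 then obtain \<alpha> where \<alpha>: "!!t. t \<in> T ==> p t = (%X. \<Sum>k<Suc n. \<alpha> t k * monf k X)" by metis
 show ?case
 proof (cases "\<forall>t\<in>T. \<alpha> t n = 0")
  case True
  have "p t \<in> lowspan n" if "t \<in> T" for t
   unfolding lowspan_def using \<alpha>[OF that] True that by (intro CollectI exI[of _ "\<alpha> t"]) auto
  then show ?thesis using Suc.IH[of T p] Suc.prems by auto
 next
  case False
  then obtain t0 where t0: "t0 \<in> T" "\<alpha> t0 n ~= 0" by blast
  define r where "r t = \<alpha> t n / \<alpha> t0 n" for t
  define p' where "p' t = (%X. p t X - r t * p t0 X)" for t
  define T' where "T' = T - {t0}"
  have T': "finite T'" "card T' > n" using Suc.prems(1,2) t0(1) by (auto simp: T'_def)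
  have "p' t \<in> lowspan n" if "t \<in> T'" for t
  proof -
   have "t \<in> T" using that by (simp add: T'_def)
   have "p' t = (%X. \<Sum>k<n. (\<alpha> t k - r t * \<alpha> t0 k) * monf k X)"
    unfolding p'_def \<alpha>[OF \<open>t \<in> T\<close>] \<alpha>[OF t0(1)] using t0(2)
    by (auto simp: fun_eq_iff r_def sum_subtractf sum_distrib_left algebra_simps)
   then show ?thesis unfolding lowspan_def
    by (intro CollectI exI[of _ "%k. \<alpha> t k - r t * \<alpha> t0 k"]) simp
  qed
  then obtain \<gamma> where \<gamma>: "\<exists>t\<in>T'. \<gamma> t ~= 0" "!!X. (\<Sum>t\<in>T'. \<gamma> t * p' t X) = 0"
   using Suc.IH[OF T', of p'] by blast
  define \<delta> where "\<delta> t = (if t = t0 then - (\<Sum>t\<in>T'. \<gamma> t * r t) else \<gamma> t)" for t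
  have "(\<Sum>t\<in>T. \<delta> t * p t X) = 0" for X
  proof -
   have "(\<Sum>t\<in>T. \<delta> t * p t X) = \<delta> t0 * p t0 X + (\<Sum>t\<in>T'. \<delta> t * p t X)"
    unfolding T'_def using Suc.prems(1) t0(1) by (rule sum.remove)
   also have "(\<Sum>t\<in>T'. \<delta> t * p t X) = (\<Sum>t\<in>T'. \<gamma> t * p t X)"
    by (rule sum.cong) (auto simp: \<delta>_def T'_def)
   also have "\<delta> t0 * p t0 X + ... = (\<Sum>t\<in>T'. \<gamma> t * p' t X)"
    by (simp add: \<delta>_def p'_def sum_distrib_right sum_subtractf right_diff_distrib mult.assoc)
   finally show ?thesis using \<gamma>(2) by simp
  qed
  moreover have "\<exists>t\<in>T. \<delta> t ~= 0" using \<gamma>(1) by (auto simp: \<delta>_def T'_def)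
  ultimately show ?thesis by blast
 qed
qed

text \<open>The Nullstellensatz over an uncountable field: a maximal ideal disjoint from a countable
 multiplicative set has residue field of countable dimension, hence corresponds to a point.\<close>

lemma nullstellensatz_countable:
 fixes S J :: "(complex^'n::finite^'n => complex) set"
 assumes S: "countable S" "S \<subseteq> Rg" "(%_. 1) \<in> S" "!!s t. s \<in> S ==> t \<in> S ==> (%X. s X * t X) \<in> S"
  and J: "pideal J" "J \<inter> S = {}"
 shows "\<exists>a. (\<forall>p\<in>J. p a = 0) & (\<forall>s\<in>S. s a ~= 0)"
proof -
 \<comment> \<open>Maximality is taken among ideals disjoint from \<open>S\<close>; adding to such
   an \<open>M\<close> any element outside produces an ideal that meets \<open>S\<close>.\<close>
 define \<A> where "\<A> = {M. pideal M & J \<subseteq> M & M \<inter> S = {}}"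
 have "\<exists>M\<in>\<A>. \<forall>M'\<in>\<A>. M \<subseteq> M' --> M' = M"
 proof (rule subset_Zorn_nonempty)
  show "\<A> ~= {}" using J by (auto simp: \<A>_def)
  fix \<C> assume C: "\<C> ~= {}" "subset.chain \<A> \<C>"
  have CA: "pideal M & J \<subseteq> M & M \<inter> S = {}" if "M \<in> \<C>" for M
   using C(2) that by (auto simp: subset_chain_def \<A>_def)
  note CD = pidealD[OF conjunct1[OF CA]]
  have "pideal (\<Union>\<C>)"
   unfolding pideal_def
  proof (intro conjI ballI)
   show "\<Union>\<C> \<subseteq> Rg" "(%_. 0) \<in> \<Union>\<C>" using CD(1,2) C(1) by blast+
   show "(%X. p X + q X) \<in> \<Union>\<C>" if "p \<in> \<Union>\<C>" "q \<in> \<Union>\<C>" for p q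
   proof -
    have "\<exists>M\<in>\<C>. p \<in> M & q \<in> M" using C(2) that unfolding subset_chain_def by blast
    then show ?thesis using CD(3)[of _ p q] by blast
   qed
   show "(%X. r X * p X) \<in> \<Union>\<C>" if "p \<in> \<Union>\<C>" "r \<in> Rg" for p r using that CD(4)[of _ p r] by blast
  qed
  moreover have "J \<subseteq> \<Union>\<C>" using C(1) CA by blast
  moreover have "\<Union>\<C> \<inter> S = {}" using CA by blast
  ultimately show "\<Union>\<C> \<in> \<A>" by (simp add: \<A>_def)
 qed
 then obtain M where MA: "M \<in> \<A>" and max0: "\<forall>M'\<in>\<A>. M \<subseteq> M' --> M' = M" by (elim bexE)
 have M: "pideal M" "J \<subseteq> M" "M \<inter> S = {}" using MA by (simp_all add: \<A>_def)
 have max: "M' = M" if "M' \<in> \<A>" "M \<subseteq> M'" for M' using max0 that by simp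
 note MD = pidealD[OF M(1)]
 have meets: "\<exists>s j r. s \<in> S & j \<in> M & r \<in> Rg & s = (%X. j X + r X * a X)" if a: "a \<in> Rg" "a \<notin> M" for a
 proof (rule ccontr)
  assume no: "\<not> ?thesis"
  define M' where "M' = {%X. j X + r X * a X | j r. j \<in> M & r \<in> Rg}"
  have "pideal M'"
   unfolding pideal_def
  proof (intro conjI ballI)
   show "M' \<subseteq> Rg" using MD(1) a(1) by (auto simp: M'_def intro: poly_fun.add poly_fun.mult)
   show "(%_. 0) \<in> M'" unfolding M'_def using MD(2) Rg_const[of 0]
    by (intro CollectI exI[of _ "%_. 0"]) simp
   show "(%X. p X + q X) \<in> M'" if pq: "p \<in> M'" "q \<in> M'" for p q
   proof -
    obtain j r j' r' where "p = (%X. j X + r X * a X)" "q = (%X. j' X + r' X * a X)" "j \<in> M" "j' \<in> M" "r \<in> Rg" "r' \<in> Rg"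
     using pq by (auto simp: M'_def)
    then show ?thesis unfolding M'_def
     by (intro CollectI exI[of _ "%X. j X + j' X"] exI[of _ "%X. r X + r' X"]) (auto simp: algebra_simps intro: MD poly_fun.add)
   qed
   show "(%X. t X * p X) \<in> M'" if pt: "p \<in> M'" "t \<in> Rg" for p t
   proof -
    obtain j r where pj: "p = (%X. j X + r X * a X)" "j \<in> M" "r \<in> Rg"
     using pt by (auto simp: M'_def)
    have "(%X. t X * p X) = (%X. t X * j X + (t X * r X) * a X)"
     by (simp add: pj(1) fun_eq_iff algebra_simps)
    moreover have "(%X. t X * j X) \<in> M" "(%X. t X * r X) \<in> Rg"
     using MD(4)[OF pj(2) pt(2)] poly_fun.mult[OF pt(2) pj(3)] by auto
    ultimately show ?thesis unfolding M'_def
     by (intro CollectI, rule_tac x="%X. t X * j X" in exI, rule_tac x="%X. t X * r X" in exI) simp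
   qed
  qed
  moreover have MM: "M \<subseteq> M'"
  proof
   fix j assume "j \<in> M"
   then show "j \<in> M'" unfolding M'_def using Rg_const[of 0] by (intro CollectI exI[of _ j] exI[of _ "%_. 0"]) simp
  qed
  moreover have "M' \<inter> S = {}" using no by (auto simp: M'_def)
  ultimately have "M' = M" using max[of M'] M(2) by (simp add: \<A>_def)
  moreover have "a \<in> M'" unfolding M'_def using MD(2) Rg_const[of 1]
   by (intro CollectI exI[of _ "%_. 0"] exI[of _ "%_. 1"]) simp
  ultimately show False using a(2) by simp
 qed
 have prime: "p \<in> M \<or> q \<in> M" if pq: "p \<in> Rg" "q \<in> Rg" "(%X. p X * q X) \<in> M" for p q
 proof (rule ccontr)
  assume "\<not> ?thesis"
  then have "p \<notin> M" "q \<notin> M" by auto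
  note nn = this
  obtain s j r where s1: "s \<in> S" "j \<in> M" "r \<in> Rg" "s = (%X. j X + r X * p X)"
   using meets[OF pq(1) nn(1)] by (elim exE conjE)
  obtain s' j' r' where s2: "s' \<in> S" "j' \<in> M" "r' \<in> Rg" "s' = (%X. j' X + r' X * q X)"
   using meets[OF pq(2) nn(2)] by (elim exE conjE)
  note s = s1 s2
  have "s \<in> Rg" using s(1) S(2) by blast
  have "(%X. s X * j' X) \<in> M" using MD(4)[OF s(6) \<open>s \<in> Rg\<close>] .
  moreover have "(%X. (r' X * q X) * j X) \<in> M" using MD(4)[OF s(2) poly_fun.mult[OF s(7) pq(2)]] .
  moreover have "(%X. (r X * r' X) * (p X * q X)) \<in> M" using MD(4)[OF pq(3) poly_fun.mult[OF s(3,7)]] .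
  ultimately have "(%X. s X * j' X + ((r' X * q X) * j X + (r X * r' X) * (p X * q X))) \<in> M" by (intro MD(3))
  moreover have "(%X. s X * j' X + ((r' X * q X) * j X + (r X * r' X) * (p X * q X))) = (%X. s X * s' X)"
   by (simp add: s(4,8) fun_eq_iff algebra_simps)
  ultimately have "(%X. s X * s' X) \<in> M" by simp
  moreover have "(%X. s X * s' X) \<in> S" by (rule S(4)[OF s(1,5)])
  ultimately show False using M(3) by blast
 qed
 have one: "(%_. c) \<notin> M" if "c ~= 0" for c
 proof
  assume "(%_. c) \<in> M"
  from MD(4)[OF this Rg_const[of "1 / c"]] have "(%_. 1) \<in> M" using that by simp
  then show False using S(3) M(3) by blast
 qed
 \<comment> \<open>\<open>M\<close> is prime and contains no nonzero constant, so a nonzero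
   polynomial in \<open>x\<close> lying in \<open>M\<close> has a linear factor in
   \<open>M\<close>.\<close>
 have root: "\<exists>a. (%X. x X - a) \<in> M" if "x \<in> Rg" "w ~= 0" "(%X. poly w (x X)) \<in> M" for x w
  using that(2,3)
 proof (induction "degree w" arbitrary: w)
  case 0
  then obtain c where c: "w = [:c:]" by (metis degree_eq_zeroE)
  then have "c ~= 0" "(%_. c) \<in> M" using 0 by auto
  then show ?case using one[of c] by simp
 next
  case (Suc n)
  then have "\<not> constant (poly w)" by (simp add: constant_degree)
  then obtain l where "poly w l = 0" using fundamental_theorem_of_algebra by blast
  then obtain q where q: "w = [:- l, 1:] * q" by (auto simp: poly_eq_0_iff_dvd)
  have q0: "q ~= 0" using Suc.prems q by auto
  have dq: "n = degree q" using Suc.hyps(2) q0 unfolding q by (subst (asm) degree_mult_eq) auto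
  have "(%X. (x X - l) * poly q (x X)) \<in> M" using Suc.prems(2) unfolding q by (simp add: algebra_simps)
  then have "(%X. x X - l) \<in> M \<or> (%X. poly q (x X)) \<in> M"
   by (rule prime[OF Rg_diff[OF \<open>x \<in> Rg\<close> Rg_const] Rg_poly[OF \<open>x \<in> Rg\<close>]])
  then show ?case
  proof
   assume "(%X. x X - l) \<in> M"
   then show ?thesis by (rule exI)
  next
   assume "(%X. poly q (x X)) \<in> M"
   then show ?thesis by (rule Suc.hyps(1)[OF dq q0])
  qed
 qed
 \<comment> \<open>Otherwise, for every real c the element x - c is invertible modulo
   \<open>M\<close> up to \<open>S\<close>, with cofactor \<open>q c\<close>. There are uncountably
   many c but only countably many choices of the element of \<open>S\<close> and of the space
   \<open>lowspan n\<close>.\<close>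
 have coord: "\<exists>a. (%X. x X - a) \<in> M" if x: "x \<in> Rg" for x
 proof (rule ccontr)
  assume no: "\<not> ?thesis"
  have "(%X. x X - complex_of_real c) \<notin> M" for c
  proof
   assume "(%X. x X - complex_of_real c) \<in> M"
   then have "\<exists>a. (%X. x X - a) \<in> M" by (rule exI)
   then show False using no by (rule notE[rotated])
  qed
  from meets[OF Rg_diff[OF x Rg_const] this]
  have "\<exists>s j q. s \<in> S & j \<in> M & q \<in> Rg & (\<forall>X. s X = j X + q X * (x X - complex_of_real c))" for c
   by (simp only: fun_eq_iff)
  then obtain s j q where sjq: "s c \<in> S" "j c \<in> M" "q c \<in> Rg" "s c X = j c X + q c X * (x X - complex_of_real c)" for c X
   by metis
  have "\<exists>n. q c \<in> lowspan n" for c using mspan_lowspan[OF Rg_mspan[OF sjq(3)]] .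
  then obtain n where n: "!!c. q c \<in> lowspan (n c)" by metis
  define fib where "fib t = {c. s c = fst t & n c = snd t}" for t
  have "\<exists>t\<in>S \<times> UNIV. infinite (fib t)"
  proof (rule ccontr)
   assume "\<not> ?thesis"
   then have "countable (\<Union>t\<in>S \<times> (UNIV :: nat set). fib t)"
    using S(1) by (intro countable_UN countable_SIGMA) (auto intro: countable_finite)
   moreover have "(\<Union>t\<in>S \<times> (UNIV :: nat set). fib t) = UNIV" using sjq(1) by (auto simp: fib_def)
   ultimately show False using uncountable_UNIV_real by simp
  qed
  then obtain s0 n0 where "infinite (fib (s0, n0))" "s0 \<in> S" by auto
  then obtain T where T: "finite T" "card T = Suc n0" "T \<subseteq> fib (s0, n0)"
   using infinite_arbitrarily_large[of "fib (s0, n0)" "Suc n0"] by blast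
  have Tq: "q c \<in> lowspan n0" "s c = s0" if "c \<in> T" for c using T(3) that n[of c] by (auto simp: fib_def)
  obtain \<gamma> where \<gamma>: "\<exists>c\<in>T. \<gamma> c ~= 0" "!!X. (\<Sum>c\<in>T. \<gamma> c * q c X) = 0"
   using lowspan_dependent[OF T(1), of n0 q] T(2) Tq(1) by auto
  define L where "L c X = (\<Prod>b\<in>T - {c}. x X - complex_of_real b)" for c X
  have LR: "L c \<in> Rg" for c unfolding L_def by (intro Rg_prod Rg_diff[OF x] Rg_const)
  \<comment> \<open>Multiplying the relation among the cofactors by the product of all x - b clears
    the denominators 1 / (x - c) and yields a polynomial in \<open>x\<close> alone.\<close>
  define w where "w = (\<Sum>c\<in>T. smult (\<gamma> c) (\<Prod>b\<in>T - {c}. [:- complex_of_real b, 1:]))"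
  have pw: "poly w (x X) = (\<Sum>c\<in>T. \<gamma> c * L c X)" for X
   by (simp add: w_def poly_sum poly_prod L_def)
  have "s0 X * poly w (x X) = (\<Sum>c\<in>T. (\<gamma> c * L c X) * j c X)" for X
  proof -
   have "s0 X * poly w (x X) = (\<Sum>c\<in>T. (\<gamma> c * L c X) * s0 X)" unfolding pw by (simp add: sum_distrib_left mult_ac)
   also have "... = (\<Sum>c\<in>T. (\<gamma> c * L c X) * j c X + (\<Prod>b\<in>T. x X - complex_of_real b) * (\<gamma> c * q c X))"
   proof (rule sum.cong[OF refl])
    fix c assume c: "c \<in> T"
    have e1: "(\<Prod>b\<in>T. x X - complex_of_real b) = (x X - complex_of_real c) * L c X"
     unfolding L_def using T(1) c by (rule prod.remove)
    have e2: "s0 X = j c X + q c X * (x X - complex_of_real c)" using sjq(4)[of c X] Tq(2)[OF c] by simp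
    show "(\<gamma> c * L c X) * s0 X = (\<gamma> c * L c X) * j c X + (\<Prod>b\<in>T. x X - complex_of_real b) * (\<gamma> c * q c X)"
     unfolding e1 e2 by (simp add: algebra_simps)
   qed
   also have "... = (\<Sum>c\<in>T. (\<gamma> c * L c X) * j c X) + (\<Prod>b\<in>T. x X - complex_of_real b) * (\<Sum>c\<in>T. \<gamma> c * q c X)"
    by (simp only: sum.distrib sum_distrib_left)
   finally show ?thesis using \<gamma>(2) by simp
  qed
  moreover have "(%X. \<Sum>c\<in>T. (\<gamma> c * L c X) * j c X) \<in> M"
   using MD(4)[OF sjq(2) Rg_scale[OF LR]] by (intro pideal_sum[OF M(1)]) auto
  ultimately have "(%X. s0 X * poly w (x X)) \<in> M" by simp
  moreover have "s0 \<in> Rg" "s0 \<notin> M" using \<open>s0 \<in> S\<close> S(2) M(3) by blast+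
  ultimately have "(%X. poly w (x X)) \<in> M" using prime[OF \<open>s0 \<in> Rg\<close> Rg_poly[OF x, of w]] by simp
  \<comment> \<open>At a point c0 with nonzero coefficient all other summands contain the factor c0
    - c0.\<close>
  moreover have "w ~= 0"
  proof -
   obtain c0 where c0: "c0 \<in> T" "\<gamma> c0 ~= 0" using \<gamma>(1) by blast
   have "poly w (complex_of_real c0) = (\<Sum>c\<in>T. \<gamma> c * (\<Prod>b\<in>T - {c}. complex_of_real c0 - complex_of_real b))"
    by (simp add: w_def poly_sum poly_prod)
   also have "... = \<gamma> c0 * (\<Prod>b\<in>T - {c0}. complex_of_real c0 - complex_of_real b) + (\<Sum>c\<in>T - {c0}. \<gamma> c * (\<Prod>b\<in>T - {c}. complex_of_real c0 - complex_of_real b))"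
    using T(1) c0(1) by (rule sum.remove)
   also have "(\<Sum>c\<in>T - {c0}. \<gamma> c * (\<Prod>b\<in>T - {c}. complex_of_real c0 - complex_of_real b)) = 0"
   proof (rule sum.neutral, rule ballI)
    fix c assume "c \<in> T - {c0}"
    then have "c0 \<in> T - {c}" using c0(1) by auto
    then have "(\<Prod>b\<in>T - {c}. complex_of_real c0 - complex_of_real b) = 0" using T(1) by (intro prod_zero) auto
    then show "\<gamma> c * (\<Prod>b\<in>T - {c}. complex_of_real c0 - complex_of_real b) = 0" by simp
   qed
   finally have "poly w (complex_of_real c0) ~= 0" using T(1) c0(2) by simp
   then show ?thesis by auto
  qed
  ultimately have "\<exists>a. (%X. x X - a) \<in> M" by (intro root[OF x])
  then show False using no by (rule notE[rotated])
 qed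
 define A where "A i k = (SOME c. (%X :: complex^'n^'n. X $ i $ k - c) \<in> M)" for i k
 have A: "(%X :: complex^'n^'n. X $ i $ k - A i k) \<in> M" for i k
  unfolding A_def by (rule someI_ex[OF coord[OF poly_fun.entry]])
 define a :: "complex^'n^'n" where "a = (\<chi> i k. A i k)"
 have ev: "(%X. p X - p a) \<in> M" if "p \<in> Rg" for p
  using that
 proof (induction rule: poly_fun.induct)
  case (const c)
  then show ?case using MD(2) by simp
 next
  case (entry i k)
  then show ?case using A by (simp add: a_def)
 next
  case (add p q)
  from MD(3)[OF add.IH] show ?case by (simp add: algebra_simps)
 next
  case (mult p q)
  have "(%X. q X * (p X - p a)) \<in> M" "(%X. p a * (q X - q a)) \<in> M"
   using MD(4)[OF mult.IH(1) mult.hyps(2)] MD(4)[OF mult.IH(2) Rg_const] by auto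
  from MD(3)[OF this] show ?case by (simp add: algebra_simps)
 qed
 have zero: "p a = 0" if "p \<in> M" for p
 proof (rule ccontr)
  assume "p a ~= 0"
  have "(%X. -1 * (p X - p a)) \<in> M" using MD(4)[OF ev[OF MD(1)[OF that]] Rg_const[of "-1"]] .
  from MD(3)[OF that this] have "(%X. p a) \<in> M" by simp
  then show False using one[OF \<open>p a ~= 0\<close>] by simp
 qed
 moreover have "s a ~= 0" if "s \<in> S" for s
 proof
  assume "s a = 0"
  then have "s \<in> M" using ev[of s] that S(2) by auto
  then show False using that M(3) by blast
 qed
 ultimately show ?thesis using M(2) by blast
qed

text \<open>For every member of the cover there is a polynomial vanishing on it but not on
  \<open>C\<close>. By irreducibility no finite product of these vanishes on \<open>C\<close>, so
  the Nullstellensatz yields a point of \<open>C\<close> where none of them vanishes. The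
  determinant joins the list to keep that point invertible.\<close>

lemma irreducible_countable_cover:
 fixes C :: "(complex^'n::finite^'n) set"
 assumes C: "closedin zariski C" "C ~= {}"
  and irr: "!!A B. closedin zariski A ==> closedin zariski B ==> C \<subseteq> A \<union> B ==> C \<subseteq> A \<or> C \<subseteq> B"
  and D: "countable \<D>" "!!D. D \<in> \<D> ==> closedin zariski D" "C \<subseteq> \<Union>\<D>"
 shows "\<exists>D\<in>\<D>. C \<subseteq> D"
proof (rule ccontr)
 assume no: "\<not> ?thesis"
 have GL: "C \<subseteq> GL_set" using closedin_subset[OF C(1)] by simp
 obtain PC where PC: "PC \<subseteq> Rg" "C = zero_locus PC" using C(1) closedin_zariski by blast
 have "\<exists>f\<in>Rg. (\<forall>X\<in>D. f X = 0) & (\<exists>X\<in>C. f X ~= 0)" if "D \<in> \<D>" for D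
 proof -
  obtain P where P: "P \<subseteq> Rg" "D = zero_locus P" using D(2)[OF \<open>D \<in> \<D>\<close>] closedin_zariski by blast
  obtain X where X: "X \<in> C" "X \<notin> D" using no \<open>D \<in> \<D>\<close> by blast
  then obtain f where "f \<in> P" "f X ~= 0" using GL unfolding P(2) zero_locus_def by blast
  then show ?thesis using P X(1) by (intro bexI[of _ f]) (auto simp: zero_locus_def)
 qed
 then obtain f where f: "!!D. D \<in> \<D> ==> f D \<in> Rg & (\<forall>X\<in>D. f D X = 0) & (\<exists>X\<in>C. f D X ~= 0)" by metis
 define L where "L = insert det (f ` \<D>)"
 have L: "h \<in> Rg & (\<exists>X\<in>C. h X ~= 0)" if "h \<in> L" for h
  using that f Rg_det C(2) GL unfolding L_def by (auto simp: invertible_det_nz)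
 define prd where "prd hs = (%X :: complex^'n^'n. prod_list (map (%h. h X) hs))" for hs :: "(complex^'n^'n => complex) list"
 have prd: "prd hs \<in> Rg & (\<exists>X\<in>C. prd hs X ~= 0)" if "hs \<in> lists L" for hs
  using that
 proof (induction hs)
  case Nil
  then show ?case using C(2) Rg_const[of 1] by (auto simp: prd_def)
 next
  case (Cons h hs)
  have h: "h \<in> Rg" "\<exists>X\<in>C. h X ~= 0" using L[OF Cons.hyps(1)] by auto
  have hs: "prd hs \<in> Rg" "\<exists>X\<in>C. prd hs X ~= 0" using Cons.IH by auto
  have e: "prd (h # hs) = (%X. h X * prd hs X)" by (simp add: prd_def)
  have cl: "closedin zariski (zero_locus {h})" "closedin zariski (zero_locus {prd hs})"
   using h(1) hs(1) closedin_zariski by blast+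
  have "\<exists>X\<in>C. h X * prd hs X ~= 0"
  proof (rule ccontr)
   assume "\<not> ?thesis"
   then have "C \<subseteq> zero_locus {h} \<union> zero_locus {prd hs}" using GL by (auto simp: zero_locus_def)
   from irr[OF cl this] show False using h(2) hs(2) by (auto simp: zero_locus_def)
  qed
  then show ?case unfolding e using poly_fun.mult[OF h(1) hs(1)] by blast
 qed
 define I0 where "I0 = {p \<in> Rg. \<forall>X\<in>C. p X = 0}"
 have "pideal I0" unfolding pideal_def I0_def using Rg_const[of 0] by (auto intro: poly_fun.add poly_fun.mult)
 moreover have "I0 \<inter> prd ` lists L = {}" using prd by (auto simp: I0_def)
 moreover have "countable (prd ` lists L)" unfolding L_def using D(1) by (intro countable_image countable_lists countable_insert)
 moreover have "prd ` lists L \<subseteq> Rg" using prd by blast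
 moreover have "(%_. 1) \<in> prd ` lists L" by (rule image_eqI[of _ _ "[]"]) (auto simp: prd_def)
 moreover have "(%X. s X * t X) \<in> prd ` lists L" if st: "s \<in> prd ` lists L" "t \<in> prd ` lists L" for s t
 proof -
  obtain hs ks where "hs \<in> lists L" "ks \<in> lists L" "s = prd hs" "t = prd ks" using st by blast
  then show ?thesis by (intro image_eqI[of _ _ "hs @ ks"]) (auto simp: prd_def)
 qed
 ultimately obtain a where a: "\<forall>p\<in>I0. p a = 0" "\<forall>s\<in>prd ` lists L. s a ~= 0"
  using nullstellensatz_countable[of "prd ` lists L" I0] by blast
 have La: "h a ~= 0" if "h \<in> L" for h
 proof -
  have "prd [h] \<in> prd ` lists L" using that by (intro imageI) auto
  then show ?thesis using a(2) by (auto simp: prd_def)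
 qed
 have "a \<in> GL_set" using La[of det] by (auto simp: L_def invertible_det_nz)
 moreover have "PC \<subseteq> I0" using PC by (auto simp: I0_def zero_locus_def)
 ultimately have "a \<in> C" unfolding PC(2) zero_locus_def using a(1) by auto
 then obtain D where "D \<in> \<D>" "a \<in> D" using D(3) by blast
 then show False using f[of D] La[of "f D"] by (auto simp: L_def)
qed

section \<open>Translations, closed subgroups and closures\<close>

lemma Rg_left: "p \<in> Rg ==> (%X. p ((A :: complex^'n^'n) ** X)) \<in> Rg"
proof (induction rule: poly_fun.induct)
 case (entry i j)
 show ?case unfolding matrix_matrix_mult_def by (simp, intro Rg_sum Rg_scale poly_fun.entry)
qed (auto intro: poly_fun.intros)

lemma Rg_right: "p \<in> Rg ==> (%X. p (X ** (A :: complex^'n^'n))) \<in> Rg"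
proof (induction rule: poly_fun.induct)
 case (entry i j)
 show ?case unfolding matrix_matrix_mult_def by (simp, intro Rg_sum poly_fun.mult poly_fun.entry Rg_const)
qed (auto intro: poly_fun.intros)

lemma Rg_continuous: "p \<in> Rg ==> continuous_on UNIV (p :: complex^'n^'n => complex)"
 by (induction rule: poly_fun.induct) (auto intro!: continuous_intros)

lemma closed_left_preimage:
 assumes "closedin zariski C" "invertible A"
 shows "closedin zariski {X \<in> GL_set. A ** X \<in> (C :: (complex^'n^'n) set)}"
proof -
 obtain P where P: "P \<subseteq> Rg" "C = zero_locus P" using assms(1) closedin_zariski by blast
 let ?Q = "(%p X. p (A ** X)) ` P"
 have "?Q \<subseteq> Rg" using P(1) Rg_left by blast
 moreover have "{X \<in> GL_set. A ** X \<in> C} = zero_locus ?Q"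
  unfolding P(2) zero_locus_def using assms(2) by (auto simp: invertible_mult)
 ultimately show ?thesis using closedin_zariski by blast
qed

lemma closed_right_preimage:
 assumes "closedin zariski C" "invertible A"
 shows "closedin zariski {X \<in> GL_set. X ** A \<in> (C :: (complex^'n^'n) set)}"
proof -
 obtain P where P: "P \<subseteq> Rg" "C = zero_locus P" using assms(1) closedin_zariski by blast
 let ?Q = "(%p X. p (X ** A)) ` P"
 have "?Q \<subseteq> Rg" using P(1) Rg_right by blast
 moreover have "{X \<in> GL_set. X ** A \<in> C} = zero_locus ?Q"
  unfolding P(2) zero_locus_def using assms(2) by (auto simp: invertible_mult)
 ultimately show ?thesis using closedin_zariski by blast
qed

definition alg_sub :: "(complex^'n^'n) set => bool" where
 "alg_sub C \<longleftrightarrow> closedin zariski C & mat 1 \<in> C & (\<forall>X\<in>C. \<forall>Y\<in>C. X ** Y \<in> C) &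
   (\<forall>X\<in>C. \<exists>Y\<in>C. X ** Y = mat 1 & Y ** X = mat 1)"

lemma alg_subD:
 assumes "alg_sub C"
 shows "closedin zariski C" "mat 1 \<in> C" "X \<in> C ==> Y \<in> C ==> X ** Y \<in> C"
  "X \<in> C ==> \<exists>Y\<in>C. X ** Y = mat 1 & Y ** X = mat 1" "X \<in> C ==> invertible X"
 using assms closedin_subset[of zariski C] unfolding alg_sub_def by auto

lemma alg_sub_inverse:
 assumes C: "alg_sub C" and X: "X \<in> C" and Y: "X ** Y = mat 1 \<or> Y ** X = mat 1" shows "Y \<in> C"
 using alg_subD(4)[OF C X] Y by (metis matrix_mul_assoc matrix_mul_lid matrix_mul_rid)

lemma matrix_pow_cancel:
 assumes "Y ** X = mat 1" shows "matrix_pow Y k ** matrix_pow X k = (mat 1 :: complex^'n^'n)"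
proof -
 have "Cm Y * Cm X = 1" by (rule cmat_eqI) (simp add: assms)
 then have "Cm Y ^ k * Cm X ^ k = 1"
 proof (induction k)
  case (Suc k)
  have "Cm Y ^ Suc k * Cm X ^ Suc k = Cm Y ^ k * (Cm Y * Cm X) * Cm X ^ k"
   by (simp add: power_Suc2[of "Cm Y"] mult.assoc del: power_Suc) simp
  then show ?case using Suc by simp
 qed simp
 then have "rep (Cm Y ^ k * Cm X ^ k) = mat 1" by simp
 then show ?thesis by (simp add: rep_power)
qed

text \<open>Products pass to the closure by applying minimality to each factor in turn. Inverses
  come from Noetherianity, so closure of \<open>S\<close> under products is enough.\<close>

lemma zariski_closure_alg_sub:
 assumes S: "S \<subseteq> GL_set" "mat 1 \<in> S" "!!X Y. X \<in> S ==> Y \<in> S ==> X ** Y \<in> (S :: (complex^'n^'n) set)"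
 shows "alg_sub (zariski closure_of S)"
proof -
 let ?L = "zariski closure_of S"
 have cl: "closedin zariski ?L" by simp
 have SL: "S \<subseteq> ?L" using S(1) by (intro closure_of_subset) simp
 have LGL: "?L \<subseteq> GL_set" using closedin_subset[OF cl] by simp
 have min: "?L \<subseteq> C" if "S \<subseteq> C" "closedin zariski C" for C using that by (rule closure_of_minimal)
 have m1: "s ** X \<in> ?L" if "s \<in> S" "X \<in> ?L" for s X
 proof -
  have "?L \<subseteq> {X \<in> GL_set. s ** X \<in> ?L}"
  proof (rule min)
   show "S \<subseteq> {X \<in> GL_set. s ** X \<in> ?L}" using S SL that(1) by blast
   show "closedin zariski {X \<in> GL_set. s ** X \<in> ?L}" using S(1) that(1) by (intro closed_left_preimage[OF cl]) auto
  qed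
  then show ?thesis using that(2) by blast
 qed
 have m2: "Y ** X \<in> ?L" if "Y \<in> ?L" "X \<in> ?L" for X Y
 proof -
  have "?L \<subseteq> {Y \<in> GL_set. Y ** X \<in> ?L}"
  proof (rule min)
   show "S \<subseteq> {Y \<in> GL_set. Y ** X \<in> ?L}" using S(1) m1 that(2) by blast
   show "closedin zariski {Y \<in> GL_set. Y ** X \<in> ?L}" using LGL that(2) by (intro closed_right_preimage[OF cl]) auto
  qed
  then show ?thesis using that(1) by blast
 qed
 have inv: "\<exists>Y\<in>?L. X ** Y = mat 1 & Y ** X = mat 1" if X: "X \<in> ?L" for X
 proof -
  have "invertible X" using LGL X by auto
  then obtain Y where Y: "X ** Y = mat 1" "Y ** X = mat 1" by (auto simp: invertible_def)
  have ipow: "invertible (matrix_pow Y k)" for k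
   using matrix_pow_cancel[OF Y(1), of k] matrix_pow_cancel[OF Y(2), of k] by (auto simp: invertible_def)
  \<comment> \<open>These are the translates of the closure by powers of \<open>X\<close>. They
    decrease, hence stabilize, and testing the power \<open>X^k\<close> in the equality of two
    successive ones gives that the inverse \<open>Y\<close> belongs to the closure.\<close>
  define C where "C k = {Z \<in> GL_set. matrix_pow Y k ** Z \<in> ?L}" for k
  have "closedin zariski (C k)" for k unfolding C_def by (rule closed_left_preimage[OF cl ipow])
  moreover have "C (Suc k) \<subseteq> C k" for k
  proof
   fix Z assume "Z \<in> C (Suc k)"
   then have Z: "Z \<in> GL_set" "Y ** matrix_pow Y k ** Z \<in> ?L" by (auto simp: C_def)
   have "X ** (Y ** matrix_pow Y k ** Z) \<in> ?L" by (rule m2[OF X Z(2)])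
   then have "matrix_pow Y k ** Z \<in> ?L" by (simp add: matrix_mul_assoc Y(1))
   then show "Z \<in> C k" using Z(1) by (simp add: C_def)
  qed
  ultimately obtain k where k: "C (Suc k) = C k" using zariski_descending_chain[of C] by blast
  have ix: "invertible (matrix_pow X k)"
   using matrix_pow_cancel[OF Y(1), of k] matrix_pow_cancel[OF Y(2), of k] by (auto simp: invertible_def)
  have "mat 1 \<in> ?L" using S(2) SL by blast
  then have "matrix_pow X k \<in> C k" using ix matrix_pow_cancel[OF Y(2), of k] by (simp add: C_def)
  then have "Y ** matrix_pow Y k ** matrix_pow X k \<in> ?L" unfolding k[symmetric] by (simp add: C_def)
  then have "Y \<in> ?L" using matrix_pow_cancel[OF Y(2), of k] by (simp add: matrix_mul_assoc[symmetric])
  then show ?thesis using Y by blast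
 qed
 show ?thesis unfolding alg_sub_def using cl S(2) SL m2 inv by blast
qed

section \<open>The Lie algebra of an algebraic group\<close>

text \<open>The parameter s runs over the complex numbers, so stability under complex scalars is
  immediate; sums and brackets are obtained as limits.\<close>

definition lie :: "(complex^'n::finite^'n) set => 'n cmat set" where
 "lie C = {v. \<forall>s. rep (exp (smat s * v)) \<in> C}"

lemma lie_scale: "v \<in> lie C ==> smat c * v \<in> lie C"
 unfolding lie_def by (simp add: mult.assoc[symmetric] smat_mult[symmetric])

lemma lie_scaleR: "v \<in> lie C ==> r *\<^sub>R v \<in> lie C"
 using lie_scale[of v C "of_real r"] by (simp add: smat_of_real)

lemma lie_exp: "v \<in> lie C ==> rep (exp v) \<in> C"
proof -
 assume "v \<in> lie C"
 then have "\<forall>s. rep (exp (smat s * v)) \<in> C" by (simp add: lie_def)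
 then have "rep (exp (smat 1 * v)) \<in> C" by (rule spec)
 then show ?thesis by (simp add: smat_simps)
qed

text \<open>Polynomials are continuous, so a Zariski closed set is closed in the Euclidean topology,
  as long as the limit remains invertible.\<close>

lemma zero_locus_limit:
 assumes C: "closedin zariski C" and X: "!!k::nat. X k \<in> C" "X \<longlonglongrightarrow> L" "invertible (L :: complex^'n^'n)"
 shows "L \<in> C"
proof -
 obtain P where P: "P \<subseteq> Rg" "C = zero_locus P" using C closedin_zariski by blast
 have "p L = 0" if p: "p \<in> P" for p
 proof -
  have "isCont p L" using Rg_continuous[of p] P(1) p by (auto simp: continuous_on_eq_continuous_at)
  then have "(%k. p (X k)) \<longlonglongrightarrow> p L" using X(2) by (rule isCont_tendsto_compose)
  moreover have "p (X k) = 0" for k using X(1)[of k] p unfolding P(2) zero_locus_def by simp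
  ultimately show ?thesis by (simp add: LIMSEQ_const_iff)
 qed
 then show ?thesis using X(3) unfolding P(2) zero_locus_def by simp
qed

lemma power_diff_norm:
 fixes x y :: "'a::real_normed_algebra_1"
 assumes "norm x <= B" "norm y <= B" "1 <= B" shows "norm (x ^ k - y ^ k) <= real k * B ^ k * norm (x - y)"
proof (induction k)
 case (Suc k)
 have "x ^ Suc k - y ^ Suc k = x * (x ^ k - y ^ k) + (x - y) * y ^ k" by (simp add: algebra_simps)
 then have "norm (x ^ Suc k - y ^ Suc k) <= norm x * norm (x ^ k - y ^ k) + norm (x - y) * norm (y ^ k)"
  by (metis norm_triangle_le add_mono norm_mult_ineq)
 also have "... <= B * (real k * B ^ k * norm (x - y)) + norm (x - y) * B ^ Suc k"
 proof (intro add_mono mult_mono Suc.IH assms mult_left_mono)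
  have "norm (y ^ k) <= norm y ^ k" by (rule norm_power_ineq)
  also have "... <= B ^ k" using assms(2) by (intro power_mono) auto
  also have "... <= B ^ Suc k" using assms(3) by (intro power_increasing) auto
  finally show "norm (y ^ k) <= B ^ Suc k" .
 qed (use assms in auto)
 also have "... = real (Suc k) * B ^ Suc k * norm (x - y)" by (simp add: algebra_simps)
 finally show ?case .
qed simp

lemma exp_difference_quotient:
 "(%k. real k *\<^sub>R (exp ((1 / real k) *\<^sub>R a) - 1)) \<longlonglongrightarrow> (a :: 'n::finite cmat)"
proof -
 have "(%k. real k *\<^sub>R (exp ((1 / real k) *\<^sub>R a) - 1) - a) \<longlonglongrightarrow> 0"
 proof (rule Lim_null_comparison)
  have "\<forall>\<^sub>F k in sequentially. norm a + 1 <= real k" by (rule filterlim_real_sequentially[unfolded filterlim_at_top, rule_format])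
  then show "\<forall>\<^sub>F k in sequentially. norm (real k *\<^sub>R (exp ((1 / real k) *\<^sub>R a) - 1) - a) <= (norm a)\<^sup>2 * (1 / real k)"
  proof (rule eventually_mono)
   fix k assume k: "norm a + 1 <= real k"
   then have k0: "real k > 0" using norm_ge_zero[of a] by linarith
   let ?x = "(1 / real k) *\<^sub>R a"
   have "norm ?x <= 1" using k k0 by (simp add: field_simps)
   from norm_exp_remainder[OF this] have "norm (exp ?x - 1 - ?x) <= (norm ?x)\<^sup>2" .
   moreover have "real k *\<^sub>R (exp ?x - 1) - a = real k *\<^sub>R (exp ?x - 1 - ?x)"
    using k0 by (simp add: scaleR_diff_right)
   ultimately have "norm (real k *\<^sub>R (exp ?x - 1) - a) <= real k * (norm ?x)\<^sup>2" using k0 by simp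
   also have "... = (norm a)\<^sup>2 * (1 / real k)" using k0 by (simp add: power2_eq_square field_simps)
   finally show "norm (real k *\<^sub>R (exp ?x - 1) - a) <= (norm a)\<^sup>2 * (1 / real k)" .
  qed
  show "(%k. (norm a)\<^sup>2 * (1 / real k)) \<longlonglongrightarrow> 0"
   using tendsto_mult[OF tendsto_const lim_1_over_n, of "(norm a)\<^sup>2"] by simp
 qed
 then show ?thesis by (simp add: LIM_zero_iff)
qed

lemma scaled_limit_imp_limit:
 fixes x :: "nat => 'a::real_normed_vector"
 assumes "(%k. real k *\<^sub>R (x k - c)) \<longlonglongrightarrow> w" shows "x \<longlonglongrightarrow> c"
proof -
 have "(%k. (1 / real k) *\<^sub>R (real k *\<^sub>R (x k - c))) \<longlonglongrightarrow> 0 *\<^sub>R w"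
  by (intro tendsto_intros assms lim_1_over_n)
 moreover have "\<forall>\<^sub>F k in sequentially. (1 / real k) *\<^sub>R (real k *\<^sub>R (x k - c)) = x k - c"
  using eventually_gt_at_top[of 0] by eventually_elim simp
 ultimately have "(%k. x k - c) \<longlonglongrightarrow> 0" by (simp add: tendsto_cong)
 then show ?thesis by (simp add: LIM_zero_iff)
qed

text \<open>The core of the Lie product formula: \<open>z k\<close> agrees with exp(w / k) up to o(1
  / k), both have norm at most exp(c / k), and therefore their k-th powers differ by o(1).\<close>

lemma power_limit_exp:
 assumes z: "(%k. real k *\<^sub>R (z k - 1)) \<longlonglongrightarrow> (w :: 'n::finite cmat)"
 shows "(%k. z k ^ k) \<longlonglongrightarrow> exp w"
proof -
 define y where "y k = exp ((1 / real k) *\<^sub>R w)" for k :: nat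
 have y: "(%k. real k *\<^sub>R (y k - 1)) \<longlonglongrightarrow> w" unfolding y_def by (rule exp_difference_quotient)
 define c where "c = norm w + 1"
 have bound: "\<forall>\<^sub>F k in sequentially. norm (x k) <= exp (c / real k)"
  if x: "(%k. real k *\<^sub>R (x k - 1)) \<longlonglongrightarrow> w" for x :: "nat => 'n cmat"
 proof -
  have "(%k. norm (real k *\<^sub>R (x k - 1))) \<longlonglongrightarrow> norm w" by (rule tendsto_norm[OF x])
  then have "\<forall>\<^sub>F k in sequentially. norm (real k *\<^sub>R (x k - 1)) < c" by (rule order_tendstoD) (simp add: c_def)
  then show ?thesis using eventually_gt_at_top[of 0]
  proof eventually_elim
   case (elim k)
   have "real k * norm (x k - 1) < c" using elim(1) by (simp only: norm_scaleR abs_of_nat)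
   then have "norm (x k - 1) <= c / real k" using elim(2) by (simp add: field_simps)
   then have "norm (x k) <= 1 + c / real k" using norm_triangle_ineq[of 1 "x k - 1"] by simp
   also have "... <= exp (c / real k)" by (rule exp_ge_add_one_self)
   finally show ?case .
  qed
 qed
 have "(%k. z k ^ k - y k ^ k) \<longlonglongrightarrow> 0"
 proof (rule Lim_null_comparison)
  show "\<forall>\<^sub>F k in sequentially. norm (z k ^ k - y k ^ k) <= exp c * norm (real k *\<^sub>R (z k - 1) - real k *\<^sub>R (y k - 1))"
   using bound[OF z] bound[OF y] eventually_gt_at_top[of 0]
  proof eventually_elim
   case (elim k)
   have "1 <= exp (c / real k)" by (simp add: c_def)
   from power_diff_norm[OF elim(1,2) this, of k]
   have "norm (z k ^ k - y k ^ k) <= real k * exp (c / real k) ^ k * norm (z k - y k)" .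
   also have "exp (c / real k) ^ k = exp c" using elim(3) by (simp add: exp_of_nat_mult[symmetric])
   also have "real k * exp c * norm (z k - y k) = exp c * norm (real k *\<^sub>R (z k - y k))" by simp
   also have "real k *\<^sub>R (z k - y k) = real k *\<^sub>R (z k - 1) - real k *\<^sub>R (y k - 1)" by (simp add: algebra_simps)
   finally show ?case .
  qed
  have "(%k. exp c * norm (real k *\<^sub>R (z k - 1) - real k *\<^sub>R (y k - 1))) \<longlonglongrightarrow> exp c * norm (w - w)"
   by (intro tendsto_intros z y)
  then show "(%k. exp c * norm (real k *\<^sub>R (z k - 1) - real k *\<^sub>R (y k - 1))) \<longlonglongrightarrow> 0" by simp
 qed
 moreover have "\<forall>\<^sub>F k in sequentially. y k ^ k = exp w"
  using eventually_gt_at_top[of 0]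
 proof eventually_elim
  case (elim k)
  have "of_nat k * ((1 / real k) *\<^sub>R w) = w" using elim by (simp add: of_nat_smat smat_of_real[of "real k", simplified])
  then show ?case unfolding y_def exp_power by simp
 qed
 then have "(%k. y k ^ k) \<longlonglongrightarrow> exp w" by (rule tendsto_eventually)
 ultimately have "(%k. (z k ^ k - y k ^ k) + y k ^ k) \<longlonglongrightarrow> 0 + exp w" by (rule tendsto_add)
 then show ?thesis by simp
qed

lemma alg_sub_power: "alg_sub C ==> rep x \<in> C ==> rep (x ^ k) \<in> C"
proof (induction k)
 case (Suc k)
 have "rep x ** rep (x ^ k) \<in> C" by (rule alg_subD(3)) (use Suc in auto)
 then show ?case by simp
qed (simp add: alg_subD(2))

text \<open>The Lie product formula: the powers of exp(a / k) exp(b / k) stay in the group and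
  converge to exp(a + b).\<close>

lemma lie_add:
 assumes C: "alg_sub C" and u: "u \<in> lie C" and v: "v \<in> lie C" shows "u + v \<in> lie C"
 unfolding lie_def
proof (intro CollectI allI)
 fix s
 define a b where "a = smat s * u" and "b = smat s * v"
 have ab: "a \<in> lie C" "b \<in> lie C" using u v lie_scale by (auto simp: a_def b_def)
 define z where "z k = exp ((1 / real k) *\<^sub>R a) * exp ((1 / real k) *\<^sub>R b)" for k :: nat
 have "(%k. real k *\<^sub>R (exp ((1 / real k) *\<^sub>R a) - 1) * exp ((1 / real k) *\<^sub>R b) + real k *\<^sub>R (exp ((1 / real k) *\<^sub>R b) - 1)) \<longlonglongrightarrow> a * 1 + b"
  by (intro tendsto_intros exp_difference_quotient scaled_limit_imp_limit[OF exp_difference_quotient])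
 moreover have "real k *\<^sub>R (z k - 1) = real k *\<^sub>R (exp ((1 / real k) *\<^sub>R a) - 1) * exp ((1 / real k) *\<^sub>R b) + real k *\<^sub>R (exp ((1 / real k) *\<^sub>R b) - 1)" for k
 proof -
  have "z k - 1 = (exp ((1 / real k) *\<^sub>R a) - 1) * exp ((1 / real k) *\<^sub>R b) + (exp ((1 / real k) *\<^sub>R b) - 1)"
   by (simp add: z_def left_diff_distrib)
  then show ?thesis by (simp only: scaleR_add_right mult_scaleR_left)
 qed
 ultimately have "(%k. real k *\<^sub>R (z k - 1)) \<longlonglongrightarrow> a + b" by (simp only: mult_1_right)
 from power_limit_exp[OF this] have lim: "(%k. rep (z k ^ k)) \<longlonglongrightarrow> rep (exp (a + b))" by (rule tendsto_rep)
 have mem: "rep (z k ^ k) \<in> C" for k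
 proof (rule alg_sub_power[OF C])
  show "rep (z k) \<in> C" unfolding z_def rep_simps by (rule alg_subD(3)[OF C]) (rule lie_exp[OF lie_scaleR]; rule ab)+
 qed
 have "rep (exp (a + b)) \<in> C" by (rule zero_locus_limit[OF alg_subD(1)[OF C] mem lim invertible_exp])
 then show "rep (exp (smat s * (u + v))) \<in> C" by (simp add: a_def b_def distrib_left)
qed

lemma exp_conj:
 assumes "y * x = (1 :: 'n::finite cmat)" shows "exp (x * a * y) = x * exp a * y"
proof (cases "x * y = 1")
 case True
 have "(x * a * y) ^ k = x * a ^ k * y" for k
 proof (induction k)
  case (Suc k)
  have "(x * a * y) ^ Suc k = (x * a * y) * (x * a ^ k * y)" using Suc by simp
  also have "... = x * a * (y * x) * (a ^ k * y)" by (simp only: mult.assoc)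
  finally show ?case by (simp add: assms mult.assoc)
 qed (simp add: True)
 moreover have "(%k. x * (a ^ k /\<^sub>R fact k) * y) sums (x * exp a * y)"
  by (intro sums_mult sums_mult2 exp_converges)
 ultimately have "(%k. (x * a * y) ^ k /\<^sub>R fact k) sums (x * exp a * y)" by simp
 then show ?thesis using exp_converges[of "x * a * y"] sums_unique2 by blast
next
 case False
 have "rep y ** rep x = mat 1" using arg_cong[OF assms, of rep] by simp
 then have "rep x ** rep y = mat 1" using matrix_left_right_inverse by blast
 then have "x * y = 1" by (intro cmat_eqI) simp
 then show ?thesis using False by simp
qed

lemma lie_Ad:
 assumes C: "alg_sub C" and v: "v \<in> lie C" and x: "rep x \<in> C" "y * x = 1" "x * y = 1"
 shows "x * v * y \<in> lie C"
 unfolding lie_def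
proof (intro CollectI allI)
 fix s
 have "smat s * (x * v * y) = x * (smat s * v) * y" by (simp add: mult.assoc smat_left_commute)
 then have "exp (smat s * (x * v * y)) = x * exp (smat s * v) * y" using exp_conj[OF x(2)] by simp
 moreover have "rep y \<in> C" by (rule alg_sub_inverse[OF C x(1)]) (use arg_cong[OF x(3), of rep] in simp)
 ultimately show "rep (exp (smat s * (x * v * y))) \<in> C"
  using v x(1) alg_subD(3)[OF C] by (simp add: lie_def)
qed

lemma lie_subspace: assumes C: "alg_sub C" shows "subspace (rep ` lie C)"
proof (rule subspaceI)
 have "0 \<in> lie C" using alg_subD(2)[OF C] by (simp add: lie_def)
 then show "0 \<in> rep ` lie C" by (rule rev_image_eqI) simp
 show "x + y \<in> rep ` lie C" if xy: "x \<in> rep ` lie C" "y \<in> rep ` lie C" for x y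
 proof -
  obtain u v where "u \<in> lie C" "v \<in> lie C" "x = rep u" "y = rep v" using xy by blast
  then show ?thesis using lie_add[OF C] by (intro rev_image_eqI[of "u + v"]) auto
 qed
 show "c *\<^sub>R x \<in> rep ` lie C" if x: "x \<in> rep ` lie C" for c x
 proof -
  obtain u where "u \<in> lie C" "x = rep u" using x by blast
  then show ?thesis using lie_scaleR[of u C c] by (intro rev_image_eqI[of "c *\<^sub>R u"]) auto
 qed
qed

lemma lie_limit:
 assumes C: "alg_sub C" and v: "!!k::nat. v k \<in> lie C" "v \<longlonglongrightarrow> w" shows "w \<in> lie C"
proof -
 have cl: "closed (rep ` lie C)" by (rule closed_subspace[OF lie_subspace[OF C]])
 have lim: "(%k. rep (v k)) \<longlonglongrightarrow> rep w" by (rule tendsto_rep[OF v(2)])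
 have "rep w \<in> rep ` lie C" by (rule closed_sequentially[OF cl _ lim]) (use v(1) in simp)
 then show ?thesis by (auto simp: rep_inject)
qed

lemma lie_minus: "alg_sub C ==> u \<in> lie C ==> v \<in> lie C ==> u - v \<in> lie C"
 using lie_add[of C u "(-1) *\<^sub>R v"] lie_scaleR[of v C "-1"] by simp

text \<open>The bracket is the derivative at 0 of conjugation by exp(t u), a limit of difference
  quotients inside the finite-dimensional, hence closed, subspace \<open>lie C\<close>.\<close>

lemma lie_bracket:
 assumes C: "alg_sub C" and u: "u \<in> lie C" and v: "v \<in> lie C" shows "u * v - v * u \<in> lie C"
proof (rule lie_limit[OF C])
 let ?E = "%k::nat. exp ((1 / real k) *\<^sub>R u)" and ?F = "%k::nat. exp ((1 / real k) *\<^sub>R (- u))"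
 have F: "?F k = exp (- ((1 / real k) *\<^sub>R u))" for k by simp
 show "real k *\<^sub>R (?E k * v * ?F k - v) \<in> lie C" for k
 proof -
  have "?E k * v * ?F k \<in> lie C"
   unfolding F by (rule lie_Ad[OF C v lie_exp[OF lie_scaleR[OF u]] exp_inverse_cmat(2,1)])
  then show ?thesis by (rule lie_scaleR[OF lie_minus[OF C _ v]])
 qed
 have "(%k. real k *\<^sub>R (?E k - 1) * v * ?F k + v * (real k *\<^sub>R (?F k - 1))) \<longlonglongrightarrow> u * v * 1 + v * (- u)"
  by (intro tendsto_intros exp_difference_quotient scaled_limit_imp_limit[OF exp_difference_quotient])
 moreover have "real k *\<^sub>R (?E k * v * ?F k - v) = real k *\<^sub>R (?E k - 1) * v * ?F k + v * (real k *\<^sub>R (?F k - 1))" for k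
 proof -
  have "?E k * v * ?F k - v = (?E k - 1) * v * ?F k + v * (?F k - 1)"
   by (simp only: left_diff_distrib right_diff_distrib mult_1_left mult_1_right) simp
  then show ?thesis by (simp only: scaleR_add_right mult_scaleR_left mult_scaleR_right)
 qed
 ultimately show "(%k. real k *\<^sub>R (?E k * v * ?F k - v)) \<longlonglongrightarrow> u * v - v * u"
  by (simp only: mult_1_right mult_minus_right add_uminus_conv_diff)
qed

lemma continuous_on_exp_cmat: "continuous_on UNIV (exp :: 'n::finite cmat => 'n cmat)"
proof -
 have "continuous_on (ball 0 B) (exp :: 'n cmat => 'n cmat)" for B
 proof -
  have "uniform_limit (ball 0 B) (%n x. \<Sum>k<n. x ^ k /\<^sub>R fact k) (%x :: 'n cmat. \<Sum>k. x ^ k /\<^sub>R fact k) sequentially"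
  proof (rule Weierstrass_m_test)
   fix k and x :: "'n cmat" assume "x \<in> ball 0 B"
   then have "norm x <= B" by simp
   then have "norm (x ^ k) <= B ^ k" using norm_power_ineq[of x k] power_mono[of "norm x" B k] by simp
   then show "norm (x ^ k /\<^sub>R fact k) <= B ^ k /\<^sub>R fact k" by (simp add: mult_left_mono)
  qed (rule summable_exp_generic)
  then have "uniform_limit (ball 0 B) (%n x. \<Sum>k<n. x ^ k /\<^sub>R fact k) (exp :: 'n cmat => 'n cmat) sequentially"
   by (simp add: exp_def)
  then show ?thesis
   by (rule uniform_limit_theorem[rotated]) (auto intro!: always_eventually continuous_intros)
 qed
 then have "continuous (at x) (exp :: 'n cmat => 'n cmat)" for x
  using continuous_on_interior[of "ball 0 (norm x + 1)" exp x] by simp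
 then show ?thesis by (simp add: continuous_at_imp_continuous_on)
qed

text \<open>A logarithm near 1 by Brouwer's fixed point theorem: v is a fixed point of v -> x - 1 -
  (exp v - 1 - v). The quadratic remainder maps the ball of radius \<delta> into itself, since
  \<delta>^2 <= \<delta> / 2.\<close>

lemma exp_locally_surjective:
 assumes "0 < \<delta>" "\<delta> <= 1/2" "norm (x - 1) <= \<delta> / 2"
 shows "\<exists>v. norm v <= \<delta> & exp v = (x :: 'n::finite cmat)"
proof -
 define S where "S = rep ` cball (0 :: 'n cmat) \<delta>"
 have S: "S = {A. norm (Cm A) <= \<delta>}"
  unfolding S_def by (auto intro!: image_eqI[of _ _ "Cm _"])
 have "closed S" unfolding S by (intro closed_Collect_le continuous_intros continuous_on_id)
 moreover have "bounded S"
  unfolding S_def by (rule bounded_linear_image[OF bounded_cball bounded_linear_rep])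
 ultimately have cS: "compact S" by (simp add: compact_eq_bounded_closed)
 have cvx: "convex S" unfolding S_def by (rule convex_linear_image[OF bounded_linear.linear[OF bounded_linear_rep] convex_cball])
 have ne: "S ~= {}" using assms(1) by (auto simp: S_def)
 define \<phi> where "\<phi> A = rep (x - 1 - (exp (Cm A) - 1 - Cm A))" for A
 have "continuous_on S \<phi>" unfolding \<phi>_def
  by (intro continuous_intros continuous_on_compose2[OF continuous_on_exp_cmat] continuous_on_id) auto
 moreover have "\<phi> A \<in> S" if "A \<in> S" for A
 proof -
  have n: "norm (Cm A) <= \<delta>" using that by (simp add: S)
  then have "norm (exp (Cm A) - 1 - Cm A) <= (norm (Cm A))\<^sup>2" using assms(2) by (intro norm_exp_remainder) linarith
  also have "... <= \<delta>\<^sup>2" using n by (intro power_mono) auto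
  also have "... <= \<delta> / 2" using assms(1,2) by (simp add: power2_eq_square)
  finally have "norm (x - 1 - (exp (Cm A) - 1 - Cm A)) <= \<delta>" using assms(3) norm_triangle_ineq4[of "x - 1" "exp (Cm A) - 1 - Cm A"] by linarith
  then show ?thesis unfolding S \<phi>_def mem_Collect_eq Cm_rep .
 qed
 then have "\<phi> \<in> S \<rightarrow> S" by blast
 ultimately obtain A where A: "A \<in> S" "\<phi> A = A" using brouwer[OF cS cvx ne] by blast
 have "x - 1 - (exp (Cm A) - 1 - Cm A) = Cm A" using arg_cong[OF A(2), of Cm] unfolding \<phi>_def Cm_rep .
 then have "exp (Cm A) = x" by (simp add: algebra_simps)
 then show ?thesis using A(1) by (intro exI[of _ "Cm A"]) (simp add: S)
qed

text \<open>If v is small, so are its eigenvalues, and the defining equations along exp(s v) have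
  frequencies of imaginary part at most 1. The exponential is injective on that strip, so the powers
  of x, which satisfy the equations, force the whole one-parameter group to do so.\<close>

lemma alg_sub_log:
 assumes C: "alg_sub C"
 shows "\<exists>\<epsilon>>0. \<forall>x :: 'n::finite cmat. rep x \<in> C --> norm (x - 1) < \<epsilon> --> (\<exists>v\<in>lie C. exp v = x)"
proof -
 obtain P0 where P0: "P0 \<subseteq> Rg" "C = zero_locus P0" using alg_subD(1)[OF C] closedin_zariski by blast
 obtain P where P: "P \<subseteq> P0" "finite P" "zero_locus P = zero_locus P0" using zero_locus_finite[OF P0(1)] by blast
 have PR: "P \<subseteq> Rg" using P(1) P0(1) by blast
 have CP: "C = zero_locus P" using P(3) P0(2) by simp
 have "\<forall>p\<in>P. \<exists>d::nat. \<forall>c\<ge>0. \<forall>M :: complex => complex^'n^'n. (\<forall>i j. (%s. M s $ i $ j) \<in> epoly {\<mu>. \<bar>Im \<mu>\<bar> <= c}) -->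
   (%s. p (M s)) \<in> epoly {\<mu>. \<bar>Im \<mu>\<bar> <= real d * c}"
  using PR poly_fun_epoly_strip by blast
 from bchoice[OF this] obtain d where d0: "\<forall>p\<in>P. \<forall>c\<ge>0. \<forall>M :: complex => complex^'n^'n. (\<forall>i j. (%s. M s $ i $ j) \<in> epoly {\<mu>. \<bar>Im \<mu>\<bar> <= c}) -->
   (%s. p (M s)) \<in> epoly {\<mu>. \<bar>Im \<mu>\<bar> <= real (d p :: nat) * c}" by (elim exE)
 have d: "!!p c (M :: complex => complex^'n^'n). p \<in> P ==> c >= 0 ==> (!!i j. (%s. M s $ i $ j) \<in> epoly {\<mu>. \<bar>Im \<mu>\<bar> <= c}) ==>
   (%s. p (M s)) \<in> epoly {\<mu>. \<bar>Im \<mu>\<bar> <= real (d p) * c}" by (rule d0[rule_format])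
 define N where "N = Max (insert 1 (d ` P))"
 have N: "1 <= N" "!!p. p \<in> P ==> d p <= N" using P(2) by (auto simp: N_def)
 \<comment> \<open>\<open>N\<close> bounds the degrees of the finitely many defining equations,
   whence N \<delta> <= 1; and \<delta> <= 1/2 is what the local logarithm requires.\<close>
 define \<delta> where "\<delta> = 1 / (2 * real N)"
 have \<delta>: "0 < \<delta>" "\<delta> <= 1/2" "real N * \<delta> <= 1" using N(1) by (auto simp: \<delta>_def field_simps)
 have inj: "inj_on (%\<mu>. exp (\<mu> * 1)) {\<mu>. \<bar>Im \<mu>\<bar> <= 1}"
 proof (rule inj_onI)
  fix \<mu> \<nu> :: complex assume m: "\<mu> \<in> {\<mu>. \<bar>Im \<mu>\<bar> <= 1}" "\<nu> \<in> {\<mu>. \<bar>Im \<mu>\<bar> <= 1}" and e: "exp (\<mu> * 1) = exp (\<nu> * 1)"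
  obtain k :: int where k: "\<mu> = \<nu> + of_int (2 * k) * of_real pi * \<i>" using e by (auto simp: exp_eq)
  have "Im \<mu> - Im \<nu> = 2 * real_of_int k * pi" using k by simp
  moreover have "\<bar>Im \<mu> - Im \<nu>\<bar> <= 2" using m by (simp add: abs_le_iff)
  ultimately have "\<bar>real_of_int k\<bar> * (2 * pi) <= 2" by (simp add: abs_mult mult_ac)
  moreover have "2 * pi > 2" using pi_gt3 by simp
  ultimately have "\<bar>real_of_int k\<bar> < 1"
   using mult_right_mono[of 1 "\<bar>real_of_int k\<bar>" "2 * pi"] by linarith
  then have "k = 0" by simp
  then show "\<mu> = \<nu>" using k by simp
 qed
 have "\<exists>v\<in>lie C. exp v = x" if x: "rep x \<in> C" "norm (x - 1) < \<delta> / 2" for x :: "'n cmat"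
 proof -
  obtain v where v: "norm v <= \<delta>" "exp v = x" using exp_locally_surjective[OF \<delta>(1,2), of x] x(2) by auto
  have "\<exists>\<Lambda>. (\<forall>l\<in>\<Lambda>. \<exists>u\<noteq>0. v * u = smat l * u) & (\<forall>i j. (%s. ent (exp (smat s * v)) i j) \<in> epoly \<Lambda>)"
  proof (rule exp_epoly[of v])
   fix \<Lambda> assume a: "finite \<Lambda>" "!!l. l \<in> \<Lambda> ==> \<exists>u\<noteq>0. v * u = smat l * u" "!!i j. (%s. ent (exp (smat s * v)) i j) \<in> epoly \<Lambda>"
   show ?thesis by (rule exI[of _ \<Lambda>], intro conjI ballI allI a(2,3))
  qed
  then obtain \<Lambda> where \<Lambda>0: "\<forall>l\<in>\<Lambda>. \<exists>u\<noteq>0. v * u = smat l * u" "\<forall>i j. (%s. ent (exp (smat s * v)) i j) \<in> epoly \<Lambda>"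
   by (elim exE conjE)
  note \<Lambda> = bspec[OF \<Lambda>0(1)] \<Lambda>0(2)[rule_format]
  have sub: "\<Lambda> \<subseteq> {\<mu>. \<bar>Im \<mu>\<bar> <= \<delta>}"
  proof
   fix l assume "l \<in> \<Lambda>"
   then obtain u where "u ~= 0" "v * u = smat l * u" using \<Lambda>(1) by blast
   then have "cmod l <= norm v" by (rule eigenvalue_norm)
   then show "l \<in> {\<mu>. \<bar>Im \<mu>\<bar> <= \<delta>}" using v(1) abs_Im_le_cmod[of l] by simp
  qed
  have "rep (exp (smat s * v)) \<in> C" for s
  proof -
   have "p (rep (exp (smat s * v))) = 0" if p: "p \<in> P" for p
   proof (rule epoly_zero[where f="%s. p (rep (exp (smat s * v)))" and s=s, OF _ inj])
    have "(%s. p (rep (exp (smat s * v)))) \<in> epoly {\<mu>. \<bar>Im \<mu>\<bar> <= real (d p) * \<delta>}"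
     by (rule d[OF p]) (use \<delta>(1) epoly_mono[OF \<Lambda>(2) sub] in auto)
    moreover have "real (d p) * \<delta> <= 1"
     using N(2)[OF p] \<delta> mult_right_mono[of "real (d p)" "real N" \<delta>] by linarith
    then have "{\<mu>. \<bar>Im \<mu>\<bar> <= real (d p) * \<delta>} \<subseteq> {\<mu>. \<bar>Im \<mu>\<bar> <= 1}" by auto
    ultimately show "(%s. p (rep (exp (smat s * v)))) \<in> epoly {\<mu>. \<bar>Im \<mu>\<bar> <= 1}" by (rule epoly_mono)
    show "p (rep (exp (smat (of_nat k * 1) * v))) = 0" for k :: nat
    proof -
     have "exp (smat (of_nat k * 1) * v) = x ^ k" unfolding v(2)[symmetric] exp_power by (simp add: of_nat_smat)
     then have "rep (exp (smat (of_nat k * 1) * v)) \<in> C" using alg_sub_power[OF C x(1)] by simp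
     then show ?thesis using p unfolding CP zero_locus_def by blast
    qed
   qed simp
   then show ?thesis unfolding CP zero_locus_def by (simp add: invertible_exp)
  qed
  then have "v \<in> lie C" by (simp add: lie_def)
  then show ?thesis using v(2) by blast
 qed
 then show ?thesis using \<delta>(1) by (intro exI[of _ "\<delta> / 2"]) auto
qed

lemma zariski_minimal:
 assumes "S ~= {}" "!!C. C \<in> S ==> closedin zariski (C :: (complex^'n^'n) set)"
 shows "\<exists>C\<in>S. \<forall>D\<in>S. D \<subseteq> C --> D = C"
proof (rule ccontr)
 assume "\<not> ?thesis"
 then have "\<forall>C\<in>S. \<exists>D. D \<in> S & D \<subset> C" by blast
 then obtain f where f: "!!C. C \<in> S ==> f C \<in> S & f C \<subset> C" by metis
 obtain C0 where C0: "C0 \<in> S" using assms(1) by blast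
 define C where "C k = (f ^^ k) C0" for k
 have CS: "C k \<in> S" for k by (induction k) (auto simp: C_def C0 f)
 have "C (Suc k) \<subset> C k" for k using f[OF CS[of k]] by (simp add: C_def)
 then show False using zariski_descending_chain[of C] assms(2)[OF CS] by blast
qed

text \<open>Near 1 the groups coincide through the logarithm, so the cosets of \<open>L\<close> in
  \<open>Z\<close> are open in the Euclidean topology and countably many cover \<open>Z\<close>.
  Reducing to finitely many makes the complement of \<open>L\<close> in \<open>Z\<close> Zariski
  closed, and a connected set containing 1 cannot meet it.\<close>

theorem identity_component_subset:
 assumes Z: "alg_sub Z" and L: "alg_sub L" "L \<subseteq> Z" and lie: "lie Z \<subseteq> lie (L :: (complex^'n::finite^'n) set)"
 shows "identity_component Z \<subseteq> L"
proof -
 obtain \<epsilon> where e: "\<epsilon> > 0" "!!x :: 'n cmat. rep x \<in> Z ==> norm (x - 1) < \<epsilon> ==> \<exists>v\<in>lie Z. exp v = x"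
  using alg_sub_log[OF Z] by blast
 have near: "rep x \<in> L" if "rep x \<in> Z" "norm (x - 1) < \<epsilon>" for x :: "'n cmat"
  using e(2)[OF that] lie_exp[of _ L] lie by blast
 \<comment> \<open>The left coset of \<open>L\<close> by the inverse of \<open>X\<close>, written
   without the inverse.\<close>
 define co where "co X = {W \<in> GL_set. X ** W \<in> L}" for X
 note ZD = alg_subD[OF Z] and LD = alg_subD[OF L(1)]
 have cancel: "W \<in> A" if A: "alg_sub A" "X \<in> A" "X ** W \<in> A" for A and X W :: "complex^'n^'n"
 proof -
  obtain Y where "Y \<in> A" "Y ** X = mat 1" using alg_subD(4)[OF A(1,2)] by blast
  then show ?thesis using alg_subD(3)[OF A(1) _ A(3)] by (metis matrix_mul_assoc matrix_mul_lid)
 qed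
 have coZ: "co X \<subseteq> Z" if "X \<in> Z" for X using cancel[OF Z that] L(2) by (auto simp: co_def)
 have co_closed: "closedin zariski (co X)" if "X \<in> Z" for X
  unfolding co_def using LD(1) ZD(5)[OF that] by (rule closed_left_preimage)
 have co_open: "openin (top_of_set Z) (co X)" if X: "X \<in> Z" for X
  unfolding openin_contains_ball
 proof (intro conjI ballI)
  show "co X \<subseteq> Z" by (rule coZ[OF X])
  fix W assume W: "W \<in> co X"
  then obtain Y where Y: "Y \<in> Z" "Y ** W = mat 1" "W ** Y = mat 1" using ZD(4) coZ[OF X] by blast
  have "continuous_on UNIV (%V. norm (Cm Y * Cm V - 1))" by (intro continuous_intros)
  then have o: "open {V. norm (Cm Y * Cm V - 1) < \<epsilon>}" by (intro open_Collect_less continuous_intros)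
  have "Cm Y * Cm W = 1" by (rule cmat_eqI) (simp add: Y)
  then have "W \<in> {V. norm (Cm Y * Cm V - 1) < \<epsilon>}" using e(1) by simp
  then obtain r where r: "r > 0" "ball W r \<subseteq> {V. norm (Cm Y * Cm V - 1) < \<epsilon>}" using o open_contains_ball by blast
  have "V \<in> co X" if V: "V \<in> ball W r" "V \<in> Z" for V
  proof -
   have "rep (Cm Y * Cm V) \<in> L" using r(2) V ZD(3)[OF Y(1)] by (intro near) auto
   then have "(X ** W) ** (Y ** V) \<in> L" using W LD(3) by (simp add: co_def)
   moreover have "(X ** W) ** (Y ** V) = X ** ((W ** Y) ** V)" by (simp only: matrix_mul_assoc)
   ultimately show ?thesis using V ZD(5) by (simp add: co_def Y(3))
  qed
  then show "\<exists>e>0. ball W e \<inter> Z \<subseteq> co X" using r(1) by blast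
 qed
 then have op: "openin (top_of_set Z) U" if "U \<in> co ` Z" for U using that by blast
 obtain \<D> where D: "\<D> \<subseteq> co ` Z" "countable \<D>" "\<Union>\<D> = \<Union>(co ` Z)"
  using Lindelof_openin[of "co ` Z" Z] op by blast
 have cov: "Z \<subseteq> \<Union>\<D>"
 proof
  fix X assume X: "X \<in> Z"
  obtain Y where Y: "Y \<in> Z" "Y ** X = mat 1" using ZD(4)[OF X] by blast
  then have "X \<in> co Y" using LD(2) ZD(5)[OF X] by (simp add: co_def)
  then show "X \<in> \<Union>\<D>" using Y(1) D(3) by blast
 qed
 \<comment> \<open>Noetherian induction: a minimal closed subset without finite subcover is
   irreducible, hence contained in a single coset of the countable cover.\<close>
 have "\<exists>F\<subseteq>\<D>. finite F & C \<subseteq> \<Union>F" if C: "closedin zariski C" "C \<subseteq> Z" for C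
 proof (rule ccontr)
  assume no: "\<not> ?thesis"
  define S where "S = {C. closedin zariski C & C \<subseteq> Z & \<not> (\<exists>F\<subseteq>\<D>. finite F & C \<subseteq> \<Union>F)}"
  have "S ~= {}" using no C by (auto simp: S_def)
  from zariski_minimal[OF this] obtain M where M: "M \<in> S" "!!D. D \<in> S ==> D \<subseteq> M ==> D = M" by (auto simp: S_def)
  have MS: "closedin zariski M" "M \<subseteq> Z" "\<not> (\<exists>F\<subseteq>\<D>. finite F & M \<subseteq> \<Union>F)" using M(1) by (auto simp: S_def)
  have "M ~= {}" using MS(3) by auto
  have irr: "M \<subseteq> A \<or> M \<subseteq> B" if AB: "closedin zariski A" "closedin zariski B" "M \<subseteq> A \<union> B" for A B
  proof (rule ccontr)
   assume n: "\<not> ?thesis"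
   have fin: "\<exists>F\<subseteq>\<D>. finite F & M \<inter> E \<subseteq> \<Union>F" if E: "closedin zariski E" "\<not> M \<subseteq> E" for E
   proof (rule ccontr)
    assume nf: "\<not> ?thesis"
    have "closedin zariski (M \<inter> E)" using MS(1) E(1) by (rule closedin_Int)
    then have "M \<inter> E \<in> S" using MS(2) nf unfolding S_def by blast
    from M(2)[OF this] show False using E(2) by blast
   qed
   obtain F G where "F \<subseteq> \<D>" "finite F" "M \<inter> A \<subseteq> \<Union>F" "G \<subseteq> \<D>" "finite G" "M \<inter> B \<subseteq> \<Union>G"
    using fin[OF AB(1)] fin[OF AB(2)] n by blast
   then have "F \<union> G \<subseteq> \<D> & finite (F \<union> G) & M \<subseteq> \<Union>(F \<union> G)" using AB(3) by blast
   then show False using MS(3) by blast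
  qed
  have "closedin zariski E" if "E \<in> \<D>" for E using that D(1) co_closed by blast
  then obtain E where "E \<in> \<D>" "M \<subseteq> E"
   using irreducible_countable_cover[OF MS(1) \<open>M ~= {}\<close> irr D(2)] MS(2) cov by blast
  then have "{E} \<subseteq> \<D> & finite {E} & M \<subseteq> \<Union>{E}" by simp
  then show False using MS(3) by blast
 qed
 from this[OF ZD(1)] obtain F where F: "F \<subseteq> \<D>" "finite F" "Z \<subseteq> \<Union>F" by blast
 have sub: "W \<in> L" if X: "X \<in> Z" and V: "V \<in> co X" "V \<in> L" and W: "W \<in> co X" for X V W
 proof -
  obtain V' where "V' \<in> L" "V ** V' = mat 1" using LD(4)[OF V(2)] by blast
  then have "X \<in> L" using LD(3)[of "X ** V" V'] V(1) by (simp add: co_def matrix_mul_assoc[symmetric])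
  then show ?thesis using cancel[OF L(1), of X W] W by (simp add: co_def)
 qed
 have "Z - L = \<Union>{E \<in> F. E \<inter> L = {}}"
 proof
  show "Z - L \<subseteq> \<Union>{E \<in> F. E \<inter> L = {}}"
  proof
   fix W assume W: "W \<in> Z - L"
   then obtain E where E: "E \<in> F" "W \<in> E" using F(3) by blast
   then obtain X where "X \<in> Z" "E = co X" using F(1) D(1) by blast
   then have "E \<inter> L = {}" using sub[of X _ W] W E(2) by blast
   then show "W \<in> \<Union>{E \<in> F. E \<inter> L = {}}" using E by blast
  qed
 qed (use F(1) D(1) coZ in blast)
 moreover have "closedin zariski E" if "E \<in> F" for E using that F(1) D(1) co_closed by blast
 then have "closedin zariski (\<Union>{E \<in> F. E \<inter> L = {}})" using F(2) by (intro closedin_Union) auto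
 ultimately have clR: "closedin zariski (Z - L)" by simp
 show ?thesis
 proof
  fix Y assume "Y \<in> identity_component Z"
  then obtain T where T: "connectedin (subtopology zariski Z) T" "mat 1 \<in> T" "Y \<in> T"
   by (auto simp: identity_component_def connected_component_of_def)
  then have T': "connectedin zariski T" "T \<subseteq> Z" by (auto simp: connectedin_subtopology)
  then have "T \<subseteq> L \<union> (Z - L)" "L \<inter> (Z - L) \<inter> T = {}" "L \<inter> T ~= {}" using T LD(2) by blast+
  then have "(Z - L) \<inter> T = {}" using T'(1) clR LD(1) unfolding connectedin_closedin by blast
  then show "Y \<in> L" using T(3) T'(2) by blast
 qed
qed

section \<open>Representations of sl2\<close>

text \<open>Conjugation by exp(t a) solves B' = [a, B]; guessing the solution replaces summing the
  adjoint series.\<close>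

lemma conj_ode:
 fixes a :: "'n::finite cmat"
 assumes B: "!!t. (B has_vector_derivative B' t) (at t)" and eq: "!!t. a * B t - B t * a = B' t"
 shows "B 1 = exp a * B 0 * exp (- a)"
proof -
 define P Q where "P t = exp (t *\<^sub>R (- a))" and "Q t = exp (t *\<^sub>R a)" for t :: real
 have "((%t. P t * B t * Q t) has_vector_derivative 0) (at t)" for t
 proof -
  have dP: "(P has_vector_derivative P t * (- a)) (at t)" and dQ: "(Q has_vector_derivative Q t * a) (at t)"
   unfolding P_def Q_def by (rule exp_scaleR_has_vector_derivative_right)+
  have "((%t. P t * B t * Q t) has_vector_derivative (P t * B t) * (Q t * a) + (P t * B' t + P t * (- a) * B t) * Q t) (at t)"
   by (intro has_vector_derivative_mult dP dQ B)
  moreover have "Q t * a = a * Q t" unfolding Q_def by (rule exp_times_scaleR_commute)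
  ultimately show ?thesis unfolding eq[symmetric] by (simp add: algebra_simps)
 qed
 then obtain c where c: "!!t. t \<in> UNIV ==> P t * B t * Q t = c"
  using has_vector_derivative_zero_constant[of UNIV "%t. P t * B t * Q t"] by auto
 have "exp (- a) * B 1 * exp a = B 0" using c[of 1] c[of 0] by (simp add: P_def Q_def)
 then have "exp a * B 0 * exp (- a) = (exp a * exp (- a)) * B 1 * (exp a * exp (- a))" by (simp only: mult.assoc flip: \<open>exp (- a) * B 1 * exp a = B 0\<close>)
 then show ?thesis by (simp add: exp_inverse_cmat)
qed

definition br :: "'n::finite cmat => 'n cmat => 'n cmat" where "br a b = a * b - b * a"

lemma br_simps:
 "br a (x + y) = br a x + br a y" "br a (x - y) = br a x - br a y" "br a (smat c * x) = smat c * br a x"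
 "br a (r *\<^sub>R x) = r *\<^sub>R br a x" "br a 0 = 0" "br a (- x) = - br a x"
 "br (x + y) a = br x a + br y a" "br (x - y) a = br x a - br y a" "br (smat c * x) a = smat c * br x a"
 "br (r *\<^sub>R x) a = r *\<^sub>R br x a" "br 0 a = 0" "br (- x) a = - br x a"
 by (auto simp: br_def algebra_simps smat_left_commute)

lemma br_flip: "br b a = - br a b" by (simp add: br_def)
lemma br_jacobi: "br a (br b x) = br b (br a x) + br (br a b) x" by (simp add: br_def algebra_simps)

lemma exp_conj_quadratic:
 assumes "br a b = c" "br a c = d" "br a d = 0"
 shows "exp a * b * exp (- a) = b + c + (1/2) *\<^sub>R (d :: 'n::finite cmat)"
proof -
 define B where "B t = b + t *\<^sub>R c + (t\<^sup>2 / 2) *\<^sub>R d" for t :: real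
 have "(B has_vector_derivative (c + t *\<^sub>R d)) (at t)" for t
  unfolding B_def by (auto intro!: derivative_eq_intros)
 moreover have "a * B t - B t * a = c + t *\<^sub>R d" for t
 proof -
  have "a * B t - B t * a = br a (B t)" by (simp add: br_def)
  also have "... = c + t *\<^sub>R d" unfolding B_def br_simps assms by simp
  finally show ?thesis .
 qed
 ultimately have "B 1 = exp a * B 0 * exp (- a)" by (rule conj_ode)
 then show ?thesis by (simp add: B_def)
qed

text \<open>The action of exp(s ad h) on a Jordan chain of length at most two; the term s q will
  expose a nondiagonalizable part.\<close>

lemma exp_conj_jordan:
 assumes v: "br h v = smat l * v + q" and q: "br h q = smat l * (q :: 'n::finite cmat)"
 shows "exp (smat s * h) * v * exp (- (smat s * h)) = smat (exp (s * l)) * (v + smat s * q)"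
proof -
 define B where "B t = smat (exp (t *\<^sub>R (s * l))) * (v + t *\<^sub>R (smat s * q))" for t :: real
 define B' where "B' t = smat (exp (t *\<^sub>R (s * l))) * (smat s * q) + smat (exp (t *\<^sub>R (s * l)) * (s * l)) * (v + t *\<^sub>R (smat s * q))" for t :: real
 have "(B has_vector_derivative B' t) (at t)" for t
 proof -
  have "((%t. smat (exp (t *\<^sub>R (s * l))) :: 'n cmat) has_vector_derivative smat (exp (t *\<^sub>R (s * l)) * (s * l))) (at t)"
   by (rule bounded_linear.has_vector_derivative[OF bounded_linear_smat exp_scaleR_has_vector_derivative_right])
  moreover have "((%t. v + t *\<^sub>R (smat s * q)) has_vector_derivative smat s * q) (at t)"
   by (auto intro!: derivative_eq_intros)
  ultimately show ?thesis unfolding B_def B'_def by (rule has_vector_derivative_mult)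
 qed
 moreover have "smat s * h * B t - B t * (smat s * h) = B' t" for t
 proof -
  have "smat s * h * B t - B t * (smat s * h) = br (smat s * h) (B t)" by (simp add: br_def)
  also have "... = B' t" unfolding B_def B'_def br_simps v q
   by (rule cmat_entI) (simp add: scaleR_conv_of_real[where 'a=complex] algebra_simps del: rep_simps(6))
  finally show ?thesis .
 qed
 ultimately have "B 1 = exp (smat s * h) * B 0 * exp (- (smat s * h))" by (rule conj_ode)
 then show ?thesis by (simp add: B_def smat_simps)
qed

definition wt :: "'n::finite cmat => 'n cmat set => real => 'n cmat set" where
 "wt h V r = {v \<in> V. br h v = r *\<^sub>R v}"

locale sl2_triple =
 fixes e f h :: "'n::finite cmat"
 assumes he: "br h e = 2 *\<^sub>R e" and hf: "br h f = (-2) *\<^sub>R f" and ef: "br e f = h"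
begin

lemma swap: "sl2_triple f e (- h)"
proof
 show "br (- h) f = 2 *\<^sub>R f" "br (- h) e = (-2) *\<^sub>R e" "br f e = - h"
  by (simp_all add: br_simps he hf br_flip[of f e] ef)
qed

lemma fe: "br f (br e v) = br e (br f v) - br h v"
 using br_jacobi[of f e v] by (simp add: br_flip[of f e] ef br_simps)

end

text \<open>The modules considered are complex subspaces of the matrix space stable under the
  adjoint action of the triple.\<close>

locale sl2_rep = sl2_triple +
 fixes V :: "'n::finite cmat set"
 assumes V_0: "0 \<in> V" and V_add: "v \<in> V ==> w \<in> V ==> v + w \<in> V" and V_scale: "v \<in> V ==> smat c * v \<in> V"
  and V_e: "v \<in> V ==> br e v \<in> V" and V_f: "v \<in> V ==> br f v \<in> V"
begin

lemma V_scaleR: "v \<in> V ==> r *\<^sub>R v \<in> V" using V_scale[of v "of_real r"] by (simp add: smat_of_real)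
lemma V_diff: "v \<in> V ==> w \<in> V ==> v - w \<in> V" using V_add[of v "(-1) *\<^sub>R w"] V_scaleR[of w "-1"] by simp
lemma V_h: "v \<in> V ==> br h v \<in> V"
 using fe[of v] V_diff[OF V_e[OF V_f[of v]] V_f[OF V_e[of v]]] by simp

lemma swap_rep: "sl2_rep f e (- h) V"
 using swap by (auto simp: sl2_rep_def sl2_rep_axioms_def V_0 V_add V_scale V_e V_f)

lemma wt_e: "v \<in> wt h V r ==> br e v \<in> wt h V (r + 2)"
 using br_jacobi[of h e v] by (auto simp: wt_def V_e he br_simps scaleR_add_left)
lemma wt_f: "v \<in> wt h V r ==> br f v \<in> wt h V (r - 2)"
 using br_jacobi[of h f v] by (auto simp: wt_def V_f hf br_simps scaleR_diff_left)

lemma wt_bound: assumes "v \<in> wt h V r" "v ~= 0" shows "\<bar>r\<bar> <= 2 * norm h"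
proof -
 have "\<bar>r\<bar> * norm v = norm (h * v - v * h)" using assms(1) by (simp add: wt_def br_def)
 also have "... <= norm (h * v) + norm (v * h)" by (rule norm_triangle_ineq4)
 also have "... <= norm h * norm v + norm v * norm h" by (intro add_mono norm_mult_ineq)
 finally have "\<bar>r\<bar> * norm v <= (2 * norm h) * norm v" by simp
 then show ?thesis using assms(2) by (simp only: mult_le_cancel_right) auto
qed

text \<open>If e f v = 0 at a positive weight, then f maps e^(k+1) v to a negative multiple of e^k v
  for every k. The raising chain would never end, although weights are bounded by twice the norm of
  h.\<close>

lemma ef_injective:
 assumes v: "v \<in> wt h V r" and r: "r > 0" and 0: "br e (br f v) = 0" shows "v = 0"
proof (rule ccontr)
 assume nz: "v ~= 0"
 define x where "x k = (br e ^^ k) v" for k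
 have xS: "x (Suc k) = br e (x k)" for k by (simp add: x_def)
 have xw: "x k \<in> wt h V (r + 2 * real k)" for k
 proof (induction k)
  case (Suc k)
  from wt_e[OF Suc] show ?case by (simp add: xS algebra_simps)
 qed (simp add: x_def v)
 have xh: "br h (x k) = (r + 2 * real k) *\<^sub>R x k" for k using xw[of k] by (simp add: wt_def)
 have c: "\<exists>c<0. br f (x (Suc k)) = c *\<^sub>R x k" for k
 proof (induction k)
  case 0
  have "br f (x (Suc 0)) = (- r) *\<^sub>R x 0" unfolding xS fe using xh[of 0] by (simp add: x_def assms(3))
  then show ?case using r by (intro exI[of _ "- r"]) simp
 next
  case (Suc k)
  then obtain c where c: "c < 0" "br f (x (Suc k)) = c *\<^sub>R x k" by blast
  have "br f (x (Suc (Suc k))) = br e (br f (x (Suc k))) - br h (x (Suc k))" unfolding xS[of "Suc k"] by (rule fe)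
  also have "... = (c - (r + 2 * real (Suc k))) *\<^sub>R x (Suc k)"
   unfolding c(2) xh br_simps xS[of k, symmetric] by (simp only: scaleR_diff_left)
  finally show ?case using c(1) r by (intro exI[of _ "c - (r + 2 * real (Suc k))"]) auto
 qed
 have xnz: "x k ~= 0" for k
 proof (induction k)
  case (Suc k)
  obtain c where "c < 0" "br f (x (Suc k)) = c *\<^sub>R x k" using c by blast
  then show ?case using Suc by (auto simp: br_simps)
 qed (simp add: x_def nz)
 obtain k :: nat where "real k > norm h" using reals_Archimedean2 by blast
 moreover have "\<bar>r + 2 * real k\<bar> <= 2 * norm h" by (rule wt_bound[OF xw xnz])
 ultimately show False using r by linarith
qed

lemma wt_subspace: "subspace (rep ` wt h V r)"
proof (rule subspaceI)
 show "0 \<in> rep ` wt h V r" by (rule image_eqI[of _ _ 0]) (auto simp: wt_def V_0 br_simps)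
 show "x + y \<in> rep ` wt h V r" if xy: "x \<in> rep ` wt h V r" "y \<in> rep ` wt h V r" for x y
 proof -
  obtain u v where "u \<in> wt h V r" "v \<in> wt h V r" "x = rep u" "y = rep v" using xy by blast
  then show ?thesis by (intro image_eqI[of _ _ "u + v"]) (auto simp: wt_def V_add br_simps scaleR_add_right)
 qed
 show "c *\<^sub>R x \<in> rep ` wt h V r" if x: "x \<in> rep ` wt h V r" for c x
 proof -
  obtain u where "u \<in> wt h V r" "x = rep u" using x by blast
  then show ?thesis by (intro image_eqI[of _ _ "c *\<^sub>R u"]) (auto simp: wt_def V_scaleR br_simps)
 qed
qed

text \<open>An injective endomorphism of a finite-dimensional weight space is onto.\<close>

lemma ef_surjective:
 assumes v: "v \<in> wt h V r" and r: "r > 0" shows "\<exists>u\<in>wt h V r. br e (br f u) = v"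
proof -
 let ?T = "rep ` wt h V r" and ?g = "%A. rep (br e (br f (Cm A)))"
 have Cm_lin: "Cm (A + B) = Cm A + Cm B" "Cm (c *\<^sub>R A) = c *\<^sub>R Cm A" for A B :: "complex^'n^'n" and c
  by (rule cmat_eqI; simp)+
 have lin: "linear ?g" by (rule linearI) (simp_all add: Cm_lin br_simps)
 have mp: "br e (br f u) \<in> wt h V r" if "u \<in> wt h V r" for u using wt_e[OF wt_f[OF that]] by simp
 have sub: "?g ` ?T \<subseteq> ?T" using mp by auto
 have "A = 0" if A: "A \<in> ?T" "?g A = 0" for A
 proof -
  obtain u where u: "u \<in> wt h V r" "A = rep u" using A(1) by blast
  have "br e (br f u) = 0" by (rule cmat_eqI) (use A(2) u(2) in simp)
  then have "u = 0" by (rule ef_injective[OF u(1) r])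
  then show ?thesis by (simp add: u(2))
 qed
 then have "inj_on ?g ?T" using linear_inj_on_iff_eq_0[OF lin wt_subspace] by blast
 then have "inj_on ?g (span ?T)" using span_eq_iff wt_subspace by metis
 then have "dim (?g ` ?T) = dim ?T" by (rule dim_image_eq[OF lin])
 then have "?g ` ?T = ?T" using subspace_dim_equal[OF linear_subspace_image[OF lin wt_subspace] wt_subspace sub] by simp
 then have "rep v \<in> ?g ` ?T" using v by blast
 then obtain u where "u \<in> wt h V r" "rep v = rep (br e (br f u))" by auto
 then show ?thesis by (metis cmat_eqI)
qed

text \<open>By surjectivity of e f, every vector of weight 2 m + 2 is e applied to one of weight 2
  m.\<close>

lemma generated_positive:
 assumes W0: "wt h V 0 \<subseteq> W" and We: "!!v. v \<in> W ==> br e v \<in> W" shows "wt h V (2 * real m) \<subseteq> W"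
proof (induction m)
 case (Suc m)
 show ?case
 proof
  fix v assume "v \<in> wt h V (2 * real (Suc m))"
  then obtain u where u: "u \<in> wt h V (2 * real (Suc m))" "br e (br f u) = v" using ef_surjective[of v "2 * real (Suc m)"] by auto
  have "br f u \<in> wt h V (2 * real m)" using wt_f[OF u(1)] by (simp add: algebra_simps)
  then show "v \<in> W" using We Suc u(2) by blast
 qed
qed (use W0 in simp)

text \<open>Downward induction from a weight too large to occur. For v of weight 2 m choose u with e
  f u = e v; then f u is in \<open>W\<close> by induction and v - f u is killed by e.\<close>

lemma generated_kernel:
 assumes We: "!!v. v \<in> V ==> br e v = 0 ==> v \<in> W" and Wf: "!!v. v \<in> W ==> br f v \<in> W"
  and Wa: "!!v w. v \<in> W ==> w \<in> W ==> v + w \<in> W"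
 shows "wt h V 0 \<subseteq> W"
proof -
 obtain N :: nat where N: "real N > norm h" using reals_Archimedean2 by blast
 have W0: "0 \<in> W" by (rule We[OF V_0]) (simp add: br_simps)
 have "wt h V (2 * real (N - k)) \<subseteq> W" for k
 proof (induction k)
  case 0
  show ?case
  proof
   fix v assume v: "v \<in> wt h V (2 * real (N - 0))"
   have "v = 0" using wt_bound[OF v] N by fastforce
   then show "v \<in> W" using W0 by simp
  qed
 next
  case (Suc k)
  show ?case
  proof (cases "k < N")
   case True
   define m where "m = N - Suc k"
   have m: "2 * real (N - k) = 2 * real m + 2" "N - Suc k = m" using True by (auto simp: m_def of_nat_diff)
   show ?thesis unfolding m
   proof
    fix v assume v: "v \<in> wt h V (2 * real m)"
    obtain u where u: "u \<in> wt h V (2 * real m + 2)" "br e (br f u) = br e v" using ef_surjective[OF wt_e[OF v]] by auto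
    have "br f u \<in> W" using Wf Suc u(1) unfolding m(1) by blast
    moreover have "v - br f u \<in> W"
     by (rule We) (use u v in \<open>auto simp: wt_def V_diff V_f br_simps\<close>)
    ultimately have "br f u + (v - br f u) \<in> W" by (rule Wa)
    then show "v \<in> W" by simp
   qed
  qed (use Suc in simp)
 qed
 from this[of N] show ?thesis by simp
qed

end

section \<open>Diagonalizing ad h with even weights\<close>

inductive_set ann :: "'n::finite cmat => 'n cmat set" for h where
 zero: "0 \<in> ann h"
| step: "br h x - smat l * x \<in> ann h ==> x \<in> ann h"

lemma ann_br: "x \<in> ann h ==> br h x - smat m * x \<in> ann h"
proof (induction rule: ann.induct)
 case zero then show ?case by (simp add: br_simps ann.zero)
next
 case (step x l)
 have "br h (br h x - smat m * x) - smat l * (br h x - smat m * x) = br h (br h x - smat l * x) - smat m * (br h x - smat l * x)"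
  unfolding br_simps by (rule cmat_entI) (simp add: scaleR_conv_of_real[where 'a=complex] algebra_simps del: rep_simps(6))
 from ann.step[of h "br h x - smat m * x" l, unfolded this, OF step.IH] show ?case .
qed

lemma ann_add: "x \<in> ann h ==> y \<in> ann h ==> x + y \<in> ann h"
proof (induction arbitrary: y rule: ann.induct)
 case (step x l)
 have "br h (x + y) - smat l * (x + y) = (br h x - smat l * x) + (br h y - smat l * y)" by (simp add: br_simps algebra_simps)
 from ann.step[of h "x + y" l, unfolded this, OF step.IH[OF ann_br[OF step.prems]]] show ?case .
qed simp

lemma ann_scale: "x \<in> ann h ==> smat c * x \<in> ann h"
proof (induction rule: ann.induct)
 case (step x l)
 have "br h (smat c * x) - smat l * (smat c * x) = smat c * (br h x - smat l * x)"
  unfolding br_simps by (rule cmat_entI) (simp add: scaleR_conv_of_real[where 'a=complex] algebra_simps del: rep_simps(6))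
 from ann.step[of h "smat c * x" l, unfolded this, OF step.IH] show ?case .
qed (simp add: ann.zero)

text \<open>Left and right multiplication by h commute, and ad h - (a - b) is the difference of left
  multiplication by h - a and right multiplication by h - b. Annihilating products on both sides
  therefore combine into one for ad h.\<close>

lemma ann_factors: "factors h ls * x = 0 ==> x * factors h rs = 0 ==> x \<in> ann h"
proof (induction "length ls + length rs" arbitrary: ls rs x)
 case 0 then show ?case by (simp add: ann.zero)
next
 case (Suc N)
 show ?case
 proof (cases "ls = [] \<or> rs = []")
  case True then show ?thesis using Suc.prems by (auto simp: ann.zero)
 next
  case False
  then obtain a ls' b rs' where l: "ls = a # ls'" "rs = b # rs'" by (meson neq_Nil_conv)
  have "(h - smat a) * x \<in> ann h"
  proof (rule Suc.hyps(1))
   show "N = length ls' + length rs" using Suc.hyps(2) l by simp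
   have "factors h ls' * ((h - smat a) * x) = factors h ls * x" unfolding mult.assoc[symmetric] factors_commute by (simp add: l)
   then show "factors h ls' * ((h - smat a) * x) = 0" using Suc.prems by simp
   show "(h - smat a) * x * factors h rs = 0" using Suc.prems by (simp only: mult.assoc) simp
  qed
  moreover have "x * (h - smat b) \<in> ann h"
  proof (rule Suc.hyps(1))
   show "N = length ls + length rs'" using Suc.hyps(2) l by simp
   show "factors h ls * (x * (h - smat b)) = 0" using Suc.prems by (simp only: mult.assoc[symmetric]) simp
   show "x * (h - smat b) * factors h rs' = 0" using Suc.prems l by (simp add: mult.assoc)
  qed
  ultimately have "(h - smat a) * x + smat (-1) * (x * (h - smat b)) \<in> ann h" by (intro ann_add ann_scale)
  moreover have "(h - smat a) * x + smat (-1) * (x * (h - smat b)) = br h x - smat (a - b) * x"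
   by (simp add: br_def smat_simps algebra_simps smat_central)
  ultimately have "br h x - smat (a - b) * x \<in> ann h" by simp
  then show ?thesis by (rule ann.step)
 qed
qed

lemma ann_UNIV: "x \<in> ann h"
proof -
 obtain ls where "factors h ls = 0" using annihilating_factors by blast
 then show ?thesis using ann_factors[of h ls x ls] by simp
qed

inductive_set wsum :: "'n::finite cmat => 'n cmat set => 'n cmat set" for h V where
 zero: "0 \<in> wsum h V"
| add: "x \<in> wsum h V ==> v \<in> wt h V (2 * of_int k) ==> x + v \<in> wsum h V"

context sl2_rep begin

lemma wsum_V: "x \<in> wsum h V ==> x \<in> V"
 by (induction rule: wsum.induct) (auto simp: V_0 V_add wt_def)

lemma wt_scale: "v \<in> wt h V r ==> smat c * v \<in> wt h V r"
 by (auto simp: wt_def V_scale br_simps)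

text \<open>On a sum of eigenspaces the image of ad h - l and its kernel together span everything;
  the kernel is nonzero only if l is one of the even weights.\<close>

lemma wsum_split:
 "w \<in> wsum h V ==> \<exists>p\<in>wsum h V. \<exists>q. q \<in> V & br h q = smat l * q & (q = 0 \<or> (\<exists>k::int. l = 2 * of_int k)) & w = br h p - smat l * p + q"
proof (induction rule: wsum.induct)
 case zero
 show ?case by (intro bexI[of _ 0] exI[of _ 0]) (auto simp: V_0 br_simps wsum.zero)
next
 case (add x v k)
 from add.IH obtain p q where pq: "p \<in> wsum h V" "q \<in> V" "br h q = smat l * q" "q = 0 \<or> (\<exists>k::int. l = 2 * of_int k)"
  "x = br h p - smat l * p + q" by blast
 have hv: "br h v = smat (2 * of_int k) * v" "v \<in> V"
  using add.hyps(2) smat_of_real[of "2 * of_int k" v] by (auto simp: wt_def)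
 show ?case
 proof (cases "l = 2 * of_int k")
  case True
  show ?thesis
   by (intro bexI[OF _ pq(1)] exI[of _ "q + v"] conjI) (use pq hv True in \<open>simp_all add: V_add br_simps distrib_left\<close>)
 next
  case False
  define c where "c = 1 / (2 * of_int k - l)"
  have c: "c * (2 * of_int k) - l * c = 1" using False by (simp add: c_def divide_simps)
  have "smat c * (smat (2 * of_int k) * v) - smat l * (smat c * v) = smat (c * (2 * of_int k) - l * c) * v"
   by (simp only: smat_simps smat_mult left_diff_distrib mult.assoc)
  then have "br h (smat c * v) - smat l * (smat c * v) = v" unfolding br_simps hv c by (simp add: smat_simps)
  then have "x + v = br h (p + smat c * v) - smat l * (p + smat c * v) + q" unfolding pq(5) by (simp add: br_simps algebra_simps)
  moreover have "p + smat c * v \<in> wsum h V" by (rule wsum.add[OF pq(1) wt_scale[OF add.hyps(2)]])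
  ultimately show ?thesis using pq(2-4) by blast
 qed
qed

text \<open>Induction over the factors annihilating x. After subtracting a solved part p, the rest y
  satisfies ad h y = l y + q. Since exp(pi i ad h) fixes y, the Jordan term q vanishes, and then l
  is an even integer unless y = 0.\<close>

lemma weight_decomposition:
 assumes S: "!!v. v \<in> V ==> exp (smat (of_real pi * \<i>) * h) * v = v * exp (smat (of_real pi * \<i>) * h)"
 shows "V \<subseteq> wsum h V"
proof
 fix x assume "x \<in> V"
 have "x \<in> ann h" by (rule ann_UNIV)
 then show "x \<in> wsum h V" using \<open>x \<in> V\<close>
 proof (induction rule: ann.induct)
  case zero show ?case by (rule wsum.zero)
 next
  case (step x l)
  have "br h x - smat l * x \<in> wsum h V" using step.IH step.prems by (simp add: V_diff V_h V_scale)
  from wsum_split[OF this, of l] obtain p q where pq: "p \<in> wsum h V" "q \<in> V" "br h q = smat l * q" "q = 0 \<or> (\<exists>k::int. l = 2 * of_int k)"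
   "br h x - smat l * x = br h p - smat l * p + q" by blast
  define y where "y = x - p"
  have yV: "y \<in> V" using step.prems wsum_V[OF pq(1)] by (simp add: y_def V_diff)
  have y: "br h y = smat l * y + q" using pq(5) by (simp add: y_def br_simps algebra_simps)
  let ?s = "of_real pi * \<i>"
  have "exp (smat ?s * h) * y * exp (- (smat ?s * h)) = y" unfolding S[OF yV] by (simp add: mult.assoc exp_inverse_cmat)
  then have ey: "smat (exp (?s * l)) * (y + smat ?s * q) = y" using exp_conj_jordan[OF y pq(3), of ?s] by simp
  have q0: "q = 0"
  proof (rule ccontr)
   assume "q ~= 0"
   then obtain k :: int where "l = 2 * of_int k" using pq(4) by blast
   then have "exp (?s * l) = 1" by (auto simp: exp_eq_1 algebra_simps)
   then have "smat ?s * q = 0" using ey by (simp add: smat_simps)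
   then have "smat (1 / ?s) * (smat ?s * q) = 0" by simp
   then have "smat (1 / ?s * ?s) * q = 0" by (simp only: smat_mult mult.assoc)
   then show False using \<open>q ~= 0\<close> by (simp add: smat_simps)
  qed
  show ?case
  proof (cases "y = 0")
   case True then show ?thesis using pq(1) by (simp add: y_def)
  next
   case False
   have "exp (?s * l) = 1"
   proof (rule ccontr)
    assume n: "exp (?s * l) ~= 1"
    let ?d = "exp (?s * l) - 1"
    have "smat ?d * y = 0" using ey q0 by (simp add: smat_simps left_diff_distrib)
    then have "smat (1 / ?d) * (smat ?d * y) = 0" by simp
    then have "smat (1 / ?d * ?d) * y = 0" by (simp only: smat_mult mult.assoc)
    then show False using False n by (simp add: smat_simps)
   qed
   then obtain n :: int where "Re (?s * l) = 0" "Im (?s * l) = of_int (2 * n) * pi" by (auto simp: exp_eq_1)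
   then have "Im l = 0" "Re l = 2 * of_int n" by auto
   then have "l = of_real (2 * of_int n)" by (simp add: complex_eq_iff)
   then have "br h y = (2 * of_int n) *\<^sub>R y" using y q0 smat_of_real[of "2 * of_int n" y] by simp
   then have "p + y \<in> wsum h V" by (intro wsum.add[OF pq(1)]) (auto simp: wt_def yV)
   then show ?thesis by (simp add: y_def)
  qed
 qed
qed

text \<open>The centralizer of h is the weight space 0, and the kernel of e generates it by
  lowering. From weight 0, e reaches all positive even weights and, after swapping the triple, f
  reaches all negative ones.\<close>

theorem generated_by_centralizer:
 assumes S: "!!v. v \<in> V ==> exp (smat (of_real pi * \<i>) * h) * v = v * exp (smat (of_real pi * \<i>) * h)"
  and We: "!!v. v \<in> W ==> br e v \<in> W" and Wf: "!!v. v \<in> W ==> br f v \<in> W"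
  and Wa: "!!v w. v \<in> W ==> w \<in> W ==> v + w \<in> W"
  and c: "(\<forall>v\<in>V. br h v = 0 --> v \<in> W) \<or> (\<forall>v\<in>V. br e v = 0 --> v \<in> W)"
 shows "V \<subseteq> W"
proof -
 have W0: "wt h V 0 \<subseteq> W"
  using c generated_kernel[OF _ Wf Wa] by (auto simp: wt_def)
 interpret r: sl2_rep f e "- h" V by (rule swap_rep)
 have "wt (- h) V 0 \<subseteq> W" using W0 by (auto simp: wt_def br_simps)
 note neg = r.generated_positive[OF this Wf]
 have "wt h V (2 * of_int k) \<subseteq> W" for k :: int
 proof (cases "k >= 0")
  case True then show ?thesis using generated_positive[OF W0 We, of "nat k"] by simp
 next
  case False
  have "wt h V (2 * of_int k) \<subseteq> wt (- h) V (2 * real (nat (- k)))"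
   using False by (auto simp: wt_def br_simps)
  then show ?thesis using neg[of "nat (- k)"] by blast
 qed
 then have "wsum h V \<subseteq> W"
 proof (intro subsetI)
  fix x assume a: "!!k. wt h V (2 * of_int k) \<subseteq> W" and "x \<in> wsum h V"
  from this(2) show "x \<in> W"
  proof (induction rule: wsum.induct)
   case zero
   have "0 \<in> wt h V 0" by (simp add: wt_def V_0 br_simps)
   then show ?case using W0 by blast
  next
   case (add x v k) then show ?case using a Wa by blast
  qed
 qed
 then show ?thesis using weight_decomposition[OF S] by blast
qed
end

section \<open>Complex conjugation, real spectra and one-parameter groups\<close>

definition cn :: "'n::finite cmat => 'n cmat" where "cn A = Cm (\<chi> i j. cnj (ent A i j))"

lemma ent_cn [simp]: "ent (cn A) i j = cnj (ent A i j)" by (simp add: cn_def)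

lemma cn_simps: "cn (A + B) = cn A + cn B" "cn (r *\<^sub>R A) = r *\<^sub>R cn A" "cn (smat c * A) = smat (cnj c) * cn A" "cn 1 = 1"
 "cn (cn A) = A" "cn (A * B) = cn A * cn B" "cn (A - B) = cn A - cn B" "cn (- A) = - cn A"
proof -
 show "cn (A + B) = cn A + cn B" "cn (r *\<^sub>R A) = r *\<^sub>R cn A" "cn (smat c * A) = smat (cnj c) * cn A"
  "cn (cn A) = A" "cn (A - B) = cn A - cn B" "cn (- A) = - cn A"
  by (rule cmat_entI; simp del: rep_simps(6))+
 show "cn 1 = 1" by (rule cmat_entI) (simp add: mat_def)
 show "cn (A * B) = cn A * cn B" by (rule cmat_entI) (simp add: matrix_matrix_mult_def)
qed

lemma cn_real_iff: "cn A = A \<longleftrightarrow> (\<forall>i j. ent A i j \<in> \<real>)"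
proof
 assume "cn A = A"
 then have "cnj (ent A i j) = ent A i j" for i j by (metis ent_cn)
 then show "\<forall>i j. ent A i j \<in> \<real>" by (simp add: Reals_cnj_iff)
qed (auto intro!: cmat_entI simp: Reals_cnj_iff)

lemma bounded_linear_cn: "bounded_linear (cn :: 'n::finite cmat => 'n cmat)"
proof -
 have "linear (%A :: complex^'n^'n. \<chi> i j. cnj (A $ i $ j))" by (rule linearI) (simp_all add: vec_eq_iff)
 then have "bounded_linear (%A :: complex^'n^'n. \<chi> i j. cnj (A $ i $ j))" by (simp add: linear_conv_bounded_linear)
 from bounded_linear_compose[OF bounded_linear_Cm bounded_linear_compose[OF this bounded_linear_rep]]
 show ?thesis by (simp add: cn_def[abs_def])
qed

lemma cn_power: "cn (A ^ k) = cn A ^ k" by (induction k) (auto simp: cn_simps)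

lemma cn_exp: "exp (cn A) = cn (exp A)"
proof -
 have "(%k. cn (A ^ k /\<^sub>R fact k)) sums cn (exp A)" by (rule bounded_linear.sums[OF bounded_linear_cn exp_converges])
 then have "(%k. cn A ^ k /\<^sub>R fact k) sums cn (exp A)" by (simp add: cn_simps cn_power)
 then show ?thesis using exp_converges sums_unique2 by blast
qed

text \<open>All eigenvalues are real, in the formulation with a nonzero matrix u that
  \<open>annihilating_factors\<close> provides.\<close>

definition rspec :: "'n::finite cmat => bool" where
 "rspec v \<longleftrightarrow> (\<forall>l u. u ~= 0 --> v * u = smat l * u --> l \<in> \<real>)"

lemma rspec_conj: assumes "rspec v" "y * x = 1" "x * y = 1" shows "rspec (x * v * y)"
 unfolding rspec_def
proof (intro allI impI)
 fix l u assume u: "u ~= 0" and eq: "x * v * y * u = smat l * u"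
 have "y * (x * v * y * u) = (y * x) * v * (y * u)" by (simp only: mult.assoc)
 then have "v * (y * u) = smat l * (y * u)" using eq assms(2) by (simp add: smat_left_commute)
 moreover have "y * u ~= 0"
 proof
  assume "y * u = 0"
  then have "(x * y) * u = 0" by (simp add: mult.assoc)
  then show False using u assms(3) by simp
 qed
 ultimately show "l \<in> \<real>" using assms(1) by (simp add: rspec_def)
qed

lemma rspec_scaleR: assumes "rspec v" shows "rspec (c *\<^sub>R v)"
 unfolding rspec_def
proof (intro allI impI)
 fix l u assume u: "u ~= 0" and eq: "c *\<^sub>R v * u = smat l * u"
 show "l \<in> \<real>"
 proof (cases "c = 0")
  case True
  then have "smat l * u = smat 0 * u" using eq by (simp add: smat_simps)
  show ?thesis
  proof (rule ccontr)
   assume "l \<notin> \<real>" then have "l ~= 0" by auto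
   have "smat (1 / l) * (smat l * u) = 0" using eq True by simp
   then have "smat (1 / l * l) * u = 0" by (simp only: smat_mult mult.assoc)
   then show False using u \<open>l ~= 0\<close> by (simp add: smat_simps)
  qed
 next
  case False
  have "v * u = (1 / c) *\<^sub>R (c *\<^sub>R v * u)" using False by simp
  also have "... = smat (of_real (1 / c)) * (smat l * u)" unfolding eq by (rule smat_of_real[symmetric])
  also have "... = smat (of_real (1 / c) * l) * u" by (simp only: smat_mult mult.assoc)
  finally have r: "of_real (1 / c) * l \<in> \<real>" using assms u unfolding rspec_def by blast
  have "of_real c * (of_real (1 / c) * l) \<in> \<real>" by (intro Reals_mult Reals_of_real r)
  then show ?thesis using False by simp
 qed
qed

lemma exp_kernel: assumes "a * u = (0 :: 'n::finite cmat)" shows "exp a * u = u"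
proof -
 have "((%t. exp (t *\<^sub>R a) * u) has_vector_derivative 0) (at t)" for t
 proof -
  have "((%t. exp (t *\<^sub>R a) * u) has_vector_derivative exp (t *\<^sub>R a) * a * u) (at t)"
   by (rule bounded_linear.has_vector_derivative[OF bounded_linear_mult_left exp_scaleR_has_vector_derivative_right])
  then show ?thesis by (simp add: mult.assoc assms)
 qed
 then obtain c where c: "!!t. t \<in> UNIV ==> exp (t *\<^sub>R a) * u = c"
  using has_vector_derivative_zero_constant[of UNIV "%t. exp (t *\<^sub>R a) * u"] by auto
 show ?thesis using c[of 0] c[of 1] by simp
qed

lemma exp_eigen: assumes "v * u = smat l * u" shows "exp (smat s * v) * u = smat (exp (s * l)) * u"
proof -
 have "smat s * v = smat (s * l) + smat s * (v - smat l)" by (simp add: smat_mult right_diff_distrib)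
 then have "exp (smat s * v) * u = smat (exp (s * l)) * (exp (smat s * (v - smat l)) * u)"
  by (simp only: exp_add_smat mult.assoc)
 moreover have "smat s * (v - smat l) * u = 0" by (simp add: mult.assoc left_diff_distrib assms)
 ultimately show ?thesis by (simp add: exp_kernel)
qed

text \<open>Brackets are read off from an explicit formula for conjugation by the one-parameter
  group.\<close>

lemma br_derivative:
 assumes "!!t. exp (t *\<^sub>R a) * b * exp (- (t *\<^sub>R a)) = B t" "(B has_vector_derivative w) (at 0)"
 shows "br a b = (w :: 'n::finite cmat)"
proof -
 have P: "((%t. exp (t *\<^sub>R a)) has_vector_derivative exp (0 *\<^sub>R a) * a) (at 0)"
  and N: "((%t. exp (t *\<^sub>R (- a))) has_vector_derivative exp (0 *\<^sub>R (- a)) * (- a)) (at 0)"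
  by (rule exp_scaleR_has_vector_derivative_right)+
 have "((%t. (exp (t *\<^sub>R a) * b) * exp (t *\<^sub>R (- a))) has_vector_derivative
   (exp (0 *\<^sub>R a) * b) * (exp (0 *\<^sub>R (- a)) * (- a)) + (exp (0 *\<^sub>R a) * a * b) * exp (0 *\<^sub>R (- a))) (at 0)"
  by (intro has_vector_derivative_mult N bounded_linear.has_vector_derivative[OF bounded_linear_mult_left P])
 then have "(B has_vector_derivative br a b) (at 0)" by (simp add: br_def assms(1)[abs_def])
 then show ?thesis using assms(2) by (rule vector_derivative_unique_at)
qed

lemma one_parameter_exp:
 fixes \<phi> :: "real => 'n::finite cmat"
 assumes add: "!!s t. \<phi> (s + t) = \<phi> s * \<phi> t" and one: "\<phi> 0 = 1" and der: "(\<phi> has_vector_derivative w) (at 0)"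
 shows "\<phi> t = exp (t *\<^sub>R w)"
proof -
 define \<psi> where "\<psi> t = \<phi> t * exp (t *\<^sub>R (- w))" for t
 have d\<phi>: "(\<phi> has_vector_derivative \<phi> t * w) (at t)" for t
 proof -
  have "((%s. \<phi> t * \<phi> s) has_vector_derivative \<phi> t * w) (at 0)"
   by (rule bounded_linear.has_vector_derivative[OF bounded_linear_mult_right der])
  then have "((%s. \<phi> (t + s)) has_vector_derivative \<phi> t * w) (at (t - t))" by (simp add: add)
  moreover have "((%s. s - t) has_vector_derivative 1) (at t)" by (auto intro!: derivative_eq_intros)
  ultimately have "((%s. \<phi> (t + s)) \<circ> (%s. s - t) has_vector_derivative 1 *\<^sub>R (\<phi> t * w)) (at t)"
   by (intro vector_diff_chain_at)
  then show ?thesis by (simp add: o_def)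
 qed
 have "(\<psi> has_vector_derivative 0) (at t)" for t
 proof -
  have "(\<psi> has_vector_derivative \<phi> t * (exp (t *\<^sub>R (- w)) * (- w)) + \<phi> t * w * exp (t *\<^sub>R (- w))) (at t)"
   unfolding \<psi>_def by (intro has_vector_derivative_mult d\<phi> exp_scaleR_has_vector_derivative_right)
  moreover have "exp (t *\<^sub>R (- w)) * (- w) = (- w) * exp (t *\<^sub>R (- w))" by (rule exp_times_scaleR_commute)
  ultimately show ?thesis by (simp only:) (simp add: mult.assoc)
 qed
 then obtain c where c: "!!t. t \<in> UNIV ==> \<psi> t = c"
  using has_vector_derivative_zero_constant[of UNIV \<psi>] by auto
 have "\<phi> t * exp (- (t *\<^sub>R w)) = 1" using c[of t] c[of 0] by (simp add: \<psi>_def one)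
 then have "\<phi> t * (exp (- (t *\<^sub>R w)) * exp (t *\<^sub>R w)) = exp (t *\<^sub>R w)" by (simp add: mult.assoc[symmetric])
 then show ?thesis by (simp add: exp_inverse_cmat)
qed

lemma Cm_simps: "Cm (A ** B) = Cm A * Cm B" "Cm (mat 1) = 1" "Cm (A + B) = Cm A + Cm B" "Cm (r *\<^sub>R A) = r *\<^sub>R Cm A"
 by (rule cmat_eqI; simp)+

lemma br_self: "br a a = 0" by (simp add: br_def)

section \<open>Smooth homomorphisms from SL(2,R) to real matrices\<close>

locale sl2_hom =
 fixes \<rho> :: "real^2^2 => complex^'n::finite^'n"
 assumes mul: "k \<in> SL2R ==> l \<in> SL2R ==> \<rho> (k ** l) = \<rho> k ** \<rho> l"
  and inv: "k \<in> SL2R ==> invertible (\<rho> k)"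
  and smooth: "smooth_map_on SL2R \<rho>"
  and real: "k \<in> SL2R ==> \<rho> k $ i $ j \<in> \<real>"
begin

definition R :: "real^2^2 => 'n cmat" where "R k = Cm (\<rho> k)"

lemma rep_R [simp]: "rep (R k) = \<rho> k" by (simp add: R_def)

lemma R_mult: "k \<in> SL2R ==> l \<in> SL2R ==> R (k ** l) = R k * R l"
 by (simp add: R_def mul Cm_simps)

lemma R_one: "R (mat 1) = 1"
proof -
 obtain Y where Y: "Y ** \<rho> (mat 1) = mat 1" using inv[OF SL2R_one] by (auto simp: invertible_def)
 have "\<rho> (mat 1) = (Y ** \<rho> (mat 1)) ** \<rho> (mat 1)" by (simp add: Y)
 also have "... = Y ** \<rho> (mat 1 ** mat 1)" unfolding mul[OF SL2R_one SL2R_one] by (simp add: matrix_mul_assoc)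
 finally show ?thesis by (simp add: Y R_def Cm_simps)
qed

lemma R_adj2: "k \<in> SL2R ==> R k * R (adj2 k) = 1" "k \<in> SL2R ==> R (adj2 k) * R k = 1"
 using R_mult[of k "adj2 k"] R_mult[of "adj2 k" k] by (simp_all add: adj2_SL2R R_one)

lemma cn_R: "k \<in> SL2R ==> cn (R k) = R k" using real by (simp add: cn_real_iff)

text \<open>Smoothness provides a local extension differentiable at 1; the chain rule then
  differentiates \<rho> along any curve in SL(2,R) through the same linear map.\<close>

lemma differential_exists:
 "\<exists>D. linear D & (\<forall>c X. (\<forall>t. c t \<in> SL2R) --> c 0 = mat 1 --> (c has_vector_derivative X) (at 0) -->
   ((%t::real. R (c t)) has_vector_derivative D X) (at 0))"
proof -
 obtain U F where U: "open U" "mat 1 \<in> U" "\<forall>k. Ck_on k U F" "\<forall>y\<in>U \<inter> SL2R. F y = \<rho> y"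
  using smooth SL2R_one unfolding smooth_map_on_def by blast
 have "Ck_on (Suc 0) U F" using U(3) by blast
 then have "F differentiable at (mat 1)" using U(2) by simp
 then obtain D where D: "(F has_derivative D) (at (mat 1))" by (auto simp: differentiable_def)
 have linD: "linear D" using D by (rule has_derivative_linear)
 have "linear (%X. Cm (D X))" by (rule linearI) (simp_all add: linear_add[OF linD] linear_scale[OF linD] Cm_simps)
 moreover have "((%t. R (c t)) has_vector_derivative Cm (D X)) (at 0)"
  if c: "\<forall>t. c t \<in> SL2R" "c 0 = mat 1" "(c has_vector_derivative X) (at 0)" for c :: "real => real^2^2" and X
 proof -
  have "(c has_derivative (%t. t *\<^sub>R X)) (at 0)" using c(3) by (simp add: has_vector_derivative_def)
  moreover have "(F has_derivative D) (at (c 0))" using D c(2) by simp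
  ultimately have "(F \<circ> c has_derivative D \<circ> (%t. t *\<^sub>R X)) (at 0)" by (rule diff_chain_at)
  then have Fc: "((%t. F (c t)) has_vector_derivative D X) (at 0)"
   by (simp add: has_vector_derivative_def o_def linear_scale[OF linD])
  have "isCont c 0" using c(3) has_vector_derivative_continuous by blast
  then have "\<forall>\<^sub>F t in nhds 0. c t \<in> U"
   unfolding isCont_def tendsto_at_iff_tendsto_nhds by (rule topological_tendstoD) (use U(1,2) c(2) in simp_all)
  then have "\<forall>\<^sub>F t in nhds 0. F (c t) = \<rho> (c t)" by eventually_elim (use U(4) c(1) in auto)
  then obtain S where S: "open S" "0 \<in> S" "!!t. t \<in> S ==> F (c t) = \<rho> (c t)" unfolding eventually_nhds by blast
  have "((%t. \<rho> (c t)) has_vector_derivative D X) (at 0)"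
   by (rule has_vector_derivative_transform_within_open[OF Fc S])
  from bounded_linear.has_vector_derivative[OF bounded_linear_Cm this] show ?thesis by (simp add: R_def)
 qed
 ultimately show ?thesis by blast
qed

definition d :: "real^2^2 => 'n cmat" where
 "d = (SOME D. linear D & (\<forall>c X. (\<forall>t. c t \<in> SL2R) --> c 0 = mat 1 --> (c has_vector_derivative X) (at 0) -->
   ((%t::real. R (c t)) has_vector_derivative D X) (at 0)))"

lemma d_linear: "linear d" unfolding d_def using someI_ex[OF differential_exists] by (rule conjunct1)

lemma d_curve:
 assumes "!!t. c t \<in> SL2R" "c 0 = mat 1" "(c has_vector_derivative X) (at 0)"
 shows "((%t::real. R (c t)) has_vector_derivative d X) (at 0)"
 using someI_ex[OF differential_exists, folded d_def, THEN conjunct2, rule_format, OF assms] .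

abbreviation "e \<equiv> d (sl 0 1 0)"
abbreviation "f \<equiv> d (sl 0 0 1)"
abbreviation "h \<equiv> d (sl 1 0 0)"

lemma d_sl: "d (sl p q r) = p *\<^sub>R h + q *\<^sub>R e + r *\<^sub>R f"
proof -
 have "sl p q r = p *\<^sub>R sl 1 0 0 + q *\<^sub>R sl 0 1 0 + r *\<^sub>R sl 0 0 1" by (simp add: mat2_simps)
 then show ?thesis by (simp only: linear_add[OF d_linear] linear_scale[OF d_linear])
qed

lemma R_one_param: assumes "one_param c X" shows "R (c t) = exp (t *\<^sub>R d X)"
proof (rule one_parameter_exp[where \<phi>="%t. R (c t)"])
 show "R (c (s + t)) = R (c s) * R (c t)" for s t using assms R_mult by (simp add: one_param_def)
 show "R (c 0) = 1" using assms R_one by (simp add: one_param_def)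
 show "((%t. R (c t)) has_vector_derivative d X) (at 0)" using assms by (intro d_curve) (auto simp: one_param_def)
qed

lemmas R_cE = R_one_param[OF one_param_cE] and R_cF = R_one_param[OF one_param_cF]
 and R_cH = R_one_param[OF one_param_cH] and R_rot = R_one_param[OF one_param_rot]

lemma cn_d: assumes "one_param c X" shows "cn (d X) = d X"
proof -
 have c: "((%t. R (c t)) has_vector_derivative d X) (at 0)" using assms by (intro d_curve) (auto simp: one_param_def)
 have "((%t. cn (R (c t))) has_vector_derivative cn (d X)) (at 0)"
  by (rule bounded_linear.has_vector_derivative[OF bounded_linear_cn c])
 moreover have "cn (R (c t)) = R (c t)" for t using assms by (simp add: one_param_def cn_R)
 ultimately show ?thesis using c vector_derivative_unique_at by fastforce
qed

lemma cn_efh: "cn e = e" "cn f = f" "cn h = h" by (rule cn_d one_param_cE one_param_cF one_param_cH)+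

lemma Ad_one_param:
 assumes c: "one_param c X" and k: "k \<in> SL2R" shows "d (k ** X ** adj2 k) = R k * d X * R (adj2 k)"
proof -
 have cs: "!!t. c t \<in> SL2R" "c 0 = mat 1" "(c has_vector_derivative X) (at 0)" using c by (auto simp: one_param_def)
 have "linear (%Y. k ** Y ** adj2 k)" by (rule linear_sandwich2)
 then have "bounded_linear (%Y. k ** Y ** adj2 k)" by (simp add: linear_conv_bounded_linear)
 from bounded_linear.has_vector_derivative[OF this cs(3)]
 have "((%t. k ** c t ** adj2 k) has_vector_derivative k ** X ** adj2 k) (at 0)" .
 then have "((%t. R (k ** c t ** adj2 k)) has_vector_derivative d (k ** X ** adj2 k)) (at 0)"
  by (intro d_curve) (simp_all add: SL2R_mult k cs adj2_SL2R)
 moreover have "R (k ** c t ** adj2 k) = R k * R (c t) * R (adj2 k)" for t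
  by (simp add: R_mult SL2R_mult k cs adj2_SL2R)
 ultimately have 1: "((%t. R k * R (c t) * R (adj2 k)) has_vector_derivative d (k ** X ** adj2 k)) (at 0)" by simp
 have "((%t. R k * R (c t) * R (adj2 k)) has_vector_derivative R k * d X * R (adj2 k)) (at 0)"
  by (rule bounded_linear.has_vector_derivative[OF bounded_linear_mult_left
   bounded_linear.has_vector_derivative[OF bounded_linear_mult_right d_curve[OF cs]]])
 then show ?thesis using 1 vector_derivative_unique_at by blast
qed

lemmas Ad_E = Ad_one_param[OF one_param_cE] and Ad_F = Ad_one_param[OF one_param_cF] and Ad_H = Ad_one_param[OF one_param_cH]

lemma Ad: assumes k: "k \<in> SL2R" shows "d (k ** sl p q r ** adj2 k) = R k * d (sl p q r) * R (adj2 k)"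
proof -
 have "sl p q r = p *\<^sub>R sl 1 0 0 + q *\<^sub>R sl 0 1 0 + r *\<^sub>R sl 0 0 1" by (simp add: mat2_simps)
 then have "k ** sl p q r ** adj2 k = p *\<^sub>R (k ** sl 1 0 0 ** adj2 k) + q *\<^sub>R (k ** sl 0 1 0 ** adj2 k) + r *\<^sub>R (k ** sl 0 0 1 ** adj2 k)"
  by (simp only: linear_add[OF linear_sandwich2] linear_scale[OF linear_sandwich2])
 then show ?thesis unfolding d_sl[of p q r]
  by (simp only: linear_add[OF d_linear] linear_scale[OF d_linear] Ad_E[OF k] Ad_F[OF k] Ad_H[OF k]) (simp add: algebra_simps)
qed

text \<open>Each relation is the derivative of a conjugation identity already valid in SL(2,R), so
  the module structure needs no second derivatives of \<rho>.\<close>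

lemma triple: "sl2_triple e f h"
proof
 have eh: "br e h = (-2) *\<^sub>R e"
 proof (rule br_derivative)
  have A: "R (cE t) * h * R (adj2 (cE t)) = h - (2 * t) *\<^sub>R e" for t
   using Ad[of "cE t" 1 0 0] d_sl[of 1 "- (2 * t)" 0] by (simp add: mat2_simps)
  show "exp (t *\<^sub>R e) * h * exp (- (t *\<^sub>R e)) = h - (2 * t) *\<^sub>R e" for t
   using A[of t] R_cE[of t] R_cE[of "- t"] by simp
  show "((%t. h - (2 * t) *\<^sub>R e) has_vector_derivative (-2) *\<^sub>R e) (at 0)" by (auto intro!: derivative_eq_intros)
 qed
 show "br h e = 2 *\<^sub>R e" unfolding br_flip[of h e] eh by simp
 have fh: "br f h = 2 *\<^sub>R f"
 proof (rule br_derivative)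
  have A: "R (cF t) * h * R (adj2 (cF t)) = h + (2 * t) *\<^sub>R f" for t
   using Ad[of "cF t" 1 0 0] d_sl[of 1 0 "2 * t"] by (simp add: mat2_simps)
  show "exp (t *\<^sub>R f) * h * exp (- (t *\<^sub>R f)) = h + (2 * t) *\<^sub>R f" for t
   using A[of t] R_cF[of t] R_cF[of "- t"] by simp
  show "((%t. h + (2 * t) *\<^sub>R f) has_vector_derivative 2 *\<^sub>R f) (at 0)" by (auto intro!: derivative_eq_intros)
 qed
 show "br h f = (-2) *\<^sub>R f" unfolding br_flip[of h f] fh by simp
 show "br e f = h"
 proof (rule br_derivative)
  have A: "R (cE t) * f * R (adj2 (cE t)) = t *\<^sub>R h - (t * t) *\<^sub>R e + f" for t
   using Ad[of "cE t" 0 0 1] d_sl[of t "- (t * t)" 1] by (simp add: mat2_simps)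
  show "exp (t *\<^sub>R e) * f * exp (- (t *\<^sub>R e)) = t *\<^sub>R h - (t * t) *\<^sub>R e + f" for t
   using A[of t] R_cE[of t] R_cE[of "- t"] by simp
  show "((%t. t *\<^sub>R h - (t * t) *\<^sub>R e + f) has_vector_derivative h) (at 0)" by (auto intro!: derivative_eq_intros)
 qed
qed

sublocale sl2_triple e f h by (rule triple)

abbreviation "mI \<equiv> mat2 (- 1) 0 0 (- 1)"

lemma R_mI: "R mI * R mI = 1" using R_mult[of mI mI] R_one by (simp add: mat2_simps mat2_one)

lemma R_mI_commute: "k \<in> SL2R ==> R mI * R k = R k * R mI"
proof -
 assume k: "k \<in> SL2R"
 obtain a b c d where "k = mat2 a b c d" by (rule mat2_cases)
 then have "mI ** k = k ** mI" by (simp add: mat2_simps)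
 then show ?thesis using R_mult[of mI k] R_mult[of k mI] k by simp
qed

lemma R_mI_d: "R mI * d (sl p q r) = d (sl p q r) * R mI"
proof -
 have "R mI * d (sl p q r) * R mI = d (sl p q r)" using Ad[of mI p q r] by (simp add: mat2_simps)
 then have "R mI * d (sl p q r) * (R mI * R mI) = d (sl p q r) * R mI" by (simp add: mult.assoc[symmetric])
 then show ?thesis by (simp add: R_mI)
qed

lemma exp_commute_cmat: assumes "x * a = a * (x :: 'n cmat)" shows "x * exp a = exp a * x"
proof -
 have "exp (- a) * x * exp (- (- a)) = x + 0 + (1/2) *\<^sub>R 0"
  by (rule exp_conj_quadratic) (simp_all add: br_def assms)
 then have "exp a * (exp (- a) * x * exp a) = exp a * x" by simp
 then have "(exp a * exp (- a)) * (x * exp a) = exp a * x" by (simp only: mult.assoc)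
 then show ?thesis by (simp add: exp_inverse_cmat)
qed

text \<open>Over the complex numbers i h is conjugate to e - f, the generator of rotations, and
  rotation by pi is minus the identity. The image of minus the identity commutes with the
  conjugating elements, so the conjugation drops out.\<close>

lemma exp_pi_h: "exp (smat (of_real pi * \<i>) * h) = R mI"
proof -
 let ?i = "smat \<i> :: 'n cmat"
 \<comment> \<open>Two explicit steps of the conjugation: exp(i f / 2) carries i h to i h - f, and
   exp(i e) carries that to e - f.\<close>
 define y where "y = exp (smat (\<i> / 2) * f)"
 define y' where "y' = exp (- (smat (\<i> / 2) * f))"
 define x where "x = exp (?i * e)"
 define x' where "x' = exp (- (?i * e))"
 have brfh: "br f h = 2 *\<^sub>R f" using hf br_flip[of f h] by simp
 have breh: "br e h = (-2) *\<^sub>R e" using he br_flip[of e h] by simp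
 have ee: "br e e = 0" "br f f = 0" by (simp_all add: br_def)
 have 1: "y * (?i * h) * y' = ?i * h - f"
 proof -
  have "y * (?i * h) * y' = ?i * h + (- f) + (1/2) *\<^sub>R 0"
   unfolding y_def y'_def
  proof (rule exp_conj_quadratic)
   show "br (smat (\<i> / 2) * f) (?i * h) = - f" unfolding br_simps brfh
    by (rule cmat_entI) (simp add: scaleR_conv_of_real[where 'a=complex] del: rep_simps(6))
  qed (simp_all add: br_simps br_self)
  then show ?thesis by simp
 qed
 have 2: "x * (?i * h - f) * x' = e - f"
 proof -
  have "x * (?i * h - f) * x' = (?i * h - f) + (2 *\<^sub>R e - ?i * h) + (1/2) *\<^sub>R ((-2) *\<^sub>R e)"
   unfolding x_def x'_def
  proof (rule exp_conj_quadratic)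
   show "br (?i * e) (?i * h - f) = 2 *\<^sub>R e - ?i * h" unfolding br_simps breh ef
    by (rule cmat_entI) (simp add: scaleR_conv_of_real[where 'a=complex] algebra_simps del: rep_simps(6))
   show "br (?i * e) (2 *\<^sub>R e - ?i * h) = (-2) *\<^sub>R e" unfolding br_simps breh ee
    by (rule cmat_entI) (simp add: scaleR_conv_of_real[where 'a=complex] algebra_simps del: rep_simps(6))
  qed (simp_all add: br_simps br_self)
  moreover have "(a - b) + (2 *\<^sub>R c - a) + (1/2) *\<^sub>R ((-2) *\<^sub>R c) = c - b" for a b c :: "'n cmat"
  proof -
   have "(a - b) + (2 *\<^sub>R c - a) + (1/2) *\<^sub>R ((-2) *\<^sub>R c) = (2 + (1/2) * (-2)) *\<^sub>R c - b"
    unfolding scaleR_add_left scaleR_scaleR[symmetric] by (simp del: scaleR_scaleR)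
   then show ?thesis by simp
  qed
  ultimately show ?thesis by (simp only:)
 qed
 have inv: "y * y' = 1" "y' * y = 1" "x * x' = 1" "x' * x = 1"
  unfolding x_def x'_def y_def y'_def by (rule exp_inverse_cmat)+
 define a where "a = smat (of_real pi * \<i>) * h"
 have a: "a = pi *\<^sub>R (?i * h)" unfolding a_def smat_mult mult.assoc by (rule smat_of_real)
 have "(x * y) * a * (y' * x') = pi *\<^sub>R (x * (y * (?i * h) * y') * x')" unfolding a by (simp add: mult.assoc)
 also have "... = pi *\<^sub>R d (sl 0 1 (- 1))" unfolding 1 2 d_sl[of 0 1 "- 1"] by simp
 finally have "exp ((x * y) * a * (y' * x')) = R (rot pi)" by (simp only: R_rot)
 then have "exp ((x * y) * a * (y' * x')) = R mI" by simp
 moreover have "(y' * x') * (x * y) = 1"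
 proof -
  have "(y' * x') * (x * y) = y' * (x' * x) * y" by (simp only: mult.assoc)
  then show ?thesis by (simp add: inv)
 qed
 ultimately have c: "(x * y) * exp a * (y' * x') = R mI" by (simp add: exp_conj)
 have "R mI * x = x * R mI" unfolding x_def
  by (rule exp_commute_cmat) (simp only: R_mI_d mult.assoc smat_left_commute)
 moreover have "R mI * y = y * R mI" unfolding y_def
  by (rule exp_commute_cmat) (simp only: R_mI_d mult.assoc smat_left_commute)
 ultimately have com: "R mI * (x * y) = (x * y) * R mI"
 proof -
  assume xx: "R mI * x = x * R mI" and yy: "R mI * y = y * R mI"
  have "R mI * (x * y) = (R mI * x) * y" by (simp only: mult.assoc)
  also have "... = x * (R mI * y)" unfolding xx by (simp only: mult.assoc)
  finally show ?thesis unfolding yy by (simp only: mult.assoc)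
 qed
 have "(y' * x') * ((x * y) * exp a * (y' * x')) * (x * y) = ((y' * x') * (x * y)) * exp a * ((y' * x') * (x * y))" by (simp only: mult.assoc)
 then have "exp a = (y' * x') * R mI * (x * y)" unfolding c \<open>(y' * x') * (x * y) = 1\<close> mult_1_left mult_1_right by (rule sym)
 also have "... = ((y' * x') * (x * y)) * R mI" unfolding mult.assoc[of "y' * x'" "R mI"] com by (simp only: mult.assoc)
 finally show ?thesis unfolding a_def \<open>(y' * x') * (x * y) = 1\<close> by simp
qed

lemma lie_differential_A0: "lie_differential \<rho> A0 = rep h"
proof -
 have "((%t. R (cH t)) has_vector_derivative h) (at 0)"
  using one_param_cH by (intro d_curve) (auto simp: one_param_def)
 from bounded_linear.has_vector_derivative[OF bounded_linear_rep this]
 have "((%t. \<rho> (cH t)) has_vector_derivative rep h) (at 0)" by simp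
 then show ?thesis unfolding lie_differential_def matrix_exp_A0 by (rule vector_derivative_at)
qed

lemma sigma_eq: "sigma \<rho> = \<rho> mI"
proof -
 have "Cm (\<chi> i j. of_real pi * \<i> * rep h $ i $ j) = smat (of_real pi * \<i>) * h"
  by (rule cmat_entI) (simp only: ent_smat_mult, simp)
 then show ?thesis unfolding sigma_def lie_differential_A0 matrix_exp_eq by (simp add: exp_pi_h)
qed

text \<open>The square of exp(pi i h) is 1, so exp(2 pi i l) = 1 for every eigenvalue l.\<close>

lemma rspec_h: "rspec h"
 unfolding rspec_def
proof (intro allI impI)
 fix l u assume u: "u ~= 0" and eq: "h * u = smat l * u"
 let ?s = "of_real pi * \<i>"
 have 1: "R mI * u = smat (exp (?s * l)) * u" using exp_eigen[OF eq, of ?s] by (simp add: exp_pi_h)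
 have "u = R mI * (R mI * u)" by (simp add: mult.assoc[symmetric] R_mI)
 also have "... = R mI * (smat (exp (?s * l)) * u)" by (simp only: 1)
 also have "... = smat (exp (?s * l)) * (R mI * u)" by (rule smat_left_commute)
 also have "... = smat (exp (?s * l) * exp (?s * l)) * u" unfolding 1 by (simp only: smat_mult mult.assoc)
 finally have e2: "smat (exp (?s * l) * exp (?s * l) - 1) * u = 0" by (simp add: smat_simps left_diff_distrib)
 let ?d = "exp (?s * l) * exp (?s * l) - 1"
 have "?d = 0"
 proof (rule ccontr)
  assume n: "?d ~= 0"
  have "smat (1 / ?d) * (smat ?d * u) = 0" using e2 by simp
  then have "smat (1 / ?d * ?d) * u = 0" by (simp only: smat_mult mult.assoc)
  then show False using u n by (simp add: smat_simps)
 qed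
 then have "exp (?s * l + ?s * l) = 1" unfolding exp_add by simp
 then have "Re (?s * l + ?s * l) = 0" by (simp only: exp_eq_1)
 then have "Im l = 0" by simp
 then show "l \<in> \<real>" by (simp add: complex_is_Real_iff)
qed

text \<open>Conjugation by \<open>R (cH t)\<close> rescales e by exp(2 t), so each eigenvalue may be
  rescaled arbitrarily while remaining below the norm of e; it is therefore 0.\<close>

lemma rspec_e: "rspec e"
 unfolding rspec_def
proof (intro allI impI)
 fix l u assume u: "u ~= 0" and eq: "e * u = smat l * u"
 have b: "exp (- (2 * t)) * cmod l <= norm e" for t :: real
 proof -
  have k: "cH t \<in> SL2R" by (simp add: exp_minus)
  have "R (cH t) * e * R (adj2 (cH t)) = (exp (2 * t)) *\<^sub>R e"
   using Ad[OF k, of 0 1 0] d_sl[of 0 "exp (2 * t)" 0] by (simp add: mat2_simps exp_minus exp_add[symmetric])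
  then have "exp (2 * t) *\<^sub>R e = R (cH t) * e * R (adj2 (cH t))" by simp
  let ?x = "R (cH t) * u"
  have "exp (2 * t) *\<^sub>R e * ?x = R (cH t) * e * (R (adj2 (cH t)) * R (cH t)) * u"
   unfolding \<open>exp (2 * t) *\<^sub>R e = _\<close> by (simp only: mult.assoc)
  also have "... = smat l * ?x" by (simp only: R_adj2(2)[OF k] mult_1_right mult.assoc eq smat_left_commute)
  finally have ex: "exp (2 * t) *\<^sub>R e * ?x = smat l * ?x" .
  have "e * ?x = exp (- (2 * t)) *\<^sub>R (exp (2 * t) *\<^sub>R e * ?x)" by (simp add: exp_minus)
  also have "... = exp (- (2 * t)) *\<^sub>R (smat l * ?x)" unfolding ex ..
  also have "... = smat (of_real (exp (- (2 * t))) * l) * ?x" by (simp only: smat_of_real[symmetric] smat_mult mult.assoc)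
  finally have "e * ?x = smat (of_real (exp (- (2 * t))) * l) * ?x" .
  moreover have "?x ~= 0"
  proof
   assume "?x = 0"
   then have "(R (adj2 (cH t)) * R (cH t)) * u = 0" by (simp only: mult.assoc) simp
   then show False using u unfolding R_adj2(2)[OF k] by simp
  qed
  ultimately have "cmod (of_real (exp (- (2 * t))) * l) <= norm e" by (intro eigenvalue_norm)
  then show ?thesis by (simp add: norm_mult)
 qed
 have "l = 0"
 proof (rule ccontr)
  assume "l ~= 0"
  then have l: "cmod l > 0" by simp
  define M where "M = (norm e + 1) / cmod l"
  have M: "M > 0" using l by (simp add: M_def add_nonneg_pos)
  have "exp (- (2 * (- ln M / 2))) * cmod l = norm e + 1" using M l by (simp add: M_def)
  then show False using b[of "- ln M / 2"] by linarith
 qed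
 then show "l \<in> \<real>" by simp
qed
end

section \<open>Zariski dense deformations\<close>

lemma zariski_left_continuous:
 assumes "invertible (A :: complex^'n::finite^'n)" shows "continuous_map zariski zariski (%X. A ** X)"
 unfolding continuous_map_closedin
proof (intro conjI allI impI)
 show "(%X. A ** X) \<in> topspace zariski \<rightarrow> topspace zariski" using assms by (auto intro: invertible_mult)
 fix C assume "closedin zariski (C :: (complex^'n^'n) set)"
 from closed_left_preimage[OF this assms] show "closedin zariski {x \<in> topspace zariski. A ** x \<in> C}" by simp
qed

lemma identity_component_iff:
 "Y \<in> identity_component Z \<longleftrightarrow> (\<exists>T. connectedin zariski T & T \<subseteq> Z & mat 1 \<in> T & Y \<in> T)"
 unfolding identity_component_def by (auto simp: connected_component_of_def connectedin_subtopology)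

lemma identity_component_mult:
 assumes Z: "alg_sub Z" and X: "X \<in> identity_component Z" and Y: "Y \<in> identity_component Z"
 shows "X ** Y \<in> identity_component (Z :: (complex^'n::finite^'n) set)"
proof -
 obtain S T where S: "connectedin zariski S" "S \<subseteq> Z" "mat 1 \<in> S" "X \<in> S" and T: "connectedin zariski T" "T \<subseteq> Z" "mat 1 \<in> T" "Y \<in> T"
  using X Y unfolding identity_component_iff by blast
 have XZ: "X \<in> Z" using S by blast
 let ?T = "(%A. X ** A) ` T"
 have c: "connectedin zariski ?T"
  by (rule connectedin_continuous_map_image[OF zariski_left_continuous[OF alg_subD(5)[OF Z XZ]] T(1)])
 have "X \<in> ?T" using T(3) by (intro image_eqI[of _ _ "mat 1"]) auto
 then have "connectedin zariski (S \<union> ?T)" using S(4) by (intro connectedin_Un S(1) c) blast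
 moreover have "?T \<subseteq> Z" using T(2) alg_subD(3)[OF Z XZ] by blast
 moreover have "X ** Y \<in> ?T" using T(4) by blast
 ultimately show ?thesis unfolding identity_component_iff using S(2,3) by (intro exI[of _ "S \<union> ?T"]) blast
qed

lemma identity_component_inverse:
 assumes Z: "alg_sub Z" and X: "X \<in> identity_component Z" and Y: "Y ** X = mat 1"
 shows "Y \<in> identity_component (Z :: (complex^'n::finite^'n) set)"
proof -
 obtain S where S: "connectedin zariski S" "S \<subseteq> Z" "mat 1 \<in> S" "X \<in> S" using X unfolding identity_component_iff by blast
 have YZ: "Y \<in> Z" using alg_sub_inverse[OF Z _ disjI2[OF Y]] S by blast
 let ?T = "(%A. Y ** A) ` S"
 have c: "connectedin zariski ?T"
  by (rule connectedin_continuous_map_image[OF zariski_left_continuous[OF alg_subD(5)[OF Z YZ]] S(1)])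
 have "mat 1 \<in> ?T" by (rule image_eqI[where x = X]) (simp_all add: Y S)
 moreover have "Y \<in> ?T" using S(3) by (intro image_eqI[of _ _ "mat 1"]) auto
 moreover have "?T \<subseteq> Z" using S(2) alg_subD(3)[OF Z YZ] by blast
 ultimately show ?thesis unfolding identity_component_iff using c by (intro exI[of _ ?T]) blast
qed

lemma identity_component_closed:
 assumes Z: "alg_sub Z" shows "closedin zariski (identity_component (Z :: (complex^'n::finite^'n) set))"
proof -
 have "closedin (subtopology zariski Z) (identity_component Z)"
  unfolding identity_component_def by (rule closedin_connected_component_of)
 then show ?thesis using closedin_trans_full alg_subD(1)[OF Z] by blast
qed

text \<open>The one-parameter map is continuous from the Euclidean to the Zariski topology, so its
  image is Zariski connected.\<close>

lemma identity_component_exp: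
 assumes v: "v \<in> lie Z" shows "rep (exp (smat s * v)) \<in> identity_component (Z :: (complex^'n::finite^'n) set)"
proof -
 let ?\<gamma> = "%s. rep (exp (smat s * v))"
 have "continuous_map euclidean zariski ?\<gamma>"
  unfolding continuous_map_closedin
 proof (intro conjI allI impI)
  show "?\<gamma> \<in> topspace euclidean \<rightarrow> topspace zariski" by (auto simp: invertible_exp)
  fix C assume "closedin zariski (C :: (complex^'n^'n) set)"
  then obtain P where P: "P \<subseteq> Rg" "C = zero_locus P" using closedin_zariski by blast
  have c: "continuous_on UNIV ?\<gamma>"
   by (intro continuous_intros continuous_on_compose2[OF continuous_on_exp_cmat]) auto
  have "closed {s. p (?\<gamma> s) = 0}" if "p \<in> P" for p
  proof -
   have "continuous_on UNIV (%s. p (?\<gamma> s))"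
    by (rule continuous_on_compose2[OF Rg_continuous c]) (use that P(1) in auto)
   then show ?thesis by (intro closed_Collect_eq continuous_intros)
  qed
  then have "closed (\<Inter>p\<in>P. {s. p (?\<gamma> s) = 0})" by blast
  moreover have "{s \<in> topspace euclidean. ?\<gamma> s \<in> C} = (\<Inter>p\<in>P. {s. p (?\<gamma> s) = 0})"
   unfolding P(2) zero_locus_def by (auto simp: invertible_exp)
  ultimately show "closedin euclidean {s \<in> topspace euclidean. ?\<gamma> s \<in> C}" by simp
 qed
 then have "connectedin zariski (range ?\<gamma>)" by (rule connectedin_continuous_map_image) (simp add: connectedin_iff_connected connected_UNIV)
 moreover have "range ?\<gamma> \<subseteq> Z" using v by (auto simp: lie_def)
 moreover have "mat 1 \<in> range ?\<gamma>" by (rule image_eqI[of _ _ 0]) (auto simp: smat_simps)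
 ultimately show ?thesis unfolding identity_component_iff by blast
qed

lemma poly_fun_real_cnj:
 "p \<in> poly_fun \<real> ==> p (rep (cn (Cm X))) = cnj (p (X :: complex^'n::finite^'n))"
 by (induction rule: poly_fun.induct) (auto simp: Reals_cnj_iff)

lemma alg_sub_commutant:
 assumes GG: "alg_sub GG" shows "alg_sub {X \<in> GG. A ** X = X ** (A :: complex^'n::finite^'n)}"
 unfolding alg_sub_def
proof (intro conjI ballI)
 let ?p = "%i j X. (A ** X) $ i $ j + (-1) * (X ** A) $ i $ j"
 let ?P = "{?p i j |i j. True}"
 have pe: "(%X. X $ i $ j) \<in> Rg" for i j :: 'n by (rule poly_fun.entry)
 have "?p i j \<in> Rg" for i j
  by (rule poly_fun.add[OF Rg_left[OF pe] poly_fun.mult[OF poly_fun.const[OF UNIV_I] Rg_right[OF pe]]])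
 then have PR: "?P \<subseteq> Rg" by blast
 have "{X \<in> GG. A ** X = X ** A} = GG \<inter> zero_locus ?P"
 proof (intro Set.set_eqI iffI)
  fix X assume "X \<in> {X \<in> GG. A ** X = X ** A}"
  then show "X \<in> GG \<inter> zero_locus ?P" using alg_subD(5)[OF GG] by (auto simp: zero_locus_def)
 next
  fix X assume X: "X \<in> GG \<inter> zero_locus ?P"
  have a: "\<forall>p\<in>?P. p X = 0" using IntD2[OF X] unfolding zero_locus_def by (elim CollectE conjE)
  have "?p i j \<in> ?P" for i j by (rule CollectI, rule exI[of _ i], rule exI[of _ j], simp)
  then have "?p i j X = 0" for i j using bspec[OF a, of "?p i j"] by simp
  then have "A ** X = X ** A" by (simp add: vec_eq_iff)
  then show "X \<in> {X \<in> GG. A ** X = X ** A}" using X by blast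
 qed
 moreover have "closedin zariski (zero_locus ?P)" unfolding closedin_zariski using PR by blast
 ultimately show "closedin zariski {X \<in> GG. A ** X = X ** A}" using alg_subD(1)[OF GG] by (simp add: closedin_Int)
 show "mat 1 \<in> {X \<in> GG. A ** X = X ** A}" using alg_subD(2)[OF GG] by simp
 show "X ** Y \<in> {X \<in> GG. A ** X = X ** A}" if XY: "X \<in> {X \<in> GG. A ** X = X ** A}" "Y \<in> {X \<in> GG. A ** X = X ** A}" for X Y
 proof -
  have "A ** (X ** Y) = (X ** A) ** Y" using XY by (simp add: matrix_mul_assoc)
  also have "... = (X ** Y) ** A" using XY by (simp add: matrix_mul_assoc[symmetric])
  finally show ?thesis using XY alg_subD(3)[OF GG] by simp
 qed
 show "\<exists>Y\<in>{X \<in> GG. A ** X = X ** A}. X ** Y = mat 1 & Y ** X = mat 1" if X: "X \<in> {X \<in> GG. A ** X = X ** A}" for X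
 proof -
  obtain Y where Y: "Y \<in> GG" "X ** Y = mat 1" "Y ** X = mat 1" using X alg_subD(4)[OF GG] by blast
  have "A ** Y = (Y ** X) ** A ** Y" by (simp add: Y)
  also have "... = Y ** (X ** A) ** Y" by (simp add: matrix_mul_assoc)
  also have "... = Y ** (A ** X) ** Y" using X by simp
  also have "... = Y ** A ** (X ** Y)" by (simp add: matrix_mul_assoc)
  finally show ?thesis using Y by auto
 qed
qed

lemma commute_derivative:
 assumes "!!t::real. S * exp (t *\<^sub>R v) = exp (t *\<^sub>R v) * (S :: 'n::finite cmat)" shows "S * v = v * S"
proof -
 have d: "((%t. exp (t *\<^sub>R v)) has_vector_derivative exp (0 *\<^sub>R v) * v) (at 0)" by (rule exp_scaleR_has_vector_derivative_right)
 have 1: "((%t. S * exp (t *\<^sub>R v)) has_vector_derivative S * (exp (0 *\<^sub>R v) * v)) (at 0)"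
  by (rule bounded_linear.has_vector_derivative[OF bounded_linear_mult_right d])
 have 2: "((%t. exp (t *\<^sub>R v) * S) has_vector_derivative (exp (0 *\<^sub>R v) * v) * S) (at 0)"
  by (rule bounded_linear.has_vector_derivative[OF bounded_linear_mult_left d])
 have "S * (exp (0 *\<^sub>R v) * v) = (exp (0 *\<^sub>R v) * v) * S" by (rule vector_derivative_unique_at[OF 1[unfolded assms] 2])
 then show ?thesis by simp
qed

lemma lie_br: "alg_sub C ==> u \<in> lie C ==> v \<in> lie C ==> br u v \<in> lie C"
 unfolding br_def by (rule lie_bracket)

lemma lie_scaleR_cancel: "c *\<^sub>R v \<in> lie C ==> c ~= 0 ==> v \<in> lie C"
 using lie_scaleR[of "c *\<^sub>R v" C "1 / c"] by simp

text \<open>With real spectrum the integral powers of exp v determine the whole complex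
  one-parameter group.\<close>

lemma lie_realI:
 assumes C: "alg_sub C" and v: "rspec v" and x: "rep (exp v) \<in> C" shows "v \<in> lie C"
proof -
 obtain P where P: "P \<subseteq> poly_fun UNIV" "C = zero_locus P" using alg_subD(1)[OF C] closedin_zariski by blast
 have "rep (exp (smat (of_nat k) * v)) \<in> C" for k :: nat
  using alg_sub_power[OF C x, of k] by (simp add: exp_power of_nat_smat del: rep_simps)
 then have z: "!!k::nat. rep (exp (smat (of_nat k) * v)) \<in> zero_locus P" unfolding P(2) .
 have r: "!!l u. u ~= 0 ==> v * u = smat l * u ==> l \<in> \<real>" using v unfolding rspec_def by blast
 have "rep (exp (smat s * v)) \<in> zero_locus P" for s by (rule exp_zero_locus_real[OF P(1) _ z]) (rule r)
 then show ?thesis unfolding lie_def P(2) by simp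
qed

text \<open>Bracketing x with e isolates h when e is available. When only h is available, combining
  the first and second brackets of x with h isolates e, at the price of q being nonzero.\<close>

lemma (in sl2_triple) generate:
 assumes C: "alg_sub C" and x: "p *\<^sub>R h + q *\<^sub>R e + r *\<^sub>R f \<in> lie C" "r ~= 0"
  and y: "(h \<in> lie C & q ~= 0) \<or> e \<in> lie C"
 shows "e \<in> lie C & f \<in> lie C & h \<in> lie C"
proof -
 let ?x = "p *\<^sub>R h + q *\<^sub>R e + r *\<^sub>R f"
 have eh: "br e h = (-2) *\<^sub>R e" using he br_flip[of e h] by simp
 have main: "f \<in> lie C" if "e \<in> lie C" "h \<in> lie C"
 proof -
  have "?x - (p *\<^sub>R h + q *\<^sub>R e) \<in> lie C" by (intro lie_minus[OF C] lie_add[OF C] lie_scaleR x that)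
  then have "r *\<^sub>R f \<in> lie C" by simp
  then show ?thesis using x(2) by (rule lie_scaleR_cancel)
 qed
 show ?thesis
 proof (cases "e \<in> lie C")
  case True
  have "br e ?x \<in> lie C" by (rule lie_br[OF C True x(1)])
  then have "(p *\<^sub>R (-2) *\<^sub>R e + r *\<^sub>R h) - (- 2 * p) *\<^sub>R e \<in> lie C"
   unfolding br_simps eh br_self ef by (intro lie_minus[OF C] lie_scaleR True) simp
  then have "r *\<^sub>R h \<in> lie C" by (simp add: mult.commute)
  then have "h \<in> lie C" using x(2) by (rule lie_scaleR_cancel)
  then show ?thesis using True main by blast
 next
  case False
  then have hL: "h \<in> lie C" "q ~= 0" using y by auto
  have 1: "br h ?x \<in> lie C" by (rule lie_br[OF C hL(1) x(1)])
  have 2: "br h (br h ?x) \<in> lie C" by (rule lie_br[OF C hL(1) 1])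
  have "2 *\<^sub>R br h ?x + br h (br h ?x) = (8 * q) *\<^sub>R e"
  proof -
   have 3: "br h ?x = (2 * q) *\<^sub>R e - (2 * r) *\<^sub>R f" unfolding br_simps he hf br_self by (simp add: mult.commute)
   have "br h (br h ?x) = (4 * q) *\<^sub>R e + (4 * r) *\<^sub>R f" unfolding 3 unfolding br_simps he hf by (simp add: mult.commute)
   then have "2 *\<^sub>R br h ?x + br h (br h ?x) = (4 * q) *\<^sub>R e + (4 * q) *\<^sub>R e" unfolding 3 by (simp add: scaleR_diff_right)
   also have "... = (8 * q) *\<^sub>R e" by (simp flip: scaleR_add_left)
   finally show ?thesis .
  qed
  then have "(8 * q) *\<^sub>R e \<in> lie C" using lie_add[OF C lie_scaleR[OF 1, of 2] 2] by simp
  then have "e \<in> lie C" by (rule lie_scaleR_cancel) (use hL in simp)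
  then show ?thesis using False by simp
 qed
qed

lemma sl2_triple_conj:
 assumes t: "sl2_triple e f h" and xy: "y * x = 1"
 shows "sl2_triple (x * e * y) (x * f * y) (x * h * y)"
proof -
 interpret sl2_triple e f h by (rule t)
 have c: "br (x * a * y) (x * b * y) = x * br a b * y" for a b
 proof -
  have "(x * a * y) * (x * b * y) = x * a * (y * x) * b * y" for a b by (simp only: mult.assoc)
  then show ?thesis unfolding br_def xy by (simp add: algebra_simps)
 qed
 show ?thesis by unfold_locales (simp_all add: c he hf ef)
qed

section \<open>The even subgroup and closures inside it\<close>

locale real_sl2 = sl2_hom \<rho> for \<rho> :: "real^2^2 => complex^'n::finite^'n" +
 fixes GG G :: "(complex^'n^'n) set"
 assumes GG: "alg_sub GG" and GGR: "defined_over_R GG"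
  and G_GG: "G \<subseteq> real_points GG" and G_mult: "X \<in> G ==> Y \<in> G ==> X ** Y \<in> G" and G_one: "mat 1 \<in> G"
  and G_inv: "X \<in> G ==> \<exists>Y\<in>G. X ** Y = mat 1 & Y ** X = mat 1"
  and G_open: "openin (top_of_set (real_points GG)) G"
  and \<rho>G: "k \<in> SL2R ==> \<rho> k \<in> G"
begin

abbreviation "Z \<equiv> {X \<in> GG. \<rho> mI ** X = X ** \<rho> mI}"
abbreviation "Z0 \<equiv> identity_component Z"
abbreviation "H \<equiv> G \<inter> Z0"

lemma Z: "alg_sub Z" by (rule alg_sub_commutant[OF GG])

lemma \<rho>Z: "k \<in> SL2R ==> \<rho> k \<in> Z"
proof -
 assume k: "k \<in> SL2R"
 have "rep (R mI * R k) = rep (R k * R mI)" using R_mI_commute[OF k] by simp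
 then show ?thesis using \<rho>G[OF k] G_GG by (auto simp: real_points_def)
qed

text \<open>The nilpotent e comes from the single element \<rho>(\<open>cE 1\<close>) because its
  spectrum is real; f is a conjugate of - e, and h is a bracket.\<close>

lemma lie_efh: assumes C: "alg_sub C" and k: "!!k. k \<in> SL2R ==> \<rho> k \<in> C" shows "e \<in> lie C" "f \<in> lie C" "h \<in> lie C"
proof -
 have "rep (exp (1 *\<^sub>R e)) = \<rho> (cE 1)" unfolding R_cE[symmetric] by simp
 moreover have "\<rho> (cE 1) \<in> C" by (rule k) simp
 ultimately have "rep (exp e) \<in> C" by simp
 then show el: "e \<in> lie C" by (rule lie_realI[OF C rspec_e])
 let ?J = "mat2 0 1 (- 1) 0"
 have J: "?J \<in> SL2R" by simp
 have "rep (R ?J) \<in> C" using k[OF J] by simp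
 from lie_Ad[OF C el this R_adj2(2)[OF J] R_adj2(1)[OF J]] have "R ?J * e * R (adj2 ?J) \<in> lie C" .
 moreover have "R ?J * e * R (adj2 ?J) = (- 1) *\<^sub>R f"
  using Ad[OF J, of 0 1 0] d_sl[of 0 0 "- 1"] by (simp add: mat2_simps)
 ultimately have "(- 1) *\<^sub>R f \<in> lie C" by (simp only:)
 then show fl: "f \<in> lie C" by (rule lie_scaleR_cancel) simp
 show "h \<in> lie C" using lie_br[OF C el fl] unfolding ef .
qed

lemma rho_mem: assumes C: "mat 1 \<in> C" "!!X Y. X \<in> C ==> Y \<in> C ==> X ** Y \<in> C"
  and ef': "!!s. rep (exp (smat s * e)) \<in> C" "!!s. rep (exp (smat s * f)) \<in> C" and k: "k \<in> SL2R"
 shows "\<rho> k \<in> C"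
proof -
 obtain x y z w where kk: "k = cE x ** cF y ** cE z ** cF w" using SL2R_generated[OF k] by blast
 have E: "\<rho> (cE t) \<in> C" for t
 proof -
  have "rep (exp (smat (of_real t) * e)) = \<rho> (cE t)" unfolding smat_of_real R_cE[symmetric] by simp
  then show ?thesis using ef'(1)[of "of_real t"] by (simp only:)
 qed
 have F: "\<rho> (cF t) \<in> C" for t
 proof -
  have "rep (exp (smat (of_real t) * f)) = \<rho> (cF t)" unfolding smat_of_real R_cF[symmetric] by simp
  then show ?thesis using ef'(2)[of "of_real t"] by (simp only:)
 qed
 have S: "cE t \<in> SL2R" "cF t \<in> SL2R" for t by simp_all
 have "\<rho> k = \<rho> (cE x) ** \<rho> (cF y) ** \<rho> (cE z) ** \<rho> (cF w)"
  unfolding kk using S by (simp only: mul SL2R_mult)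
 then show ?thesis using C(2) E F by (simp only:)
qed

lemma Z0_Z: "Z0 \<subseteq> Z" unfolding identity_component_def using connected_component_of_subset_topspace[of "subtopology zariski Z"] by auto

lemma Z0_one: "mat 1 \<in> Z0"
 using identity_component_exp[of 0 Z 0] alg_subD(2)[OF Z] by (simp add: lie_def)

lemma \<rho>Z0: "k \<in> SL2R ==> \<rho> k \<in> Z0"
 by (rule rho_mem[OF Z0_one identity_component_mult[OF Z]
  identity_component_exp[OF lie_efh(1)[OF Z \<rho>Z]] identity_component_exp[OF lie_efh(2)[OF Z \<rho>Z]]])

lemma H_mult: "X \<in> H ==> Y \<in> H ==> X ** Y \<in> H" using G_mult identity_component_mult[OF Z] by blast
lemma H_one: "mat 1 \<in> H" using G_one Z0_one by blast
lemma H_inv: "X \<in> H ==> \<exists>Y\<in>H. X ** Y = mat 1 & Y ** X = mat 1"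
 using G_inv identity_component_inverse[OF Z] by blast
lemma \<rho>H: "k \<in> SL2R ==> \<rho> k \<in> H" using \<rho>G \<rho>Z0 by blast

text \<open>Together with \<open>exp_pi_h\<close> this says that exp(pi i ad h) is trivial on
  \<open>lie Z\<close>, the source of even weights.\<close>

lemma lie_Z_commute: assumes v: "v \<in> lie Z" shows "R mI * v = v * R mI"
proof (rule commute_derivative)
 fix t :: real
 have "rep (exp (smat (of_real t) * v)) \<in> Z" using v unfolding lie_def by blast
 then have "\<rho> mI ** rep (exp (t *\<^sub>R v)) = rep (exp (t *\<^sub>R v)) ** \<rho> mI" by (simp add: smat_of_real)
 then have "rep (R mI * exp (t *\<^sub>R v)) = rep (exp (t *\<^sub>R v) * R mI)" by simp
 then show "R mI * exp (t *\<^sub>R v) = exp (t *\<^sub>R v) * R mI" by (rule cmat_eqI)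
qed

lemma mI_SL: "mI \<in> SL2R" by simp

lemma cn_Z: assumes X: "X \<in> Z" shows "rep (cn (Cm X)) \<in> Z"
proof -
 obtain P where P: "P \<subseteq> poly_fun \<real>" "GG = zero_locus P" using GGR unfolding defined_over_R_def by blast
 obtain Y where Y: "X ** Y = mat 1" "Y ** X = mat 1" using X alg_subD(4)[OF GG] by blast
 have "cn (Cm X) * cn (Cm Y) = 1" "cn (Cm Y) * cn (Cm X) = 1"
  unfolding cn_simps(6)[symmetric] Cm_simps(1)[symmetric] Y Cm_simps(2) cn_simps(4) by simp_all
 from arg_cong[OF this(1), of rep] arg_cong[OF this(2), of rep]
 have "invertible (rep (cn (Cm X)))" unfolding invertible_def by auto
 moreover have "p (rep (cn (Cm X))) = 0" if "p \<in> P" for p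
  using poly_fun_real_cnj[of p X] that P X unfolding zero_locus_def by auto
 ultimately have 1: "rep (cn (Cm X)) \<in> GG" unfolding P(2) zero_locus_def by simp
 have "R mI * Cm X = Cm X * R mI" by (rule cmat_eqI) (use X in simp)
 from arg_cong[OF this, of cn] have "R mI * cn (Cm X) = cn (Cm X) * R mI" unfolding cn_simps cn_R[OF mI_SL] .
 from arg_cong[OF this, of rep] show ?thesis using 1 by simp
qed

lemma cn_lie: assumes v: "v \<in> lie Z" shows "cn v \<in> lie Z"
 unfolding lie_def
proof (rule CollectI, rule allI)
 fix s
 have "smat s * cn v = cn (smat (cnj s) * v)" by (simp only: cn_simps(3) complex_cnj_cnj)
 then have "rep (exp (smat s * cn v)) = rep (cn (Cm (rep (exp (smat (cnj s) * v)))))" by (simp add: cn_exp)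
 moreover have "rep (exp (smat (cnj s) * v)) \<in> Z" using v unfolding lie_def by blast
 ultimately show "rep (exp (smat s * cn v)) \<in> Z" using cn_Z by (simp only:)
qed

text \<open>\<open>G\<close> is a Euclidean open subgroup of the real points: small parameters land
  in \<open>G\<close>, and any t is a multiple of a small one.\<close>

lemma exp_real_H: assumes v: "v \<in> lie Z" "cn v = v" shows "rep (exp (t *\<^sub>R v)) \<in> H"
proof -
 let ?\<gamma> = "%t. rep (exp (t *\<^sub>R v))"
 have Zt: "?\<gamma> t \<in> Z" "?\<gamma> t \<in> Z0" for t
  using v(1) identity_component_exp[OF v(1), of "of_real t"] unfolding lie_def by (auto simp: smat_of_real[symmetric])
 have "cn (exp (t *\<^sub>R v)) = exp (t *\<^sub>R v)" for t unfolding cn_exp[symmetric] cn_simps v(2) ..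
 then have rp: "?\<gamma> t \<in> real_points GG" for t using Zt(1) unfolding real_points_def cn_real_iff by blast
 obtain W where W: "open W" "G = real_points GG \<inter> W" using G_open unfolding openin_open by blast
 have c: "continuous_on UNIV ?\<gamma>"
  by (intro continuous_intros continuous_on_compose2[OF continuous_on_exp_cmat]) auto
 have "open (?\<gamma> -` W)" by (rule open_vimage[OF W(1) c])
 moreover have "0 \<in> ?\<gamma> -` W" using G_one W(2) by simp
 ultimately obtain \<delta> where d: "\<delta> > 0" "ball 0 \<delta> \<subseteq> ?\<gamma> -` W" using open_contains_ball by blast
 obtain m :: nat where m: "real m > \<bar>t\<bar> / \<delta>" using reals_Archimedean2 by blast
 have m0: "real m > 0" using m divide_nonneg_pos[OF abs_ge_zero[of t] d(1)] by linarith
 have "\<bar>t / real m\<bar> < \<delta>" using m m0 d(1) by (simp add: field_simps)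
 then have "t / real m \<in> ball 0 \<delta>" by simp
 then have G1: "?\<gamma> (t / real m) \<in> G" using d(2) W(2) rp by blast
 have "?\<gamma> (real j * (t / real m)) \<in> G" for j
 proof (induction j)
  case (Suc j)
  have "exp ((real (Suc j) * (t / real m)) *\<^sub>R v) = exp ((t / real m) *\<^sub>R v) * exp ((real j * (t / real m)) *\<^sub>R v)"
  proof -
   have e: "real (Suc j) * x = x + real j * x" for x by (simp add: distrib_right)
   show ?thesis unfolding e scaleR_add_left by (rule exp_add_commuting) simp
  qed
  then show ?case using G_mult[OF G1 Suc] by simp
 qed (use G_one in simp)
 from this[of m] m0 have "?\<gamma> t \<in> G" by simp
 then show ?thesis using Zt(2) by blast
qed

lemma rep_lie_Z: "sl2_rep e f h (lie Z)"
proof (rule sl2_rep.intro[OF triple], rule sl2_rep_axioms.intro)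
 show "0 \<in> lie Z" using alg_subD(2)[OF Z] by (simp add: lie_def)
 show "v + w \<in> lie Z" if "v \<in> lie Z" "w \<in> lie Z" for v w by (rule lie_add[OF Z that])
 show "smat c * v \<in> lie Z" if "v \<in> lie Z" for v c by (rule lie_scale[OF that])
 show "br e v \<in> lie Z" if "v \<in> lie Z" for v by (rule lie_br[OF Z lie_efh(1)[OF Z \<rho>Z] that])
 show "br f v \<in> lie Z" if "v \<in> lie Z" for v by (rule lie_br[OF Z lie_efh(2)[OF Z \<rho>Z] that])
qed

abbreviation "y T \<equiv> d (slY T)"

lemma Ad_slY: assumes k: "k \<in> SL2R" shows "d (k ** slY T ** adj2 k) = R k * y T * R (adj2 k)"
 unfolding slY_def by (cases T) (simp_all only: if_True if_False Ad[OF k])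

lemma cn_y: "cn (y T) = y T" unfolding slY_def by (cases T) (simp_all only: if_True if_False cn_efh)

lemma R_conj_cY:
 assumes k: "k \<in> SL2R" and s: "s = 1 \<or> s = - 1" and a: "a = s *\<^sub>R (k ** cY T c ** adj2 k)"
 shows "\<exists>S. (S = 1 \<or> S = R mI) & R a = S * exp (c *\<^sub>R (R k * y T * R (adj2 k)))"
proof -
 have cY: "cY T c \<in> SL2R" by (simp add: cY_def exp_minus)
 have RcY: "R (cY T c) = exp (c *\<^sub>R y T)" unfolding cY_def slY_def by (cases T) (simp_all only: if_True if_False R_cH R_cE)
 have S: "k ** cY T c ** adj2 k \<in> SL2R" by (intro SL2R_mult adj2_SL2R k cY)
 have "R (k ** cY T c ** adj2 k) = R k * exp (c *\<^sub>R y T) * R (adj2 k)"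
  by (simp add: R_mult SL2R_mult adj2_SL2R k cY RcY)
 also have "... = exp (c *\<^sub>R (R k * y T * R (adj2 k)))" using exp_conj[OF R_adj2(2)[OF k], of "c *\<^sub>R y T"] by simp
 finally have E: "R (k ** cY T c ** adj2 k) = exp (c *\<^sub>R (R k * y T * R (adj2 k)))" .
 have "(- 1) *\<^sub>R X = mI ** X" for X :: "real^2^2" by (cases X rule: mat2_cases) (simp add: mat2_simps)
 then have "R ((- 1) *\<^sub>R (k ** cY T c ** adj2 k)) = R mI * R (k ** cY T c ** adj2 k)" using R_mult[OF mI_SL S] by simp
 then show ?thesis using s E unfolding a by (auto intro: exI[of _ 1])
qed

text \<open>Squaring a removes the sign, as the image of minus the identity is a commuting
  involution; what remains is exp(2 c X) with X of real spectrum.\<close>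

lemma lie_conj_y:
 assumes L: "alg_sub L" and k: "k \<in> SL2R" and s: "s = 1 \<or> s = - 1" and a: "a = s *\<^sub>R (k ** cY T c ** adj2 k)" "a \<in> SL2R"
  and c: "c ~= 0" and aL: "\<rho> a \<in> L"
 shows "R k * y T * R (adj2 k) \<in> lie L"
proof -
 let ?X = "R k * y T * R (adj2 k)"
 obtain S where S: "S = 1 \<or> S = R mI" "R a = S * exp (c *\<^sub>R ?X)" using R_conj_cY[OF k s a(1)] by blast
 have SS: "S * S = 1" "S * R a = R a * S" using S(1) R_mI R_mI_commute[OF a(2)] by auto
 have "exp (c *\<^sub>R ?X) = S * R a" unfolding S(2) mult.assoc[symmetric] SS by simp
 then have "exp (c *\<^sub>R ?X) * exp (c *\<^sub>R ?X) = S * (R a * S) * R a" by (simp add: mult.assoc)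
 also have "... = (S * S) * R a * R a" unfolding SS(2)[symmetric] by (simp add: mult.assoc)
 finally have "exp ((c + c) *\<^sub>R ?X) = R a * R a" unfolding SS scaleR_add_left by (subst exp_add_commuting) auto
 then have "rep (exp ((c + c) *\<^sub>R ?X)) \<in> L" using alg_subD(3)[OF L aL aL] by simp
 moreover have "rspec (y T)" using rspec_h rspec_e unfolding slY_def by (cases T) (simp_all only: if_True if_False)
 then have "rspec ((c + c) *\<^sub>R ?X)" by (intro rspec_scaleR rspec_conj) (use R_adj2[OF k] in auto)
 ultimately have "(c + c) *\<^sub>R ?X \<in> lie L" by (intro lie_realI[OF L])
 then show ?thesis by (rule lie_scaleR_cancel) (use c in simp)
qed

text \<open>The generators of a_0 and a_1 lie in \<open>lie L\<close>. In the frame moved by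
  \<open>k0\<close> they are a standard vector and \<open>sl p q r\<close>, and
  \<open>generation_criterion\<close> provides the nonvanishing coefficients from which the whole
  triple is generated.\<close>

lemma rho_mem_closure:
 assumes L: "alg_sub L"
  and a0: "a0 = s0 *\<^sub>R (k0 ** cY T0 c0 ** adj2 k0)" "s0 = 1 \<or> s0 = - 1" "k0 \<in> SL2R" "c0 ~= 0" "a0 \<in> SL2R" "\<rho> a0 \<in> L"
  and a1: "a1 = s1 *\<^sub>R (k1 ** cY T1 c1 ** adj2 k1)" "s1 = 1 \<or> s1 = - 1" "k1 \<in> SL2R" "c1 ~= 0" "a1 \<in> SL2R" "\<rho> a1 \<in> L"
  and nc: "\<not> words_commute a0 a1" and k: "k \<in> SL2R"
 shows "\<rho> k \<in> L"
proof -
 obtain p q r where M: "(adj2 k0 ** k1) ** slY T1 ** adj2 (adj2 k0 ** k1) = sl p q r" "r ~= 0" "T0 --> q ~= 0"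
  using generation_criterion[OF a0(1-3) a1(1-3) nc] by blast
 let ?c = "%v. R k0 * v * R (adj2 k0)"
 have "k0 ** sl p q r ** adj2 k0 = (k0 ** adj2 k0) ** k1 ** slY T1 ** adj2 k1 ** (k0 ** adj2 k0)"
  unfolding M(1)[symmetric] by (simp add: adj2_mult adj2_adj2 matrix_mul_assoc)
 then have "k0 ** sl p q r ** adj2 k0 = k1 ** slY T1 ** adj2 k1" by (simp add: adj2_SL2R[OF a0(3)])
 then have "?c (d (sl p q r)) = R k1 * y T1 * R (adj2 k1)" using Ad[OF a0(3), of p q r] Ad_slY[OF a1(3)] by simp
 then have "p *\<^sub>R ?c h + q *\<^sub>R ?c e + r *\<^sub>R ?c f \<in> lie L"
  using lie_conj_y[OF L a1(3,2,1,5,4,6)] unfolding d_sl[of p q r] by (simp only: distrib_left distrib_right mult_scaleR_left mult_scaleR_right)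
 from sl2_triple.generate[OF sl2_triple_conj[OF triple R_adj2(2)[OF a0(3)]] L this M(2)]
 have g: "(?c h \<in> lie L & q ~= 0) \<or> ?c e \<in> lie L ==> ?c e \<in> lie L & ?c f \<in> lie L & ?c h \<in> lie L" .
 have "(?c h \<in> lie L & q ~= 0) \<or> ?c e \<in> lie L"
  using lie_conj_y[OF L a0(3,2,1,5,4,6)] M(3) unfolding slY_def by (cases T0) (simp_all only: if_True if_False simp_thms)
 note ef' = g[OF this]
 let ?C = "{Y. \<rho> k0 ** Y ** \<rho> (adj2 k0) \<in> L}"
 have k0: "\<rho> k0 ** \<rho> (adj2 k0) = mat 1" "\<rho> (adj2 k0) ** \<rho> k0 = mat 1"
  using arg_cong[OF R_adj2(1)[OF a0(3)], of rep] arg_cong[OF R_adj2(2)[OF a0(3)], of rep] by simp_all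
 have "exp (smat s * ?c v) = ?c (exp (smat s * v))" for s v
  using exp_conj[OF R_adj2(2)[OF a0(3)], of "smat s * v"] by (simp add: mult.assoc smat_left_commute)
 then have E: "rep (exp (smat s * v)) \<in> ?C" if "?c v \<in> lie L" for s v using that by (simp add: lie_def)
 have "\<rho> (adj2 k0 ** k ** k0) \<in> ?C"
 proof (rule rho_mem[OF _ _ E[OF conjunct1[OF ef']] E[OF conjunct1[OF conjunct2[OF ef']]]])
  show "mat 1 \<in> ?C" using k0 alg_subD(2)[OF L] by simp
  fix X Y assume "X \<in> ?C" "Y \<in> ?C"
  then have "(\<rho> k0 ** X ** \<rho> (adj2 k0)) ** (\<rho> k0 ** Y ** \<rho> (adj2 k0)) \<in> L" using alg_subD(3)[OF L] by blast
  moreover have "(\<rho> k0 ** X ** \<rho> (adj2 k0)) ** (\<rho> k0 ** Y ** \<rho> (adj2 k0)) = \<rho> k0 ** X ** (\<rho> (adj2 k0) ** \<rho> k0) ** Y ** \<rho> (adj2 k0)"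
   by (simp only: matrix_mul_assoc)
  ultimately show "X ** Y \<in> ?C" by (simp add: k0 matrix_mul_assoc)
 qed (intro SL2R_mult adj2_SL2R a0 k)
 then have "\<rho> (k0 ** (adj2 k0 ** k ** k0) ** adj2 k0) \<in> L" by (simp add: mul SL2R_mult adj2_SL2R a0(3) k)
 moreover have "k0 ** (adj2 k0 ** k ** k0) ** adj2 k0 = (k0 ** adj2 k0) ** k ** (k0 ** adj2 k0)" by (simp only: matrix_mul_assoc)
 ultimately show ?thesis by (simp add: adj2_SL2R[OF a0(3)])
qed

text \<open>Deformations through real points reach only vectors fixed by conjugation. The
  centralizer of the real vector \<open>y T\<close> is stable under conjugation, so its real vectors
  span it over the complex numbers.\<close>

lemma identity_component_dense:
 assumes L: "alg_sub L" "L \<subseteq> Z" and k: "!!k. k \<in> SL2R ==> \<rho> k \<in> L"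
  and c: "!!v. v \<in> lie Z ==> cn v = v ==> br (y T) v = 0 ==> v \<in> lie L"
 shows "Z0 \<subseteq> L"
proof (rule identity_component_subset[OF Z L])
 have cc: "v \<in> lie L" if v: "v \<in> lie Z" "br (y T) v = 0" for v
 proof -
  note 1 = lie_add[OF Z v(1) cn_lie[OF v(1)]] lie_scale[OF lie_minus[OF Z v(1) cn_lie[OF v(1)]], of "- \<i>"]
  have "br (y T) (cn v) = cn (br (y T) v)" by (simp add: br_def cn_simps cn_y)
  also have "... = 0" unfolding v(2) using cn_simps(7)[of 0 0] by simp
  finally have "br (y T) (v + cn v) = 0" "br (y T) (smat (- \<i>) * (v - cn v)) = 0" using v(2) by (simp_all add: br_simps)
  moreover have "cn (v + cn v) = v + cn v" by (simp add: cn_simps)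
  moreover have "cn (smat (- \<i>) * (v - cn v)) = smat (- \<i>) * (v - cn v)"
   unfolding cn_simps(3) cn_simps(5,7) by (simp add: smat_simps algebra_simps)
  ultimately have "v + cn v \<in> lie L" "smat (- \<i>) * (v - cn v) \<in> lie L" using 1 by (auto intro: c)
  from lie_add[OF L(1) this(1) lie_scale[OF this(2), of \<i>]]
  have "v + cn v + smat \<i> * (smat (- \<i>) * (v - cn v)) \<in> lie L" .
  moreover have "smat \<i> * (smat (- \<i>) * (v - cn v)) = v - cn v"
   by (simp add: mult.assoc[symmetric] smat_mult[symmetric] smat_simps)
  ultimately have "2 *\<^sub>R v \<in> lie L" by (simp add: scaleR_2)
  then show ?thesis by (rule lie_scaleR_cancel) simp
 qed
 note l = lie_efh[OF L(1) k]
 show "lie Z \<subseteq> lie L"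
 proof (rule sl2_rep.generated_by_centralizer[OF rep_lie_Z])
  show "exp (smat (of_real pi * \<i>) * h) * v = v * exp (smat (of_real pi * \<i>) * h)" if "v \<in> lie Z" for v
   unfolding exp_pi_h by (rule lie_Z_commute[OF that])
  show "(\<forall>v\<in>lie Z. br h v = 0 --> v \<in> lie L) \<or> (\<forall>v\<in>lie Z. br e v = 0 --> v \<in> lie L)"
   using cc unfolding slY_def by (cases T) (simp_all only: if_True if_False, blast+)
 qed (use L(1) l lie_br lie_add in blast)+
qed

section \<open>The group of paths and the deformation\<close>

definition path_inv :: "(real => 'n cmat) => (real => 'n cmat) => bool" where
 "path_inv F F' \<longleftrightarrow> continuous_on UNIV F & continuous_on UNIV F' &
   (\<forall>t. rep (F t) \<in> H & rep (F' t) \<in> H & F t * F' t = 1 & F' t * F t = 1)"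

text \<open>Continuous paths in \<open>H\<close> with continuous inverse, multiplied pointwise. A
  homomorphism into this group is a family of representations in which every group element moves
  continuously.\<close>

definition Q :: "(real => 'n cmat) monoid" where
 "Q = \<lparr>carrier = {F. \<exists>F'. path_inv F F'}, mult = (%E F t. E t * F t), one = (%_. 1)\<rparr>"

lemma group_Q: "group Q"
proof (rule groupI)
 fix E F assume "E \<in> carrier Q" "F \<in> carrier Q"
 then obtain E' F' where c: "path_inv E E'" "path_inv F F'" by (auto simp: Q_def)
 have "path_inv (%t. E t * F t) (%t. F' t * E' t)"
  unfolding path_inv_def
 proof (intro conjI allI)
  fix t
  show "rep (E t * F t) \<in> H" "rep (F' t * E' t) \<in> H" using H_mult c by (simp_all add: path_inv_def)
  have "E t * F t * (F' t * E' t) = E t * (F t * F' t) * E' t" "F' t * E' t * (E t * F t) = F' t * (E' t * E t) * F t"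
   by (simp_all only: mult.assoc)
  then show "E t * F t * (F' t * E' t) = 1" "F' t * E' t * (E t * F t) = 1" using c by (simp_all add: path_inv_def)
 qed (use c in \<open>auto simp: path_inv_def intro: continuous_on_mult\<close>)
 then show "E \<otimes>\<^bsub>Q\<^esub> F \<in> carrier Q" by (auto simp: Q_def)
next
 have "path_inv (%_. 1) (%_. 1)" using H_one by (simp add: path_inv_def)
 then show "\<one>\<^bsub>Q\<^esub> \<in> carrier Q" by (auto simp: Q_def)
next
 fix F assume "F \<in> carrier Q"
 then obtain F' where "path_inv F F'" by (auto simp: Q_def)
 then have "path_inv F' F" "F' \<otimes>\<^bsub>Q\<^esub> F = \<one>\<^bsub>Q\<^esub>" by (auto simp: path_inv_def Q_def)
 then show "\<exists>E\<in>carrier Q. E \<otimes>\<^bsub>Q\<^esub> F = \<one>\<^bsub>Q\<^esub>" by (auto simp: Q_def)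
qed (simp_all add: Q_def mult.assoc)

text \<open>The twist applied to constant paths, with the one-parameter groups exp(t v_i) as
  twisting elements. They equal 1 at t = 0, so evaluation there recovers \<rho>.\<close>

lemma deformation:
 assumes S: "surface_group g x \<Gamma> \<phi>"
  and v: "!!i. i < g ==> v i \<in> lie Z" "!!i. i < g ==> cn (v i) = v i"
  and c: "!!i. i < g ==> R (surface_group.ga g x \<Gamma> \<phi> i) * v i = v i * R (surface_group.ga g x \<Gamma> \<phi> i)"
 obtains r :: "real => real^2^2 => complex^'n^'n" where "!!t \<gamma>. \<gamma> \<in> \<Gamma> ==> r t \<gamma> \<in> H"
  "!!t a b. a \<in> \<Gamma> ==> b \<in> \<Gamma> ==> r t (a ** b) = r t a ** r t b"
  "!!\<gamma>. \<gamma> \<in> \<Gamma> ==> continuous_on UNIV (%t. r t \<gamma>)" "!!\<gamma>. \<gamma> \<in> \<Gamma> ==> r 0 \<gamma> = \<rho> \<gamma>"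
  "!!t i. i < g ==> r t (surface_group.ga g x \<Gamma> \<phi> i) = \<rho> (surface_group.ga g x \<Gamma> \<phi> i)"
  "!!t i. i < g ==> r t (surface_group.gb g x \<Gamma> \<phi> i) = rep (exp (t *\<^sub>R v i)) ** \<rho> (surface_group.gb g x \<Gamma> \<phi> i)"
proof -
 interpret S: surface_group g x \<Gamma> \<phi> by (rule S)
 have SL: "\<gamma> \<in> SL2R" if "\<gamma> \<in> \<Gamma>" for \<gamma> using that S.\<Gamma>_SL by blast
 let ?r = "%\<gamma> (_::real). R \<gamma>" and ?z = "%i t. exp (t *\<^sub>R v i)" and ?f = "%F (_::real). F (0::real) :: 'n cmat"
 have r: "?r \<in> hom (matrix_group \<Gamma>) Q"
 proof (rule homI)
  fix a assume "a \<in> carrier (matrix_group \<Gamma>)"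
  then have a: "a \<in> SL2R" using SL by (simp add: matrix_group_def)
  have "path_inv (?r a) (?r (adj2 a))" using a R_adj2 adj2_SL2R(1) \<rho>H by (simp add: path_inv_def)
  then show "?r a \<in> carrier Q" by (auto simp: Q_def)
  fix b assume "b \<in> carrier (matrix_group \<Gamma>)"
  then have "b \<in> SL2R" using SL by (simp add: matrix_group_def)
  then show "?r (a \<otimes>\<^bsub>matrix_group \<Gamma>\<^esub> b) = ?r a \<otimes>\<^bsub>Q\<^esub> ?r b" using a by (simp add: matrix_group_def Q_def R_mult)
 qed
 have z: "?z i \<in> carrier Q" if "i < g" for i
 proof -
  have h: "rep (exp (t *\<^sub>R v i)) \<in> H" for t by (intro exp_real_H v that)
  have e: "exp (t *\<^sub>R v i) * exp ((- t) *\<^sub>R v i) = 1" "exp ((- t) *\<^sub>R v i) * exp (t *\<^sub>R v i) = 1" for t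
   by (simp_all add: exp_inverse_cmat)
  have "path_inv (?z i) (%t. exp ((- t) *\<^sub>R v i))" unfolding path_inv_def
   by (intro conjI allI continuous_intros continuous_on_compose2[OF continuous_on_exp_cmat] subset_UNIV h e)
  then show ?thesis by (auto simp: Q_def)
 qed
 have zr: "?z i \<otimes>\<^bsub>Q\<^esub> ?r (S.ga i) = ?r (S.ga i) \<otimes>\<^bsub>Q\<^esub> ?z i" if "i < g" for i
  using exp_commute_cmat[of "R (S.ga i)" "_ *\<^sub>R v i"] c[OF that] by (auto simp: Q_def)
 have f: "?f \<in> hom Q Q"
 proof (rule homI)
  fix F assume "F \<in> carrier Q"
  then obtain F' where "path_inv F F'" by (auto simp: Q_def)
  then have "path_inv (?f F) (?f F')" by (auto simp: path_inv_def)
  then show "?f F \<in> carrier Q" by (auto simp: Q_def)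
 qed (simp add: Q_def)
 have f1: "?f (?z i) = \<one>\<^bsub>Q\<^esub>" if "i < g" for i by (simp add: Q_def)
 obtain r' where r': "r' \<in> hom (matrix_group \<Gamma>) Q" "\<forall>i<g. r' (S.ga i) = ?r (S.ga i) & r' (S.gb i) = ?z i \<otimes>\<^bsub>Q\<^esub> ?r (S.gb i)"
   "\<forall>\<gamma>\<in>\<Gamma>. ?f (r' \<gamma>) = ?f (?r \<gamma>)"
  using S.twist[OF group_Q r, of ?z Q ?f, OF z zr group_Q f f1] by blast
 have rc: "\<exists>F'. path_inv (r' \<gamma>) F'" if "\<gamma> \<in> \<Gamma>" for \<gamma> using hom_in_carrier[OF r'(1)] that by (simp add: matrix_group_def Q_def)
 show ?thesis
 proof (rule that[of "%t \<gamma>. rep (r' \<gamma> t)"])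
  fix \<gamma> assume g: "\<gamma> \<in> \<Gamma>"
  show "rep (r' \<gamma> t) \<in> H" for t using rc[OF g] by (auto simp: path_inv_def)
  show "continuous_on UNIV (%t. rep (r' \<gamma> t))" using rc[OF g] by (auto simp: path_inv_def intro: continuous_on_rep)
  show "rep (r' \<gamma> 0) = \<rho> \<gamma>" using r'(3) g by (metis rep_R)
  show "rep (r' (\<gamma> ** b) t) = rep (r' \<gamma> t) ** rep (r' b t)" if "b \<in> \<Gamma>" for b t
   using hom_mult[OF r'(1), of \<gamma> b] g that by (simp add: matrix_group_def Q_def)
 qed (use r'(2) in \<open>simp_all add: Q_def\<close>)
qed

lemma dense_deformation:
 assumes S: "surface_group g x \<Gamma> \<phi>" and disc: "discrete \<Gamma>" and g: "g >= 2 + 2 * DIM(complex^'n^'n)"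
  and U: "openin (Hom_topology \<Gamma> G) U" "restrict \<rho> \<Gamma> \<in> U"
 shows "\<exists>\<rho>'\<in>U. subtopology zariski G closure_of (\<rho>' ` \<Gamma>) = H"
proof -
 interpret S: surface_group g x \<Gamma> \<phi> by (rule S)
 have SL: "\<gamma> \<in> SL2R" if "\<gamma> \<in> \<Gamma>" for \<gamma> using that S.\<Gamma>_SL by blast
 obtain s c k T where a: "!!i. i < g ==> (s i = (1::real) \<or> s i = - 1) & c i ~= 0 & k i \<in> SL2R &
   S.ga i = s i *\<^sub>R (k i ** cY (T i) (c i) ** adj2 (k i))"
  using S.ga_conj[OF disc] by metis
 define V where "V \<theta> = {v \<in> lie Z. cn v = v & br (y \<theta>) v = 0}" for \<theta>
 \<comment> \<open>The indices 0 and 1 are reserved for generating \<rho>(SL2). Among the others, at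
   least 2 DIM in number, one of the two types occurs at least DIM times.\<close>
 let ?I = "%\<theta>. {i \<in> {2..<g}. T i = \<theta>}"
 have "{2..<g} = ?I True \<union> ?I False" by auto
 then have "card {2..<g} <= card (?I True) + card (?I False)" by (metis card_Un_le)
 then have "DIM(complex^'n^'n) <= card (?I True) \<or> DIM(complex^'n^'n) <= card (?I False)" using g by simp linarith
 then obtain \<theta> where \<theta>: "card (?I \<theta>) >= DIM(complex^'n^'n)" by blast
 obtain B where B: "B \<subseteq> rep ` V \<theta>" "independent B" "rep ` V \<theta> \<subseteq> span B" "card B = dim (rep ` V \<theta>)"
  using basis_exists[of "rep ` V \<theta>"] by blast
 have "card B <= card (?I \<theta>)" using B(4) dim_subset_UNIV[of "rep ` V \<theta>"] \<theta> by linarith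
 then obtain j where j: "j ` B \<subseteq> ?I \<theta>" "inj_on j B"
  using card_le_inj[of B "?I \<theta>"] independent_bound[OF B(2)] by auto
 \<comment> \<open>A basis of the real centralizer of the frequent type is distributed injectively
   over indices of that type; all other handles receive 0 and are not twisted.\<close>
 define w where "w i = (if i \<in> j ` B then Cm (inv_into B j i) else 0)" for i
 have w: "w i \<in> V (T i)" for i
 proof (cases "i \<in> j ` B")
  case True
  then have "inv_into B j i \<in> rep ` V \<theta>" using B(1) inv_into_into[of i j B] by blast
  then show ?thesis using True j(1) by (auto simp: w_def)
 next
  case False
  have "0 \<in> lie Z" using alg_subD(2)[OF Z] by (simp add: lie_def)
  then show ?thesis using False cn_simps(7)[of 0 0] by (simp add: w_def V_def br_simps)
 qed
 let ?c = "%i v. R (k i) * v * R (adj2 (k i))"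
 \<comment> \<open>The conjugation that brings a_i to standard form carries \<open>w i\<close> into
   the centralizer of a_i, as twisting requires.\<close>
 define v where "v i = ?c i (w i)" for i
 have kS: "k i \<in> SL2R" if "i < g" for i using a that by blast
 have vZ: "v i \<in> lie Z" "cn (v i) = v i" if "i < g" for i
 proof -
  show "v i \<in> lie Z" unfolding v_def
   using w[of i] \<rho>Z[OF kS[OF that]] by (intro lie_Ad[OF Z _ _ R_adj2(2,1)[OF kS[OF that]]]) (simp_all add: V_def)
  show "cn (v i) = v i" unfolding v_def cn_simps
   using w[of i] kS[OF that] by (simp add: cn_R adj2_SL2R V_def)
 qed
 have cm: "R (S.ga i) * v i = v i * R (S.ga i)" if i: "i < g" for i
 proof -
  let ?X = "?c i (y (T i))"
  obtain P where P: "P = 1 \<or> P = R mI" "R (S.ga i) = P * exp (c i *\<^sub>R ?X)"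
   using R_conj_cY[of "k i" "s i" "S.ga i" "T i" "c i"] a[OF i] by blast
  have Pv: "P * v i = v i * P" using P(1) lie_Z_commute[OF vZ(1)[OF i]] by auto
  have m: "?c i p * ?c i q = ?c i (p * q)" for p q
  proof -
   have "?c i p * ?c i q = R (k i) * p * (R (adj2 (k i)) * R (k i)) * q * R (adj2 (k i))" by (simp only: mult.assoc)
   then show ?thesis unfolding R_adj2(2)[OF kS[OF i]] by (simp add: mult.assoc)
  qed
  have "y (T i) * w i = w i * y (T i)" using w[of i] by (simp add: V_def br_def)
  then have "v i * (c i *\<^sub>R ?X) = (c i *\<^sub>R ?X) * v i" using m unfolding v_def by simp
  from exp_commute_cmat[OF this] have "v i * exp (c i *\<^sub>R ?X) = exp (c i *\<^sub>R ?X) * v i" .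
  then show ?thesis unfolding P(2) by (metis Pv mult.assoc)
 qed
 obtain r :: "real => real^2^2 => complex^'n^'n" where r: "!!t \<gamma>. \<gamma> \<in> \<Gamma> ==> r t \<gamma> \<in> H"
   "!!t a b. a \<in> \<Gamma> ==> b \<in> \<Gamma> ==> r t (a ** b) = r t a ** r t b"
   "!!\<gamma>. \<gamma> \<in> \<Gamma> ==> continuous_on UNIV (%t. r t \<gamma>)" "!!\<gamma>. \<gamma> \<in> \<Gamma> ==> r 0 \<gamma> = \<rho> \<gamma>"
   "!!t i. i < g ==> r t (S.ga i) = \<rho> (S.ga i)" "!!t i. i < g ==> r t (S.gb i) = rep (exp (t *\<^sub>R v i)) ** \<rho> (S.gb i)"
  by (rule deformation[OF S vZ cm]) (assumption+, blast)
 let ?r = "%t. restrict (r t) \<Gamma>"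
 have "continuous_map euclideanreal (Hom_topology \<Gamma> G) ?r"
  unfolding Hom_topology_def continuous_map_in_subtopology continuous_map_componentwise
 proof (intro conjI ballI)
  show "?r \<in> topspace euclideanreal \<rightarrow> hom (matrix_group \<Gamma>) (matrix_group G)"
   using r(1,2) S.\<Gamma>_mult by (auto simp: hom_def matrix_group_def)
  show "continuous_map euclideanreal euclidean (%t. ?r t \<gamma>)" "(%t. ?r t \<gamma>) \<in> topspace euclideanreal \<rightarrow> G"
   if "\<gamma> \<in> \<Gamma>" for \<gamma> using r(1,3)[OF that] that by auto
 qed auto
 from openin_continuous_map_preimage[OF this U(1)] have op: "open {t. ?r t \<in> U}" by simp
 have "?r 0 = restrict \<rho> \<Gamma>" using r(4) by (auto simp: restrict_def)
 then have ne: "{t. ?r t \<in> U} ~= {}" using U(2) by (metis (mono_tags) empty_iff mem_Collect_eq)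
 \<comment> \<open>One exceptional set for each handle, valid for all polynomial systems at once.
   This matters because the closure \<open>L\<close>, and with it the system, depends on the t still
   to be chosen.\<close>
 obtain E :: "nat => real set" where E: "!!i. countable (E i)"
   "!!i t P s. t \<notin> E i ==> P \<subseteq> poly_fun UNIV ==> (!!m::nat. rep (exp (smat (of_nat m * of_real t) * v i)) \<in> zero_locus P) ==>
     rep (exp (smat s * v i)) \<in> zero_locus P"
  using exp_zero_locus_generic[of "v _"] by metis
 have "countable (\<Union>i. E i)" using E(1) by blast
 then obtain t where "t \<in> {t. ?r t \<in> U}" "t \<notin> (\<Union>i. E i)" using open_minus_countable[OF _ ne op] by metis
 then have t: "?r t \<in> U" "t \<notin> E i" for i by blast+
 define L where "L = zariski closure_of (r t ` \<Gamma>)"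
 have rH: "r t ` \<Gamma> \<subseteq> H" using r(1) by auto
 have "r t ` \<Gamma> \<subseteq> GL_set" using rH Z0_Z alg_subD(5)[OF Z] by blast
 moreover have "mat 1 \<in> r t ` \<Gamma>"
 proof -
  obtain Y where Y: "Y ** r t (mat 1) = mat 1" using H_inv[OF r(1)[OF S.\<Gamma>_one]] by blast
  have "r t (mat 1) = (Y ** r t (mat 1)) ** r t (mat 1)" by (simp add: Y)
  also have "... = Y ** r t (mat 1 ** mat 1)" unfolding r(2)[OF S.\<Gamma>_one S.\<Gamma>_one] by (simp add: matrix_mul_assoc)
  finally show ?thesis using S.\<Gamma>_one by (auto simp: Y intro!: rev_image_eqI)
 qed
 ultimately have L: "alg_sub L" unfolding L_def
  by (rule zariski_closure_alg_sub) (use S.\<Gamma>_mult in \<open>auto simp flip: r(2)\<close>)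
 have "L \<subseteq> Z0" unfolding L_def by (rule closure_of_minimal[OF _ identity_component_closed[OF Z]]) (use rH in blast)
 have rL: "r t \<gamma> \<in> L" if "\<gamma> \<in> \<Gamma>" for \<gamma>
  using closure_of_subset[of "r t ` \<Gamma>" zariski] \<open>r t ` \<Gamma> \<subseteq> GL_set\<close> that unfolding L_def by auto
 have g2: "0 < g" "1 < g" "2 <= g" using g by auto
 have aL: "\<rho> (S.ga i) \<in> L" "S.ga i \<in> SL2R" if "i < g" for i using rL[OF S.ga(1)] r(5) SL S.ga(1) that by metis+
 \<comment> \<open>The twist leaves a_0 and a_1 unchanged, so their images under \<rho> lie in the
   closure.\<close>
 have \<rho>L: "\<rho> l \<in> L" if "l \<in> SL2R" for l
  using rho_mem_closure[OF L _ _ _ _ aL(2,1)[OF g2(1)] _ _ _ _ aL(2,1)[OF g2(2)] S.not_words_commute[OF g2(3)] that]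
   a[OF g2(1)] a[OF g2(2)] by blast
 \<comment> \<open>Both \<rho>(b_i) and exp(t v_i) \<rho>(b_i) lie in \<open>L\<close>, hence so do
   exp(t v_i) and its powers. Genericity of t then gives v_i, and conjugating back by an element of
   \<open>L\<close> gives \<open>w i\<close>.\<close>
 have wL: "w i \<in> lie L" if i: "i < g" for i
 proof -
  obtain P where P: "P \<subseteq> poly_fun UNIV" "L = zero_locus P" using alg_subD(1)[OF L] closedin_zariski by blast
  have b: "\<rho> (S.gb i) \<in> L" "rep (exp (t *\<^sub>R v i)) ** \<rho> (S.gb i) \<in> L"
   using \<rho>L[OF SL[OF S.gb(1)[OF i]]] rL[OF S.gb(1)[OF i]] r(6)[OF i] by auto
  obtain Y where Y: "Y \<in> L" "\<rho> (S.gb i) ** Y = mat 1" using alg_subD(4)[OF L b(1)] by blast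
  have "rep (exp (t *\<^sub>R v i)) ** \<rho> (S.gb i) ** Y \<in> L" by (rule alg_subD(3)[OF L b(2) Y(1)])
  then have "rep (exp (t *\<^sub>R v i)) \<in> L" using Y(2) by (simp add: matrix_mul_assoc[symmetric])
  from alg_sub_power[OF L this] have "rep (exp (smat (of_nat m * of_real t) * v i)) \<in> zero_locus P" for m
   unfolding exp_power of_nat_smat smat_of_real[symmetric] P(2) by (simp add: smat_mult mult.assoc)
  then have "v i \<in> lie L" using E(2)[OF t(2) P(1)] unfolding lie_def P(2) by blast
  moreover have "rep (R (adj2 (k i))) \<in> L" using \<rho>L adj2_SL2R(1)[OF kS[OF i]] by simp
  ultimately have "R (adj2 (k i)) * v i * R (k i) \<in> lie L" using R_adj2[OF kS[OF i]] by (intro lie_Ad[OF L])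
  moreover have "R (adj2 (k i)) * v i * R (k i) = (R (adj2 (k i)) * R (k i)) * w i * (R (adj2 (k i)) * R (k i))"
   unfolding v_def by (simp only: mult.assoc)
  ultimately show ?thesis unfolding R_adj2(2)[OF kS[OF i]] by simp
 qed
 have "b \<in> rep ` lie L" if "b \<in> B" for b
 proof -
  have "w (j b) = Cm b" using that j(2) by (simp add: w_def)
  moreover have "j b < g" using that j(1) by auto
  ultimately show ?thesis using wL by (metis rep_Cm image_eqI)
 qed
 then have "span B \<subseteq> rep ` lie L" by (intro span_minimal lie_subspace[OF L]) blast
 then have VL: "u \<in> lie L" if "u \<in> V \<theta>" for u using that B(3) by (metis (no_types) cmat_eqI imageE image_eqI subsetD)
 have "Z0 \<subseteq> L" by (rule identity_component_dense[OF L _ \<rho>L, of \<theta>]) (use \<open>L \<subseteq> Z0\<close> Z0_Z VL V_def in auto)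
 then have "L = Z0" using \<open>L \<subseteq> Z0\<close> by blast
 moreover have "G \<inter> ?r t ` \<Gamma> = r t ` \<Gamma>" using rH by (auto simp: image_iff)
 ultimately show ?thesis using t(1) unfolding closure_of_subtopology L_def by (intro bexI[of _ "?r t"]) simp_all
qed

end

section \<open>From the reductive group to the algebraic setting\<close>

lemma matrix_subgroup_inverse:
 assumes M: "group (matrix_group M)" and N: "subgroup N (matrix_group M)" and X: "X \<in> N"
 shows "\<exists>Y\<in>N. X ** Y = mat 1 & Y ** X = (mat 1 :: complex^'n^'n)"
proof -
 let ?Y = "inv\<^bsub>matrix_group M\<^esub> X"
 have "X \<otimes>\<^bsub>matrix_group M\<^esub> ?Y = \<one>\<^bsub>matrix_group M\<^esub>" "?Y \<otimes>\<^bsub>matrix_group M\<^esub> X = \<one>\<^bsub>matrix_group M\<^esub>"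
  using subgroup.mem_carrier[OF N X] by (simp_all add: group.l_inv[OF M] group.r_inv[OF M])
 then show ?thesis using subgroup.m_inv_closed[OF N X] by (auto simp: matrix_group_def)
qed

lemma group_real_points:
 assumes GG: "alg_sub (GG :: (complex^'n::finite^'n) set)" shows "group (matrix_group (real_points GG))"
proof (rule groupI)
 have rp: "X \<in> real_points GG \<longleftrightarrow> X \<in> GG & cn (Cm X) = Cm X" for X by (auto simp: real_points_def cn_real_iff)
 show "\<one>\<^bsub>matrix_group (real_points GG)\<^esub> \<in> carrier (matrix_group (real_points GG))"
  using alg_subD(2)[OF GG] by (simp add: matrix_group_def rp Cm_simps cn_simps)
 fix X assume "X \<in> carrier (matrix_group (real_points GG))"
 then have X: "X \<in> GG" "cn (Cm X) = Cm X" by (simp_all add: matrix_group_def rp)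
 show "X \<otimes>\<^bsub>matrix_group (real_points GG)\<^esub> Y \<in> carrier (matrix_group (real_points GG))"
  if "Y \<in> carrier (matrix_group (real_points GG))" for Y
  using that X alg_subD(3)[OF GG] by (simp add: matrix_group_def rp Cm_simps cn_simps)
 obtain Y where Y: "Y \<in> GG" "X ** Y = mat 1" "Y ** X = mat 1" using alg_subD(4)[OF GG X(1)] by blast
 have YX: "Cm Y * Cm X = 1" "Cm X * Cm Y = 1" using Y by (simp_all add: Cm_simps(1)[symmetric] Cm_simps(2))
 have "cn (Cm Y) * Cm X = 1" using arg_cong[OF YX(1), of cn] by (simp add: cn_simps X(2))
 then have "cn (Cm Y) = Cm Y" by (metis YX(2) mult.assoc mult.left_neutral mult.right_neutral)
 then show "\<exists>Y\<in>carrier (matrix_group (real_points GG)). Y \<otimes>\<^bsub>matrix_group (real_points GG)\<^esub> X = \<one>\<^bsub>matrix_group (real_points GG)\<^esub>"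
  using Y by (auto simp: matrix_group_def rp)
qed (simp_all add: matrix_group_def matrix_mul_assoc)

theorem theorem1p6:
  fixes GG G :: "(complex^'n^'n) set"
    and \<rho> :: "real^2^2 \<Rightarrow> complex^'n^'n"
  assumes "real_reductive_group GG G"
    and "lie_group_hom SL2R G \<rho>"
  shows "\<exists>g\<^sub>0\<ge>2. \<forall>g\<ge>g\<^sub>0. \<forall>\<Gamma> :: (real^2^2) set. \<forall>x \<in> topspace (genus_surface g).
           subgroup \<Gamma> (matrix_group SL2R) \<and> discrete \<Gamma> \<and>
           matrix_group \<Gamma> \<cong> fundamental_group (genus_surface g) x \<longrightarrow>
           (\<forall>U. openin (Hom_topology \<Gamma> G) U \<and> restrict \<rho> \<Gamma> \<in> U \<longrightarrow>
              (\<exists>\<rho>'\<in>U. subtopology zariski G closure_of (\<rho>' ` \<Gamma>) = G_even GG G \<rho>))"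
proof -
 have GGs: "closedin zariski GG" "subgroup GG (matrix_group GL_set)" and GGR: "defined_over_R GG"
  and Gs: "subgroup G (matrix_group (real_points GG))" and Go: "openin (top_of_set (real_points GG)) G"
  using assms(1) by (auto simp: real_reductive_group_def reductive_def linear_algebraic_group_def)
 have hom: "\<rho> \<in> hom (matrix_group SL2R) (matrix_group G)" and smooth: "smooth_map_on SL2R \<rho>"
  using assms(2) by (auto simp: lie_group_hom_def)
 have GG: "alg_sub GG"
  unfolding alg_sub_def
 proof (intro conjI ballI)
  show "mat 1 \<in> GG" using subgroup.one_closed[OF GGs(2)] by (simp add: matrix_group_def)
  fix X assume X: "X \<in> GG"
  show "X ** Y \<in> GG" if "Y \<in> GG" for Y using subgroup.m_closed[OF GGs(2) X that] by (simp add: matrix_group_def)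
  show "\<exists>Y\<in>GG. X ** Y = mat 1 & Y ** X = mat 1" by (rule matrix_subgroup_inverse[OF group_GL GGs(2) X])
 qed (rule GGs(1))
 have sub: "G \<subseteq> real_points GG" "mat 1 \<in> G" "!!X Y. X \<in> G ==> Y \<in> G ==> X ** Y \<in> G"
  using subgroup.subset[OF Gs] subgroup.one_closed[OF Gs] subgroup.m_closed[OF Gs] by (simp_all add: matrix_group_def)
 have \<rho>: "\<rho> k \<in> G" "l \<in> SL2R ==> \<rho> (k ** l) = \<rho> k ** \<rho> l" if "k \<in> SL2R" for k l
  using hom that by (auto simp: hom_def matrix_group_def)
 have GGG: "X \<in> GG" "X $ i $ j \<in> \<real>" if "X \<in> G" for X i j using that sub(1) by (auto simp: real_points_def)
 interpret real_sl2 \<rho> GG G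
 proof
  show "invertible (\<rho> k)" if "k \<in> SL2R" for k using \<rho>(1)[OF that] GGG(1) alg_subD(5)[OF GG] by blast
  show "\<exists>Y\<in>G. X ** Y = mat 1 & Y ** X = mat 1" if "X \<in> G" for X using that by (rule matrix_subgroup_inverse[OF group_real_points[OF GG] Gs])
 qed (use \<rho> sub GGG GG GGR Go smooth in auto)
 \<comment> \<open>The element \<sigma> is the image of minus the identity by
   \<open>sigma_eq\<close>, so its centralizer is \<open>Z\<close>; intersecting with
   \<open>G\<close> already imposes real entries.\<close>
 have even: "G_even GG G \<rho> = H"
  using sub(1) Z0_Z by (auto simp: G_even_def GG_even_def sigma_eq real_points_def)
 show ?thesis
 proof (intro exI[of _ "2 + 2 * DIM(complex^'n^'n)"] conjI allI ballI impI; (elim conjE)?)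
  fix g \<Gamma> x U
  assume g: "2 + 2 * DIM(complex^'n^'n) <= g" and x: "x \<in> topspace (genus_surface g)"
   and \<Gamma>: "subgroup \<Gamma> (matrix_group SL2R)" "discrete \<Gamma>" "matrix_group \<Gamma> \<cong> fundamental_group (genus_surface g) x"
   and U: "openin (Hom_topology \<Gamma> G) U" "restrict \<rho> \<Gamma> \<in> U"
  obtain \<phi> where "\<phi> \<in> iso (matrix_group \<Gamma>) (fundamental_group (genus_surface g) x)" using \<Gamma>(3) by (auto simp: is_iso_def)
  then have "surface_group g x \<Gamma> \<phi>" using g x \<Gamma>(1) by (intro surface_group.intro) simp_all
  from dense_deformation[OF this \<Gamma>(2) g U]
  show "\<exists>\<rho>'\<in>U. subtopology zariski G closure_of (\<rho>' ` \<Gamma>) = G_even GG G \<rho>" unfolding even .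
 qed simp
qed

end
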